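(* Let $M$ be a simple admissible $\widetilde{W}_d$-module that is a free $U(\mathfrak{h})$-module of finite rank. Then $M\cong \mathcal{F}(P,V)$ for some simple $\mathcal{K}_d$-module $P$ that is a free $U(\mathfrak{h})$-module of finite rank and some finite dimensional simple $\mathfrak{gl}_d$-module $V$.
   Context: All algebras and vector spaces are over $\mathbb{C}$, and $d\ge 1$ is a fixed integer. Let $A_d=\mathbb{C}[x_1^{\pm1},\dots,x_d^{\pm1}]$, $x^r=x_1^{r_1}\cdots x_d^{r_d}$ for $r=(r_1,\dots,r_d)^T\in\mathbb{Z}^d$, $\partial_i=x_i\frac{\partial}{\partial x_i}$, and $(u|v)=u^Tv$ for $u,v\in\mathbb{C}^d$ (column vectors). The Witt algebra $W_d$ is the Lie algebra of derivations of $A_d$. It is spanned by $D(u,r)=x^r\sum_{i=1}^d u_i\partial_i$ ($u\in\mathbb{C}^d$, $r\in\mathbb{Z}^d$), with $[D(u,r),D(v,s)]=D(w,r+s)$, $w=(u|s)v-(v|r)u$. Its Cartan subalgebra is $\mathfrak{h}=\mathrm{span}\{\partial_1,\dots,\partial_d\}$, and $U(\mathfrak{h})=\mathbb{C}[\partial_1,\dots,\partial_d]$. The extended Witt algebra is $\widetilde{W}_d=W_d\ltimes A_d$, with $A_d$ abelian and $[D(u,r),x^m]=(u|m)x^{r+m}$. A $\widetilde{W}_d$-module $P$ is admissible if $x^0v=v$ and $x^{n+r}v=x^rx^nv$ for all $r,n\in\mathbb{Z}^d$, $v\in P$. $\mathcal{K}_d=\mathbb{C}[x_1^{\pm1},\dots,x_d^{\pm1},\partial_1,\dots,\partial_d]$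 is the Weyl algebra (unital associative algebra of differential operators on $A_d$). Every $\mathcal{K}_d$-module is an admissible $\widetilde{W}_d$-module by restriction to the Lie subalgebra of $\mathcal{K}_d$ spanned by all $x^r\partial_i$ and $x^r$. For a $\mathfrak{gl}_d$-module $V$ ($\mathfrak{gl}_d$ = all complex $d\times d$ matrices) and an admissible $\widetilde{W}_d$-module $P$, $\mathcal{F}(P,V)=P\otimes V$ is the admissible $\widetilde{W}_d$-module with $$D(u,r)(z\otimes y)=D(u,r)z\otimes y+x^rz\otimes (ru^T)y,\qquad x^r(z\otimes y)=x^rz\otimes y,$$ for $u\in\mathbb{C}^d$, $r\in\mathbb{Z}^d$, $z\in P$, $y\in V$. *)

theory Defs
  imports
    "HOL-Analysis.Finite_Cartesian_Product"
    "HOL-Library.Poly_Mapping"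
    "HOL-Algebra.Module"
    "HOL-Algebra.AbelCoset"
    "HOL-Algebra.Algebraic_Closure_Type"
begin

section \<open>Modules and vector spaces\<close>

text \<open>
  Complex vector spaces, Lie algebras and their modules are records over an explicit carrier. The
  ring multiplication and unit of a module record carry no meaning and are left undefined.
\<close>

abbreviation complex_ring :: "complex ring" where
  "complex_ring \<equiv> ring_of_type_algebra"

definition module_record ::
    "'m set \<Rightarrow> ('m \<Rightarrow> 'm \<Rightarrow> 'm) \<Rightarrow> 'm \<Rightarrow> ('c \<Rightarrow> 'm \<Rightarrow> 'm) \<Rightarrow> ('c, 'm) module" where
  "module_record S pl z sc =
    \<lparr>carrier = S, monoid.mult = undefined, one = undefined, ring.zero = z, add = pl, Module.module.smult = sc\<rparr>"

definition module_basis :: "'c ring \<Rightarrow> ('c, 'm) module \<Rightarrow> 'm set \<Rightarrow> bool" where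
  "module_basis R M B \<longleftrightarrow> finite B \<and> B \<subseteq> carrier M \<and>
    (\<forall>v\<in>carrier M. \<exists>!c. c \<in> B \<rightarrow>\<^sub>E carrier R \<and> v = (\<Oplus>\<^bsub>M\<^esub>b\<in>B. c b \<odot>\<^bsub>M\<^esub> b))"

definition free_of_finite_rank :: "'c ring \<Rightarrow> ('c, 'm) module \<Rightarrow> bool" where
  "free_of_finite_rank R M \<longleftrightarrow> Module.module R M \<and> (\<exists>B. module_basis R M B)"

abbreviation finite_dimensional :: "(complex, 'm) module \<Rightarrow> bool" where
  "finite_dimensional V \<equiv> free_of_finite_rank complex_ring V"

definition submodule_span :: "'c ring \<Rightarrow> ('c, 'm) module \<Rightarrow> 'm set \<Rightarrow> 'm set" where
  "submodule_span R M S = \<Inter>{N. submodule N R M \<and> S \<subseteq> N}"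

definition quot_map :: "('c, 'm) module \<Rightarrow> 'm set \<Rightarrow> ('m \<Rightarrow> 'm) \<Rightarrow> 'm set \<Rightarrow> 'm set" where
  "quot_map M N f C = (\<Union>x\<in>C. a_r_coset M N (f x))"

definition quot_module :: "('c, 'm) module \<Rightarrow> 'm set \<Rightarrow> ('c, 'm set) module" where
  "quot_module M N =
    module_record (A_RCOSETS M N) (set_add M) N (\<lambda>c. quot_map M N (\<lambda>x. c \<odot>\<^bsub>M\<^esub> x))"

text \<open>Simplicity of \<open>M\<close> under the operators \<open>act a\<close>, \<open>a \<in> A\<close>.\<close>

definition simple_action :: "'g set \<Rightarrow> (complex, 'm) module \<Rightarrow> ('g \<Rightarrow> 'm \<Rightarrow> 'm) \<Rightarrow> bool" where
  "simple_action A M act \<longleftrightarrow> carrier M \<noteq> {\<zero>\<^bsub>M\<^esub>} \<and>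
    (\<forall>N. submodule N complex_ring M \<and> (\<forall>a\<in>A. \<forall>v\<in>N. act a v \<in> N)
       \<longrightarrow> N = {\<zero>\<^bsub>M\<^esub>} \<or> N = carrier M)"

section \<open>Lie algebras and their modules\<close>

record 'g lie_alg = "(complex, 'g) module" +
  bracket :: "'g \<Rightarrow> 'g \<Rightarrow> 'g"

locale lie_algebra = Module.module complex_ring L for L :: "'g lie_alg" +
  assumes bracket_closed:
      "\<lbrakk>x \<in> carrier L; y \<in> carrier L\<rbrakk> \<Longrightarrow> bracket L x y \<in> carrier L"
    and bracket_add_left:
      "\<lbrakk>x \<in> carrier L; y \<in> carrier L; z \<in> carrier L\<rbrakk>
        \<Longrightarrow> bracket L (x \<oplus>\<^bsub>L\<^esub> y) z = bracket L x z \<oplus>\<^bsub>L\<^esub> bracket L y z"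
    and bracket_add_right:
      "\<lbrakk>x \<in> carrier L; y \<in> carrier L; z \<in> carrier L\<rbrakk>
        \<Longrightarrow> bracket L x (y \<oplus>\<^bsub>L\<^esub> z) = bracket L x y \<oplus>\<^bsub>L\<^esub> bracket L x z"
    and bracket_smult_left:
      "\<lbrakk>x \<in> carrier L; y \<in> carrier L\<rbrakk>
        \<Longrightarrow> bracket L (c \<odot>\<^bsub>L\<^esub> x) y = c \<odot>\<^bsub>L\<^esub> bracket L x y"
    and bracket_smult_right:
      "\<lbrakk>x \<in> carrier L; y \<in> carrier L\<rbrakk>
        \<Longrightarrow> bracket L x (c \<odot>\<^bsub>L\<^esub> y) = c \<odot>\<^bsub>L\<^esub> bracket L x y"
    and bracket_self: "x \<in> carrier L \<Longrightarrow> bracket L x x = \<zero>\<^bsub>L\<^esub>"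
    and jacobi:
      "\<lbrakk>x \<in> carrier L; y \<in> carrier L; z \<in> carrier L\<rbrakk>
        \<Longrightarrow> bracket L x (bracket L y z) \<oplus>\<^bsub>L\<^esub> bracket L y (bracket L z x)
              \<oplus>\<^bsub>L\<^esub> bracket L z (bracket L x y) = \<zero>\<^bsub>L\<^esub>"

locale lie_module = lie_algebra L + M: Module.module complex_ring M
  for L :: "'g lie_alg" and M :: "(complex, 'm) module" and act :: "'g \<Rightarrow> 'm \<Rightarrow> 'm" +
  assumes act_closed: "\<lbrakk>x \<in> carrier L; v \<in> carrier M\<rbrakk> \<Longrightarrow> act x v \<in> carrier M"
    and act_add_left:
      "\<lbrakk>x \<in> carrier L; y \<in> carrier L; v \<in> carrier M\<rbrakk>
        \<Longrightarrow> act (x \<oplus>\<^bsub>L\<^esub> y) v = act x v \<oplus>\<^bsub>M\<^esub> act y v"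
    and act_add_right:
      "\<lbrakk>x \<in> carrier L; v \<in> carrier M; w \<in> carrier M\<rbrakk>
        \<Longrightarrow> act x (v \<oplus>\<^bsub>M\<^esub> w) = act x v \<oplus>\<^bsub>M\<^esub> act x w"
    and act_smult_left:
      "\<lbrakk>x \<in> carrier L; v \<in> carrier M\<rbrakk> \<Longrightarrow> act (c \<odot>\<^bsub>L\<^esub> x) v = c \<odot>\<^bsub>M\<^esub> act x v"
    and act_smult_right:
      "\<lbrakk>x \<in> carrier L; v \<in> carrier M\<rbrakk> \<Longrightarrow> act x (c \<odot>\<^bsub>M\<^esub> v) = c \<odot>\<^bsub>M\<^esub> act x v"
    and act_bracket:
      "\<lbrakk>x \<in> carrier L; y \<in> carrier L; v \<in> carrier M\<rbrakk>
        \<Longrightarrow> act (bracket L x y) v = act x (act y v) \<ominus>\<^bsub>M\<^esub> act y (act x v)"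

definition simple_lie_module ::
    "'g lie_alg \<Rightarrow> (complex, 'm) module \<Rightarrow> ('g \<Rightarrow> 'm \<Rightarrow> 'm) \<Rightarrow> bool" where
  "simple_lie_module L M act \<longleftrightarrow> lie_module L M act \<and> simple_action (carrier L) M act"

definition lie_module_isomorphic ::
    "'g lie_alg \<Rightarrow> (complex, 'm) module \<Rightarrow> ('g \<Rightarrow> 'm \<Rightarrow> 'm)
      \<Rightarrow> (complex, 'n) module \<Rightarrow> ('g \<Rightarrow> 'n \<Rightarrow> 'n) \<Rightarrow> bool" where
  "lie_module_isomorphic L M act N act' \<longleftrightarrow> lie_module L M act \<and> lie_module L N act' \<and>
    (\<exists>\<phi>. bij_betw \<phi> (carrier M) (carrier N) \<and>
      (\<forall>v\<in>carrier M. \<forall>w\<in>carrier M. \<phi> (v \<oplus>\<^bsub>M\<^esub> w) = \<phi> v \<oplus>\<^bsub>N\<^esub> \<phi> w) \<and>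
      (\<forall>c. \<forall>v\<in>carrier M. \<phi> (c \<odot>\<^bsub>M\<^esub> v) = c \<odot>\<^bsub>N\<^esub> \<phi> v) \<and>
      (\<forall>x\<in>carrier L. \<forall>v\<in>carrier M. \<phi> (act x v) = act' x (\<phi> v)))"

definition gl :: "(complex ^ 'd ^ 'd) lie_alg" where
  "gl = \<lparr>carrier = UNIV, monoid.mult = undefined, one = undefined, ring.zero = 0, add = (+),
         Module.module.smult = (\<lambda>c A. \<chi> i j. c * A $ i $ j), bracket = (\<lambda>A B. A ** B - B ** A)\<rparr>"

section \<open>Laurent polynomials and the extended Witt algebra\<close>

text \<open>\<open>A\<^sub>d\<close> is the group algebra of \<open>\<int>\<^sup>d\<close>; its product is the convolution product on finitely
  supported functions, and \<open>d\<close> is the cardinality of the index type.\<close>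

type_synonym 'd laurent = "(int ^ 'd) \<Rightarrow>\<^sub>0 complex"

definition pm_scale :: "complex \<Rightarrow> ('a \<Rightarrow>\<^sub>0 complex) \<Rightarrow> ('a \<Rightarrow>\<^sub>0 complex)" where
  "pm_scale c = Poly_Mapping.map ((*) c)"

definition xmon :: "int ^ 'd \<Rightarrow> 'd::finite laurent" where
  "xmon r = Poly_Mapping.single r 1"

text \<open>\<open>\<partial>\<^sub>i = x\<^sub>i \<partial>/\<partial>x\<^sub>i\<close> multiplies the monomial \<open>x\<^sup>r\<close> by \<open>r\<^sub>i\<close>.\<close>

definition euler :: "'d \<Rightarrow> 'd::finite laurent \<Rightarrow> 'd laurent" where
  "euler i = Poly_Mapping.mapp (\<lambda>r c. of_int (r $ i) * c)"

definition witt_D :: "complex ^ 'd \<Rightarrow> int ^ 'd \<Rightarrow> 'd::finite laurent \<Rightarrow> 'd laurent" where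
  "witt_D u r f = xmon r * (\<Sum>i\<in>UNIV. pm_scale (u $ i) (euler i f))"

definition witt :: "('d::finite laurent \<Rightarrow> 'd laurent) set" where
  "witt = {\<xi>. (\<forall>f g. \<xi> (f + g) = \<xi> f + \<xi> g) \<and> (\<forall>c f. \<xi> (pm_scale c f) = pm_scale c (\<xi> f)) \<and>
              (\<forall>f g. \<xi> (f * g) = \<xi> f * g + f * \<xi> g)}"

text \<open>The pair \<open>(\<xi>, a)\<close> stands for \<open>\<xi> + a\<close> in the semidirect product of \<open>W\<^sub>d\<close> and \<open>A\<^sub>d\<close>.\<close>

type_synonym 'd ext_witt_elem = "('d laurent \<Rightarrow> 'd laurent) \<times> 'd laurent"

definition ext_witt :: "'d::finite ext_witt_elem lie_alg" where
  "ext_witt =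
    \<lparr>carrier = witt \<times> UNIV, monoid.mult = undefined, one = undefined,
     ring.zero = (\<lambda>f. 0, 0),
     add = (\<lambda>(\<xi>, a) (\<eta>, b). (\<lambda>f. \<xi> f + \<eta> f, a + b)),
     Module.module.smult = (\<lambda>c (\<xi>, a). (\<lambda>f. pm_scale c (\<xi> f), pm_scale c a)),
     bracket = (\<lambda>(\<xi>, a) (\<eta>, b). (\<lambda>f. \<xi> (\<eta> f) - \<eta> (\<xi> f), \<xi> b - \<eta> a))\<rparr>"

abbreviation of_D :: "complex ^ 'd \<Rightarrow> int ^ 'd \<Rightarrow> 'd::finite ext_witt_elem" where
  "of_D u r \<equiv> (witt_D u r, 0)"

abbreviation of_A :: "'d laurent \<Rightarrow> 'd::finite ext_witt_elem" where
  "of_A a \<equiv> (\<lambda>f. 0, a)"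

definition admissible :: "(complex, 'm) module \<Rightarrow> ('d::finite ext_witt_elem \<Rightarrow> 'm \<Rightarrow> 'm) \<Rightarrow> bool"
  where
  "admissible P act \<longleftrightarrow> lie_module ext_witt P act \<and>
    (\<forall>v\<in>carrier P. act (of_A (xmon 0)) v = v) \<and>
    (\<forall>r n. \<forall>v\<in>carrier P. act (of_A (xmon (n + r))) v = act (of_A (xmon r)) (act (of_A (xmon n)) v))"

section \<open>Freeness over the enveloping algebra of the Cartan subalgebra\<close>

text \<open>\<open>U(\<hh>)\<close> is the polynomial ring in the commuting variables \<open>\<partial>\<^sub>i\<close>.\<close>

type_synonym 'd U_h = "('d \<Rightarrow>\<^sub>0 nat) \<Rightarrow>\<^sub>0 complex"

definition U_h_const :: "complex \<Rightarrow> 'd U_h" where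
  "U_h_const c = Poly_Mapping.single 0 c"

definition U_h_var :: "'d \<Rightarrow> 'd U_h" where
  "U_h_var i = Poly_Mapping.single (Poly_Mapping.single i 1) 1"

text \<open>The action \<open>\<mu>\<close> of \<open>U(\<hh>)\<close> is determined on the carrier by the scalars and the \<open>\<partial>\<^sub>i\<close>, since these
  generate the ring.\<close>

definition U_h_free_of_finite_rank ::
    "(complex, 'm) module \<Rightarrow> ('d::finite ext_witt_elem \<Rightarrow> 'm \<Rightarrow> 'm) \<Rightarrow> bool" where
  "U_h_free_of_finite_rank M act \<longleftrightarrow>
    (\<exists>\<mu> :: 'd U_h \<Rightarrow> 'm \<Rightarrow> 'm.
      (\<forall>c. \<forall>v\<in>carrier M. \<mu> (U_h_const c) v = c \<odot>\<^bsub>M\<^esub> v) \<and>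
      (\<forall>i. \<forall>v\<in>carrier M. \<mu> (U_h_var i) v = act (of_D (axis i 1) 0) v) \<and>
      free_of_finite_rank ring_of_type_algebra
        (module_record (carrier M) (add M) \<zero>\<^bsub>M\<^esub> \<mu>))"

section \<open>The Weyl algebra\<close>

inductive_set weyl :: "('d::finite laurent \<Rightarrow> 'd laurent) set" where
  xmon: "(\<lambda>f. xmon r * f) \<in> weyl"
| euler: "euler i \<in> weyl"
| add: "\<lbrakk>S \<in> weyl; T \<in> weyl\<rbrakk> \<Longrightarrow> (\<lambda>f. S f + T f) \<in> weyl"
| scale: "T \<in> weyl \<Longrightarrow> (\<lambda>f. pm_scale c (T f)) \<in> weyl"
| comp: "\<lbrakk>S \<in> weyl; T \<in> weyl\<rbrakk> \<Longrightarrow> (\<lambda>f. S (T f)) \<in> weyl"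

locale weyl_module = Module.module complex_ring P
  for P :: "(complex, 'p) module"
    and act :: "('d::finite laurent \<Rightarrow> 'd laurent) \<Rightarrow> 'p \<Rightarrow> 'p" +
  assumes act_closed: "\<lbrakk>T \<in> weyl; v \<in> carrier P\<rbrakk> \<Longrightarrow> act T v \<in> carrier P"
    and act_add_left:
      "\<lbrakk>S \<in> weyl; T \<in> weyl; v \<in> carrier P\<rbrakk>
        \<Longrightarrow> act (\<lambda>f. S f + T f) v = act S v \<oplus>\<^bsub>P\<^esub> act T v"
    and act_add_right:
      "\<lbrakk>T \<in> weyl; v \<in> carrier P; w \<in> carrier P\<rbrakk>
        \<Longrightarrow> act T (v \<oplus>\<^bsub>P\<^esub> w) = act T v \<oplus>\<^bsub>P\<^esub> act T w"
    and act_scale_left: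
      "\<lbrakk>T \<in> weyl; v \<in> carrier P\<rbrakk> \<Longrightarrow> act (\<lambda>f. pm_scale c (T f)) v = c \<odot>\<^bsub>P\<^esub> act T v"
    and act_scale_right:
      "\<lbrakk>T \<in> weyl; v \<in> carrier P\<rbrakk> \<Longrightarrow> act T (c \<odot>\<^bsub>P\<^esub> v) = c \<odot>\<^bsub>P\<^esub> act T v"
    and act_id: "v \<in> carrier P \<Longrightarrow> act (\<lambda>f. f) v = v"
    and act_comp:
      "\<lbrakk>S \<in> weyl; T \<in> weyl; v \<in> carrier P\<rbrakk> \<Longrightarrow> act (\<lambda>f. S (T f)) v = act S (act T v)"

definition simple_weyl_module ::
    "(complex, 'p) module \<Rightarrow> (('d::finite laurent \<Rightarrow> 'd laurent) \<Rightarrow> 'p \<Rightarrow> 'p) \<Rightarrow> bool" where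
  "simple_weyl_module P act \<longleftrightarrow> weyl_module P act \<and> simple_action weyl P act"

text \<open>Restriction to the Lie subalgebra \<open>W\<^sub>d + A\<^sub>d\<close> of the Weyl algebra.\<close>

definition weyl_restrict ::
    "(('d::finite laurent \<Rightarrow> 'd laurent) \<Rightarrow> 'p \<Rightarrow> 'p) \<Rightarrow> 'd ext_witt_elem \<Rightarrow> 'p \<Rightarrow> 'p" where
  "weyl_restrict act = (\<lambda>(\<xi>, a). act (\<lambda>f. \<xi> f + a * f))"

section \<open>Tensor products and the modules \<open>\<F>(P, V)\<close>\<close>

definition free_space :: "'b set \<Rightarrow> (complex, 'b \<Rightarrow>\<^sub>0 complex) module" where
  "free_space B = module_record {f. Poly_Mapping.keys f \<subseteq> B} (+) 0 pm_scale"

definition free_extend :: "('b \<Rightarrow> ('e \<Rightarrow>\<^sub>0 complex)) \<Rightarrow> ('b \<Rightarrow>\<^sub>0 complex) \<Rightarrow> ('e \<Rightarrow>\<^sub>0 complex)" where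
  "free_extend g f = (\<Sum>b\<in>Poly_Mapping.keys f. pm_scale (Poly_Mapping.lookup f b) (g b))"

text \<open>The pair \<open>(z, y)\<close> as a basis vector of the free space; its class in the quotient below is the
  pure tensor \<open>z \<otimes> y\<close>.\<close>

abbreviation pair :: "'p \<Rightarrow> 'v \<Rightarrow> ('p \<times> 'v) \<Rightarrow>\<^sub>0 complex" where
  "pair z y \<equiv> Poly_Mapping.single (z, y) 1"

definition tensor_relators ::
    "(complex, 'p) module \<Rightarrow> (complex, 'v) module \<Rightarrow> (('p \<times> 'v) \<Rightarrow>\<^sub>0 complex) set" where
  "tensor_relators P V =
     {pair (z \<oplus>\<^bsub>P\<^esub> z') y - pair z y - pair z' y | z z' y.
        z \<in> carrier P \<and> z' \<in> carrier P \<and> y \<in> carrier V}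
   \<union> {pair z (y \<oplus>\<^bsub>V\<^esub> y') - pair z y - pair z y' | z y y'.
        z \<in> carrier P \<and> y \<in> carrier V \<and> y' \<in> carrier V}
   \<union> {pair (c \<odot>\<^bsub>P\<^esub> z) y - pm_scale c (pair z y) | c z y. z \<in> carrier P \<and> y \<in> carrier V}
   \<union> {pair z (c \<odot>\<^bsub>V\<^esub> y) - pm_scale c (pair z y) | c z y. z \<in> carrier P \<and> y \<in> carrier V}"

definition tensor_kernel ::
    "(complex, 'p) module \<Rightarrow> (complex, 'v) module \<Rightarrow> (('p \<times> 'v) \<Rightarrow>\<^sub>0 complex) set" where
  "tensor_kernel P V =
     submodule_span complex_ring (free_space (carrier P \<times> carrier V)) (tensor_relators P V)"

definition tensor ::
    "(complex, 'p) module \<Rightarrow> (complex, 'v) module \<Rightarrow> (complex, (('p \<times> 'v) \<Rightarrow>\<^sub>0 complex) set) module"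
  where
  "tensor P V = quot_module (free_space (carrier P \<times> carrier V)) (tensor_kernel P V)"

text \<open>
  \<open>\<F>(P, V)\<close> is prescribed on \<open>D(u, r)\<close> and \<open>x\<^sup>r\<close>. To extend linearly to an arbitrary derivation
  \<open>\<xi> = \<Sum>\<^sub>r D(u\<^sub>r, r)\<close>, the vector \<open>u\<^sub>r\<close> is read off from \<open>\<xi>(x\<^sub>i) = \<Sum>\<^sub>r (u\<^sub>r)\<^sub>i x\<^sub>i x\<^sup>r\<close>; see
  \<open>witt_coeff_D\<close> and \<open>witt_decomposition\<close> below.
\<close>

definition witt_coeff :: "('d::finite laurent \<Rightarrow> 'd laurent) \<Rightarrow> int ^ 'd \<Rightarrow> complex ^ 'd" where
  "witt_coeff \<xi> r = (\<chi> i. Poly_Mapping.lookup (\<xi> (xmon (axis i 1))) (r + axis i 1))"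

definition witt_supp :: "('d::finite laurent \<Rightarrow> 'd laurent) \<Rightarrow> (int ^ 'd) set" where
  "witt_supp \<xi> = {r. witt_coeff \<xi> r \<noteq> 0}"

definition outer :: "int ^ 'd \<Rightarrow> complex ^ 'd \<Rightarrow> complex ^ 'd ^ 'd" where
  "outer r u = (\<chi> i j. of_int (r $ i) * u $ j)"

definition F_on_pair ::
    "('d::finite ext_witt_elem \<Rightarrow> 'p \<Rightarrow> 'p) \<Rightarrow> (complex ^ 'd ^ 'd \<Rightarrow> 'v \<Rightarrow> 'v)
      \<Rightarrow> 'd ext_witt_elem \<Rightarrow> 'p \<times> 'v \<Rightarrow> (('p \<times> 'v) \<Rightarrow>\<^sub>0 complex)" where
  "F_on_pair actP actV = (\<lambda>(\<xi>, a) (z, y).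
     (\<Sum>r\<in>witt_supp \<xi>.
        pair (actP (of_D (witt_coeff \<xi> r) r) z) y
      + pair (actP (of_A (xmon r)) z) (actV (outer r (witt_coeff \<xi> r)) y))
     + pair (actP (of_A a) z) y)"

definition F_act ::
    "(complex, 'p) module \<Rightarrow> ('d::finite ext_witt_elem \<Rightarrow> 'p \<Rightarrow> 'p)
      \<Rightarrow> (complex, 'v) module \<Rightarrow> (complex ^ 'd ^ 'd \<Rightarrow> 'v \<Rightarrow> 'v)
      \<Rightarrow> 'd ext_witt_elem \<Rightarrow> (('p \<times> 'v) \<Rightarrow>\<^sub>0 complex) set \<Rightarrow> (('p \<times> 'v) \<Rightarrow>\<^sub>0 complex) set" where
  "F_act P actP V actV w =
     quot_map (free_space (carrier P \<times> carrier V)) (tensor_kernel P V)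
       (free_extend (F_on_pair actP actV w))"

section \<open>Basic facts on the structures above\<close>

lemma lookup_pm_scale [simp]: "Poly_Mapping.lookup (pm_scale c f) k = c * Poly_Mapping.lookup f k"
  by (auto simp: pm_scale_def Poly_Mapping.map.rep_eq when_def)

lemma lookup_euler [simp]:
  "Poly_Mapping.lookup (euler i f) r = of_int (r $ i) * Poly_Mapping.lookup f r"
  by (auto simp: euler_def lookup_mapp in_keys_iff when_def)

lemma pm_scale_times: "pm_scale c f = Poly_Mapping.single 0 c * f"
  for f :: "'a::comm_monoid_add \<Rightarrow>\<^sub>0 complex"
  by (rule poly_mapping_eqI) (metis lookup_pm_scale mult_map_scale_conv_mult pm_scale_def)

lemma pm_scale_add: "pm_scale c (f + g) = pm_scale c f + pm_scale c g"
  by (rule poly_mapping_eqI) (simp add: lookup_add algebra_simps)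

lemma pm_scale_minus: "pm_scale c (f - g) = pm_scale c f - pm_scale c g"
  by (rule poly_mapping_eqI) (simp add: lookup_minus algebra_simps)

lemma pm_scale_add_left: "pm_scale (c + c') f = pm_scale c f + pm_scale c' f"
  by (rule poly_mapping_eqI) (simp add: lookup_add algebra_simps)

lemma pm_scale_assoc: "pm_scale (c * c') f = pm_scale c (pm_scale c' f)"
  by (rule poly_mapping_eqI) (simp add: algebra_simps)

lemma pm_scale_one [simp]: "pm_scale 1 f = f"
  by (rule poly_mapping_eqI) simp

lemma pm_scale_zero [simp]: "pm_scale 0 f = 0" "pm_scale c 0 = 0"
  by (rule poly_mapping_eqI; simp)+

lemma pm_scale_sum: "pm_scale c (sum g S) = (\<Sum>s\<in>S. pm_scale c (g s))"
  by (induction S rule: infinite_finite_induct) (auto simp: pm_scale_add)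

lemma pm_scale_mult_left: "pm_scale c f * g = pm_scale c (f * g)"
  for f :: "'a::comm_monoid_add \<Rightarrow>\<^sub>0 complex"
  by (simp add: pm_scale_times mult.assoc)

lemma pm_scale_mult_right: "f * pm_scale c g = pm_scale c (f * g)"
  for f :: "'a::comm_monoid_add \<Rightarrow>\<^sub>0 complex"
  by (simp add: pm_scale_times algebra_simps)

lemma pm_scale_single: "pm_scale c (Poly_Mapping.single k d) = Poly_Mapping.single k (c * d)"
  by (rule poly_mapping_eqI) (simp add: lookup_single when_def)

lemma xmon_mult: "xmon r * xmon s = xmon (r + s)"
  by (simp add: xmon_def mult_single)

lemma xmon_0: "xmon 0 = 1"
  by (simp add: xmon_def)

lemma lookup_xmon: "Poly_Mapping.lookup (xmon r) k = (if k = r then 1 else 0)"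
  by (simp add: xmon_def lookup_single when_def)

lemma pm_induct [case_names zero single add]:
  fixes f :: "'a \<Rightarrow>\<^sub>0 'b::comm_monoid_add"
  assumes z: "Q 0" and s: "\<And>k c. Q (Poly_Mapping.single k c)"
    and a: "\<And>f g. Q f \<Longrightarrow> Q g \<Longrightarrow> Q (f + g)"
  shows "Q f"
proof (induction f rule: update_induct)
  case const
  then show ?case by (simp add: z)
next
  case (update f k v)
  have "Poly_Mapping.update k v f = f + Poly_Mapping.single k v"
    using update by (intro poly_mapping_eqI)
      (auto simp: lookup_update lookup_add lookup_single in_keys_iff when_def)
  then show ?case using a update s by simp
qed

lemma euler_add: "euler i (f + g) = euler i f + euler i g"
  by (rule poly_mapping_eqI) (simp add: lookup_add algebra_simps)

lemma euler_scale: "euler i (pm_scale c f) = pm_scale c (euler i f)"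
  by (rule poly_mapping_eqI) (simp add: algebra_simps)

lemma euler_single: "euler i (Poly_Mapping.single r c) = Poly_Mapping.single r (of_int (r $ i) * c)"
  by (rule poly_mapping_eqI) (simp add: lookup_single when_def)

lemma euler_mult: "euler i (f * g) = euler i f * g + f * euler i g"
proof (induction f rule: pm_induct)
  case zero
  have "euler i 0 = 0" by (rule poly_mapping_eqI) simp
  then show ?case by simp
next
  case (single r c)
  show ?case
  proof (induction g rule: pm_induct)
    case zero
    have "euler i 0 = 0" by (rule poly_mapping_eqI) simp
    then show ?case by simp
  next
    case (single s c')
    show ?case by (simp add: mult_single euler_single single_add [symmetric] algebra_simps)
  next
    case (add f g)
    then show ?case by (simp add: distrib_left euler_add)
  qed
next
  case (add f g)
  then show ?case by (simp add: distrib_right euler_add)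
qed

lemma witt_D_in_witt: "witt_D u r \<in> witt"
  unfolding witt_def witt_D_def
  by (auto simp: euler_add euler_scale euler_mult pm_scale_add sum.distrib sum_distrib_left
      sum_distrib_right pm_scale_sum pm_scale_mult_left pm_scale_mult_right algebra_simps
      pm_scale_assoc [symmetric])

lemma witt_D_xmon: "witt_D u r (xmon m) = pm_scale (\<Sum>i\<in>UNIV. u $ i * of_int (m $ i)) (xmon (r + m))"
proof -
  have "(\<Sum>i\<in>UNIV. pm_scale (u $ i) (euler i (xmon m)))
      = pm_scale (\<Sum>i\<in>UNIV. u $ i * of_int (m $ i)) (xmon m)"
    by (rule poly_mapping_eqI)
      (simp add: lookup_sum sum_distrib_right xmon_def lookup_single when_def)
  then show ?thesis by (simp add: witt_D_def pm_scale_mult_right xmon_mult)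
qed

lemma sum_axis: "(\<Sum>j\<in>UNIV. u $ j * of_int (axis i (1::int) $ j)) = u $ i"
  for u :: "complex ^ 'd::finite"
  by (simp add: axis_def if_distrib cong: if_cong)

lemma witt_coeff_D: "witt_coeff (witt_D u r) s = (if s = r then u else 0)"
  by (simp add: witt_coeff_def vec_eq_iff witt_D_xmon sum_axis lookup_xmon)

lemma finite_witt_supp: "finite (witt_supp \<xi>)"
proof -
  have "witt_supp \<xi> \<subseteq> (\<Union>i. (\<lambda>k. k - axis i 1) ` Poly_Mapping.keys (\<xi> (xmon (axis i 1))))"
  proof
    fix r assume "r \<in> witt_supp \<xi>"
    then obtain i where "Poly_Mapping.lookup (\<xi> (xmon (axis i 1))) (r + axis i 1) \<noteq> 0"
      by (auto simp: witt_supp_def witt_coeff_def vec_eq_iff)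
    then have "r + axis i 1 \<in> Poly_Mapping.keys (\<xi> (xmon (axis i 1)))" by (simp add: in_keys_iff)
    moreover have "r = (r + axis i 1) - axis i 1" by simp
    ultimately show "r \<in> (\<Union>i. (\<lambda>k. k - axis i 1) ` Poly_Mapping.keys (\<xi> (xmon (axis i 1))))"
      by blast
  qed
  then show ?thesis by (rule finite_subset) auto
qed

lemma witt_0:
  assumes "\<xi> \<in> witt"
  shows "\<xi> 0 = 0"
proof -
  have "\<xi> (0 + 0) = \<xi> 0 + \<xi> 0" using assms unfolding witt_def by blast
  then show ?thesis by simp
qed

lemma witt_eqI:
  fixes \<xi> \<eta> :: "'d::finite laurent \<Rightarrow> 'd laurent"
  assumes \<xi>: "\<xi> \<in> witt" and \<eta>: "\<eta> \<in> witt"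
    and eq: "\<And>i. \<xi> (xmon (axis i 1)) = \<eta> (xmon (axis i 1))"
  shows "\<xi> = \<eta>"
proof -
  have add: "\<zeta> (f + g) = \<zeta> f + \<zeta> g" and scale: "\<zeta> (pm_scale c f) = pm_scale c (\<zeta> f)"
    and mult: "\<zeta> (f * g) = \<zeta> f * g + f * \<zeta> g" if "\<zeta> \<in> {\<xi>, \<eta>}" for \<zeta> f g c
    using that \<xi> \<eta> unfolding witt_def by auto
  define G where "G = {s. \<xi> (xmon s) = \<eta> (xmon s)}"
  have G_add: "r + s \<in> G" if "r \<in> G" "s \<in> G" for r s
    using that by (simp add: G_def xmon_mult [symmetric] mult)
  have one: "\<zeta> 1 = 0" if "\<zeta> \<in> {\<xi>, \<eta>}" for \<zeta>
    using mult[OF that, of 1 1] by simp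
  have G_0: "0 \<in> G" by (simp add: G_def xmon_0 one)
  have G_minus: "- s \<in> G" if "s \<in> G" for s
  proof -
    have *: "\<zeta> (xmon (- s)) = - (xmon (- s) * xmon (- s) * \<zeta> (xmon s))" if z: "\<zeta> \<in> {\<xi>, \<eta>}" for \<zeta>
    proof -
      have "0 = \<zeta> (xmon (- s) * xmon s)" using one[OF z] by (simp add: xmon_mult xmon_0)
      also have "\<dots> = \<zeta> (xmon (- s)) * xmon s + xmon (- s) * \<zeta> (xmon s)" by (rule mult[OF z])
      finally have "0 = (\<zeta> (xmon (- s)) * xmon s + xmon (- s) * \<zeta> (xmon s)) * xmon (- s)" by simp
      also have "\<dots> = \<zeta> (xmon (- s)) * (xmon s * xmon (- s))
          + xmon (- s) * xmon (- s) * \<zeta> (xmon s)"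
        by (simp only: distrib_right distrib_left mult_ac)
      finally show ?thesis by (simp add: xmon_mult xmon_0 eq_neg_iff_add_eq_0)
    qed
    show ?thesis using *[of \<xi>] *[of \<eta>] that by (simp add: G_def)
  qed
  have ax_add: "axis i (m + n) = axis i m + axis i n" for i :: 'd and m n :: int
    by (simp add: vec_eq_iff axis_def)
  have ax: "axis i n \<in> G" for i n
  proof (induction n rule: int_induct[where k = 0])
    case base
    have "(axis i 0 :: int ^ 'd) = 0" by (simp add: vec_eq_iff axis_def)
    then show ?case using G_0 by (simp only:)
  next
    case (step1 n)
    have "axis i (1::int) \<in> G" using eq by (simp add: G_def)
    then show ?case using G_add step1 by (simp add: ax_add)
  next
    case (step2 n)
    have "axis i (1::int) \<in> G" using eq by (simp add: G_def)
    then have "- axis i (1::int) \<in> G" by (rule G_minus)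
    then have "axis i n + - axis i 1 \<in> G" using G_add step2 by blast
    moreover have "axis i n + - axis i 1 = axis i (n - 1)" by (simp add: vec_eq_iff axis_def)
    ultimately show ?case by simp
  qed
  have G_sum: "(\<Sum>i\<in>S. axis i (s $ i)) \<in> G" for S s
    by (induction S rule: infinite_finite_induct) (auto simp: G_0 ax G_add)
  have "s = (\<Sum>i\<in>UNIV. axis i (s $ i))" for s :: "int ^ 'd"
    by (simp add: vec_eq_iff axis_def)
  then have all: "s \<in> G" for s using G_sum by metis
  show ?thesis
  proof
    fix f
    show "\<xi> f = \<eta> f"
    proof (induction f rule: pm_induct)
      case zero
      then show ?case using witt_0 \<xi> \<eta> by metis
    next
      case (single k c)
      have "Poly_Mapping.single k c = pm_scale c (xmon k)" by (simp add: xmon_def pm_scale_single)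
      then show ?case using all[of k] scale[of \<xi> c "xmon k"] scale[of \<eta> c "xmon k"]
        by (simp add: G_def)
    next
      case (add f g)
      then show ?case using assms unfolding witt_def by auto
    qed
  qed
qed

lemma witt_sum: "(\<And>r. r \<in> S \<Longrightarrow> g r \<in> witt) \<Longrightarrow> (\<lambda>f. \<Sum>r\<in>S. g r f) \<in> witt"
  unfolding witt_def
  by (auto simp: sum.distrib pm_scale_sum sum_distrib_left sum_distrib_right)

lemma witt_decomposition:
  assumes \<xi>: "\<xi> \<in> witt"
  shows "\<xi> = (\<lambda>f. \<Sum>r\<in>witt_supp \<xi>. witt_D (witt_coeff \<xi> r) r f)"
proof (rule witt_eqI[OF \<xi> witt_sum[OF witt_D_in_witt]])
  fix i
  show "\<xi> (xmon (axis i 1)) = (\<Sum>r\<in>witt_supp \<xi>. witt_D (witt_coeff \<xi> r) r (xmon (axis i 1)))"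
  proof (rule poly_mapping_eqI)
    fix k
    have "(\<Sum>r\<in>witt_supp \<xi>. Poly_Mapping.lookup (witt_D (witt_coeff \<xi> r) r (xmon (axis i 1))) k)
        = (\<Sum>r\<in>witt_supp \<xi>. if r = k - axis i 1 then witt_coeff \<xi> r $ i else 0)"
      by (intro sum.cong refl)
        (auto simp: witt_D_xmon sum_axis lookup_xmon algebra_simps)
    also have "\<dots> = witt_coeff \<xi> (k - axis i 1) $ i"
      using finite_witt_supp[of \<xi>] by (simp add: witt_supp_def)
    also have "\<dots> = Poly_Mapping.lookup (\<xi> (xmon (axis i 1))) k"
      by (simp add: witt_coeff_def)
    finally show "Poly_Mapping.lookup (\<xi> (xmon (axis i 1))) k
        = Poly_Mapping.lookup (\<Sum>r\<in>witt_supp \<xi>. witt_D (witt_coeff \<xi> r) r (xmon (axis i 1))) k"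
      by (simp add: lookup_sum)
  qed
qed

lemma weyl_sum: "(\<And>s. s \<in> S \<Longrightarrow> g s \<in> weyl) \<Longrightarrow> (\<lambda>f. \<Sum>s\<in>S. g s f) \<in> weyl"
proof (induction S rule: infinite_finite_induct)
  case (insert x F)
  then show ?case using weyl.add[of "g x" "\<lambda>f. \<Sum>s\<in>F. g s f"] by simp
qed (use weyl.scale[OF weyl.euler, of 0] in simp_all)

lemma mult_in_weyl: "(\<lambda>f. a * f) \<in> weyl"
proof (induction a rule: pm_induct)
  case zero
  show ?case using weyl.scale[OF weyl.euler, of 0] by simp
next
  case (single k c)
  have "Poly_Mapping.single k c = pm_scale c (xmon k)" by (simp add: xmon_def pm_scale_single)
  then show ?case using weyl.scale[OF weyl.xmon, of c k] by (simp add: pm_scale_mult_left)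
next
  case (add a b)
  then show ?case using weyl.add by (simp add: distrib_right)
qed

lemma witt_D_in_weyl: "witt_D u r \<in> weyl"
  unfolding witt_D_def [abs_def]
  by (rule weyl.comp[OF weyl.xmon]) (intro weyl_sum weyl.scale weyl.euler)

lemma ext_witt_in_weyl:
  assumes "\<xi> \<in> witt"
  shows "(\<lambda>f. \<xi> f + a * f) \<in> weyl"
proof -
  have "(\<lambda>f. \<Sum>r\<in>witt_supp \<xi>. witt_D (witt_coeff \<xi> r) r f) \<in> weyl"
    by (rule weyl_sum) (rule witt_D_in_weyl)
  then have "\<xi> \<in> weyl" by (simp flip: witt_decomposition[OF assms])
  then show ?thesis by (rule weyl.add[OF _ mult_in_weyl])
qed

lemma witt_bracket:
  assumes "\<xi> \<in> witt" "\<eta> \<in> witt"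
  shows "(\<lambda>f. \<xi> (\<eta> f) - \<eta> (\<xi> f)) \<in> witt"
  using assms unfolding witt_def by (auto simp: algebra_simps pm_scale_minus)

lemma witt_D_bracket:
  "bracket ext_witt (of_D u r) (of_D v s) =
     of_D (\<chi> i. (\<Sum>j\<in>UNIV. u $ j * of_int (s $ j)) * v $ i
              - (\<Sum>j\<in>UNIV. v $ j * of_int (r $ j)) * u $ i) (r + s)"
proof -
  have "(\<lambda>f. witt_D u r (witt_D v s f) - witt_D v s (witt_D u r f)) =
     witt_D (\<chi> i. (\<Sum>j\<in>UNIV. u $ j * of_int (s $ j)) * v $ i
              - (\<Sum>j\<in>UNIV. v $ j * of_int (r $ j)) * u $ i) (r + s)"
  proof (rule witt_eqI[OF witt_bracket witt_D_in_witt])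
    have sc: "witt_D u r (pm_scale c f) = pm_scale c (witt_D u r f)" for u r c f
      using witt_D_in_witt[of u r] unfolding witt_def by blast
    show "witt_D u r (witt_D v s (xmon (axis i 1))) - witt_D v s (witt_D u r (xmon (axis i 1))) =
      witt_D (\<chi> i. (\<Sum>j\<in>UNIV. u $ j * of_int (s $ j)) * v $ i
              - (\<Sum>j\<in>UNIV. v $ j * of_int (r $ j)) * u $ i) (r + s) (xmon (axis i 1))" for i
    proof -
      have diff: "pm_scale a f - pm_scale b f = pm_scale (a - b) f" for a b and f :: "'a laurent"
        by (rule poly_mapping_eqI) (simp add: lookup_minus left_diff_distrib)
      have exps: "r + (s + axis i 1) = r + s + axis i 1" "s + (r + axis i 1) = r + s + axis i 1"
        by (simp_all add: add_ac)
      have dot: "(\<Sum>j\<in>UNIV. u $ j * of_int ((s + axis i 1) $ j))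
          = (\<Sum>j\<in>UNIV. u $ j * of_int (s $ j)) + u $ i" for u :: "complex ^ 'a" and s
        by (simp add: distrib_left sum.distrib sum_axis)
      show ?thesis
        unfolding witt_D_xmon sc pm_scale_assoc [symmetric] exps diff dot sum_axis
        by (simp add: algebra_simps)
    qed
  qed (rule witt_D_in_witt)+
  then show ?thesis using witt_0[OF witt_D_in_witt[of u r]] witt_0[OF witt_D_in_witt[of v s]]
    by (simp add: ext_witt_def)
qed

lemma of_D_of_A_bracket:
  "bracket ext_witt (of_D u r) (of_A (xmon m)) =
     of_A (pm_scale (\<Sum>i\<in>UNIV. u $ i * of_int (m $ i)) (xmon (r + m)))"
  using witt_0[OF witt_D_in_witt[of u r]] by (simp add: ext_witt_def witt_D_xmon)

lemma lie_algebra_ext_witt: "lie_algebra ext_witt"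
proof -
  have closed: "(\<lambda>f. \<xi> f + \<eta> f) \<in> witt" "(\<lambda>f. pm_scale c (\<xi> f)) \<in> witt"
      "(\<lambda>f. \<xi> (\<eta> f) - \<eta> (\<xi> f)) \<in> witt" "(\<lambda>f. - \<xi> f) \<in> witt"
    if "\<xi> \<in> witt" "\<eta> \<in> witt" for \<xi> \<eta> :: "'a laurent \<Rightarrow> 'a laurent" and c
  proof -
    have neg: "- pm_scale c f = pm_scale c (- f)" for c and f :: "'a laurent"
      by (rule poly_mapping_eqI) simp
    show "(\<lambda>f. \<xi> f + \<eta> f) \<in> witt" "(\<lambda>f. pm_scale c (\<xi> f)) \<in> witt"
      "(\<lambda>f. \<xi> (\<eta> f) - \<eta> (\<xi> f)) \<in> witt" "(\<lambda>f. - \<xi> f) \<in> witt"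
      using that unfolding witt_def
      by (auto simp: algebra_simps pm_scale_add pm_scale_minus pm_scale_assoc [symmetric]
          pm_scale_mult_left pm_scale_mult_right neg)
  qed
  have zero: "(\<lambda>f. 0) \<in> witt" by (simp add: witt_def)
  have add_D: "\<xi> (f + g) = \<xi> f + \<xi> g" and scale_D: "\<xi> (pm_scale c f) = pm_scale c (\<xi> f)"
    and minus_D: "\<xi> (f - g) = \<xi> f - \<xi> g"
    if "\<xi> \<in> witt" for \<xi> :: "'a laurent \<Rightarrow> 'a laurent" and f g c
  proof -
    show *: "\<xi> (f + g) = \<xi> f + \<xi> g" for f g using that unfolding witt_def by auto
    show "\<xi> (pm_scale c f) = pm_scale c (\<xi> f)" using that unfolding witt_def by auto
    show "\<xi> (f - g) = \<xi> f - \<xi> g" using *[of "f - g" g] by simp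
  qed
  have "abelian_group (ext_witt :: 'a ext_witt_elem lie_alg)"
  proof (rule abelian_groupI)
    fix x :: "'a ext_witt_elem" assume "x \<in> carrier ext_witt"
    then show "\<exists>y\<in>carrier ext_witt. y \<oplus>\<^bsub>ext_witt\<^esub> x = \<zero>\<^bsub>ext_witt\<^esub>"
      by (intro bexI[of _ "(\<lambda>f. - fst x f, - snd x)"])
        (auto simp: ext_witt_def closed zero split: prod.splits)
  qed (auto simp: ext_witt_def closed zero add_ac)
  then have "Module.module complex_ring (ext_witt :: 'a ext_witt_elem lie_alg)"
    by (rule moduleI[OF cring_from_type_algebra])
      (auto simp: ext_witt_def closed zero ring_of_type_algebra_def pm_scale_add pm_scale_add_left
        pm_scale_assoc)
  then show ?thesis
    unfolding lie_algebra_def lie_algebra_axioms_def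
    by (auto simp: ext_witt_def closed zero add_D scale_D minus_D pm_scale_minus algebra_simps)
qed

lemma lie_algebra_gl: "lie_algebra gl"
proof -
  have scale: "(\<chi> i j. c * A $ i $ j) ** B = (\<chi> i j. c * (A ** B) $ i $ j)"
    "A ** (\<chi> i j. c * B $ i $ j) = (\<chi> i j. c * (A ** B) $ i $ j)"
    for c and A B :: "complex ^ 'a ^ 'a"
    by (simp_all add: vec_eq_iff matrix_matrix_mult_def sum_distrib_left algebra_simps)
  have distrib: "(A + B) ** C = A ** C + B ** C" "(A - B) ** C = A ** C - B ** C"
    "A ** (B - C) = A ** B - A ** C" for A B C :: "complex ^ 'a ^ 'a"
    by (simp_all add: vec_eq_iff matrix_matrix_mult_def sum.distrib sum_subtractf algebra_simps)
  have "abelian_group (gl :: (complex ^ 'a ^ 'a) lie_alg)"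
  proof (rule abelian_groupI)
    fix x :: "complex ^ 'a ^ 'a"
    show "\<exists>y\<in>carrier gl. y \<oplus>\<^bsub>gl\<^esub> x = \<zero>\<^bsub>gl\<^esub>"
      by (intro bexI[of _ "- x"]) (auto simp: gl_def)
  qed (auto simp: gl_def add_ac)
  then have "Module.module complex_ring (gl :: (complex ^ 'a ^ 'a) lie_alg)"
    by (rule moduleI[OF cring_from_type_algebra])
      (auto simp: gl_def ring_of_type_algebra_def vec_eq_iff algebra_simps)
  then show ?thesis
    unfolding lie_algebra_def lie_algebra_axioms_def
    by (auto simp: gl_def scale matrix_add_ldistrib distrib matrix_mul_assoc)
      (simp_all add: vec_eq_iff algebra_simps)
qed

end

theory Submission
  imports Defs "HOL-Computational_Algebra.Polynomial" "HOL-Computational_Algebra.Fundamental_Theorem_Algebra"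
begin

no_notation fps_nth (infixl "$" 75)

text \<open>
  The operators \<open>X(u, r) = x\<^sup>-\<^sup>r D(u, r) - D(u, 0)\<close> on \<open>M\<close> commute with all \<open>x\<^sup>s\<close> and all \<open>\<partial>\<^sub>i\<close>.
  Evaluating the coordinates of a vector over \<open>U(\<hh>)\<close> at the points of \<open>\<int>\<^sup>d\<close> embeds \<open>M\<close> into the
  functions from \<open>\<int>\<^sup>d\<close> to column vectors, where \<open>x\<^sup>s\<close> acts by translation, \<open>\<partial>\<^sub>i\<close> by multiplication
  with the \<open>i\<close>-th coordinate, and \<open>X(u, r)\<close> by a constant matrix. By simplicity of \<open>M\<close>, the map
  \<open>r \<mapsto> X(u, r)\<close>, extended linearly to \<open>A\<^sub>d\<close>, vanishes on a power of the augmentation ideal of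
  \<open>A\<^sub>d\<close>, and then on its square. Hence \<open>X(u, r)\<close> is linear in \<open>r\<close>, and \<open>r u\<^sup>T \<mapsto> X(u, r)\<close> is a
  representation of \<open>gl\<^sub>d\<close>. Let \<open>U\<close> be the matrix algebra generated by the \<open>X(u, r)\<close>; it contains an
  idempotent \<open>e \<noteq> 0\<close> with \<open>e U e = \<complex> e\<close>. Then \<open>P = e M\<close> and \<open>V = U q\<close> for any \<open>q \<noteq> 0\<close> in \<open>P\<close> satisfy
  \<open>M \<cong> P \<otimes> V\<close>.

  A priori \<open>P\<close> is only a projective \<open>U(\<hh>)\<close>-module. The theorem of Quillen and Suslin is avoided: the
  translations of \<open>\<int>\<^sup>d\<close> act on \<open>P\<close>, so the ideal that measures where \<open>P\<close> fails to be extended from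
  fewer variables is invariant under translations, and a nonzero invariant ideal contains \<open>1\<close>.
\<close>

section \<open>Finite matrices\<close>

text \<open>On the augmentation ideal, f \<mapsto> X represents the vector fields f \<partial>_i
  vanishing at the point 1 of the torus. An Euler field acts on those with f of order k by k - 1, up
  to higher order, whereas the commutator with a fixed matrix of finite size has bounded
  eigenvalues; this forces vanishing on a high power. In the descent from order t + 1 to order t the
  weight t - 1 is positive, so long products of the matrices of order t vanish, and their common
  kernel is a nonzero submodule. The descent stops at t = 2: linear fields have weight 0, and they
  are the gl_d that survives. Simplicity also makes U a prime algebra, because the vectors killed by
  a U form a submodule. Primeness and e U e = C e take the place of the structure theory of simple
  algebras: U commutes with the Weyl operators, V is a copy of the left ideal U e, and P is its
  multiplicity space. Projective modules are handled as idempotent matrices, and their isomorphisms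
  as factorisations, which survive every substitution of variables. The operator x_j itself supplies
  the isomorphism between the idempotent of P and its translate.\<close>

typedef (overloaded) 'a fmat = "{f :: nat \<Rightarrow> nat \<Rightarrow> 'a::zero. \<exists>n. \<forall>i j. n \<le> i \<or> n \<le> j \<longrightarrow> f i j = 0}"
  morphisms ent Abs_fmat
  by (rule exI[of _ "\<lambda>_ _. 0"]) simp

setup_lifting type_definition_fmat

lemma fmat_eqI: "(\<And>i j. ent A i j = ent B i j) \<Longrightarrow> A = B"
  by (metis ent_inject ext)

definition fbd :: "nat \<Rightarrow> 'a::zero fmat \<Rightarrow> bool" where
  "fbd n A \<longleftrightarrow> (\<forall>i j. n \<le> i \<or> n \<le> j \<longrightarrow> ent A i j = 0)"

lemma ex_fbd: "\<exists>n. fbd n A"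
  using ent[of A] by (auto simp: fbd_def)

lemma fbd_mono: "fbd n A \<Longrightarrow> n \<le> m \<Longrightarrow> fbd m A"
  by (auto simp: fbd_def)

lemma ex_fbd2: "\<exists>n. fbd n A \<and> fbd n B"
  by (meson ex_fbd fbd_mono max.cobounded1 max.cobounded2)

lemma ex_fbd3: "\<exists>n. fbd n A \<and> fbd n B \<and> fbd n C"
  by (metis ex_fbd2 ex_fbd fbd_mono max.cobounded1 max.cobounded2)

lift_definition mkm :: "nat \<Rightarrow> (nat \<Rightarrow> nat \<Rightarrow> 'a) \<Rightarrow> 'a::zero fmat" is
  "\<lambda>n f i j. if i < n \<and> j < n then f i j else 0"
  by (metis leD)

lemma ent_mkm [simp]: "ent (mkm n f) i j = (if i < n \<and> j < n then f i j else 0)"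
  by transfer simp

lemma fbd_mkm [simp]: "fbd n (mkm n f)"
  by (simp add: fbd_def)

lift_definition fmap :: "('a \<Rightarrow> 'b) \<Rightarrow> 'a::zero fmat \<Rightarrow> 'b::zero fmat" is
  "\<lambda>h f i j. if f i j = 0 then 0 else h (f i j)"
  by metis

lemma ent_fmap: "h 0 = 0 \<Longrightarrow> ent (fmap h A) i j = h (ent A i j)"
  by transfer simp

text \<open>Matrices of all sizes form one ring without unit, and this is the unit of its corner of
  size \<open>n\<close>. An idempotent stands for a projective module, \<open>idm p\<close> for the
  free module of rank \<open>p\<close>.\<close>

definition idm :: "nat \<Rightarrow> 'a::zero_neq_one fmat" where
  "idm n = mkm n (\<lambda>i j. if i = j then 1 else 0)"

lemma ent_idm: "ent (idm n) i j = (if i < n \<and> i = j then 1 else 0)"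
  by (simp add: idm_def)

instantiation fmat :: (comm_ring_1) ring
begin

lift_definition zero_fmat :: "'a fmat" is "\<lambda>_ _. 0" by auto

lift_definition plus_fmat :: "'a fmat \<Rightarrow> 'a fmat \<Rightarrow> 'a fmat" is "\<lambda>f g i j. f i j + g i j"
  by (metis (no_types, lifting) add.right_neutral max.cobounded1 max.cobounded2 le_trans)

lift_definition uminus_fmat :: "'a fmat \<Rightarrow> 'a fmat" is "\<lambda>f i j. - f i j"
  by auto

lift_definition minus_fmat :: "'a fmat \<Rightarrow> 'a fmat \<Rightarrow> 'a fmat" is "\<lambda>f g i j. f i j - g i j"
  by (metis (no_types, lifting) diff_zero max.cobounded1 max.cobounded2 le_trans)

lift_definition times_fmat :: "'a fmat \<Rightarrow> 'a fmat \<Rightarrow> 'a fmat" is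
  "\<lambda>f g i k. \<Sum>j | f i j \<noteq> 0. f i j * g j k"
proof -
  fix f g :: "nat \<Rightarrow> nat \<Rightarrow> 'a"
  assume "\<exists>n. \<forall>i j. n \<le> i \<or> n \<le> j \<longrightarrow> f i j = 0" "\<exists>n. \<forall>i j. n \<le> i \<or> n \<le> j \<longrightarrow> g i j = 0"
  then obtain n m where n: "\<forall>i j. n \<le> i \<or> n \<le> j \<longrightarrow> f i j = 0"
    and m: "\<forall>i j. m \<le> i \<or> m \<le> j \<longrightarrow> g i j = 0" by auto
  have "(\<Sum>j | f i j \<noteq> 0. f i j * g j k) = 0" if "max n m \<le> i \<or> max n m \<le> k" for i k
    by (rule sum.neutral) (use that n m in auto)
  then show "\<exists>n. \<forall>i j. n \<le> i \<or> n \<le> j \<longrightarrow> (\<Sum>ja | f i ja \<noteq> 0. f i ja * g ja j) = 0"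
    by blast
qed

lemma ent_zero [simp]: "ent 0 i j = 0" by transfer simp
lemma ent_add [simp]: "ent (A + B) i j = ent A i j + ent B i j" by transfer simp
lemma ent_uminus [simp]: "ent (- A) i j = - ent A i j" by transfer simp
lemma ent_minus [simp]: "ent (A - B) i j = ent A i j - ent B i j" by transfer simp

text \<open>The inner range may be shorter than the \<open>fbd\<close> bounds of the factors, as for
  an n x p matrix times a p x n matrix with p < n.\<close>

lemma ent_times_gen:
  assumes "\<And>j. n \<le> j \<Longrightarrow> ent A i j = 0 \<or> ent B j k = 0"
  shows "ent (A * B) i k = (\<Sum>j<n. ent A i j * ent B j k)"
proof -
  obtain m where m: "fbd m A" using ex_fbd by blast
  have "ent (A * B) i k = (\<Sum>j | ent A i j \<noteq> 0. ent A i j * ent B j k)" by transfer simp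
  also have "\<dots> = (\<Sum>j<max m n. ent A i j * ent B j k)"
    by (rule sum.mono_neutral_left) (use m in \<open>auto simp: fbd_def less_max_iff_disj not_le[symmetric]\<close>)
  also have "\<dots> = (\<Sum>j<n. ent A i j * ent B j k)"
    by (rule sum.mono_neutral_right) (use assms in \<open>auto simp: not_less\<close>, metis mult_zero_left mult_zero_right)
  finally show ?thesis .
qed

lemma ent_times: "fbd n A \<or> fbd n B \<Longrightarrow> ent (A * B) i k = (\<Sum>j<n. ent A i j * ent B j k)"
  by (rule ent_times_gen) (auto simp: fbd_def)

lemma fbd_times: "fbd n A \<Longrightarrow> fbd n B \<Longrightarrow> fbd n (A * B)"
  by (auto simp: fbd_def ent_times[of n A B] intro!: sum.neutral)

instance
proof
  fix A B C :: "'a fmat"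
  obtain n where n: "fbd n A" "fbd n B" "fbd n C" using ex_fbd3 by blast
  show "A + B + C = A + (B + C)" "A + B = B + A" "0 + A = A" "- A + A = 0" "A - B = A + - B"
    by (auto intro!: fmat_eqI)
  show "A * B * C = A * (B * C)"
  proof (rule fmat_eqI)
    fix i k
    have "ent (A * B * C) i k = (\<Sum>j<n. \<Sum>l<n. ent A i l * ent B l j * ent C j k)"
      using n by (simp add: ent_times[of n] fbd_times sum_distrib_right)
    also have "\<dots> = (\<Sum>l<n. \<Sum>j<n. ent A i l * ent B l j * ent C j k)" by (rule sum.swap)
    also have "\<dots> = ent (A * (B * C)) i k"
      using n by (simp add: ent_times[of n] fbd_times sum_distrib_left mult.assoc)
    finally show "ent (A * B * C) i k = ent (A * (B * C)) i k" .
  qed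
  show "(A + B) * C = A * C + B * C" "A * (B + C) = A * B + A * C"
    using n by (auto intro!: fmat_eqI simp: ent_times[of n] algebra_simps sum.distrib)
qed

end

lemma fbd_0 [simp]: "fbd n 0"
  and fbd_add: "fbd n A \<Longrightarrow> fbd n B \<Longrightarrow> fbd n (A + B)"
  and fbd_minus: "fbd n A \<Longrightarrow> fbd n B \<Longrightarrow> fbd n (A - B)"
  and fbd_uminus: "fbd n A \<Longrightarrow> fbd n (- A)"
  for A B :: "'a::comm_ring_1 fmat"
  by (auto simp: fbd_def)

lemma fbd_sum: "(\<And>x. x \<in> S \<Longrightarrow> fbd n (f x)) \<Longrightarrow> fbd n (sum f S)"
  for f :: "'b \<Rightarrow> 'a::comm_ring_1 fmat"
  by (induction S rule: infinite_finite_induct) (auto intro: fbd_add)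

lemma ent_sum: "ent (sum f S) i j = (\<Sum>x\<in>S. ent (f x) i j)"
  for f :: "'b \<Rightarrow> 'a::comm_ring_1 fmat"
  by (induction S rule: infinite_finite_induct) auto

lemma fbd_idm [simp]: "fbd n (idm n)"
  by (simp add: idm_def)

lemma idm_mult [simp]: "fbd n A \<Longrightarrow> idm n * A = A"
  and mult_idm [simp]: "fbd n A \<Longrightarrow> A * idm n = A"
  for A :: "'a::comm_ring_1 fmat"
proof -
  assume A: "fbd n A"
  have "ent (idm n * A) i j = ent A i j" for i j
    using A sum.remove[of "{..<n}" i "\<lambda>k. ent (idm n) i k * ent A k j"]
    by (cases "i < n") (auto simp: ent_times[of n] ent_idm fbd_def not_less intro!: sum.neutral)
  moreover have "ent (A * idm n) i j = ent A i j" for i j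
    using A sum.remove[of "{..<n}" j "\<lambda>k. ent A i k * ent (idm n) k j"]
    by (cases "j < n") (auto simp: ent_times[of n] ent_idm fbd_def not_less intro!: sum.neutral)
  ultimately show "idm n * A = A" "A * idm n = A" by (auto intro: fmat_eqI)
qed

lemma idm_idem [simp]: "idm n * idm n = (idm n :: 'a::comm_ring_1 fmat)"
  by simp

lift_definition smat :: "'a \<Rightarrow> 'a fmat \<Rightarrow> 'a::comm_ring_1 fmat" is "\<lambda>c f i j. c * f i j"
  by (metis mult_zero_right)

lemma ent_smat [simp]: "ent (smat c A) i j = c * ent A i j" by transfer simp

lemma fbd_smat: "fbd n A \<Longrightarrow> fbd n (smat c A)" by (auto simp: fbd_def)

lemma smat_mult_left: "smat c A * B = smat c (A * B)"
proof -
  obtain n where "fbd n A" using ex_fbd by blast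
  then show ?thesis
    by (auto intro!: fmat_eqI simp: ent_times[of n] fbd_smat sum_distrib_left mult.assoc)
qed

lemma smat_mult_right: "A * smat c B = smat c (A * B)"
proof -
  obtain n where "fbd n B" using ex_fbd by blast
  then show ?thesis
    by (auto intro!: fmat_eqI simp: ent_times[of n] fbd_smat sum_distrib_left mult_ac)
qed

lemma smat_add: "smat c (A + B) = smat c A + smat c B"
  and smat_minus: "smat c (A - B) = smat c A - smat c B"
  and smat_add_left: "smat (c + d) A = smat c A + smat d A"
  and smat_minus_left: "smat (c - d) A = smat c A - smat d A"
  and smat_smat [simp]: "smat c (smat d A) = smat (c * d) A"
  and smat_1 [simp]: "smat 1 A = A"
  and smat_0 [simp]: "smat 0 A = 0" "smat c 0 = 0"
  and smat_neg: "smat (- c) A = - smat c A"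
  by (auto intro!: fmat_eqI simp: algebra_simps)

lemma smat_sum: "smat c (sum f S) = (\<Sum>x\<in>S. smat c (f x))"
  by (induction S rule: infinite_finite_induct) (auto simp: smat_add)

lemma smat_cancel: "c \<noteq> 0 \<Longrightarrow> smat c A = smat c B \<Longrightarrow> A = B" for c :: "'a::idom"
  by (metis ent_smat fmat_eqI mult_left_cancel)

section \<open>Ring homomorphisms and their entrywise action on matrices\<close>

definition rhom :: "('a::comm_ring_1 \<Rightarrow> 'b::comm_ring_1) \<Rightarrow> bool" where
  "rhom h \<longleftrightarrow> h 1 = 1 \<and> (\<forall>a b. h (a + b) = h a + h b) \<and> (\<forall>a b. h (a * b) = h a * h b)"

lemma rhom_add: "rhom h \<Longrightarrow> h (a + b) = h a + h b"
  and rhom_mult: "rhom h \<Longrightarrow> h (a * b) = h a * h b"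
  and rhom_1: "rhom h \<Longrightarrow> h 1 = 1"
  by (auto simp: rhom_def)

lemma rhom_0: "rhom h \<Longrightarrow> h 0 = 0"
  using rhom_add[of h 0 0] by simp

lemma rhom_neg: "rhom h \<Longrightarrow> h (- a) = - h a"
  using rhom_add[of h a "- a"] by (simp add: rhom_0 add_eq_0_iff)

lemma rhom_minus: "rhom h \<Longrightarrow> h (a - b) = h a - h b"
  using rhom_add[of h a "- b"] by (simp add: rhom_neg)

lemma rhom_sum: "rhom h \<Longrightarrow> h (sum f S) = (\<Sum>x\<in>S. h (f x))"
  by (induction S rule: infinite_finite_induct) (auto simp: rhom_0 rhom_add)

lemma rhom_prod: "rhom h \<Longrightarrow> h (prod f S) = (\<Prod>x\<in>S. h (f x))"
  by (induction S rule: infinite_finite_induct) (auto simp: rhom_1 rhom_mult)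

lemma rhom_power: "rhom h \<Longrightarrow> h (a ^ k) = h a ^ k"
  by (induction k) (auto simp: rhom_1 rhom_mult)

lemma rhom_comp: "rhom g \<Longrightarrow> rhom h \<Longrightarrow> rhom (\<lambda>x. g (h x))"
  by (simp add: rhom_def)

lemma rhom_id: "rhom (\<lambda>x. x)"
  by (simp add: rhom_def)

lemma ent_fmap_rhom [simp]: "rhom h \<Longrightarrow> ent (fmap h A) i j = h (ent A i j)"
  by (simp add: ent_fmap rhom_0)

lemma fbd_fmap: "rhom h \<Longrightarrow> fbd n A \<Longrightarrow> fbd n (fmap h A)"
  by (simp add: fbd_def rhom_0)

lemma fmap_mult: "rhom h \<Longrightarrow> fmap h (A * B) = fmap h A * fmap h B"
proof -
  assume h: "rhom h"
  obtain n where "fbd n A" using ex_fbd by blast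
  with h show ?thesis
    by (auto intro!: fmat_eqI simp: ent_times[of n] fbd_fmap rhom_sum rhom_mult)
qed

lemma fmap_smat: "rhom h \<Longrightarrow> fmap h (smat c A) = smat (h c) (fmap h A)"
  by (auto intro!: fmat_eqI simp: rhom_mult)

lemma fmap_idm: "rhom h \<Longrightarrow> fmap h (idm n) = idm n"
  by (auto intro!: fmat_eqI simp: ent_idm rhom_1 rhom_0)

lemma fmap_fmap: "rhom g \<Longrightarrow> rhom h \<Longrightarrow> fmap g (fmap h A) = fmap (\<lambda>x. g (h x)) A"
  by (auto intro!: fmat_eqI simp: rhom_comp)

subsection \<open>Murray--von Neumann equivalence of idempotents\<close>

text \<open>For idempotents this means that their images are isomorphic as projective modules.
  Bases, ranks and sizes do not enter, so the relation passes through every ring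
  homomorphism.\<close>

definition mvn :: "'a::comm_ring_1 fmat \<Rightarrow> 'a fmat \<Rightarrow> bool" where
  "mvn A B \<longleftrightarrow> (\<exists>f g. A = f * g \<and> B = g * f)"

lemma mvn_refl: "A * A = A \<Longrightarrow> mvn A A"
  unfolding mvn_def by metis

lemma mvn_sym: "mvn A B \<Longrightarrow> mvn B A"
  unfolding mvn_def by metis

text \<open>Composing the two factorisations produces \<open>A * A\<close> and \<open>C * C\<close>,
  so idempotency is what closes the argument.\<close>

lemma mvn_trans:
  assumes "mvn A B" "mvn B C" "A * A = A" "C * C = C"
  shows "mvn A C"
proof -
  obtain f g where fg: "A = f * g" "B = g * f" using assms(1) mvn_def by blast
  obtain h k where hk: "B = h * k" "C = k * h" using assms(2) mvn_def by blast
  have "A = f * g * (f * g)" using assms fg by simp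
  also have "\<dots> = (f * h) * (k * g)" using fg hk by (metis mult.assoc)
  finally have 1: "A = (f * h) * (k * g)" .
  have "C = k * h * (k * h)" using assms hk by simp
  also have "\<dots> = (k * g) * (f * h)" using fg hk by (metis mult.assoc)
  finally show ?thesis using 1 mvn_def by blast
qed

lemma mvn_fmap: "rhom h \<Longrightarrow> mvn A B \<Longrightarrow> mvn (fmap h A) (fmap h B)"
  unfolding mvn_def by (metis fmap_mult)

section \<open>Polynomial rings\<close>

definition pw :: "('v \<Rightarrow> 'b::comm_monoid_mult) \<Rightarrow> ('v \<Rightarrow>\<^sub>0 nat) \<Rightarrow> 'b" where
  "pw x m = (\<Prod>i\<in>Poly_Mapping.keys m. x i ^ Poly_Mapping.lookup m i)"

lemma pw_superset:
  "finite S \<Longrightarrow> Poly_Mapping.keys m \<subseteq> S \<Longrightarrow> pw x m = (\<Prod>i\<in>S. x i ^ Poly_Mapping.lookup m i)"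
  unfolding pw_def by (rule prod.mono_neutral_left) (auto simp: in_keys_iff)

lemma pw_0 [simp]: "pw x 0 = 1"
  by (simp add: pw_def)

lemma pw_single [simp]: "pw x (Poly_Mapping.single i k) = x i ^ k"
  by (auto simp: pw_def)

lemma pw_add: "pw x (m + m') = pw x m * pw x m'"
proof -
  let ?S = "Poly_Mapping.keys m \<union> Poly_Mapping.keys m'"
  have "Poly_Mapping.keys (m + m') \<subseteq> ?S" by (rule Poly_Mapping.keys_add)
  then show ?thesis
    by (simp add: pw_superset[of ?S] lookup_add power_add prod.distrib)
qed

text \<open>The homomorphism given by the universal property of the polynomial ring. Evaluation,
  substitution, translation and restriction to a line are all instances of it.\<close>

definition pins :: "(complex \<Rightarrow> 'b) \<Rightarrow> ('v \<Rightarrow> 'b) \<Rightarrow> 'v U_h \<Rightarrow> 'b::comm_ring_1" where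
  "pins h x p = (\<Sum>m\<in>Poly_Mapping.keys p. h (Poly_Mapping.lookup p m) * pw x m)"

lemma pins_superset:
  "rhom h \<Longrightarrow> finite S \<Longrightarrow> Poly_Mapping.keys p \<subseteq> S
    \<Longrightarrow> pins h x p = (\<Sum>m\<in>S. h (Poly_Mapping.lookup p m) * pw x m)"
  unfolding pins_def by (rule sum.mono_neutral_left) (auto simp: in_keys_iff rhom_0)

lemma pins_add: "rhom h \<Longrightarrow> pins h x (p + q) = pins h x p + pins h x q"
proof -
  assume h: "rhom h"
  let ?S = "Poly_Mapping.keys p \<union> Poly_Mapping.keys q"
  have "Poly_Mapping.keys (p + q) \<subseteq> ?S" by (rule Poly_Mapping.keys_add)
  with h show ?thesis
    by (simp add: pins_superset[of h ?S] lookup_add rhom_add algebra_simps sum.distrib)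
qed

lemma pins_single: "rhom h \<Longrightarrow> pins h x (Poly_Mapping.single m c) = h c * pw x m"
  by (auto simp: pins_def rhom_0)

lemma rhom_pins: "rhom h \<Longrightarrow> rhom (pins h x)"
proof -
  assume h: "rhom h"
  have [simp]: "pins h x 0 = 0" by (simp add: pins_def)
  have "pins h x (p * q) = pins h x p * pins h x q" for p q
  proof (induction p rule: pm_induct)
    case (single m c)
    show ?case
    proof (induction q rule: pm_induct)
      case (single m' c')
      show ?case by (simp add: mult_single pins_single h pw_add rhom_mult mult_ac)
    qed (simp_all add: distrib_left pins_add h)
  qed (simp_all add: distrib_right pins_add h)
  moreover have "pins h x 1 = 1"
    using pins_single[OF h, of x 0 1] h by (simp add: rhom_1)
  ultimately show ?thesis using h by (simp add: rhom_def[of "pins h x"] pins_add)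
qed

lemma pins_const [simp]: "rhom h \<Longrightarrow> pins h x (U_h_const c) = h c"
  by (simp add: U_h_const_def pins_single)

lemma pins_var [simp]: "rhom h \<Longrightarrow> pins h x (U_h_var i) = x i"
  by (simp add: U_h_var_def pins_single rhom_1)

lemma U_h_single: "Poly_Mapping.single m c = U_h_const c * pw U_h_var m"
proof -
  have *: "Poly_Mapping.single (Poly_Mapping.single k n) 1 = (U_h_var k ^ n :: 'a U_h)" for k n
  proof (induction n)
    case (Suc n)
    have "Poly_Mapping.single k (Suc n) = Poly_Mapping.single k 1 + Poly_Mapping.single k n"
      by (simp flip: single_add)
    then show ?case using Suc by (metis U_h_var_def mult_single mult_1 power_Suc)
  qed simp
  have "Poly_Mapping.single m 1 = (pw U_h_var m :: 'a U_h)"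
  proof (induction m rule: pm_induct)
    case (add f g)
    then show ?case by (simp add: pw_add mult_single flip: add)
  qed (simp_all add: *)
  moreover have "Poly_Mapping.single m c = U_h_const c * Poly_Mapping.single m 1"
    by (simp add: U_h_const_def mult_single)
  ultimately show ?thesis by simp
qed

lemma U_h_induct [case_names const var add mult]:
  assumes "\<And>c. Q (U_h_const c)" "\<And>i. Q (U_h_var i)"
    and "\<And>p q. Q p \<Longrightarrow> Q q \<Longrightarrow> Q (p + q)" and "\<And>p q. Q p \<Longrightarrow> Q q \<Longrightarrow> Q (p * q)"
  shows "Q p"
proof -
  have 1: "Q 1" using assms(1)[of 1] by (simp add: U_h_const_def)
  have "Q (U_h_var i ^ k)" for i k by (induction k) (auto simp: 1 assms)
  then have "Q (prod (\<lambda>i. U_h_var i ^ f i) S)" for f S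
    by (induction S rule: infinite_finite_induct) (auto simp: 1 assms)
  then have "Q (Poly_Mapping.single m c)" for m c
    by (simp add: U_h_single pw_def assms)
  then show ?thesis
    by (induction p rule: pm_induct) (use assms(1)[of 0] assms in \<open>auto simp: U_h_const_def\<close>)
qed

lemma rhom_eqI:
  assumes "rhom f" "rhom g" "\<And>c. f (U_h_const c) = g (U_h_const c)" "\<And>i. f (U_h_var i) = g (U_h_var i)"
  shows "f p = g p"
  by (induction p rule: U_h_induct) (use assms in \<open>auto simp: rhom_add rhom_mult\<close>)

lemma rhom_const: "rhom U_h_const"
  by (auto simp: rhom_def U_h_const_def single_add mult_single)

definition peval :: "('v \<Rightarrow> complex) \<Rightarrow> 'v U_h \<Rightarrow> complex" where
  "peval = pins (\<lambda>c. c)"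

definition psubst :: "('v \<Rightarrow> 'w U_h) \<Rightarrow> 'v U_h \<Rightarrow> 'w U_h" where
  "psubst = pins U_h_const"

lemma rhom_peval: "rhom (peval x)"
  by (simp add: peval_def rhom_pins rhom_id)

lemma rhom_psubst: "rhom (psubst x)"
  by (simp add: psubst_def rhom_pins rhom_const)

lemma peval_simps [simp]: "peval x (U_h_const c) = c" "peval x (U_h_var i) = x i"
  "peval x (p + q) = peval x p + peval x q" "peval x (p - q) = peval x p - peval x q"
  "peval x (p * q) = peval x p * peval x q"
  "peval x 0 = 0" "peval x 1 = 1"
  using rhom_peval[of x]
  by (simp_all add: rhom_add rhom_minus rhom_mult rhom_0 rhom_1) (simp_all add: peval_def rhom_id)

lemma psubst_simps [simp]: "psubst x (U_h_const c) = U_h_const c" "psubst x (U_h_var i) = x i"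
  "psubst x (p + q) = psubst x p + psubst x q" "psubst x (p - q) = psubst x p - psubst x q"
  "psubst x (p * q) = psubst x p * psubst x q"
  "psubst x 0 = 0" "psubst x 1 = 1"
  using rhom_psubst[of x]
  by (simp_all add: rhom_add rhom_minus rhom_mult rhom_0 rhom_1) (simp_all add: psubst_def rhom_const)

definition pshift :: "('v \<Rightarrow> complex) \<Rightarrow> 'v U_h \<Rightarrow> 'v U_h" where
  "pshift t = psubst (\<lambda>j. U_h_var j + U_h_const (t j))"

lemma rhom_pshift: "rhom (pshift t)"
  by (simp add: pshift_def rhom_psubst)

lemma U_h_const_simps [simp]: "U_h_const (a + b) = U_h_const a + U_h_const b"
  "U_h_const (a * b) = U_h_const a * U_h_const b" "U_h_const 0 = 0" "U_h_const 1 = 1"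
  "U_h_const (- a) = - U_h_const a"
  by (simp_all add: rhom_add rhom_mult rhom_0 rhom_1 rhom_neg rhom_const)

lemma pshift_simps [simp]: "pshift t (U_h_const c) = U_h_const c"
  "pshift t (U_h_var i) = U_h_var i + U_h_const (t i)"
  "pshift t (p + q) = pshift t p + pshift t q" "pshift t (p - q) = pshift t p - pshift t q"
  "pshift t (p * q) = pshift t p * pshift t q"
  "pshift t 0 = 0" "pshift t 1 = 1"
  by (simp_all add: pshift_def)

lemma pshift_pshift: "pshift s (pshift t p) = pshift (\<lambda>i. s i + t i) p"
  by (rule rhom_eqI) (auto simp: rhom_comp rhom_pshift add_ac)

lemma pshift_0: "pshift (\<lambda>i. 0) p = p"
  by (rule rhom_eqI) (auto simp: rhom_id rhom_pshift)

lemma peval_pshift: "peval x (pshift t p) = peval (\<lambda>i. x i + t i) p"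
  by (rule rhom_eqI) (auto simp: rhom_comp rhom_pshift rhom_peval)

subsection \<open>Shift-invariant ideals\<close>

definition mdeg :: "('v \<Rightarrow>\<^sub>0 nat) \<Rightarrow> nat" where
  "mdeg m = (\<Sum>i\<in>Poly_Mapping.keys m. Poly_Mapping.lookup m i)"

lemma mdeg_superset:
  "finite S \<Longrightarrow> Poly_Mapping.keys m \<subseteq> S \<Longrightarrow> mdeg m = (\<Sum>i\<in>S. Poly_Mapping.lookup m i)"
  unfolding mdeg_def by (rule sum.mono_neutral_left) (auto simp: in_keys_iff)

lemma mdeg_add: "mdeg (m + m') = mdeg m + mdeg m'"
proof -
  let ?S = "Poly_Mapping.keys m \<union> Poly_Mapping.keys m'"
  have "Poly_Mapping.keys (m + m') \<subseteq> ?S" by (rule Poly_Mapping.keys_add)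
  then show ?thesis by (simp add: mdeg_superset[of ?S] lookup_add sum.distrib)
qed

lemma mdeg_single [simp]: "mdeg (Poly_Mapping.single i k) = k"
  by (auto simp: mdeg_def)

abbreviation unit1 :: "'v \<Rightarrow> 'v \<Rightarrow> complex" where
  "unit1 i \<equiv> (\<lambda>j. if j = i then 1 else 0)"

lemma pshift_single_0:
  assumes "Poly_Mapping.lookup m i = 0"
  shows "pshift (unit1 i) (Poly_Mapping.single m c) = Poly_Mapping.single m c"
proof -
  have "pshift (unit1 i) (Poly_Mapping.single m c)
      = U_h_const c * (\<Prod>j\<in>Poly_Mapping.keys m. (U_h_var j + U_h_const (unit1 i j)) ^ Poly_Mapping.lookup m j)"
    by (simp add: U_h_single pw_def rhom_prod[OF rhom_pshift] rhom_power[OF rhom_pshift])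
  also have "\<dots> = U_h_const c * pw U_h_var m"
    unfolding pw_def
    by (intro arg_cong2[where f = "(*)"] refl prod.cong) (use assms in \<open>auto simp: in_keys_iff\<close>)
  finally show ?thesis by (simp flip: U_h_single)
qed

lemma var_power: "U_h_var i ^ k = Poly_Mapping.single (Poly_Mapping.single i k) 1"
  by (simp add: U_h_single)

lemma pshift_single:
  "pshift (unit1 i) (Poly_Mapping.single m c) =
    (\<Sum>k\<le>Poly_Mapping.lookup m i. Poly_Mapping.single (m - Poly_Mapping.single i k)
        (c * of_nat (Poly_Mapping.lookup m i choose k)))"
proof -
  let ?a = "Poly_Mapping.lookup m i"
  let ?m = "m - Poly_Mapping.single i ?a"
  have m: "m = ?m + Poly_Mapping.single i ?a"
    by (rule poly_mapping_eqI) (simp add: lookup_add lookup_minus lookup_single when_def)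
  have mk: "?m + Poly_Mapping.single i (?a - k) = m - Poly_Mapping.single i k" for k
    by (rule poly_mapping_eqI) (simp add: lookup_add lookup_minus lookup_single when_def)
  have nat: "(of_nat n :: 'a U_h) = Poly_Mapping.single 0 (of_nat n)" for n
    by simp
  have "Poly_Mapping.single m c = Poly_Mapping.single ?m c * U_h_var i ^ ?a"
    using m by (metis var_power mult_single mult.right_neutral)
  then have "pshift (unit1 i) (Poly_Mapping.single m c) = Poly_Mapping.single ?m c * (1 + U_h_var i) ^ ?a"
    by (simp only: pshift_simps rhom_power[OF rhom_pshift]) (simp add: pshift_single_0 lookup_minus add.commute)
  also have "(1 + U_h_var i) ^ ?a = (\<Sum>k\<le>?a. of_nat (?a choose k) * 1 ^ k * U_h_var i ^ (?a - k) :: 'a U_h)"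
    by (rule binomial_ring)
  also have "Poly_Mapping.single ?m c * \<dots> = (\<Sum>k\<le>?a. Poly_Mapping.single (m - Poly_Mapping.single i k)
        (c * of_nat (?a choose k)))"
    unfolding sum_distrib_left
    by (intro sum.cong refl)
      (simp only: nat var_power mult_single mk mult.assoc[symmetric] add_0_left add_0_right power_one mult_1_right)
  finally show ?thesis .
qed

text \<open>In the binomial expansion of the shifted variable, only the terms with k = 0 and k = 1
  keep degree at least D - 1. To this order a unit shift adds the partial derivative.\<close>

lemma pshift_single_top:
  assumes m: "mdeg m \<le> D" and t: "D \<le> mdeg t + 1"
  shows "Poly_Mapping.lookup (pshift (unit1 i) (Poly_Mapping.single m c)) t =
    (c when m = t) + of_nat (Poly_Mapping.lookup t i + 1) * (c when m = t + Poly_Mapping.single i 1)"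
proof -
  let ?a = "Poly_Mapping.lookup m i"
  let ?g = "\<lambda>k. (c * of_nat (?a choose k)) when m - Poly_Mapping.single i k = t"
  have split: "m = (m - Poly_Mapping.single i k) + Poly_Mapping.single i k" if "k \<le> ?a" for k
    using that by (intro poly_mapping_eqI) (auto simp: lookup_add lookup_minus lookup_single when_def)
  have small: "?g k = 0" if "k \<le> ?a" "k \<notin> {0, 1}" for k
  proof -
    have "mdeg m = mdeg (m - Poly_Mapping.single i k) + k"
      using split[OF that(1)] by (metis mdeg_add mdeg_single)
    then show ?thesis using that m t by (auto simp: when_def)
  qed
  have "Poly_Mapping.lookup (pshift (unit1 i) (Poly_Mapping.single m c)) t = (\<Sum>k\<le>?a. ?g k)"
    by (simp add: pshift_single lookup_sum lookup_single)
  also have "\<dots> = (\<Sum>k\<in>{..?a} \<inter> {0,1}. ?g k)"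
    by (rule sum.mono_neutral_right) (use small in auto)
  also have "\<dots> = ?g 0 + (if ?a = 0 then 0 else ?g 1)"
  proof (cases "?a = 0")
    case False
    then have "{..?a} \<inter> {0,1} = {0,1}" by auto
    then show ?thesis using False by simp
  qed auto
  also have "?g 0 = (c when m = t)" by simp
  also have "(if ?a = 0 then 0 else ?g 1)
      = of_nat (Poly_Mapping.lookup t i + 1) * (c when m = t + Poly_Mapping.single i 1)"
  proof (cases "m = t + Poly_Mapping.single i 1")
    case True
    then have "?a = Poly_Mapping.lookup t i + 1" by (simp add: lookup_add)
    moreover have "m - Poly_Mapping.single i 1 = t" using True by simp
    ultimately show ?thesis using True by (simp add: mult.commute)
  next
    case False
    then have "m - Poly_Mapping.single i 1 \<noteq> t" if "?a \<noteq> 0"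
      using split[of 1] that by (metis One_nat_def Suc_leI neq0_conv)
    then show ?thesis using False by auto
  qed
  finally show ?thesis .
qed

lemma sum_single_keys: "(\<Sum>m\<in>Poly_Mapping.keys f. Poly_Mapping.single m (Poly_Mapping.lookup f m)) = f"
  by (rule poly_mapping_eqI)
    (auto simp: lookup_sum lookup_single when_def in_keys_iff sum.delta intro!: sum.neutral)

lemma pshift_top:
  assumes f: "\<And>m. m \<in> Poly_Mapping.keys f \<Longrightarrow> mdeg m \<le> D" and t: "D \<le> mdeg t + 1"
  shows "Poly_Mapping.lookup (pshift (unit1 i) f) t = Poly_Mapping.lookup f t
    + of_nat (Poly_Mapping.lookup t i + 1) * Poly_Mapping.lookup f (t + Poly_Mapping.single i 1)"
proof -
  have *: "(\<Sum>m\<in>Poly_Mapping.keys f. Poly_Mapping.lookup f m when m = s) = Poly_Mapping.lookup f s" for s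
    by (cases "s \<in> Poly_Mapping.keys f")
      (auto simp: when_def in_keys_iff sum.delta intro!: sum.neutral)
  have "pshift (unit1 i) f
      = (\<Sum>m\<in>Poly_Mapping.keys f. pshift (unit1 i) (Poly_Mapping.single m (Poly_Mapping.lookup f m)))"
    by (simp add: sum_single_keys flip: rhom_sum[OF rhom_pshift])
  then have "Poly_Mapping.lookup (pshift (unit1 i) f) t = (\<Sum>m\<in>Poly_Mapping.keys f.
      (Poly_Mapping.lookup f m when m = t) + of_nat (Poly_Mapping.lookup t i + 1)
         * (Poly_Mapping.lookup f m when m = t + Poly_Mapping.single i 1))"
    using pshift_single_top[OF f t] by (simp add: lookup_sum)
  then show ?thesis by (simp add: sum.distrib * flip: sum_distrib_left)
qed

text \<open>The difference \<open>pshift (unit1 i) f - f\<close> stays in the ideal. Its part of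
  degree D is the partial derivative of the part of \<open>f\<close> of degree D + 1, which is
  nonzero in characteristic 0 if the variable occurs there. Repeating this ends at a nonzero
  constant.\<close>

lemma shift_ideal_one:
  fixes I :: "'v U_h set"
  assumes minus: "\<And>f g. f \<in> I \<Longrightarrow> g \<in> I \<Longrightarrow> f - g \<in> I"
    and mult: "\<And>f g. f \<in> I \<Longrightarrow> g * f \<in> I"
    and shift: "\<And>f i. f \<in> I \<Longrightarrow> pshift (unit1 i) f \<in> I"
    and "f \<in> I" "f \<noteq> 0"
  shows "1 \<in> I"
proof -
  have "\<forall>f\<in>I. f \<noteq> 0 \<longrightarrow> (\<forall>m\<in>Poly_Mapping.keys f. mdeg m \<le> D) \<longrightarrow> 1 \<in> I" for D
  proof (induction D)
    case 0
    show ?case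
    proof (intro ballI impI)
      fix f assume f: "f \<in> I" "f \<noteq> 0" "\<forall>m\<in>Poly_Mapping.keys f. mdeg m \<le> 0"
      have "m = 0" if "m \<in> Poly_Mapping.keys f" for m
        using f(3) that by (intro poly_mapping_eqI) (auto simp: mdeg_def in_keys_iff)
      then have "Poly_Mapping.keys f = {0}" using f(2) by (metis keys_eq_empty subset_singletonD subsetI singletonI)
      then have "Poly_Mapping.single 0 (Poly_Mapping.lookup f 0) = f"
        using sum_single_keys[of f] by simp
      moreover have "Poly_Mapping.lookup f 0 \<noteq> 0"
        using \<open>Poly_Mapping.keys f = {0}\<close> by (metis in_keys_iff singletonI)
      ultimately have "U_h_const (inverse (Poly_Mapping.lookup f 0)) * f = 1"
        by (metis U_h_const_def U_h_const_simps(2,4) left_inverse)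
      then show "1 \<in> I" using mult[OF f(1)] by metis
    qed
  next
    case (Suc D)
    show ?case
    proof (intro ballI impI)
      fix f assume f: "f \<in> I" "f \<noteq> 0" "\<forall>m\<in>Poly_Mapping.keys f. mdeg m \<le> Suc D"
      show "1 \<in> I"
      proof (cases "\<forall>m\<in>Poly_Mapping.keys f. mdeg m \<le> D")
        case True
        then show ?thesis using Suc f by blast
      next
        case False
        then obtain m where m: "m \<in> Poly_Mapping.keys f" "mdeg m = Suc D"
          using f(3) by (metis le_SucE)
        then obtain i where i: "Poly_Mapping.lookup m i \<noteq> 0"
          by (metis mdeg_def sum.neutral nat.distinct(1))
        define g where "g = pshift (unit1 i) f - f"
        define t where "t = m - Poly_Mapping.single i 1"
        have mt: "m = t + Poly_Mapping.single i 1" unfolding t_def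
          using i by (intro poly_mapping_eqI) (auto simp: lookup_add lookup_minus lookup_single when_def)
        have deg_t: "mdeg t = D" using m(2) mt by (simp add: mdeg_add)
        have top: "Poly_Mapping.lookup g s = of_nat (Poly_Mapping.lookup s i + 1)
            * Poly_Mapping.lookup f (s + Poly_Mapping.single i 1)" if "D \<le> mdeg s" for s
          using pshift_top[of f "Suc D" s i] f(3) that by (simp add: g_def lookup_minus)
        have "Poly_Mapping.lookup f m \<noteq> 0" using m(1) by (simp add: in_keys_iff)
        then have "Poly_Mapping.lookup g t \<noteq> 0"
          using top[of t] deg_t mt by (simp del: of_nat_Suc of_nat_add)
        then have "g \<noteq> 0" by auto
        moreover have "g \<in> I" unfolding g_def by (intro minus shift f)
        moreover have "\<forall>s\<in>Poly_Mapping.keys g. mdeg s \<le> D"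
        proof (rule ballI, rule ccontr)
          fix s assume s: "s \<in> Poly_Mapping.keys g" "\<not> mdeg s \<le> D"
          then have "s + Poly_Mapping.single i 1 \<notin> Poly_Mapping.keys f"
            using f(3) by (force simp: mdeg_add)
          then show False using s top[of s] by (simp add: in_keys_iff)
        qed
        ultimately show ?thesis using Suc by blast
      qed
    qed
  qed
  moreover have "\<forall>m\<in>Poly_Mapping.keys f. mdeg m \<le> (\<Sum>m\<in>Poly_Mapping.keys f. mdeg m)"
    by (auto intro: member_le_sum)
  ultimately show ?thesis using assms by blast
qed

text \<open>The polynomials vanishing on the whole lattice form a shift-invariant ideal that does
  not contain 1. This density of the lattice is what makes the function model of the module
  faithful.\<close>

lemma peval_int_eq_0:
  fixes p :: "'v U_h"
  assumes "\<And>m :: 'v \<Rightarrow> int. peval (\<lambda>i. of_int (m i)) p = 0"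
  shows "p = 0"
proof (rule ccontr)
  assume "p \<noteq> 0"
  define I where "I = {q :: 'v U_h. \<forall>m :: 'v \<Rightarrow> int. peval (\<lambda>i. of_int (m i)) q = 0}"
  have "1 \<in> I"
  proof (rule shift_ideal_one)
    show "p \<in> I" "p \<noteq> 0" using assms \<open>p \<noteq> 0\<close> by (auto simp: I_def)
    fix f i assume "f \<in> I"
    then have "peval (\<lambda>j. of_int (m j + (if j = i then 1 else 0))) f = 0" for m :: "'v \<Rightarrow> int"
      by (simp only: I_def mem_Collect_eq)
    moreover have "(\<lambda>j. of_int (m j + (if j = i then 1 else 0))) = (\<lambda>j. of_int (m j) + unit1 i j)"
      for m :: "'v \<Rightarrow> int" by auto
    ultimately show "pshift (unit1 i) f \<in> I" by (simp add: I_def peval_pshift)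
  qed (auto simp: I_def)
  then show False by (simp add: I_def)
qed

section \<open>Idempotent matrices over polynomial rings\<close>

text \<open>Over a field, submodules of a free module over the polynomials in one variable are free,
  by division with remainder in the last coordinate. Over a domain pseudo-division does the same at
  the price of a factor \<open>c\<close>, and \<open>c\<close> is a constant rather than a
  polynomial.\<close>

lemma pseudo_basis:
  fixes S :: "(nat \<Rightarrow> 'a::idom poly) set"
  assumes "\<And>u v. u \<in> S \<Longrightarrow> v \<in> S \<Longrightarrow> (\<lambda>i. u i - v i) \<in> S"
    and "\<And>c v. v \<in> S \<Longrightarrow> (\<lambda>i. c * v i) \<in> S"
    and "\<And>v i. v \<in> S \<Longrightarrow> N \<le> i \<Longrightarrow> v i = 0"
  shows "\<exists>(p::nat) b. (\<forall>k<p. b k \<in> S) \<and>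
    (\<forall>q. (\<forall>i. (\<Sum>k<p. q k * b k i) = 0) \<longrightarrow> (\<forall>k<p. q k = 0)) \<and>
    (\<forall>v\<in>S. \<exists>c q. c \<noteq> 0 \<and> (\<forall>i. smult c (v i) = (\<Sum>k<p. q k * b k i)))"
  using assms
proof (induction N arbitrary: S)
  case 0
  then show ?case
    by - (rule exI[of _ 0], auto intro!: exI[of _ "1::'a"])
next
  case (Suc N)
  define S' where "S' = {v \<in> S. v N = 0}"
  have "\<exists>(p::nat) b. (\<forall>k<p. b k \<in> S') \<and>
    (\<forall>q. (\<forall>i. (\<Sum>k<p. q k * b k i) = 0) \<longrightarrow> (\<forall>k<p. q k = 0)) \<and>
    (\<forall>v\<in>S'. \<exists>c q. c \<noteq> 0 \<and> (\<forall>i. smult c (v i) = (\<Sum>k<p. q k * b k i)))"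
  proof (rule Suc.IH)
    fix v i assume "v \<in> S'" "N \<le> i"
    then show "v i = 0" using Suc.prems(3)[of v i] by (cases "i = N") (auto simp: S'_def)
  qed (use Suc.prems in \<open>auto simp: S'_def\<close>)
  then obtain p :: nat and b where b: "\<And>k. k < p \<Longrightarrow> b k \<in> S'"
    and ind: "\<And>q. (\<forall>i. (\<Sum>k<p. q k * b k i) = 0) \<Longrightarrow> \<forall>k<p. q k = 0"
    and sp: "\<And>v. v \<in> S' \<Longrightarrow> \<exists>c q. c \<noteq> 0 \<and> (\<forall>i. smult c (v i) = (\<Sum>k<p. q k * b k i))"
    by blast
  show ?case
  proof (cases "S' = S")
    case True
    then show ?thesis using b ind sp by blast
  next
    case False
    then have "\<exists>v. v \<in> S \<and> v N \<noteq> 0" by (auto simp: S'_def)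
    then obtain u where u: "u \<in> S" "u N \<noteq> 0"
      and least: "\<And>v. v \<in> S \<Longrightarrow> v N \<noteq> 0 \<Longrightarrow> degree (u N) \<le> degree (v N)"
      using ex_has_least_nat[of "\<lambda>v. v \<in> S \<and> v N \<noteq> 0" _ "\<lambda>v. degree (v N)"] by blast
    define b' where "b' = b(p := u)"
    have sum_b': "(\<Sum>k<Suc p. q k * b' k i) = (\<Sum>k<p. q k * b k i) + q p * u i" for q i
      by (simp add: b'_def)
    have bN: "b k N = 0" if "k < p" for k using b[OF that] by (simp add: S'_def)
    have "\<forall>k<Suc p. b' k \<in> S" using b u by (auto simp: b'_def S'_def less_Suc_eq)
    moreover have "\<forall>k<Suc p. q k = 0" if q: "\<forall>i. (\<Sum>k<Suc p. q k * b' k i) = 0" for q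
    proof -
      have "q p * u N = 0" using q[unfolded sum_b', rule_format, of N] bN by simp
      then have "q p = 0" using u by simp
      then show ?thesis using q[unfolded sum_b'] ind[of q] by (auto simp: less_Suc_eq)
    qed
    moreover have "\<exists>c q. c \<noteq> 0 \<and> (\<forall>i. smult c (v i) = (\<Sum>k<Suc p. q k * b' k i))" if v: "v \<in> S" for v
    proof -
      obtain q r where qr: "pseudo_divmod (v N) (u N) = (q, r)" by fastforce
      define l where "l = coeff (u N) (degree (u N)) ^ (Suc (degree (v N)) - degree (u N))"
      have l: "smult l (v N) = u N * q + r" "r = 0 \<or> degree r < degree (u N)"
        using pseudo_divmod[OF u(2) qr] by (auto simp: l_def)
      have l0: "l \<noteq> 0" using u(2) by (simp add: l_def)
      \<comment> \<open>The last coordinate of \<open>w\<close> is the pseudo-remainder. Since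
        \<open>u N\<close> has least degree among nonzero last coordinates, it vanishes, and
        \<open>w\<close> falls under the induction hypothesis.\<close>
      define w where "w = (\<lambda>i. [:l:] * v i - q * u i)"
      have w: "w \<in> S" unfolding w_def by (intro Suc.prems v u)
      have "w N = r" using l(1) by (simp add: w_def mult.commute)
      then have "w N = 0" using least[OF w] l(2) by (metis leD)
      then have "w \<in> S'" using w by (simp add: S'_def)
      then obtain c q' where c: "c \<noteq> 0" "\<forall>i. smult c (w i) = (\<Sum>k<p. q' k * b k i)"
        using sp by blast
      have "smult (c * l) (v i) = (\<Sum>k<Suc p. (q'(p := [:c:] * q)) k * b' k i)" for i
        unfolding sum_b' using c(2)[rule_format, of i]
        by (simp add: w_def smult_diff_right algebra_simps)
      then show ?thesis using c(1) l0 by (metis no_zero_divisors)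
    qed
    ultimately show ?thesis by blast
  qed
qed

lemma smult_sum_right: "smult a (sum f S) = (\<Sum>x\<in>S. smult a (f x))"
  by (induction S rule: infinite_finite_induct) (auto simp: smult_add_right)

text \<open>Over the fraction field of the coefficients the image of \<open>E\<close> is free. With
  denominators cleared, \<open>f\<close> has a pseudo-basis of the fixed vectors of \<open>E\<close>
  as columns, and \<open>g\<close> holds the coordinates of the columns of \<open>E\<close>.\<close>

lemma idem_pseudo_split:
  fixes E :: "'a::idom poly fmat"
  assumes E: "E * E = E"
  shows "\<exists>c p f g. c \<noteq> 0 \<and> f * g = smat [:c:] E \<and> g * f = smat [:c:] (idm p) \<and> f * idm p = f"
proof -
  obtain n where n: "fbd n E" using ex_fbd by blast
  define S where "S = {v. \<forall>i. (\<Sum>j<n. ent E i j * v j) = v i}"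
  have SD: "(\<Sum>j<n. ent E i j * v j) = v i" if "v \<in> S" for v i
    using that unfolding S_def by blast
  have "\<exists>(p::nat) b. (\<forall>k<p. b k \<in> S) \<and>
    (\<forall>q. (\<forall>i. (\<Sum>k<p. q k * b k i) = 0) \<longrightarrow> (\<forall>k<p. q k = 0)) \<and>
    (\<forall>v\<in>S. \<exists>c q. c \<noteq> 0 \<and> (\<forall>i. smult c (v i) = (\<Sum>k<p. q k * b k i)))"
  proof (rule pseudo_basis)
    show "(\<lambda>i. u i - v i) \<in> S" if "u \<in> S" "v \<in> S" for u v
      using that unfolding S_def by (simp add: right_diff_distrib sum_subtractf)
    show "(\<lambda>i. c * v i) \<in> S" if "v \<in> S" for c v
      using that unfolding S_def
      by (simp add: mult.left_commute[of _ c] flip: sum_distrib_left)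
    show "v i = 0" if "v \<in> S" "n \<le> i" for v i
      using SD[OF that(1), of i] n that by (simp add: fbd_def)
  qed
  then obtain p :: nat and b where b: "\<And>k. k < p \<Longrightarrow> b k \<in> S"
    and ind: "\<And>q. (\<forall>i. (\<Sum>k<p. q k * b k i) = 0) \<Longrightarrow> \<forall>k<p. q k = 0"
    and sp: "\<And>v. v \<in> S \<Longrightarrow> \<exists>c q. c \<noteq> 0 \<and> (\<forall>i. smult c (v i) = (\<Sum>k<p. q k * b k i))"
    by blast
  have col: "(\<lambda>i. ent E i j) \<in> S" for j
    using E n by (simp add: S_def flip: ent_times[of n])
  have "\<forall>j. \<exists>c q. c \<noteq> 0 \<and> (\<forall>i. smult c (ent E i j) = (\<Sum>k<p. q k * b k i))"
    using sp[OF col] by (rule allI)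
  then obtain c q where c: "\<And>j. c j \<noteq> 0"
    and q: "\<And>i j. smult (c j) (ent E i j) = (\<Sum>k<p. q j k * b k i)" by metis
  \<comment> \<open>One common denominator for all columns of \<open>E\<close>; column
    \<open>j\<close> still needs the factors other than \<open>c j\<close>, which go into
    \<open>g\<close>.\<close>
  define C where "C = (\<Prod>j<n. c j)"
  define M where "M = max n p"
  define f where "f = mkm M (\<lambda>i k. if i < n \<and> k < p then b k i else 0)"
  define g where "g = mkm M (\<lambda>k j. if k < p \<and> j < n then smult (\<Prod>l\<in>{..<n} - {j}. c l) (q j k) else 0)"
  have fM: "fbd M f" "fbd M g" by (simp_all add: f_def g_def)
  have bn: "b k i = 0" if "k < p" "n \<le> i" for k i
    using SD[OF b[OF that(1)], of i] n that by (simp add: fbd_def)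
  have f: "ent f i k = (if k < p then b k i else 0)" for i k
    using bn[of k i] by (auto simp: f_def M_def)
  have C0: "C \<noteq> 0" using c by (simp add: C_def)
  have fg: "f * g = smat [:C:] E"
  proof (rule fmat_eqI)
    fix i j
    have "ent (f * g) i j = (\<Sum>k<p. b k i * ent g k j)"
      by (subst ent_times_gen[of p]) (auto simp: f)
    also have "\<dots> = [:C:] * ent E i j"
    proof (cases "j < n")
      case True
      have C_eq: "C = c j * (\<Prod>l\<in>{..<n} - {j}. c l)"
        using True by (simp add: C_def prod.remove)
      have "(\<Sum>k<p. b k i * ent g k j) = smult (\<Prod>l\<in>{..<n} - {j}. c l) (\<Sum>k<p. q j k * b k i)"
        using True by (auto simp: g_def M_def smult_sum_right mult.commute intro!: sum.cong)
      then show ?thesis unfolding q[of j i, symmetric] by (simp add: C_eq mult.commute)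
    next
      case False
      then show ?thesis using n by (auto simp: g_def fbd_def intro!: sum.neutral)
    qed
    finally show "ent (f * g) i j = ent (smat [:C:] E) i j" by simp
  qed
  have Ef: "E * f = f"
  proof (rule fmat_eqI)
    fix i k
    show "ent (E * f) i k = ent f i k"
      using n SD[OF b[of k]] by (auto simp: ent_times[of n] f)
  qed
  have "g * f = smat [:C:] (idm p)"
  proof (rule fmat_eqI)
    fix k l
    show "ent (g * f) k l = ent (smat [:C:] (idm p)) k l"
    proof (cases "l < p \<and> k < p")
      case True
      \<comment> \<open>Column \<open>l\<close> of \<open>g * f\<close> minus \<open>C\<close> times
        the unit matrix: \<open>f\<close> kills it because f g f = C f, and the columns of
        \<open>f\<close> are independent.\<close>
      define r where "r = (\<lambda>k. ent (g * f) k l - [:C:] * ent (idm p) k l)"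
      have "f * (g * f) = smat [:C:] f" by (simp add: mult.assoc[symmetric] fg smat_mult_left Ef)
      then have "(\<Sum>k<p. ent f i k * ent (g * f) k l) = [:C:] * ent f i l" for i
        using ent_times_gen[of p f i "g * f" l] by (simp add: f)
      moreover have "(\<Sum>k<p. [:C:] * ent (idm p) k l * b k i) = [:C:] * b l i" for i
      proof -
        have "[:C:] * ent (idm p) k l * b k i = (if k = l then [:C:] * b l i else 0)" if "k < p" for k
          using that by (simp add: ent_idm)
        then show ?thesis using True by simp
      qed
      ultimately have "\<forall>i. (\<Sum>k<p. r k * b k i) = 0"
        using True by (simp add: r_def left_diff_distrib right_diff_distrib sum_subtractf f mult.commute)
      then show ?thesis using ind[of r] True by (simp add: r_def)
    next
      case False
      have "ent (g * f) k l = 0"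
      proof (cases "l < p")
        case True
        then have "ent g k j = 0" for j using False by (simp add: g_def)
        then show ?thesis using fM by (simp add: ent_times[of M])
      next
        case False
        then show ?thesis using fM by (simp add: ent_times[of M] f)
      qed
      then show ?thesis using False by (auto simp: ent_idm)
    qed
  qed
  moreover have "f * idm p = f"
  proof (rule fmat_eqI)
    fix i k
    have "ent (f * idm p) i k = (\<Sum>j<p. ent f i j * ent (idm p) j k)"
      by (rule ent_times) simp
    also have "\<dots> = (\<Sum>j<p. if j = k then ent f i k else 0)"
      by (intro sum.cong) (auto simp: ent_idm)
    also have "\<dots> = ent f i k" by (simp add: f)
    finally show "ent (f * idm p) i k = ent f i k" .
  qed
  ultimately show ?thesis using C0 fg by blast
qed

subsection \<open>Substitutions in univariate polynomials\<close>

definition upe :: "('a \<Rightarrow> 'b) \<Rightarrow> 'b \<Rightarrow> 'a::comm_ring_1 poly \<Rightarrow> 'b::comm_ring_1" where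
  "upe h x p = poly (map_poly h p) x"

lemma rhom_map_poly: "rhom h \<Longrightarrow> rhom (map_poly h)"
proof -
  assume h: "rhom h"
  have 0: "h 0 = 0" using h by (rule rhom_0)
  have add: "map_poly h (p + q) = map_poly h p + map_poly h q" for p q
    by (rule poly_eqI) (simp add: coeff_map_poly 0 rhom_add[OF h])
  have sm: "map_poly h (smult a q) = smult (h a) (map_poly h q)" for a q
    by (rule poly_eqI) (simp add: coeff_map_poly 0 rhom_mult[OF h])
  have "map_poly h (p * q) = map_poly h p * map_poly h q" for p q
    by (induction p) (simp_all add: add sm map_poly_pCons 0)
  moreover have "map_poly h 1 = 1" by (simp add: map_poly_1 rhom_1[OF h] 0)
  ultimately show ?thesis by (simp add: rhom_def[of "map_poly h"] add)
qed

lemma rhom_upe: "rhom h \<Longrightarrow> rhom (upe h x)"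
  using rhom_map_poly[of h] by (simp add: rhom_def upe_def)

lemma upe_pCons [simp]: "rhom h \<Longrightarrow> upe h x (pCons a p) = h a + x * upe h x p"
  by (simp add: upe_def map_poly_pCons rhom_0)

lemma upe_0 [simp]: "upe h x 0 = 0"
  by (simp add: upe_def)

lemma rhom_const_poly: "rhom (\<lambda>a. [:a:])"
  by (simp add: rhom_def one_pCons)

lemma upe_eqI:
  fixes f g :: "'a::comm_ring_1 poly \<Rightarrow> 'b::comm_ring_1"
  assumes f: "rhom f" and g: "rhom g" and "\<And>a. f [:a:] = g [:a:]" "f [:0, 1:] = g [:0, 1:]"
  shows "f p = g p"
proof (induction p)
  case 0
  show ?case using f g by (simp add: rhom_0)
next
  case (pCons a p)
  have *: "h (pCons a p) = h [:a:] + h [:0, 1:] * h p" if "rhom h" for h :: "'a poly \<Rightarrow> 'b"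
    using rhom_add[OF that, of "[:a:]" "[:0, 1:] * p"] rhom_mult[OF that, of "[:0, 1:]" p] by simp
  show ?case using pCons assms by (simp add: *)
qed

text \<open>In \<open>R[y][z]\<close>, the map \<open>tay c\<close> is the substitution \<open>y \<mapsto> y + c z\<close>.\<close>

definition tay :: "'a::comm_ring_1 \<Rightarrow> 'a poly \<Rightarrow> 'a poly poly" where
  "tay c = upe (\<lambda>a. [:[:a:]:]) [:[:0, 1:], [:c:]:]"

lemma rhom_const2: "rhom (\<lambda>a. [:[:a:]:])"
  using rhom_comp[OF rhom_const_poly rhom_const_poly] by simp

lemma rhom_tay: "rhom (tay c)"
  by (simp add: tay_def rhom_upe rhom_const2)

lemma tay_const [simp]: "tay c [:a:] = [:[:a:]:]"
  by (simp add: tay_def rhom_const2)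

lemma tay_var [simp]: "tay c [:0, 1:] = [:[:0, 1:], [:c:]:]"
  by (simp add: tay_def rhom_const2 rhom_0 rhom_1 one_pCons)

text \<open>The Taylor remainder of p(y + c z) is divisible by c z. The factor c is the one that
  later cancels a denominator.\<close>

lemma tay_remainder: "\<exists>w. tay c p = [:p:] + [:0, [:c:]:] * w"
proof (induction p)
  case 0
  show ?case using rhom_0[OF rhom_tay] by (intro exI[of _ 0]) simp
next
  case (pCons a p)
  then obtain w where w: "tay c p = [:p:] + [:0, [:c:]:] * w" by blast
  have "tay c (pCons a p) = [:[:a:]:] + [:[:0,1:], [:c:]:] * tay c p"
    by (simp add: tay_def rhom_const2)
  also have "[:[:0,1:], [:c:]:] = [:[:0,1:]:] + [:0, [:c:]:]" by simp
  also have "[:[:a:]:] + ([:[:0,1:]:] + [:0, [:c:]:]) * tay c p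
      = ([:[:a:]:] + [:[:0,1:]:] * [:p:]) + [:0, [:c:]:] * ([:[:0,1:]:] * w + tay c p)"
    unfolding w by (simp only: algebra_simps)
  also have "[:[:a:]:] + [:[:0,1:]:] * [:p:] = [:pCons a p:]" by simp
  finally show ?case by blast
qed

lemma tay_remainder_mat: "\<exists>W. fmap (tay c) A = fmap (\<lambda>p. [:p:]) A + smat [:0, [:c:]:] W"
proof -
  obtain n where n: "fbd n A" using ex_fbd by blast
  obtain w where w: "\<And>p. tay c p = [:p:] + [:0, [:c:]:] * w p" using tay_remainder[of c] by metis
  have "fmap (tay c) A = fmap (\<lambda>p. [:p:]) A + smat [:0, [:c:]:] (mkm n (\<lambda>i j. w (ent A i j)))"
  proof (rule fmat_eqI)
    fix i j
    show "ent (fmap (tay c) A) i j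
        = ent (fmap (\<lambda>p. [:p:]) A + smat [:0, [:c:]:] (mkm n (\<lambda>i j. w (ent A i j)))) i j"
    proof (cases "i < n \<and> j < n")
      case True
      then show ?thesis using w[of "ent A i j"] by (simp add: rhom_tay rhom_const_poly)
    next
      case False
      then have "ent A i j = 0" using n by (auto simp: fbd_def)
      then show ?thesis using False by (auto simp: rhom_tay rhom_const_poly rhom_0[OF rhom_tay])
    qed
  qed
  then show ?thesis by blast
qed

text \<open>With the denominator c of a pseudo-splitting, f(y + c z) g(y) / c and f(y) g(y + c z) /
  c are the wanted factors over the fraction field. The Taylor remainder contains the factor c, so
  both have polynomial entries, namely \<open>A\<close> and \<open>A'\<close>.\<close>

lemma idem_generic_extended:
  fixes E :: "'a::idom poly fmat"
  assumes E: "E * E = E"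
  shows "\<exists>c. c \<noteq> 0 \<and> mvn (fmap (\<lambda>p. [:p:]) E) (fmap (tay c) E)"
proof -
  obtain c p f g where c: "c \<noteq> 0" and fg: "f * g = smat [:c:] E"
    and gf: "g * f = smat [:c:] (idm p)" and fp: "f * idm p = f"
    using idem_pseudo_split[OF E] by blast
  let ?k = "fmap (\<lambda>p. [:p:])" and ?t = "fmap (tay c)"
  let ?C = "[:[:c:]:]"
  note [simp] = fmap_mult[OF rhom_const_poly, symmetric] fmap_mult[OF rhom_tay, symmetric]
  have z: "[:0, [:c:]:] = ?C * [:0, 1:]" by simp
  have k: "?k f * ?k g = smat ?C (?k E)" "?k g * ?k f = smat ?C (idm p)"
    by (simp_all add: fg gf fmap_smat rhom_const_poly fmap_idm)
  have t: "?t f * ?t g = smat ?C (?t E)" "?t g * ?t f = smat ?C (idm p)"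
    by (simp_all add: fg gf fmap_smat rhom_tay fmap_idm)
  have kf: "?k f * idm p = ?k f" "?t f * idm p = ?t f"
    using fmap_mult[OF rhom_const_poly, of f "idm p"] fmap_mult[OF rhom_tay, of c f "idm p"] fp
    by (simp_all del: fmap_mult add: fmap_idm rhom_const_poly rhom_tay)
  obtain W where W: "?t f = ?k f + smat [:0, [:c:]:] W" using tay_remainder_mat by blast
  obtain W' where W': "?t g = ?k g + smat [:0, [:c:]:] W'" using tay_remainder_mat by blast
  define A where "A = ?k E + smat [:0, 1:] (W * ?k g)"
  define A' where "A' = ?k E + smat [:0, 1:] (?k f * W')"
  have A: "smat ?C A = ?t f * ?k g"
    unfolding A_def W by (simp only: distrib_right k smat_mult_left smat_add smat_smat z)
  have A': "smat ?C A' = ?k f * ?t g"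
    unfolding A'_def W' by (simp only: distrib_left k smat_mult_right smat_add smat_smat z)
  have "smat (?C * ?C) (A' * A) = smat ?C A' * smat ?C A"
    by (simp only: smat_mult_left smat_mult_right smat_smat)
  also have "\<dots> = ?k f * (?t g * ?t f) * ?k g" unfolding A A' by (simp only: mult.assoc)
  also have "\<dots> = smat (?C * ?C) (?k E)"
    by (simp only: t smat_mult_right smat_mult_left kf k smat_smat)
  finally have 1: "A' * A = ?k E"
    by (rule smat_cancel[rotated]) (use c in simp)
  have "smat (?C * ?C) (A * A') = smat ?C A * smat ?C A'"
    by (simp only: smat_mult_left smat_mult_right smat_smat)
  also have "\<dots> = ?t f * (?k g * ?k f) * ?t g" unfolding A A' by (simp only: mult.assoc)
  also have "\<dots> = smat (?C * ?C) (?t E)"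
    by (simp only: t smat_mult_right smat_mult_left kf k smat_smat)
  finally have 2: "A * A' = ?t E"
    by (rule smat_cancel[rotated]) (use c in simp)
  show ?thesis using 1 2 c unfolding mvn_def by metis
qed

subsection \<open>Shift-equivariant idempotents\<close>

abbreviation cst :: "'a::comm_ring_1 poly \<Rightarrow> 'a poly poly" where
  "cst \<equiv> (\<lambda>p. [:p:])"

lemma rhom_pcompose: "rhom (\<lambda>p. pcompose p q)"
  by (simp add: rhom_def pcompose_add pcompose_mult one_pCons)

text \<open>The substitution z \<mapsto> r z, which makes the set of admissible c closed under
  multiples.\<close>

lemma tay_scale: "pcompose (tay c p) [:0, [:r:]:] = tay (r * c) p"
  by (rule upe_eqI[OF rhom_comp[OF rhom_pcompose rhom_tay] rhom_tay])
    (simp_all add: pcompose_pCons mult.commute)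

text \<open>The substitution y \<mapsto> y + c z with z fixed. It moves an equivalence along c' z to
  the end of the segment c z, hence closure under sums.\<close>

lemma tay_tay: "upe (tay c) [:0, 1:] (tay c' p) = tay (c + c') p"
  by (rule upe_eqI[OF rhom_comp[OF rhom_upe[OF rhom_tay] rhom_tay] rhom_tay])
    (simp_all add: rhom_tay)

lemma tay_map_poly:
  assumes h: "rhom h"
  shows "map_poly (map_poly h) (tay c p) = tay (h c) (map_poly h p)"
proof -
  have [simp]: "h 0 = 0" "h 1 = 1" using h by (auto simp: rhom_0 rhom_1)
  show ?thesis
    by (rule upe_eqI[OF rhom_comp[OF rhom_map_poly[OF rhom_map_poly[OF h]] rhom_tay]
          rhom_comp[OF rhom_tay rhom_map_poly[OF h]]])
      (simp_all add: map_poly_pCons)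
qed

text \<open>Restriction to the line s + y e_i through the generic point s. The variable s_i also
  stays among the coefficients, so that the admissible c form an ideal of the ring on which all
  shifts act.\<close>

definition dir :: "'v \<Rightarrow> 'v U_h \<Rightarrow> 'v U_h poly" where
  "dir i = pins (\<lambda>c. [:U_h_const c:]) (\<lambda>j. [:U_h_var j:] + (if j = i then [:0, 1:] else 0))"

lemma rhom_const_c: "rhom (\<lambda>c. [:U_h_const c:])"
  by (rule rhom_comp[OF rhom_const_poly rhom_const])

lemma rhom_dir: "rhom (dir i)"
  by (simp add: dir_def rhom_pins rhom_const_c)

lemma dir_simps [simp]: "dir i (U_h_const c) = [:U_h_const c:]"
  "dir i (U_h_var j) = [:U_h_var j:] + (if j = i then [:0, 1:] else 0)"
  "dir i (p + q) = dir i p + dir i q"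
  using rhom_add[OF rhom_dir] by (simp_all add: dir_def rhom_const_c)

lemma dir_pshift: "map_poly (pshift t) (dir i p) = dir i (pshift t p)"
proof -
  have h: "rhom (map_poly (pshift t :: 'a U_h \<Rightarrow> _))" by (rule rhom_map_poly[OF rhom_pshift])
  show ?thesis
    by (rule rhom_eqI[OF rhom_comp[OF h rhom_dir] rhom_comp[OF rhom_dir rhom_pshift]])
      (simp_all add: rhom_add[OF h] map_poly_pCons)
qed

definition set0 :: "'v set \<Rightarrow> 'v U_h \<Rightarrow> 'v U_h" where
  "set0 J = psubst (\<lambda>j. if j \<in> J then 0 else U_h_var j)"

lemma rhom_set0: "rhom (set0 J)"
  by (simp add: set0_def rhom_psubst)

text \<open>Sets s_i = 0 and y = 0 and then z = s_i. For c = 1 the two ends of the segment become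
  \<open>E\<close> with the variable i put to 0 and \<open>E\<close> itself.\<close>

definition eval_line :: "'v \<Rightarrow> 'v U_h poly poly \<Rightarrow> 'v U_h" where
  "eval_line i = upe (upe (set0 {i}) 0) (U_h_var i)"

lemma rhom_eval_line: "rhom (eval_line i)"
  by (simp add: eval_line_def rhom_upe rhom_set0)

lemma eval_line_cst: "eval_line i (cst (dir i p)) = set0 {i} p"
  by (rule rhom_eqI[OF rhom_comp[OF rhom_eval_line rhom_comp[OF rhom_const_poly rhom_dir]] rhom_set0])
    (auto simp: eval_line_def rhom_upe set0_def rhom_psubst)

lemma eval_line_tay: "eval_line i (tay 1 (dir i p)) = p"
  by (rule rhom_eqI[OF rhom_comp[OF rhom_eval_line rhom_comp[OF rhom_tay rhom_dir]] rhom_id])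
    (auto simp: rhom_add[OF rhom_tay] rhom_0[OF rhom_tay] eval_line_def rhom_upe set0_def rhom_psubst)

lemma idem_fmap: "rhom h \<Longrightarrow> E * E = E \<Longrightarrow> fmap h E * fmap h E = fmap h E"
  by (simp flip: fmap_mult)

text \<open>The elements \<open>c\<close> for which \<open>E(s + (y + c z) e\<^sub>i)\<close> and \<open>E(s + y e\<^sub>i)\<close> are equivalent over
  \<open>R[y, z]\<close> form an ideal of \<open>R\<close>, as in Quillen's patching theorem. It is nonzero, and here it
  inherits the invariance of \<open>E\<close> under integer shifts, so it is the unit ideal.\<close>

lemma shift_idem_set0:
  fixes E :: "nat U_h fmat"
  assumes E: "E * E = E" and sh: "\<And>j. mvn (fmap (pshift (unit1 j)) E) E"
  shows "mvn (fmap (set0 {i}) E) E"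
proof -
  define F where "F = fmap (dir i) E"
  have F: "F * F = F" unfolding F_def by (rule idem_fmap[OF rhom_dir E])
  define I where "I = {c. mvn (fmap cst F) (fmap (tay c) F)}"
  have idem: "fmap cst F * fmap cst F = fmap cst F" "fmap (tay c) F * fmap (tay c) F = fmap (tay c) F" for c
    by (rule idem_fmap[OF rhom_const_poly F] idem_fmap[OF rhom_tay F])+
  have mult: "r * c \<in> I" if "c \<in> I" for r c
  proof -
    let ?h = "\<lambda>p. pcompose p [:0, [:r:]:]"
    have "mvn (fmap ?h (fmap cst F)) (fmap ?h (fmap (tay c) F))"
      using that by (intro mvn_fmap rhom_pcompose) (simp add: I_def)
    then show ?thesis
      by (simp add: I_def fmap_fmap rhom_pcompose rhom_const_poly rhom_tay tay_scale)
  qed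
  have add: "c + c' \<in> I" if "c \<in> I" "c' \<in> I" for c c'
  proof -
    let ?h = "upe (tay c) [:0, 1:]"
    have h: "rhom ?h" by (rule rhom_upe[OF rhom_tay])
    have "mvn (fmap ?h (fmap cst F)) (fmap ?h (fmap (tay c') F))"
      using that by (intro mvn_fmap h) (simp add: I_def)
    then have "mvn (fmap (tay c) F) (fmap (tay (c + c')) F)"
      by (simp add: fmap_fmap h rhom_const_poly rhom_tay tay_tay)
    then show ?thesis using that(1) mvn_trans idem unfolding I_def by blast
  qed
  have minus: "f - g \<in> I" if "f \<in> I" "g \<in> I" for f g
    using add[OF that(1) mult[OF that(2), of "- 1"]] by simp
  \<comment> \<open>Shifting the coefficients commutes with \<open>dir\<close> and carries
    \<open>tay c\<close> to \<open>tay\<close> of the shifted c. The result concerns the shifted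
    idempotent, which is equivalent to \<open>E\<close> by \<open>sh\<close>.\<close>
  have shift: "pshift (unit1 j) c \<in> I" if "c \<in> I" for c j
  proof -
    let ?s = "pshift (unit1 j)"
    let ?h = "map_poly (map_poly ?s)"
    have h: "rhom ?h" by (intro rhom_map_poly rhom_pshift)
    have hs: "rhom (map_poly ?s)" by (intro rhom_map_poly rhom_pshift)
    have "mvn (fmap ?h (fmap cst F)) (fmap ?h (fmap (tay c) F))"
      using that by (intro mvn_fmap h) (simp add: I_def)
    also have "fmap ?h (fmap cst F) = fmap cst (fmap (dir i) (fmap ?s E))"
      unfolding F_def
      by (rule fmat_eqI) (simp add: h rhom_const_poly rhom_dir rhom_pshift map_poly_pCons dir_pshift)
    also have "fmap ?h (fmap (tay c) F) = fmap (tay (?s c)) (fmap (dir i) (fmap ?s E))"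
      unfolding F_def
      by (rule fmat_eqI) (simp add: h rhom_tay rhom_dir rhom_pshift tay_map_poly dir_pshift)
    finally have 1: "mvn (fmap cst (fmap (dir i) (fmap ?s E))) (fmap (tay (?s c)) (fmap (dir i) (fmap ?s E)))" .
    have 2: "mvn (fmap cst F) (fmap cst (fmap (dir i) (fmap ?s E)))"
      and 3: "mvn (fmap (tay (?s c)) (fmap (dir i) (fmap ?s E))) (fmap (tay (?s c)) F)"
      unfolding F_def by (intro mvn_fmap rhom_const_poly rhom_tay rhom_dir sh mvn_sym[OF sh])+
    have "fmap (tay (?s c)) (fmap (dir i) (fmap ?s E)) * fmap (tay (?s c)) (fmap (dir i) (fmap ?s E))
        = fmap (tay (?s c)) (fmap (dir i) (fmap ?s E))"
      by (intro idem_fmap rhom_tay rhom_dir rhom_pshift E)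
    then show ?thesis using mvn_trans[OF mvn_trans[OF 2 1] 3] idem unfolding I_def by blast
  qed
  obtain c where "c \<noteq> 0" "c \<in> I" using idem_generic_extended[OF F] by (auto simp: I_def)
  then have "1 \<in> I" using shift_ideal_one[of I c] minus mult shift by blast
  then have "mvn (fmap (eval_line i) (fmap cst F)) (fmap (eval_line i) (fmap (tay 1) F))"
    by (intro mvn_fmap rhom_eval_line) (simp add: I_def)
  moreover have "fmap (eval_line i) (fmap cst F) = fmap (set0 {i}) E"
    unfolding F_def
    by (rule fmat_eqI) (simp add: rhom_eval_line rhom_const_poly rhom_dir rhom_set0 eval_line_cst)
  moreover have "fmap (eval_line i) (fmap (tay 1) F) = E"
    unfolding F_def
    by (rule fmat_eqI) (simp add: rhom_eval_line rhom_tay rhom_dir eval_line_tay)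
  ultimately show ?thesis by simp
qed

lemma set0_set0: "set0 J (set0 {i} p) = set0 (insert i J) p"
  by (rule rhom_eqI[OF rhom_comp[OF rhom_set0 rhom_set0] rhom_set0]) (auto simp: set0_def)

lemma shift_idem_set0_finite:
  fixes E :: "nat U_h fmat"
  assumes E: "E * E = E" and sh: "\<And>j. mvn (fmap (pshift (unit1 j)) E) E" and "finite J"
  shows "mvn (fmap (set0 J) E) E"
  using \<open>finite J\<close>
proof induction
  case empty
  have "set0 {} p = p" for p :: "nat U_h"
    by (rule rhom_eqI[OF rhom_set0 rhom_id]) (auto simp: set0_def)
  then have "fmap (set0 {}) E = E" by (auto intro!: fmat_eqI simp: rhom_set0)
  then show ?case using mvn_refl[OF E] by simp
next
  case (insert i J)
  have "mvn (fmap (set0 J) (fmap (set0 {i}) E)) (fmap (set0 J) E)"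
    by (intro mvn_fmap rhom_set0 shift_idem_set0 E sh)
  then have "mvn (fmap (set0 (insert i J)) E) (fmap (set0 J) E)"
    by (simp add: fmap_fmap rhom_set0 set0_set0)
  then show ?case using insert.IH by (rule mvn_trans) (intro idem_fmap rhom_set0 E)+
qed

section \<open>Reduction of a shift-equivariant idempotent to a constant one, and its
  splitting\<close>

lemma ex_set0_const: "\<exists>J. finite J \<and> (\<forall>J'. J \<subseteq> J' \<longrightarrow> set0 J' p = U_h_const (peval (\<lambda>_. 0) p))"
proof (induction p rule: U_h_induct)
  case (const c)
  show ?case by (intro exI[of _ "{}"]) (simp add: set0_def)
next
  case (var i)
  show ?case by (intro exI[of _ "{i}"]) (simp add: set0_def)
next
  case (add p q)
  then obtain J J' where "finite J" "finite J'"
    "\<And>K. J \<subseteq> K \<Longrightarrow> set0 K p = U_h_const (peval (\<lambda>_. 0) p)"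
    "\<And>K. J' \<subseteq> K \<Longrightarrow> set0 K q = U_h_const (peval (\<lambda>_. 0) q)" by blast
  then show ?case by (intro exI[of _ "J \<union> J'"]) (simp add: rhom_add[OF rhom_set0])
next
  case (mult p q)
  then obtain J J' where "finite J" "finite J'"
    "\<And>K. J \<subseteq> K \<Longrightarrow> set0 K p = U_h_const (peval (\<lambda>_. 0) p)"
    "\<And>K. J' \<subseteq> K \<Longrightarrow> set0 K q = U_h_const (peval (\<lambda>_. 0) q)" by blast
  then show ?case by (intro exI[of _ "J \<union> J'"]) (simp add: rhom_mult[OF rhom_set0])
qed

text \<open>The pseudo-splitting of the constant polynomial matrix, evaluated at 0; over a field the
  factor c can be inverted.\<close>

lemma complex_idem_split:
  fixes E :: "complex fmat"
  assumes E: "E * E = E"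
  shows "\<exists>p f g. f * g = E \<and> g * f = idm p"
proof -
  let ?k = "fmap (\<lambda>a::complex. [:a:])" and ?v = "fmap (upe (\<lambda>a::complex. a) 0)"
  have v: "rhom (upe (\<lambda>a::complex. a) 0)" by (rule rhom_upe[OF rhom_id])
  obtain c p f g where c: "c \<noteq> 0" and fg: "f * g = smat [:c:] (?k E)"
    and gf: "g * f = smat [:c:] (idm p)"
    using idem_pseudo_split[OF idem_fmap[OF rhom_const_poly E]] by blast
  have vk: "?v (?k E) = E" by (rule fmat_eqI) (simp add: v rhom_const_poly rhom_id)
  have "?v f * ?v g = smat c E"
    by (simp add: fg fmap_smat v vk rhom_id flip: fmap_mult[OF v])
  moreover have "?v g * ?v f = smat c (idm p)"
    by (simp add: gf fmap_smat v fmap_idm rhom_id flip: fmap_mult[OF v])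
  ultimately have "smat (inverse c) (?v f) * ?v g = E" "?v g * smat (inverse c) (?v f) = idm p"
    using c by (simp_all add: smat_mult_left smat_mult_right)
  then show ?thesis by blast
qed

text \<open>Only finitely many variables occur in \<open>E\<close>, and putting them to 0 one after
  another keeps its class. So \<open>E\<close> is equivalent to its value at the origin, which
  splits over the complex numbers.\<close>

lemma shift_idem_split_nat:
  fixes E :: "nat U_h fmat"
  assumes E: "E * E = E" and sh: "\<And>j. mvn (fmap (pshift (unit1 j)) E) E"
  shows "\<exists>p f g. f * g = E \<and> g * f = idm p"
proof -
  obtain n where n: "fbd n E" using ex_fbd by blast
  obtain J :: "nat U_h \<Rightarrow> nat set" where J: "\<And>p. finite (J p)"
    "\<And>p J'. J p \<subseteq> J' \<Longrightarrow> set0 J' p = U_h_const (peval (\<lambda>_. 0) p)"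
    using ex_set0_const by metis
  define K where "K = (\<Union>i<n. \<Union>j<n. J (ent E i j))"
  have ev: "rhom (peval (\<lambda>_. 0))" by (rule rhom_peval)
  define E0 where "E0 = fmap (peval (\<lambda>_. 0)) E"
  have "fmap (set0 K) E = fmap U_h_const E0"
  proof (rule fmat_eqI)
    fix i j
    show "ent (fmap (set0 K) E) i j = ent (fmap U_h_const E0) i j"
    proof (cases "i < n \<and> j < n")
      case True
      then have "J (ent E i j) \<subseteq> K" by (auto simp: K_def)
      then show ?thesis using J by (simp add: rhom_set0 E0_def rhom_const ev)
    next
      case False
      then have "ent E i j = 0" using n by (auto simp: fbd_def)
      then show ?thesis by (simp add: rhom_set0 E0_def rhom_const ev rhom_0[OF rhom_set0])
    qed
  qed
  moreover have "finite K" using J by (simp add: K_def)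
  ultimately have "mvn (fmap U_h_const E0) E" using shift_idem_set0_finite[OF E sh] by metis
  then obtain a b where ab: "fmap U_h_const E0 = a * b" "E = b * a" by (auto simp: mvn_def)
  have "E0 * E0 = E0" unfolding E0_def by (rule idem_fmap[OF ev E])
  then obtain p f g where fg: "f * g = E0" "g * f = idm p" using complex_idem_split by blast
  let ?f = "fmap U_h_const f" and ?g = "fmap U_h_const g"
  have FG: "?f * ?g = a * b" "?g * ?f = idm p"
    using fg ab by (simp_all add: fmap_idm rhom_const flip: fmap_mult[OF rhom_const])
  have "(b * ?f) * (?g * a) = b * (a * b) * a" using FG by (metis mult.assoc)
  also have "\<dots> = E * E" using ab by (simp add: mult.assoc)
  finally have 1: "(b * ?f) * (?g * a) = E" by (simp add: E)
  have "(?g * a) * (b * ?f) = (?g * ?f) * (?g * ?f)" using FG(1) by (metis mult.assoc)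
  then have 2: "(?g * a) * (b * ?f) = idm p" by (simp add: FG)
  show ?thesis using 1 2 by blast
qed

text \<open>Renames the variables along an injection into the natural numbers. Shifts in the
  additional variables fix the renamed matrix, since these variables do not occur in it.\<close>

lemma shift_idem_split:
  fixes E :: "'d::finite U_h fmat"
  assumes E: "E * E = E" and sh: "\<And>j. mvn (fmap (pshift (unit1 j)) E) E"
  shows "\<exists>p f g. f * g = E \<and> g * f = idm p"
proof -
  obtain \<iota> :: "'d \<Rightarrow> nat" where \<iota>: "inj \<iota>"
    using finite_imp_inj_to_nat_seg[of "UNIV :: 'd set"] by auto
  define up :: "'d U_h \<Rightarrow> nat U_h" where "up = psubst (\<lambda>i. U_h_var (\<iota> i))"
  define dn :: "nat U_h \<Rightarrow> 'd U_h" where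
    "dn = psubst (\<lambda>k. if k \<in> range \<iota> then U_h_var (inv_into UNIV \<iota> k) else 0)"
  have up: "rhom up" and dn: "rhom dn" by (simp_all add: up_def dn_def rhom_psubst)
  have dn_up: "dn (up p) = p" for p
    by (rule rhom_eqI[OF rhom_comp[OF dn up] rhom_id]) (simp_all add: up_def dn_def \<iota>)
  have sh1: "pshift (unit1 (\<iota> j)) (up p) = up (pshift (unit1 j) p)" for j p
    by (rule rhom_eqI[OF rhom_comp[OF rhom_pshift up] rhom_comp[OF up rhom_pshift]])
      (use \<iota> in \<open>auto simp: up_def dn_def inj_eq\<close>)
  have sh2: "pshift (unit1 k) (up p) = up p" if "k \<notin> range \<iota>" for k p
    by (rule rhom_eqI[OF rhom_comp[OF rhom_pshift up] up]) (use that in \<open>auto simp: up_def dn_def\<close>)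
  have "mvn (fmap (pshift (unit1 k)) (fmap up E)) (fmap up E)" for k
  proof (cases "k \<in> range \<iota>")
    case True
    then obtain j where j: "k = \<iota> j" by auto
    have "fmap (pshift (unit1 k)) (fmap up E) = fmap up (fmap (pshift (unit1 j)) E)"
      by (rule fmat_eqI) (simp only: ent_fmap_rhom rhom_pshift up j sh1)
    then show ?thesis using mvn_fmap[OF up sh] by simp
  next
    case False
    then have "fmap (pshift (unit1 k)) (fmap up E) = fmap up E"
      by (intro fmat_eqI) (simp only: ent_fmap_rhom rhom_pshift up sh2 not_False_eq_True)
    then show ?thesis using mvn_refl[OF idem_fmap[OF up E]] by simp
  qed
  then obtain p f g where fg: "f * g = fmap up E" "g * f = idm p"
    using shift_idem_split_nat[OF idem_fmap[OF up E]] by blast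
  have "fmap dn f * fmap dn g = E"
    by (simp add: fg fmap_mult[OF dn, symmetric]) (rule fmat_eqI, simp add: dn up dn_up)
  moreover have "fmap dn g * fmap dn f = idm p"
    by (simp add: fg fmap_mult[OF dn, symmetric] fmap_idm dn)
  ultimately show ?thesis by blast
qed

section \<open>Powers of the augmentation ideal\<close>

lemma int_vec_induct [case_names zero add sub]:
  fixes r :: "int ^ 'd::finite"
  assumes "Q 0" and a: "\<And>r i. Q r \<Longrightarrow> Q (r + axis i 1)" and s: "\<And>r i. Q r \<Longrightarrow> Q (r - axis i 1)"
  shows "Q r"
proof -
  have ax: "axis i (m + k) = axis i m + axis i k" for i :: 'd and m k :: int
    by (simp add: vec_eq_iff axis_def)
  have ax0: "axis i 0 = (0 :: int ^ 'd)" for i by (simp add: vec_eq_iff axis_def)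
  have one: "Q (r + axis i k)" if "Q r" for r i k
  proof (induction k rule: int_induct[where k = 0])
    case base
    then show ?case using that by (simp add: ax0)
  next
    case (step1 k)
    then show ?case using a[of "r + axis i k" i] by (simp add: ax add.assoc)
  next
    case (step2 k)
    have "r + axis i k - axis i 1 = r + axis i (k - 1)" by (simp add: vec_eq_iff axis_def)
    then show ?case by (metis s step2(2))
  qed
  have "Q (\<Sum>i\<in>S. axis i (r $ i))" if "finite S" for S
    using that by (induction S) (auto simp: assms(1) add.commute dest: one)
  moreover have "(\<Sum>i\<in>UNIV. axis i (r $ i)) = r" by (simp add: vec_eq_iff axis_def)
  ultimately show ?thesis using finite by metis
qed

definition xv :: "'d \<Rightarrow> 'd::finite laurent" where
  "xv i = xmon (axis i 1)"

lemma euler_xmon: "euler i (xmon r) = pm_scale (of_int (r $ i)) (xmon r)"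
  by (simp add: xmon_def euler_single pm_scale_single)

lemma euler_minus: "euler i (f - g) = euler i f - euler i g"
  by (rule poly_mapping_eqI) (simp add: lookup_minus algebra_simps)

lemma euler_0 [simp]: "euler i 0 = 0"
  by (rule poly_mapping_eqI) simp

lemma euler_sum: "euler i (sum f S) = (\<Sum>k\<in>S. euler i (f k))"
  by (induction S rule: infinite_finite_induct) (auto simp: euler_add)

lemma euler_1 [simp]: "euler i 1 = 0"
  using euler_xmon[of i 0] by (simp add: xmon_0)

lemma euler_xv: "euler i (xv j) = (if i = j then xv j else 0)"
  by (auto simp: xv_def euler_xmon axis_def)

text \<open>The powers of the augmentation ideal, peeled off one generator x_i - 1 at a time so that
  induction on the exponent applies. That every x^r - 1 lies in the first power is
  \<open>xmon_minus_1_mpow\<close>.\<close>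

primrec mpow :: "nat \<Rightarrow> 'd::finite laurent set" where
  "mpow 0 = UNIV"
| "mpow (Suc k) = {\<Sum>i\<in>UNIV. (xv i - 1) * g i | g. \<forall>i. g i \<in> mpow k}"

lemma mpow_add: "f \<in> mpow k \<Longrightarrow> g \<in> mpow k \<Longrightarrow> f + g \<in> mpow k"
proof (induction k arbitrary: f g)
  case (Suc k)
  then obtain a b where a: "f = (\<Sum>i\<in>UNIV. (xv i - 1) * a i)" "\<forall>i. a i \<in> mpow k"
    and b: "g = (\<Sum>i\<in>UNIV. (xv i - 1) * b i)" "\<forall>i. b i \<in> mpow k" by auto
  have "f + g = (\<Sum>i\<in>UNIV. (xv i - 1) * (a i + b i))" by (simp add: a b distrib_left sum.distrib)
  then show ?case using a b Suc.IH by auto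
qed simp

lemma mpow_mult: "f \<in> mpow k \<Longrightarrow> h * f \<in> mpow k"
proof (induction k arbitrary: f)
  case (Suc k)
  then obtain a where a: "f = (\<Sum>i\<in>UNIV. (xv i - 1) * a i)" "\<forall>i. a i \<in> mpow k" by auto
  have "h * f = (\<Sum>i\<in>UNIV. (xv i - 1) * (h * a i))" by (simp add: a sum_distrib_left mult_ac)
  then show ?case using a Suc.IH by auto
qed simp

lemma mpow_mult_right: "f \<in> mpow k \<Longrightarrow> f * h \<in> mpow k"
  using mpow_mult[of f k h] by (simp add: mult.commute)

lemma mpow_0 [simp]: "0 \<in> mpow k"
proof (induction k)
  case (Suc k)
  then show ?case by (auto intro!: exI[of _ "\<lambda>_. 0"])
qed simp

lemma mpow_minus: "f \<in> mpow k \<Longrightarrow> g \<in> mpow k \<Longrightarrow> f - g \<in> mpow k"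
  using mpow_add[of f k "- 1 * g"] mpow_mult[of g k "- 1"] by simp

lemma mpow_sum: "(\<And>i. i \<in> S \<Longrightarrow> f i \<in> mpow k) \<Longrightarrow> sum f S \<in> mpow k"
  by (induction S rule: infinite_finite_induct) (auto simp: mpow_add)

lemma mpow_xv: "f \<in> mpow k \<Longrightarrow> (xv i - 1) * f \<in> mpow (Suc k)"
proof -
  assume f: "f \<in> mpow k"
  have "(\<Sum>j\<in>UNIV. (xv j - 1) * (if j = i then f else 0)) = (\<Sum>j\<in>UNIV. if j = i then (xv j - 1) * f else 0)"
    by (rule sum.cong) auto
  then have "(xv i - 1) * f = (\<Sum>j\<in>UNIV. (xv j - 1) * (if j = i then f else 0))" by simp
  then show ?thesis using f by (auto intro!: exI[of _ "\<lambda>j. if j = i then f else 0"])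
qed

lemma mpow_mono: "f \<in> mpow (Suc k) \<Longrightarrow> f \<in> mpow k"
  by (auto intro!: mpow_sum mpow_mult)

lemma mpow_times: "f \<in> mpow a \<Longrightarrow> g \<in> mpow b \<Longrightarrow> f * g \<in> mpow (a + b)"
proof (induction a arbitrary: f)
  case 0
  then show ?case by (simp add: mpow_mult)
next
  case (Suc a)
  then obtain c where c: "f = (\<Sum>i\<in>UNIV. (xv i - 1) * c i)" "\<forall>i. c i \<in> mpow a" by auto
  have "f * g = (\<Sum>i\<in>UNIV. (xv i - 1) * (c i * g))" by (simp add: c sum_distrib_right mult.assoc)
  then show ?case using c Suc by auto
qed

lemma mpow_euler: "f \<in> mpow (Suc k) \<Longrightarrow> euler i f \<in> mpow k"
proof (induction k arbitrary: f)
  case (Suc k)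
  then obtain a where a: "f = (\<Sum>j\<in>UNIV. (xv j - 1) * a j)" "\<forall>j. a j \<in> mpow (Suc k)" by auto
  have "euler i f = (\<Sum>j\<in>UNIV. (if i = j then xv j else 0) * a j + (xv j - 1) * euler i (a j))"
    by (simp add: a euler_sum euler_mult euler_minus euler_xv)
  moreover have "\<dots> \<in> mpow (Suc k)"
    by (intro mpow_sum mpow_add mpow_xv mpow_mult Suc.IH) (use a in auto)
  ultimately show ?case by simp
qed simp

text \<open>Euler's identity at the point 1: the field with components x_i - 1 multiplies the k-th
  power by k modulo the next one, because x_j is congruent to 1. This is the source of all weights
  below.\<close>

lemma mpow_euler_sum:
  "f \<in> mpow k \<Longrightarrow> (\<Sum>i\<in>UNIV. (xv i - 1) * euler i f) - of_nat k * f \<in> mpow (Suc k)"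
proof (induction k arbitrary: f)
  case 0
  show ?case by (auto intro!: exI[of _ "\<lambda>i. euler i f"])
next
  case (Suc k)
  then obtain a where a: "f = (\<Sum>j\<in>UNIV. (xv j - 1) * a j)" "\<forall>j. a j \<in> mpow k" by auto
  let ?E = "\<lambda>f. (\<Sum>i\<in>UNIV. (xv i - 1) * euler i f)"
  have E_add: "?E (f + g) = ?E f + ?E g" for f g by (simp add: euler_add distrib_left sum.distrib)
  have E_sum: "?E (\<Sum>j\<in>UNIV. h j) = (\<Sum>j\<in>UNIV. ?E (h j))" for h :: "'a \<Rightarrow> 'a laurent"
    by (subst sum.swap) (simp add: euler_sum sum_distrib_left)
  have E1: "?E ((xv j - 1) * g) = (xv j - 1) * (xv j * g + ?E g)" for j g
  proof -
    have "?E ((xv j - 1) * g) = (\<Sum>i\<in>UNIV. (xv i - 1) * ((if i = j then xv j else 0) * g))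
        + (\<Sum>i\<in>UNIV. (xv i - 1) * ((xv j - 1) * euler i g))"
      by (simp add: euler_mult euler_minus euler_xv distrib_left sum.distrib)
    also have "(\<Sum>i\<in>UNIV. (xv i - 1) * ((if i = j then xv j else 0) * g))
        = (\<Sum>i\<in>UNIV. if i = j then (xv j - 1) * (xv j * g) else 0)"
      by (rule sum.cong) auto
    also have "\<dots> = (xv j - 1) * (xv j * g)" by simp
    also have "(\<Sum>i\<in>UNIV. (xv i - 1) * ((xv j - 1) * euler i g)) = (xv j - 1) * ?E g"
      by (simp add: sum_distrib_left mult.left_commute)
    finally show ?thesis by (simp add: distrib_left)
  qed
  have "?E f - of_nat (Suc k) * f = (\<Sum>j\<in>UNIV. (xv j - 1) * (xv j * a j + ?E (a j)) - of_nat (Suc k) * ((xv j - 1) * a j))"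
    unfolding a(1) E_sum E1 by (simp only: sum_subtractf sum_distrib_left)
  also have "\<dots> = (\<Sum>j\<in>UNIV. (xv j - 1) * ((xv j - 1) * a j + (?E (a j) - of_nat k * a j)))"
    by (rule sum.cong) (simp_all add: algebra_simps)
  also have "\<dots> \<in> mpow (Suc (Suc k))"
    by (intro mpow_sum mpow_xv mpow_add Suc.IH) (use a in auto)
  finally show ?case .
qed

lemma xmon_minus_1_mpow: "xmon r - 1 \<in> mpow (Suc 0)"
proof (induction r rule: int_vec_induct)
  case zero
  show ?case by (simp only: xmon_0 diff_self mpow_0)
next
  case (add r i)
  have "xmon (r + axis i 1) - 1 = (xv i - 1) * xmon r + (xmon r - 1)"
    by (simp add: xv_def algebra_simps flip: xmon_mult)
  also have "\<dots> \<in> mpow (Suc 0)" by (intro mpow_add mpow_xv add) simp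
  finally show ?case .
next
  case (sub r i)
  have "xmon (r - axis i 1) * xv i = xmon r" by (simp add: xv_def xmon_mult)
  then have "xmon (r - axis i 1) - 1 = (xmon r - 1) - (xv i - 1) * xmon (r - axis i 1)"
    by (simp add: algebra_simps)
  also have "\<dots> \<in> mpow (Suc 0)" by (intro mpow_minus mpow_xv sub) simp
  finally show ?case .
qed

definition aug :: "'d::finite laurent \<Rightarrow> complex" where
  "aug f = (\<Sum>r\<in>Poly_Mapping.keys f. Poly_Mapping.lookup f r)"

definition lin :: "('k \<Rightarrow> complex fmat) \<Rightarrow> ('k \<Rightarrow>\<^sub>0 complex) \<Rightarrow> complex fmat" where
  "lin x f = (\<Sum>r\<in>Poly_Mapping.keys f. smat (Poly_Mapping.lookup f r) (x r))"

lemma lin_superset: "finite S \<Longrightarrow> Poly_Mapping.keys f \<subseteq> S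
  \<Longrightarrow> lin x f = (\<Sum>r\<in>S. smat (Poly_Mapping.lookup f r) (x r))"
  unfolding lin_def by (rule sum.mono_neutral_left) (auto simp: in_keys_iff)

lemma lin_add: "lin x (f + g) = lin x f + lin x g"
proof -
  let ?S = "Poly_Mapping.keys f \<union> Poly_Mapping.keys g"
  have "Poly_Mapping.keys (f + g) \<subseteq> ?S" by (rule Poly_Mapping.keys_add)
  then show ?thesis by (simp add: lin_superset[of ?S] lookup_add smat_add_left sum.distrib)
qed

lemma lin_scale: "lin x (pm_scale c f) = smat c (lin x f)"
proof -
  have "Poly_Mapping.keys (pm_scale c f) \<subseteq> Poly_Mapping.keys f" by (auto simp: in_keys_iff)
  then show ?thesis
    by (simp add: lin_superset[of "Poly_Mapping.keys f"] smat_sum)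
qed

lemma lin_single [simp]: "lin x (Poly_Mapping.single r c) = smat c (x r)"
  by (simp add: lin_def)

lemma lin_xmon [simp]: "lin x (xmon r) = x r"
  by (simp add: xmon_def)

lemma lin_0 [simp]: "lin x 0 = 0"
  by (simp add: lin_def)

lemma lin_minus: "lin x (f - g) = lin x f - lin x g"
  using lin_add[of x "f - g" g] by (simp add: algebra_simps)

lemma lin_sum: "lin x (sum f S) = (\<Sum>k\<in>S. lin x (f k))"
  by (induction S rule: infinite_finite_induct) (auto simp: lin_add)

lemma aug_eq_lin: "smat (aug f) A = lin (\<lambda>_. A) f"
  unfolding aug_def lin_def
  by (induction "Poly_Mapping.keys f" rule: infinite_finite_induct)
    (auto intro!: fmat_eqI simp: ent_sum sum_distrib_right)

lemma rhom_aug: "rhom aug"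
proof -
  have e: "aug f = ent (lin (\<lambda>_. idm 1) f) 0 0" for f :: "'a laurent"
    by (simp add: ent_idm flip: aug_eq_lin)
  have add: "aug (f + g) = aug f + aug g" for f g :: "'a laurent" by (simp add: e lin_add)
  have single: "aug (Poly_Mapping.single r c) = c" for r :: "int ^ 'a" and c by (simp add: e ent_idm)
  have zero: "aug (0 :: 'a laurent) = 0" by (simp add: e)
  have "aug (f * g) = aug f * aug g" for f g :: "'a laurent"
  proof (induction f rule: pm_induct)
    case (single r c)
    show ?case
      by (induction g rule: pm_induct)
        (simp_all add: zero mult_single \<open>\<And>r c. aug (Poly_Mapping.single r c) = c\<close> add distrib_left)
  qed (simp_all add: zero add distrib_right)
  then show ?thesis using single[of 0 1] by (simp add: rhom_def add)
qed

lemma aug_simps [simp]: "aug (f + g) = aug f + aug g" "aug (f - g) = aug f - aug g"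
  "aug (f * g) = aug f * aug g" "aug 0 = 0" "aug 1 = 1" "aug (f ^ k) = aug f ^ k"
  "aug (xmon r) = 1" "aug (xv i) = 1"
  by (simp_all add: rhom_add rhom_minus rhom_mult rhom_0 rhom_1 rhom_power rhom_aug)
    (simp_all add: aug_def xv_def xmon_def)

lemma aug_sum: "aug (sum f S) = (\<Sum>k\<in>S. aug (f k))"
  by (rule rhom_sum[OF rhom_aug])

lemma aug_mpow: "f \<in> mpow (Suc k) \<Longrightarrow> aug f = 0"
  by (auto simp: aug_sum)

section \<open>A norm estimate for eigenvectors of commutators\<close>

definition nrm :: "nat \<Rightarrow> complex fmat \<Rightarrow> real" where
  "nrm n A = (\<Sum>i<n. \<Sum>j<n. cmod (ent A i j))"

lemma nrm_nonneg: "0 \<le> nrm n A"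
  by (simp add: nrm_def sum_nonneg)

lemma nrm_eq_0: "fbd n A \<Longrightarrow> nrm n A = 0 \<Longrightarrow> A = 0"
proof (rule fmat_eqI)
  fix i j assume A: "fbd n A" "nrm n A = 0"
  show "ent A i j = ent 0 i j"
  proof (cases "i < n \<and> j < n")
    case True
    have "(\<Sum>j<n. cmod (ent A i j)) = 0"
      using A(2) True unfolding nrm_def by (subst (asm) sum_nonneg_eq_0_iff) (auto intro: sum_nonneg)
    then show ?thesis using True by (subst (asm) sum_nonneg_eq_0_iff) auto
  qed (use A in \<open>auto simp: fbd_def\<close>)
qed

lemma nrm_mult: "fbd n A \<Longrightarrow> nrm n (A * B) \<le> nrm n A * nrm n B"
proof -
  assume A: "fbd n A"
  have "nrm n (A * B) \<le> (\<Sum>i<n. \<Sum>j<n. \<Sum>k<n. cmod (ent A i k) * cmod (ent B k j))"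
    unfolding nrm_def by (intro sum_mono) (simp add: ent_times[of n] A sum_norm_le norm_mult)
  also have "\<dots> = (\<Sum>i<n. \<Sum>k<n. cmod (ent A i k) * (\<Sum>j<n. cmod (ent B k j)))"
    unfolding sum_distrib_left by (intro sum.cong refl sum.swap)
  also have "\<dots> \<le> (\<Sum>i<n. \<Sum>k<n. cmod (ent A i k) * nrm n B)"
  proof (intro sum_mono mult_left_mono)
    fix k assume "k \<in> {..<n}"
    then show "(\<Sum>j<n. cmod (ent B k j)) \<le> nrm n B"
      unfolding nrm_def by (intro member_le_sum) (auto intro: sum_nonneg)
  qed simp
  also have "\<dots> = nrm n A * nrm n B" by (simp add: nrm_def[of n A] sum_distrib_right)
  finally show ?thesis .
qed

lemma nrm_diff: "nrm n (A - B) \<le> nrm n A + nrm n B"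
  unfolding nrm_def by (simp flip: sum.distrib add: norm_triangle_ineq4 sum_mono)

lemma nrm_smat: "nrm n (smat c A) = cmod c * nrm n A"
  by (simp add: nrm_def norm_mult sum_distrib_left)

text \<open>The map a \<mapsto> E a - a E has norm at most twice that of \<open>E\<close>, which
  bounds its eigenvalues.\<close>

lemma commutator_eigenvector:
  assumes "fbd n E" "fbd n a" and eq: "E * a - a * E = smat c a" and c: "2 * nrm n E < cmod c"
  shows "a = 0"
proof (rule nrm_eq_0)
  have "cmod c * nrm n a = nrm n (E * a - a * E)" by (simp add: eq nrm_smat)
  also have "\<dots> \<le> nrm n (E * a) + nrm n (a * E)" by (rule nrm_diff)
  also have "\<dots> \<le> nrm n E * nrm n a + nrm n a * nrm n E" using assms by (intro add_mono nrm_mult)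
  finally have "(cmod c - 2 * nrm n E) * nrm n a \<le> 0" by (simp add: algebra_simps)
  then show "nrm n a = 0" using c nrm_nonneg[of n a]
    by (smt (verit) mult_pos_pos)
qed fact

lemma euler_power: "euler i (f ^ Suc l) = of_nat (Suc l) * euler i f * f ^ l"
  by (induction l) (simp_all add: euler_mult algebra_simps)

text \<open>Column vectors are encoded as matrices supported in column 0 and the first
  \<open>n\<close> rows, which is what the two equations on \<open>w\<close> express.\<close>

lemma mat_eq_0I:
  fixes A :: "complex fmat"
  assumes A: "fbd n A" and z: "\<And>w. idm n * w = w \<Longrightarrow> w * idm 1 = w \<Longrightarrow> A * w = 0"
  shows "A = 0"
proof (rule fmat_eqI)
  fix i j
  show "ent A i j = ent 0 i j"
  proof (cases "j < n")
    case True
    define w :: "complex fmat" where "w = mkm (max n 1) (\<lambda>k l. if k = j \<and> l = 0 then 1 else 0)"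
    have w: "ent w k l = (if k = j \<and> l = 0 then 1 else 0)" for k l using True by (auto simp: w_def)
    have "idm n * w = w"
    proof (rule fmat_eqI)
      fix k l
      have "ent (idm n * w) k l = (\<Sum>p<n. ent (idm n) k p * ent w p l)" by (rule ent_times) simp
      also have "\<dots> = (\<Sum>p<n. if p = j then ent (idm n) k j * ent w j l else 0)"
        by (rule sum.cong) (auto simp: w)
      also have "\<dots> = ent w k l" using True by (auto simp: w ent_idm)
      finally show "ent (idm n * w) k l = ent w k l" .
    qed
    moreover have "w * idm 1 = w"
      by (rule fmat_eqI, subst ent_times[of 1]) (auto simp: w ent_idm)
    ultimately have "ent (A * w) i 0 = 0" using z[of w] by simp
    moreover have "ent (A * w) i 0 = (\<Sum>p<n. if p = j then ent A i j else 0)"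
      unfolding ent_times[OF disjI1[OF A]] by (rule sum.cong) (auto simp: w)
    ultimately show ?thesis using True by simp
  qed (use A in \<open>auto simp: fbd_def\<close>)
qed

section \<open>Modules of vector-valued functions on the lattice\<close>

text \<open>\<open>M\<close> consists of functions on \<open>\<int>\<^sup>d\<close> with values in the columns of length \<open>n\<close>; \<open>x\<^sup>r\<close> acts by translation,
  \<open>\<partial>\<^sub>i\<close> by multiplication with the \<open>i\<close>-th coordinate, and the constant matrix \<open>x i r\<close> is the action
  of \<open>x\<^sup>-\<^sup>r D(e\<^sub>i, r) - D(e\<^sub>i, 0)\<close>.\<close>

locale shift_module =
  fixes n :: nat and M :: "(int ^ 'd::finite \<Rightarrow> complex fmat) set"
    and x :: "'d \<Rightarrow> int ^ 'd \<Rightarrow> complex fmat"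
  assumes val: "F \<in> M \<Longrightarrow> idm n * F m = F m" and col: "F \<in> M \<Longrightarrow> F m * idm 1 = F m"
    and M_zero: "(\<lambda>m. 0) \<in> M"
    and M_add: "F \<in> M \<Longrightarrow> G \<in> M \<Longrightarrow> (\<lambda>m. F m + G m) \<in> M"
    and M_scale: "F \<in> M \<Longrightarrow> (\<lambda>m. smat c (F m)) \<in> M"
    and M_shift: "F \<in> M \<Longrightarrow> (\<lambda>m. F (m - r)) \<in> M"
    and M_euler: "F \<in> M \<Longrightarrow> (\<lambda>m. smat (of_int (m $ i)) (F m)) \<in> M"
    and M_x: "F \<in> M \<Longrightarrow> (\<lambda>m. x i r * F m) \<in> M"
    and x_fbd: "fbd n (x i r)"
    and x_0: "x i 0 = 0"
    and x_bracket: "x i r * x j s - x j s * x i r =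
      smat (of_int (s $ i)) (x j (r + s) - x j s) - smat (of_int (r $ j)) (x i (r + s) - x i r)"
    and surj: "idm n * w = w \<Longrightarrow> w * idm 1 = w \<Longrightarrow> \<exists>F\<in>M. F 0 = w"
    and M_nonzero: "M \<noteq> {\<lambda>m. 0}"
    and M_simple: "\<lbrakk>N \<subseteq> M; (\<lambda>m. 0) \<in> N; \<And>F G. F \<in> N \<Longrightarrow> G \<in> N \<Longrightarrow> (\<lambda>m. F m + G m) \<in> N;
        \<And>c F. F \<in> N \<Longrightarrow> (\<lambda>m. smat c (F m)) \<in> N;
        \<And>r F. F \<in> N \<Longrightarrow> (\<lambda>m. F (m - r)) \<in> N;
        \<And>i F. F \<in> N \<Longrightarrow> (\<lambda>m. smat (of_int (m $ i)) (F m)) \<in> N;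
        \<And>i r F. F \<in> N \<Longrightarrow> (\<lambda>m. x i r * F m) \<in> N\<rbrakk> \<Longrightarrow> N = {\<lambda>m. 0} \<or> N = M"
begin

text \<open>Linear in the Laurent polynomial and zero on constants, hence determined by its values
  on the augmentation ideal. There it stands for the vector field f \<partial>_i.\<close>

definition Xo :: "'d \<Rightarrow> 'd laurent \<Rightarrow> complex fmat" where
  "Xo i f = lin (x i) f"

lemma Xo_simps [simp]: "Xo i (f + g) = Xo i f + Xo i g" "Xo i (f - g) = Xo i f - Xo i g"
  "Xo i 0 = 0" "Xo i (xmon r) = x i r"
  by (simp_all add: Xo_def lin_add lin_minus)

lemma Xo_sum: "Xo i (sum h S) = (\<Sum>k\<in>S. Xo i (h k))"
  by (simp add: Xo_def lin_sum)

lemma Xo_1 [simp]: "Xo i 1 = 0"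
  using Xo_simps(4)[of i 0] by (simp add: xmon_0 x_0)

lemma Xo_scale: "Xo i (pm_scale c f) = smat c (Xo i f)"
  by (simp add: Xo_def lin_scale)

lemma Xo_single: "Xo i (Poly_Mapping.single r c) = smat c (x i r)"
  by (simp add: Xo_def)

lemma Xo_fbd: "fbd n (Xo i f)"
  unfolding Xo_def lin_def by (intro fbd_sum fbd_smat x_fbd)

lemma Xo_bracket_gen:
  "Xo i f * Xo j g - Xo j g * Xo i f = Xo j (f * euler i g) - smat (aug f) (Xo j (euler i g))
     - Xo i (g * euler j f) + smat (aug g) (Xo i (euler j f))"
proof (induction f rule: pm_induct)
  case (single r c)
  show ?case
  proof (induction g rule: pm_induct)
    case (single s d)
    have a: "aug (Poly_Mapping.single r c) = c" "aug (Poly_Mapping.single s d) = d"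
      by (simp_all add: aug_def)
    have "Xo i (Poly_Mapping.single r c) * Xo j (Poly_Mapping.single s d)
        - Xo j (Poly_Mapping.single s d) * Xo i (Poly_Mapping.single r c)
        = smat (c * d) (x i r * x j s - x j s * x i r)"
      by (simp add: Xo_single smat_mult_left smat_mult_right smat_minus mult.commute)
    also have "\<dots> = smat (c * (of_int (s $ i) * d)) (x j (r + s)) - smat (c * (of_int (s $ i) * d)) (x j s)
        - smat (d * (of_int (r $ j) * c)) (x i (r + s)) + smat (d * (of_int (r $ j) * c)) (x i r)"
      by (simp add: x_bracket smat_minus mult_ac)
    also have "\<dots> = Xo j (Poly_Mapping.single r c * euler i (Poly_Mapping.single s d))
        - smat c (Xo j (euler i (Poly_Mapping.single s d)))
        - Xo i (Poly_Mapping.single s d * euler j (Poly_Mapping.single r c))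
        + smat d (Xo i (euler j (Poly_Mapping.single r c)))"
      by (simp add: euler_single mult_single Xo_single add.commute[of s r])
    finally show ?case unfolding a .
  next
    case (add g h)
    show ?case using arg_cong2[where f = "(+)", OF add]
      by (simp add: euler_add distrib_left distrib_right smat_add smat_add_left algebra_simps)
  qed simp
next
  case (add f h)
  show ?case using arg_cong2[where f = "(+)", OF add]
    by (simp add: euler_add distrib_left distrib_right smat_add smat_add_left algebra_simps)
qed simp

text \<open>On the augmentation ideal the correction terms disappear, and what remains is the
  bracket of the vector fields f \<partial>_i and g \<partial>_j.\<close>

lemma Xo_bracket:
  "aug f = 0 \<Longrightarrow> aug g = 0 \<Longrightarrow>
    Xo i f * Xo j g - Xo j g * Xo i f = Xo j (f * euler i g) - Xo i (g * euler j f)"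
  by (simp add: Xo_bracket_gen)

subsection \<open>Vanishing on a high power of the augmentation ideal\<close>

text \<open>With x_j - 1 = x_j y_j, the field x_j y_j^k \<partial>_j is an exact eigenvector, of
  eigenvalue k - 1, for the bracket with (x_j - 1) \<partial>_j. The powers of x_j - 1 itself are
  eigenvectors only up to higher order.\<close>

abbreviation yv :: "'d \<Rightarrow> 'd laurent" where
  "yv j \<equiv> 1 - xmon (- axis j 1)"

lemma xv_inverse: "xv j * xmon (- axis j 1) = 1"
  by (simp add: xv_def xmon_mult xmon_0)

text \<open>For large k the eigenvalue k - 1 exceeds what the fixed matrix of (x_j - 1) \<partial>_j
  allows.\<close>

lemma Xo_y_power: "\<exists>N. \<forall>k\<ge>N. Xo j (xv j * yv j ^ k) = 0"
proof -
  obtain N :: nat where N: "2 * nrm n (Xo j (xv j - 1)) + 1 < real N" using reals_Archimedean2 by blast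
  have "Xo j (xv j * yv j ^ k) = 0" if kN: "k \<ge> Suc N" for k
  proof -
    obtain l where l: "k = Suc l" using kN by (cases k) auto
    let ?g = "xv j * yv j ^ k" and ?z = "xmon (- axis j 1) :: 'd laurent"
    have ey: "euler j (yv j) = ?z"
      by (rule poly_mapping_eqI) (simp add: euler_minus euler_xmon lookup_xmon)
    have ep: "euler j (yv j ^ k) = of_nat k * ?z * yv j ^ l"
      unfolding l euler_power ey ..
    have "(xv j - 1) * euler j ?g - ?g * euler j (xv j - 1) = (of_nat k - 1) * ?g"
    proof -
      have gen: "x * y * (x * (y * w) + x * (c * z * w)) - x * (y * w) * x
          = c * (x * z) * (x * (y * w)) - x * x * (y * w) * (1 - y)" for x y w c z :: "'d laurent"
        by (simp add: algebra_simps)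
      have xy: "xv j - 1 = xv j * yv j" by (simp add: right_diff_distrib xv_inverse)
      have eg: "euler j ?g = xv j * yv j ^ k + xv j * (of_nat k * ?z * yv j ^ l)"
        by (simp add: euler_mult euler_xv ep)
      have "(xv j - 1) * euler j ?g - ?g * euler j (xv j - 1)
          = xv j * yv j * (xv j * yv j ^ k + xv j * (of_nat k * ?z * yv j ^ l)) - xv j * yv j ^ k * xv j"
        unfolding xy[symmetric] eg by (simp add: euler_minus euler_xv)
      also have "\<dots> = of_nat k * (xv j * ?z) * (xv j * yv j ^ k) - xv j * xv j * yv j ^ k * (1 - yv j)"
        unfolding l power_Suc by (rule gen)
      also have "\<dots> = of_nat k * (xv j * ?z) * (xv j * yv j ^ k) - (xv j * ?z) * (xv j * yv j ^ k)"
        by (simp add: mult_ac)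
      finally show ?thesis by (simp only: xv_inverse mult_1_right mult_1_left left_diff_distrib)
    qed
    moreover have "(of_nat k - 1) * ?g = pm_scale (of_nat k - 1) ?g"
      by (simp add: pm_scale_times single_diff)
    ultimately have "Xo j (xv j - 1) * Xo j ?g - Xo j ?g * Xo j (xv j - 1) = smat (of_nat k - 1) (Xo j ?g)"
      using Xo_bracket[of "xv j - 1" ?g j j] by (simp only: Xo_simps(2)[symmetric]) (simp add: Xo_scale l)
    moreover have "2 * nrm n (Xo j (xv j - 1)) < cmod (of_nat k - 1)"
    proof -
      have "of_nat k - (1::complex) = of_nat l" by (simp add: l)
      then show ?thesis using N kN by (simp add: l)
    qed
    ultimately show ?thesis by (rule commutator_eigenvector[OF Xo_fbd Xo_fbd])
  qed
  then show ?thesis by blast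
qed

lemma Xo_linear_ext: "(\<And>r. Xo i (f * xmon r) = 0) \<Longrightarrow> Xo i (f * h) = 0"
proof (induction h rule: pm_induct)
  case (single r c)
  have "Poly_Mapping.single r c = pm_scale c (xmon r)" by (simp add: xmon_def pm_scale_single)
  then show ?case using single by (simp add: pm_scale_mult_right Xo_scale)
qed (simp_all add: distrib_left)

text \<open>Write ' for the Euler derivative. Bracketing f with h f kills f^2 h', which misses the
  monomials h free of x_j. Bracketing f^2 x_j^a with f x^c x_j^(-a) then kills (c_j - 2 a) f^3 x^c -
  f^2 f' x^c for every a \<noteq> 0. The difference of the cases a = 1 and a = 2 isolates f^3
  x^c.\<close>

lemma Xo_cube:
  assumes f: "aug f = 0" "Xo j f = 0"
  shows "Xo j (f ^ 3 * h) = 0"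
proof (rule Xo_linear_ext)
  have sq: "Xo j (f ^ 2 * euler j h) = 0" for h
    using Xo_bracket[of f "h * f" j j] f by (simp add: euler_mult algebra_simps power2_eq_square)
  fix c :: "int ^ 'd"
  have *: "Xo j (pm_scale (of_int (c $ j) - 2 * of_int a) (f ^ 3 * xmon c) - f ^ 2 * euler j f * xmon c) = 0"
    if "a \<noteq> 0" for a :: int
  proof -
    let ?F = "f ^ 2 * xmon (axis j a)" and ?G = "f * xmon (c - axis j a)"
    have "f ^ 2 * euler j (xmon (axis j a)) = pm_scale (of_int a) ?F"
      by (simp add: euler_xmon pm_scale_mult_right)
    then have "smat (of_int a) (Xo j ?F) = 0" using sq[of "xmon (axis j a)"] by (simp add: Xo_scale)
    then have F: "Xo j ?F = 0" using smat_cancel[of "of_int a" "Xo j ?F" 0] that by simp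
    have eF: "euler j ?F = 2 * f * euler j f * xmon (axis j a) + pm_scale (of_int a) ?F"
      by (simp add: euler_mult euler_xmon pm_scale_mult_right power2_eq_square algebra_simps)
    have eG: "euler j ?G = euler j f * xmon (c - axis j a) + pm_scale (of_int (c $ j) - of_int a) ?G"
      by (simp add: euler_mult euler_xmon pm_scale_mult_right)
    have xx: "xmon (axis j a) * xmon (c - axis j a) = xmon c" by (simp add: xmon_mult)
    have "?F * euler j ?G = (f ^ 2 * euler j f) * (xmon (axis j a) * xmon (c - axis j a))
        + pm_scale (of_int (c $ j) - of_int a) (f ^ 3 * (xmon (axis j a) * xmon (c - axis j a)))"
      unfolding eG by (simp add: distrib_left pm_scale_mult_right power2_eq_square power3_eq_cube mult_ac)
    moreover have "?G * euler j ?F = 2 * (f ^ 2 * euler j f) * (xmon (axis j a) * xmon (c - axis j a))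
        + pm_scale (of_int a) (f ^ 3 * (xmon (axis j a) * xmon (c - axis j a)))"
      unfolding eF by (simp add: distrib_left pm_scale_mult_right power2_eq_square power3_eq_cube mult_ac)
    moreover have "pm_scale (of_int (c $ j) - 2 * of_int a) (f ^ 3 * xmon c)
        = pm_scale (of_int (c $ j) - of_int a) (f ^ 3 * xmon c) - pm_scale (of_int a) (f ^ 3 * xmon c)"
      by (rule poly_mapping_eqI) (simp add: lookup_minus algebra_simps)
    ultimately have "?F * euler j ?G - ?G * euler j ?F
        = pm_scale (of_int (c $ j) - 2 * of_int a) (f ^ 3 * xmon c) - f ^ 2 * euler j f * xmon c"
      unfolding xx by (simp only:) (simp add: algebra_simps)
    moreover have "Xo j (?F * euler j ?G - ?G * euler j ?F) = 0"
      using Xo_bracket[of ?F ?G j j] f F by simp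
    ultimately show ?thesis by simp
  qed
  let ?A = "\<lambda>a::int. pm_scale (of_int (c $ j) - 2 * of_int a) (f ^ 3 * xmon c) - f ^ 2 * euler j f * xmon c"
  have "pm_scale 2 (f ^ 3 * xmon c) = ?A 1 - ?A 2"
    by (rule poly_mapping_eqI) (simp add: lookup_minus algebra_simps)
  then have "smat 2 (Xo j (f ^ 3 * xmon c)) = Xo j (?A 1 - ?A 2)" by (simp only: Xo_scale[symmetric])
  also have "\<dots> = Xo j (?A 1) - Xo j (?A 2)" by (rule Xo_simps)
  also have "\<dots> = 0 - 0" by (intro arg_cong2[where f = "(-)"] *) simp_all
  finally have "smat 2 (Xo j (f ^ 3 * xmon c)) = 0" by simp
  then show "Xo j (f ^ 3 * xmon c) = 0" using smat_cancel[of 2 "Xo j (f ^ 3 * xmon c)" 0] by simp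
qed

text \<open>Passes from the direction j to every direction k: in the bracket of (x_j - 1)
  \<partial>_k with g^2 h x_j^(-1) \<partial>_j, all terms along \<partial>_j are divisible by g and
  vanish, which leaves g^2 h \<partial>_k.\<close>

lemma Xo_square_all:
  assumes g: "\<And>h. Xo j (g * h) = 0" "aug g = 0"
  shows "Xo k (g ^ 2 * h) = 0"
proof -
  let ?a = "h * xmon (- axis j 1)"
  have "Xo k (xv j - 1) * Xo j (g ^ 2 * ?a) - Xo j (g ^ 2 * ?a) * Xo k (xv j - 1)
      = Xo j ((xv j - 1) * euler k (g ^ 2 * ?a)) - Xo k (g ^ 2 * ?a * euler j (xv j - 1))"
    by (rule Xo_bracket) (simp_all add: g)
  moreover have "Xo j (g ^ 2 * ?a) = 0"
    using g(1)[of "g * ?a"] by (simp add: power2_eq_square mult.assoc)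
  moreover have "(xv j - 1) * euler k (g ^ 2 * ?a)
      = g * ((xv j - 1) * (2 * euler k g * ?a + g * euler k ?a))"
    by (simp only: euler_mult power2_eq_square) (simp add: algebra_simps)
  moreover have "g ^ 2 * ?a * euler j (xv j - 1) = g ^ 2 * h"
  proof -
    have "g ^ 2 * ?a * euler j (xv j - 1) = g ^ 2 * h * (xv j * xmon (- axis j 1))"
      by (simp add: euler_minus euler_xv mult_ac)
    then show ?thesis by (simp add: xv_inverse)
  qed
  ultimately show ?thesis using g(1) by simp
qed

lemma Xo_xv_power: "\<exists>L. \<forall>j k h. Xo k ((xv j - 1) ^ L * h) = 0"
proof -
  obtain N where N: "\<And>j k. k \<ge> N j \<Longrightarrow> Xo j (xv j * yv j ^ k) = 0" using Xo_y_power by metis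
  \<comment> \<open>One exponent for all directions; the successor keeps it positive, so that y_j^K
    has augmentation 0.\<close>
  define K where "K = Suc (\<Sum>j\<in>UNIV. N j)"
  have K0: "0 < K" unfolding K_def by (rule zero_less_Suc)
  have K: "K \<ge> N j" for j unfolding K_def by (rule le_SucI) (rule member_le_sum, auto)
  \<comment> \<open>The factor 6 is 3 times 2: a cube for the direction j, then a square for all
    directions. The invertible factor x_j turns y_j into x_j - 1.\<close>
  have "Xo k ((xv j - 1) ^ (6 * K) * h) = 0" for j k h
  proof -
    let ?f = "xv j * yv j ^ K"
    have a: "aug ?f = 0" using K0 by simp
    have "Xo j (?f ^ 3 * h) = 0" for h by (rule Xo_cube[OF a N[OF K]])
    then have "Xo k ((?f ^ 3) ^ 2 * h) = 0" for h by (rule Xo_square_all) (use K0 in simp)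
    then have 0: "Xo k (?f ^ 6 * h) = 0" for h by (simp flip: power_mult)
    have xy: "xv j - 1 = xv j * yv j" by (simp add: right_diff_distrib xv_inverse)
    have "(xv j - 1) ^ (6 * K) = xv j ^ (6 * K) * (yv j ^ K) ^ 6"
      unfolding xy by (simp add: power_mult_distrib mult.commute flip: power_mult)
    also have "xv j ^ (6 * K) = xv j ^ 6 * xv j ^ (6 * K - 6)"
      using K0 by (simp flip: power_add)
    finally have "(xv j - 1) ^ (6 * K) = ?f ^ 6 * xv j ^ (6 * K - 6)"
      by (simp add: power_mult_distrib mult_ac)
    then show ?thesis using 0[of "xv j ^ (6 * K - 6) * h"] by (simp add: mult.assoc)
  qed
  then show ?thesis by blast
qed

text \<open>Pigeonhole: a monomial in the x_j - 1 of degree above d L contains some factor x_j - 1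
  at least L times. The induction carries along the exponents \<open>a\<close> of the generators
  already extracted.\<close>

lemma Xo_mpow_high: "\<exists>K. \<forall>k. \<forall>f\<in>mpow K. Xo k f = 0"
proof -
  obtain L where L: "\<And>j k h. Xo k ((xv j - 1) ^ L * h) = 0" using Xo_xv_power by blast
  define mon where "mon a = (\<Prod>j\<in>UNIV. (xv j - 1) ^ a j)" for a :: "'d \<Rightarrow> nat"
  have mon_Suc: "mon (a(i := Suc (a i))) = mon a * (xv i - 1)" for a i
  proof -
    have "mon (a(i := Suc (a i))) = (xv i - 1) ^ Suc (a i) * (\<Prod>j\<in>UNIV - {i}. (xv j - 1) ^ a j)"
      unfolding mon_def by (subst prod.remove[of _ i]) (auto intro!: prod.cong)
    also have "\<dots> = mon a * (xv i - 1)"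
      unfolding mon_def by (subst (2) prod.remove[of _ i]) (auto simp: mult_ac)
    finally show ?thesis .
  qed
  have "Xo k (mon a * f) = 0" if "card (UNIV :: 'd set) * L < sum a UNIV + K" "f \<in> mpow K" for K a f k
    using that
  proof (induction K arbitrary: a f)
    case 0
    have "\<exists>j. L \<le> a j"
    proof (rule ccontr)
      assume "\<not> ?thesis"
      then have "sum a UNIV \<le> card (UNIV :: 'd set) * L"
        using sum_bounded_above[of UNIV a L] by (simp add: not_le less_imp_le)
      then show False using 0 by simp
    qed
    then obtain j where j: "L \<le> a j" by blast
    have "mon a = (xv j - 1) ^ a j * (\<Prod>j\<in>UNIV - {j}. (xv j - 1) ^ a j)"
      unfolding mon_def by (rule prod.remove) auto
    also have "(xv j - 1) ^ a j = (xv j - 1) ^ L * (xv j - 1) ^ (a j - L)"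
      using j by (simp flip: power_add)
    finally show ?case using L by (simp add: mult.assoc)
  next
    case (Suc K)
    then obtain g where g: "f = (\<Sum>i\<in>UNIV. (xv i - 1) * g i)" "\<forall>i. g i \<in> mpow K" by auto
    have "mon a * f = (\<Sum>i\<in>UNIV. mon (a(i := Suc (a i))) * g i)"
      by (simp add: g sum_distrib_left mon_Suc mult.assoc)
    moreover have "Xo k (mon (a(i := Suc (a i))) * g i) = 0" for i
    proof (rule Suc.IH)
      have "sum (a(i := Suc (a i))) UNIV = Suc (a i) + sum a (UNIV - {i})"
        by (subst sum.remove[of _ i]) (auto intro!: sum.cong)
      also have "\<dots> = Suc (sum a UNIV)" by (subst (2) sum.remove[of _ i]) auto
      finally show "card (UNIV :: 'd set) * L < sum (a(i := Suc (a i))) UNIV + K" using Suc.prems by simp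
    qed (use g in auto)
    ultimately show ?case by (simp add: Xo_sum)
  qed
  from this[of "\<lambda>_. 0" "Suc (card (UNIV :: 'd set) * L)"] show ?thesis
    by (auto simp: mon_def simp del: mpow.simps)
qed

subsection \<open>Vanishing on the square of the augmentation ideal\<close>

lemma mat_zeroI: "fbd n A \<Longrightarrow> (\<And>F. F \<in> M \<Longrightarrow> A * F 0 = 0) \<Longrightarrow> A = 0"
  using mat_eq_0I surj by metis

lemma M_X: "F \<in> M \<Longrightarrow> (\<lambda>m. Xo i f * F m) \<in> M"
proof (induction f rule: pm_induct)
  case (single r c)
  then show ?case by (simp add: Xo_single smat_mult_left M_scale[OF M_x])
next
  case (add f g)
  then show ?case using M_add by (simp add: distrib_right)
qed (simp add: M_zero)

text \<open>The matrices of order t form a set \<open>J\<close> on which the commutator with the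
  Euler matrix \<open>E\<close> is multiplication by t - 1 > 0. A product of l of them has weight l
  (t - 1), so long products vanish. A longest nonzero product then has nonzero values killed by
  \<open>J\<close>. The vectors killed by \<open>J\<close> form a submodule, which by simplicity is
  everything.\<close>

lemma Xo_mpow_step:
  assumes t: "2 \<le> t" and van: "\<And>k f. f \<in> mpow (Suc t) \<Longrightarrow> Xo k f = 0"
  shows "\<And>k f. f \<in> mpow t \<Longrightarrow> Xo k f = 0"
proof -
  obtain t' where t': "t = Suc t'" using t by (cases t) auto
  define J where "J = {Xo k f | k f. f \<in> mpow t}"
  define E where "E = (\<Sum>i\<in>UNIV. Xo i (xv i - 1))"
  have aug_t: "aug f = 0" if "f \<in> mpow t" for f
    using that aug_mpow unfolding t' by blast
  have EX: "E * Xo k f - Xo k f * E = smat (of_nat t - 1) (Xo k f)" if f: "f \<in> mpow t" for k f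
  proof -
    have "E * Xo k f - Xo k f * E = (\<Sum>i\<in>UNIV. Xo i (xv i - 1) * Xo k f - Xo k f * Xo i (xv i - 1))"
      unfolding E_def by (simp only: sum_distrib_left sum_distrib_right sum_subtractf)
    also have "\<dots> = (\<Sum>i\<in>UNIV. Xo k ((xv i - 1) * euler i f) - Xo i (f * euler k (xv i - 1)))"
      by (intro sum.cong refl Xo_bracket) (simp_all add: aug_t f)
    also have "\<dots> = Xo k (\<Sum>i\<in>UNIV. (xv i - 1) * euler i f) - (\<Sum>i\<in>UNIV. if i = k then Xo k (f * xv k) else 0)"
      unfolding sum_subtractf Xo_sum
      by (intro arg_cong2[where f = "(-)"] refl sum.cong) (auto simp: euler_minus euler_xv)
    also have "\<dots> = Xo k ((\<Sum>i\<in>UNIV. (xv i - 1) * euler i f) - f * xv k)" by simp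
    \<comment> \<open>The sum is t f and f x_k is f, each up to order t + 1, where \<open>Xo\<close>
      vanishes already.\<close>
    also have "(\<Sum>i\<in>UNIV. (xv i - 1) * euler i f) - f * xv k
        = ((\<Sum>i\<in>UNIV. (xv i - 1) * euler i f) - of_nat t * f) - (xv k - 1) * f + pm_scale (of_nat t - 1) f"
      by (simp add: pm_scale_times single_diff algebra_simps)
    also have "Xo k \<dots> = smat (of_nat t - 1) (Xo k f)"
      using van[OF mpow_euler_sum[OF f]] van[OF mpow_xv[OF f]] by (simp add: Xo_scale)
    finally show ?thesis .
  qed
  have J_fbd: "fbd n a" if "a \<in> J" for a using that Xo_fbd by (auto simp: J_def)
  have EJ: "E * a - a * E = smat (of_nat t - 1) a" if "a \<in> J" for a
    using that EX by (auto simp: J_def)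
  have E_fbd: "fbd n E" unfolding E_def by (intro fbd_sum Xo_fbd)
  \<comment> \<open>Applied to \<open>idm n\<close>, this gives products in which the empty one is
    the unit of size \<open>n\<close>.\<close>
  define pr :: "complex fmat list \<Rightarrow> complex fmat \<Rightarrow> complex fmat" where "pr = foldr (*)"
  have pr_fbd: "fbd n (pr l (idm n))" if "set l \<subseteq> J" for l
    using that by (induction l) (auto simp: pr_def J_fbd fbd_times)
  have Epr: "E * pr l (idm n) - pr l (idm n) * E = smat (of_nat (length l) * (of_nat t - 1)) (pr l (idm n))"
    if "set l \<subseteq> J" for l
    using that
  proof (induction l)
    case Nil
    show ?case by (simp add: pr_def E_fbd)
  next
    case (Cons a l)
    let ?p = "pr l (idm n)"
    have "E * pr (a # l) (idm n) - pr (a # l) (idm n) * E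
        = (E * a - a * E) * ?p + a * (E * ?p - ?p * E)"
      by (simp add: pr_def algebra_simps)
    also have "\<dots> = smat (of_nat t - 1) (a * ?p) + smat (of_nat (length l) * (of_nat t - 1)) (a * ?p)"
      using Cons EJ[of a] by (simp add: smat_mult_left smat_mult_right)
    also have "\<dots> = smat (of_nat (length (a # l)) * (of_nat t - 1)) (pr (a # l) (idm n))"
      by (simp add: pr_def algebra_simps flip: smat_add_left)
    finally show ?case .
  qed
  obtain B :: nat where B: "2 * nrm n E < real B" using reals_Archimedean2 by blast
  have long: "pr l (idm n) = 0" if "set l \<subseteq> J" "B \<le> length l" for l
  proof (rule commutator_eigenvector[OF E_fbd pr_fbd[OF that(1)] Epr[OF that(1)]])
    have eq: "complex_of_nat (length l) * (of_nat t - 1) = of_nat (length l * t')" by (simp add: t')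
    have "B \<le> length l * t'" using that t t' by (cases t') auto
    then have "2 * nrm n E < real (length l * t')" using B by (meson less_le_trans of_nat_mono)
    then show "2 * nrm n E < cmod (of_nat (length l) * (of_nat t - 1))" unfolding eq norm_of_nat .
  qed
  obtain F0 m0 where F0: "F0 \<in> M" "F0 m0 \<noteq> 0"
  proof -
    obtain F where "F \<in> M" "F \<noteq> (\<lambda>m. 0)" using M_nonzero M_zero by blast
    then show ?thesis using that by (metis ext)
  qed
  have idm0: "idm n \<noteq> (0 :: complex fmat)" using val[OF F0(1), of m0] F0(2) by auto
  \<comment> \<open>The lengths of nonzero products; the bound \<open>B\<close> gives them a
    maximum, and a product of that length is annihilated by \<open>J\<close> from the left.\<close>
  define Q where "Q = (\<lambda>k. \<exists>l. set l \<subseteq> J \<and> length l = k \<and> pr l (idm n) \<noteq> 0)"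
  have "Q 0" using idm0 by (auto simp: Q_def pr_def)
  moreover have "\<forall>k. Q k \<longrightarrow> k \<le> B" using long unfolding Q_def by (metis nat_le_linear)
  ultimately have Qm: "Q (Greatest Q)" and Qg: "\<And>k. Q k \<Longrightarrow> k \<le> Greatest Q"
    using GreatestI_nat[of Q 0 B] Greatest_le_nat[of Q _ B] by blast+
  then obtain l where l: "set l \<subseteq> J" "length l = Greatest Q" "pr l (idm n) \<noteq> 0" by (auto simp: Q_def)
  have kill: "a * pr l (idm n) = 0" if "a \<in> J" for a
  proof (rule ccontr)
    assume "a * pr l (idm n) \<noteq> 0"
    then have "Q (Suc (Greatest Q))" using l that unfolding Q_def
      by (intro exI[of _ "a # l"]) (auto simp: pr_def)
    then show False using Qg by fastforce
  qed
  define N where "N = {F \<in> M. \<forall>m. \<forall>a\<in>J. a * F m = 0}"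
  have "N = {\<lambda>m. 0} \<or> N = M"
  proof (rule M_simple)
    show "(\<lambda>m. x i r * F m) \<in> N" if F: "F \<in> N" for i r F
    proof -
      \<comment> \<open>Since x^r - 1 vanishes at 1, the commutator of \<open>x i r\<close> with an
        element of \<open>J\<close> is a difference of elements of \<open>J\<close>: the derivative
        lowers the order of f by one and x^r - 1 restores it.\<close>
      have "Xo k f * (x i r * F m) = 0" if f: "f \<in> mpow t" for k f m
      proof -
        have f1: "euler i f \<in> mpow (t - 1)" using mpow_euler f unfolding t' by simp
        have "(xmon r - 1) * euler i f \<in> mpow (Suc 0 + (t - 1))"
          by (intro mpow_times xmon_minus_1_mpow f1)
        then have in1: "Xo k ((xmon r - 1) * euler i f) \<in> J" using t by (auto simp: J_def t')
        have in2: "Xo i (f * euler k (xmon r - 1)) \<in> J" using mpow_mult_right[OF f] by (auto simp: J_def)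
        have "Xo i (xmon r - 1) * Xo k f - Xo k f * Xo i (xmon r - 1)
            = Xo k ((xmon r - 1) * euler i f) - Xo i (f * euler k (xmon r - 1))"
          by (rule Xo_bracket) (simp_all add: aug_t f)
        then have "Xo k f * x i r = x i r * Xo k f
            - (Xo k ((xmon r - 1) * euler i f) - Xo i (f * euler k (xmon r - 1)))"
          by (simp only: Xo_simps Xo_1 diff_zero) (simp add: algebra_simps)
        then have "Xo k f * (x i r * F m) = x i r * (Xo k f * F m)
            - (Xo k ((xmon r - 1) * euler i f) * F m - Xo i (f * euler k (xmon r - 1)) * F m)"
          by (simp only: mult.assoc[symmetric] left_diff_distrib[symmetric])
        moreover have "Xo k f \<in> J" using f by (auto simp: J_def)
        ultimately show ?thesis using F in1 in2 by (simp only: N_def mem_Collect_eq) simp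
      qed
      then show ?thesis using F M_x by (auto simp: N_def J_def)
    qed
  qed (auto simp: N_def M_zero M_add M_scale M_shift M_euler distrib_left smat_mult_right)
  moreover have "N \<noteq> {\<lambda>m. 0}"
  proof -
    have M_pr: "(\<lambda>m. pr l (idm n) * F m) \<in> M" if "F \<in> M" "set l \<subseteq> J" for F l
      using that(2)
    proof (induction l)
      case Nil
      then show ?case using that val by (simp add: pr_def)
    next
      case (Cons a l)
      then obtain k f where a: "a = Xo k f" by (auto simp: J_def)
      have "(\<lambda>m. a * (pr l (idm n) * F m)) \<in> M" unfolding a using Cons by (intro M_X) auto
      then show ?case by (simp add: pr_def mult.assoc)
    qed
    obtain F where F: "F \<in> M" "pr l (idm n) * F 0 \<noteq> 0"
      using mat_zeroI[OF pr_fbd[OF l(1)]] l(3) by blast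
    have "(\<lambda>m. pr l (idm n) * F m) \<in> N"
      using M_pr[OF F(1) l(1)] kill by (simp add: N_def flip: mult.assoc)
    then show ?thesis using F(2) by (metis singletonD)
  qed
  ultimately have "N = M" by blast
  show "Xo k f = 0" if "f \<in> mpow t" for k f
  proof (rule mat_zeroI[OF Xo_fbd])
    fix F assume "F \<in> M"
    then have "F \<in> N" using \<open>N = M\<close> by simp
    moreover have "Xo k f \<in> J" using that by (auto simp: J_def)
    ultimately show "Xo k f * F 0 = 0" by (simp add: N_def)
  qed
qed

lemma Xo_mpow_2: "f \<in> mpow 2 \<Longrightarrow> Xo k f = 0"
proof -
  obtain K where K: "\<And>k f. f \<in> mpow K \<Longrightarrow> Xo k f = 0" using Xo_mpow_high by blast
  have "\<forall>k. \<forall>f\<in>mpow 2. Xo k f = 0" if "\<forall>k. \<forall>f\<in>mpow (K' + 2). Xo k f = 0" for K'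
    using that
  proof (induction K')
    case (Suc K')
    have "Xo k f = 0" if "f \<in> mpow (K' + 2)" for k f
      by (rule Xo_mpow_step[OF _ _ that]) (use Suc.prems in \<open>auto simp del: mpow.simps\<close>)
    then show ?case using Suc.IH by blast
  next
    case 0
    then show ?case by (simp only: add_0)
  qed
  moreover have "\<forall>k. \<forall>f\<in>mpow (K + 2). Xo k f = 0"
    using K mpow_mono by (metis add_2_eq_Suc')
  ultimately show "f \<in> mpow 2 \<Longrightarrow> Xo k f = 0" by blast
qed

text \<open>The product (x^r - 1) (x^s - 1) lies in the square of the augmentation ideal.\<close>

lemma x_add: "x k (r + s) = x k r + x k s"
proof -
  have "(xmon r - 1) * (xmon s - 1) \<in> mpow (Suc 0 + Suc 0)"
    by (intro mpow_times xmon_minus_1_mpow)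
  then have "Xo k ((xmon r - 1) * (xmon s - 1)) = 0" by (intro Xo_mpow_2) (simp only: one_add_one[symmetric] One_nat_def)
  moreover have "(xmon r - 1) * (xmon s - 1) = xmon (r + s) - xmon r - xmon s + 1"
    by (simp add: algebra_simps xmon_mult)
  ultimately show ?thesis by (simp add: algebra_simps)
qed

theorem x_linear: "x k r = (\<Sum>i\<in>UNIV. smat (of_int (r $ i)) (x k (axis i 1)))"
proof (induction r rule: int_vec_induct)
  case zero
  show ?case by (simp add: x_0)
next
  case (add r i)
  have "(\<Sum>j\<in>UNIV. smat (of_int (axis i 1 $ j)) (x k (axis j 1))) = (\<Sum>j\<in>UNIV. if j = i then x k (axis i 1) else 0)"
    by (rule sum.cong) (auto simp: axis_def)
  then show ?case by (simp add: x_add add smat_add_left sum.distrib)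
next
  case (sub r i)
  have "(\<Sum>j\<in>UNIV. smat (of_int (axis i 1 $ j)) (x k (axis j 1))) = (\<Sum>j\<in>UNIV. if j = i then x k (axis i 1) else 0)"
    by (rule sum.cong) (auto simp: axis_def)
  moreover have "x k (r - axis i 1) = x k r - x k (axis i 1)"
    using x_add[of k "r - axis i 1" "axis i 1"] by (simp add: algebra_simps)
  ultimately show ?case by (simp add: sub smat_minus_left sum_subtractf)
qed

text \<open>The commutation rule of matrix units: \<open>x i (axis p 1)\<close> plays the role of
  the unit in row p and column i.\<close>

lemma x_gl_bracket:
  "x i (axis p 1) * x j (axis q 1) - x j (axis q 1) * x i (axis p 1) =
    (if q = i then x j (axis p 1) else 0) - (if p = j then x i (axis q 1) else 0)"
  unfolding x_bracket x_add by (auto simp: axis_def)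

end

section \<open>Minimal idempotents\<close>

global_interpretation fv: vector_space "smat :: complex \<Rightarrow> complex fmat \<Rightarrow> complex fmat"
  by unfold_locales (auto simp: smat_add smat_add_left)

definition munits :: "nat \<Rightarrow> complex fmat set" where
  "munits n = (\<lambda>(k, l). mkm n (\<lambda>i j. if i = k \<and> j = l then 1 else 0)) ` ({..<n} \<times> {..<n})"

lemma finite_munits: "finite (munits n)"
  by (simp add: munits_def)

lemma fbd_span: "fbd n A \<Longrightarrow> A \<in> fv.span (munits n)"
proof -
  assume A: "fbd n A"
  define u where "u = (\<lambda>k l. mkm n (\<lambda>i j. if i = k \<and> j = l then (1::complex) else 0))"
  have "A = (\<Sum>k<n. \<Sum>l<n. smat (ent A k l) (u k l))"
  proof (rule fmat_eqI)
    fix i j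
    have "(\<Sum>k<n. \<Sum>l<n. ent A k l * ent (u k l) i j) = (\<Sum>k<n. if k = i then ent A i j else 0)"
    proof (rule sum.cong[OF refl])
      fix k assume k: "k \<in> {..<n}"
      have "(\<Sum>l<n. ent A k l * ent (u k l) i j) = (\<Sum>l<n. if l = j then (if k = i then ent A i j else 0) else 0)"
        by (rule sum.cong) (use k in \<open>auto simp: u_def\<close>)
      also have "\<dots> = (if k = i then ent A i j else 0)" using A by (auto simp: fbd_def)
      finally show "(\<Sum>l<n. ent A k l * ent (u k l) i j) = (if k = i then ent A i j else 0)" .
    qed
    also have "\<dots> = ent A i j" using A by (auto simp: fbd_def)
    finally show "ent A i j = ent (\<Sum>k<n. \<Sum>l<n. smat (ent A k l) (u k l)) i j"
      by (simp add: ent_sum)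
  qed
  moreover have "\<dots> \<in> fv.span (munits n)"
    by (intro fv.span_sum fv.span_scale fv.span_base) (auto simp: munits_def u_def)
  ultimately show ?thesis by simp
qed

text \<open>The space of all \<open>fmat\<close> is infinite-dimensional; the common size bound
  places \<open>T\<close> in the span of finitely many matrix units.\<close>

lemma dim_strict:
  assumes S: "fv.subspace S" and T: "fv.subspace T" "\<And>A. A \<in> T \<Longrightarrow> fbd n A" and ST: "S \<subset> T"
  shows "fv.dim S < fv.dim T"
proof -
  obtain a where a: "a \<in> T" "a \<notin> S" using ST by blast
  obtain B where B: "B \<subseteq> S" "fv.independent B" "S \<subseteq> fv.span B" "card B = fv.dim S"
    using fv.basis_exists by blast
  have "fv.span B \<subseteq> S" using fv.span_minimal[OF B(1) S] .
  then have "fv.independent (insert a B)" using B a by (simp add: fv.independent_insert)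
  moreover have "insert a B \<subseteq> T" using a B ST by auto
  ultimately obtain C where C: "insert a B \<subseteq> C" "C \<subseteq> T" "fv.independent C" "T \<subseteq> fv.span C"
    using fv.maximal_independent_subset_extend by metis
  have "C \<subseteq> fv.span (munits n)" using C T fbd_span by blast
  then have fin: "finite C" using fv.independent_span_bound[OF finite_munits C(3)] by blast
  have "a \<notin> B" using a B by auto
  then have "card B < card (insert a B)" using fin C(1) by (metis card_insert_disjoint finite_insert finite_subset lessI)
  also have "\<dots> \<le> card C" using fin C(1) by (rule card_mono)
  also have "card C = fv.dim T" using C by (intro fv.basis_card_eq_dim) auto
  finally show ?thesis using B by simp
qed

lemma poly_relation:
  fixes w :: "nat \<Rightarrow> complex fmat"
  assumes "\<And>k. fbd n (w k)"
  shows "\<exists>p. p \<noteq> 0 \<and> (\<Sum>k\<le>degree p. smat (coeff p k) (w k)) = 0"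
proof -
  define N where "N = Suc (card (munits n))"
  have "\<exists>c. (\<exists>k\<le>N. c k \<noteq> 0) \<and> (\<Sum>k\<le>N. smat (c k) (w k)) = 0"
  proof (cases "inj_on w {..N}")
    \<comment> \<open>Linear dependence is stated for sets, so a repetition in the sequence has to
      be turned into a relation by hand.\<close>
    case False
    then obtain k l where kl: "k \<le> N" "l \<le> N" "k \<noteq> l" "w k = w l" by (auto simp: inj_on_def)
    define c :: "nat \<Rightarrow> complex" where "c = (\<lambda>i. (if i = k then 1 else 0) - (if i = l then 1 else 0))"
    have "(\<Sum>i\<le>N. smat (c i) (w i)) = (\<Sum>i\<le>N. (if i = k then w k else 0) - (if i = l then w l else 0))"
      by (rule sum.cong) (auto simp: c_def smat_minus_left smat_neg)
    also have "\<dots> = 0" using kl by (simp add: sum_subtractf)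
    finally show ?thesis using kl by (intro exI[of _ c]) (auto simp: c_def)
  next
    case True
    have "w ` {..N} \<subseteq> fv.span (munits n)" using fbd_span assms by blast
    then have "\<not> fv.independent (w ` {..N})"
      using fv.independent_span_bound[OF finite_munits[of n], of "w ` {..N}"] card_image[OF True]
      by (auto simp: N_def)
    then obtain u where u: "\<exists>v\<in>w ` {..N}. u v \<noteq> 0" "(\<Sum>v\<in>w ` {..N}. smat (u v) v) = 0"
      by (auto simp: fv.dependent_finite)
    then show ?thesis using True by (intro exI[of _ "\<lambda>k. u (w k)"]) (auto simp: sum.reindex)
  qed
  then obtain c where c: "\<exists>k\<le>N. c k \<noteq> 0" "(\<Sum>k\<le>N. smat (c k) (w k)) = 0" by blast
  define p where "p = (\<Sum>k\<le>N. monom (c k) k)"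
  have cp: "coeff p k = (if k \<le> N then c k else 0)" for k
    by (simp add: p_def coeff_sum)
  have "p \<noteq> 0" using c(1) cp by (metis coeff_0)
  have "degree p \<le> N" by (rule degree_le) (simp add: cp)
  then have "(\<Sum>k\<le>degree p. smat (coeff p k) (w k)) = (\<Sum>k\<le>N. smat (coeff p k) (w k))"
    by (intro sum.mono_neutral_left) (auto simp: coeff_eq_0)
  also have "\<dots> = 0" using c(2) by (simp add: cp)
  finally show ?thesis using \<open>p \<noteq> 0\<close> by blast
qed

text \<open>Take p of least degree among the nonzero polynomials with p(T) j = 0, and a root z of p.
  Writing p = (X - z) q, the vector q(T) j is nonzero by minimality and is an eigenvector for
  z.\<close>

lemma eigenvector_exists:
  assumes T: "fbd n T" and J: "fv.subspace J" "\<And>A. A \<in> J \<Longrightarrow> fbd n A" "\<And>A. A \<in> J \<Longrightarrow> T * A \<in> J"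
    and j: "j \<in> J" "j \<noteq> 0"
  shows "\<exists>c v. v \<in> J \<and> v \<noteq> 0 \<and> T * v = smat c v"
proof -
  define w where "w k = (((*) T) ^^ k) j" for k
  have w_Suc: "w (Suc k) = T * w k" for k by (simp add: w_def)
  have wJ: "w k \<in> J" for k by (induction k) (use j J in \<open>auto simp: w_def\<close>)
  define S where "S N p = (\<Sum>k\<le>N. smat (coeff p k) (w k))" for N p
  have SN: "S N p = S (degree p) p" if "degree p \<le> N" for N p
    unfolding S_def using that by (intro sum.mono_neutral_right) (auto simp: coeff_eq_0)
  have "\<exists>p. p \<noteq> 0 \<and> S (degree p) p = 0"
    using poly_relation[of n w] J(2) wJ unfolding S_def by blast
  then obtain p where p: "p \<noteq> 0" "S (degree p) p = 0"
    and least: "\<And>q. q \<noteq> 0 \<Longrightarrow> S (degree q) q = 0 \<Longrightarrow> degree p \<le> degree q"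
    using ex_has_least_nat[of "\<lambda>p. p \<noteq> 0 \<and> S (degree p) p = 0" _ degree] by blast
  have "degree p \<noteq> 0"
  proof
    assume d: "degree p = 0"
    then have "coeff p 0 \<noteq> 0" using p(1) by (metis leading_coeff_0_iff)
    moreover have "smat (coeff p 0) j = 0" using p(2) d by (simp add: S_def w_def)
    ultimately show False using smat_cancel[of "coeff p 0" j 0] j by simp
  qed
  then obtain z where "poly p z = 0"
    using fundamental_theorem_of_algebra[of p] by (auto simp: constant_degree)
  then obtain q where q: "p = [:- z, 1:] * q" by (auto simp: poly_eq_0_iff_dvd)
  have q0: "q \<noteq> 0" using p q by auto
  have deg: "degree p = Suc (degree q)" unfolding q using q0 by (subst degree_mult_eq) auto
  define v where "v = S (degree q) q"
  have "v \<noteq> 0" using least[of q] q0 deg by (auto simp: v_def)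
  have "v \<in> J" unfolding v_def S_def by (intro fv.subspace_sum fv.subspace_scale J wJ)
  have p': "p = pCons 0 q - smult z q" using q by simp
  have "S (degree p) p = S (degree p) (pCons 0 q) - smat z (S (degree p) q)"
    unfolding S_def p' by (simp add: smat_minus_left sum_subtractf smat_sum)
  also have "S (degree p) (pCons 0 q) = T * v"
    by (simp add: S_def v_def deg sum.atMost_Suc_shift w_Suc smat_mult_right sum_distrib_left del: sum.atMost_Suc)
  also have "S (degree p) q = v" using SN[of q "degree p"] deg by (simp add: v_def)
  finally have "T * v = smat z v" using p(2) by simp
  then show ?thesis using \<open>v \<in> J\<close> \<open>v \<noteq> 0\<close> by blast
qed

text \<open>A right ideal \<open>a U\<close> of minimal dimension is generated by an idempotent \<open>e\<close>; left multiplication by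
  \<open>e u\<close> has an eigenvector on it, hence is scalar on it by minimality.\<close>

lemma minimal_idempotent:
  fixes U :: "complex fmat set"
  assumes U: "fv.subspace U" "\<And>A. A \<in> U \<Longrightarrow> fbd n A" "\<And>A B. A \<in> U \<Longrightarrow> B \<in> U \<Longrightarrow> A * B \<in> U"
    and one: "idm n \<in> U" "idm n \<noteq> (0 :: complex fmat)"
    and prime: "\<And>a b. a \<in> U \<Longrightarrow> b \<in> U \<Longrightarrow> a \<noteq> 0 \<Longrightarrow> b \<noteq> 0 \<Longrightarrow> \<exists>u\<in>U. a * u * b \<noteq> 0"
  shows "\<exists>e\<in>U. e * e = e \<and> e \<noteq> 0 \<and> (\<forall>u\<in>U. \<exists>c. e * u * e = smat c e)"
proof -
  let ?J = "\<lambda>a. (*) a ` U"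
  have "idm n \<in> U \<and> idm n \<noteq> (0 :: complex fmat)" using one by simp
  then obtain a where a: "a \<in> U" "a \<noteq> 0"
    and least: "\<And>b. b \<in> U \<Longrightarrow> b \<noteq> 0 \<Longrightarrow> fv.dim (?J a) \<le> fv.dim (?J b)"
    using ex_has_least_nat[of "\<lambda>a. a \<in> U \<and> a \<noteq> 0" "idm n" "\<lambda>a. fv.dim (?J a)"] by auto
  have sub: "fv.subspace (?J b)" for b
  proof (rule fv.subspaceI)
    show "0 \<in> ?J b" using fv.subspace_0[OF U(1)] by (auto intro!: image_eqI[of _ _ 0])
    show "x + y \<in> ?J b" if "x \<in> ?J b" "y \<in> ?J b" for x y
      using that fv.subspace_add[OF U(1)] by (auto simp flip: distrib_left)
    show "smat c x \<in> ?J b" if "x \<in> ?J b" for c x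
      using that fv.subspace_scale[OF U(1)] by (auto simp flip: smat_mult_right)
  qed
  have JU: "?J a \<subseteq> U" using a U by auto
  have self: "b \<in> ?J b" if "b \<in> U" for b using U(2)[OF that] one(1) by (auto intro!: image_eqI[of _ _ "idm n"])
  have min: "?J b = ?J a" if b: "b \<in> ?J a" "b \<noteq> 0" for b
  proof (rule ccontr)
    assume ne: "?J b \<noteq> ?J a"
    have bU: "b \<in> U" using b JU by blast
    obtain u0 where u0: "b = a * u0" "u0 \<in> U" using b by blast
    have "?J b \<subseteq> ?J a" using u0 U(3) by (auto simp: mult.assoc)
    then have "fv.dim (?J b) < fv.dim (?J a)"
      using ne sub JU U(2) by (intro dim_strict[where n = n]) auto
    then show False using least[OF bU b(2)] by simp
  qed
  have scalar: "\<exists>c. \<forall>A\<in>?J a. a * u * A = smat c A" if u: "u \<in> U" for u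
  proof -
    have "\<exists>c v. v \<in> ?J a \<and> v \<noteq> 0 \<and> a * u * v = smat c v"
      by (rule eigenvector_exists[of n _ _ a]) (use U JU sub self a u in \<open>auto simp: mult.assoc\<close>)
    then obtain c v where v: "v \<in> ?J a" "v \<noteq> 0" "a * u * v = smat c v" by blast
    have "a * u * A = smat c A" if "A \<in> ?J a" for A
    proof -
      obtain w where "A = v * w" using \<open>A \<in> ?J a\<close> min[OF v(1,2)] by auto
      then show ?thesis using v(3) by (metis mult.assoc smat_mult_left)
    qed
    then show ?thesis by blast
  qed
  \<comment> \<open>Primeness with both factors equal to \<open>a\<close> makes the scalar by which
    \<open>a * u\<close> acts on the right ideal nonzero; dividing by it gives the
    idempotent.\<close>
  obtain u where u: "u \<in> U" "a * u * a \<noteq> 0" using prime a by blast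
  obtain c where c: "\<And>A. A \<in> ?J a \<Longrightarrow> a * u * A = smat c A" using scalar[OF u(1)] by blast
  have c0: "c \<noteq> 0" using c[OF self[OF a(1)]] u(2) by auto
  define e where "e = smat (inverse c) (a * u)"
  have e: "e = a * smat (inverse c) u" by (simp add: e_def smat_mult_right)
  have eJ: "e \<in> ?J a" unfolding e using u fv.subspace_scale[OF U(1)] by blast
  then have eU: "e \<in> U" using JU by blast
  have "e * e = smat (inverse c) (a * u * e)" by (simp add: e_def smat_mult_left)
  then have ee: "e * e = e" using c[OF eJ] c0 by simp
  have "e * a = a" unfolding e_def using c[OF self[OF a(1)]] c0 by (simp add: smat_mult_left)
  then have e0: "e \<noteq> 0" using a by auto
  have "\<exists>c. e * u' * e = smat c e" if u': "u' \<in> U" for u'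
  proof -
    have "smat (inverse c) u * u' \<in> U" using u u' fv.subspace_scale[OF U(1)] U(3) by blast
    then obtain d where "a * (smat (inverse c) u * u') * e = smat d e" using scalar eJ by blast
    then show ?thesis unfolding e by (auto simp: mult.assoc)
  qed
  then show ?thesis using eU ee e0 by blast
qed

section \<open>The algebra generated by the constant matrices\<close>

context shift_module
begin

inductive_set U :: "complex fmat set" where
  one: "idm n \<in> U"
| gen: "x i r \<in> U"
| add: "A \<in> U \<Longrightarrow> B \<in> U \<Longrightarrow> A + B \<in> U"
| scale: "A \<in> U \<Longrightarrow> smat c A \<in> U"
| mult: "A \<in> U \<Longrightarrow> B \<in> U \<Longrightarrow> A * B \<in> U"

lemma U_fbd: "A \<in> U \<Longrightarrow> fbd n A"
  by (induction rule: U.induct) (auto intro: x_fbd fbd_add fbd_smat fbd_times)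

lemma U_subspace: "fv.subspace U"
  using U.scale[OF U.one, of 0] by (intro fv.subspaceI U.add U.scale) auto

lemma M_U: "A \<in> U \<Longrightarrow> F \<in> M \<Longrightarrow> (\<lambda>m. A * F m) \<in> M"
  by (induction arbitrary: F rule: U.induct)
    (auto simp: val M_x distrib_right M_add smat_mult_left M_scale mult.assoc)

lemma idm_nonzero: "idm n \<noteq> (0 :: complex fmat)"
proof
  assume "idm n = (0 :: complex fmat)"
  then have "F = (\<lambda>m. 0)" if "F \<in> M" for F using val[OF that] by auto
  then show False using M_zero M_nonzero by blast
qed

text \<open>The vectors killed by a U form a submodule. If a U b = 0 it contains b M \<noteq> 0, so
  it is all of M, and then a = 0 because every column is a value at 0.\<close>

lemma U_prime:
  assumes a: "a \<in> U" "a \<noteq> 0" and b: "b \<in> U" "b \<noteq> 0"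
  shows "\<exists>u\<in>U. a * u * b \<noteq> 0"
proof (rule ccontr)
  assume "\<not> ?thesis"
  then have ab: "a * (u * (b * w)) = 0" if "u \<in> U" for u w using that by (metis mult.assoc mult_zero_left)
  define N where "N = {F \<in> M. \<forall>m. \<forall>u\<in>U. a * (u * F m) = 0}"
  have "N = {\<lambda>m. 0} \<or> N = M"
  proof (rule M_simple)
    show "(\<lambda>m. x i r * F m) \<in> N" if F: "F \<in> N" for i r F
    proof -
      have "a * (u * (x i r * F m)) = 0" if "u \<in> U" for u m
      proof -
        have "a * ((u * x i r) * F m) = 0" using F U.mult[OF that U.gen] unfolding N_def by blast
        then show ?thesis by (simp add: mult.assoc)
      qed
      then show ?thesis using F M_x by (simp add: N_def)
    qed
  qed (auto simp: N_def M_zero M_add M_scale M_shift M_euler distrib_left smat_mult_right)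
  moreover have "N \<noteq> M"
  proof
    assume "N = M"
    then have "a * F 0 = 0" if "F \<in> M" for F
      using that val[OF that, of 0] U.one unfolding N_def by (metis (mono_tags, lifting) mem_Collect_eq)
    then show False using mat_zeroI[OF U_fbd[OF a(1)]] a(2) by blast
  qed
  moreover have "N \<noteq> {\<lambda>m. 0}"
  proof -
    obtain F where F: "F \<in> M" "b * F 0 \<noteq> 0" using mat_zeroI[OF U_fbd[OF b(1)]] b(2) by blast
    have "(\<lambda>m. b * F m) \<in> N" using F M_U[OF b(1)] ab by (simp add: N_def)
    then show ?thesis using F(2) by (metis singletonD)
  qed
  ultimately show False by blast
qed

lemma ex_minimal_idempotent:
  "\<exists>e\<in>U. e * e = e \<and> e \<noteq> 0 \<and> (\<forall>u\<in>U. \<exists>c. e * u * e = smat c e)"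
  by (rule minimal_idempotent) (use U_subspace U_fbd U.mult U.one idm_nonzero U_prime in auto)

end

section \<open>Coordinates on free modules\<close>

lemma ring_of_type_algebra_simps [simp]:
  "carrier ring_of_type_algebra = UNIV"
  "a \<oplus>\<^bsub>ring_of_type_algebra\<^esub> b = a + b" "a \<otimes>\<^bsub>ring_of_type_algebra\<^esub> b = a * b"
  "\<zero>\<^bsub>ring_of_type_algebra\<^esub> = 0" "\<one>\<^bsub>ring_of_type_algebra\<^esub> = 1"
  for a b :: "'c::comm_ring_1"
  by (simp_all add: ring_of_type_algebra_def)

text \<open>Freeness of rank \<open>n\<close> as a bijection onto coordinate sequences supported
  below \<open>n\<close>. Keeping carrier, addition and scalars as separate parameters lets it serve
  both U(h)-modules and complex vector spaces.\<close>

locale coords =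
  fixes C :: "'v set" and pl :: "'v \<Rightarrow> 'v \<Rightarrow> 'v" and ms :: "'r::comm_ring_1 \<Rightarrow> 'v \<Rightarrow> 'v"
    and \<kappa> :: "'v \<Rightarrow> nat \<Rightarrow> 'r" and n :: nat
  assumes bij: "bij_betw \<kappa> C {f. \<forall>k\<ge>n. f k = 0}"
    and pl_closed: "v \<in> C \<Longrightarrow> w \<in> C \<Longrightarrow> pl v w \<in> C"
    and ms_closed: "v \<in> C \<Longrightarrow> ms p v \<in> C"
    and coord_pl: "v \<in> C \<Longrightarrow> w \<in> C \<Longrightarrow> \<kappa> (pl v w) k = \<kappa> v k + \<kappa> w k"
    and coord_ms: "v \<in> C \<Longrightarrow> \<kappa> (ms p v) k = p * \<kappa> v k"
begin

lemma coord_inj: "v \<in> C \<Longrightarrow> w \<in> C \<Longrightarrow> (\<And>k. \<kappa> v k = \<kappa> w k) \<Longrightarrow> v = w"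
  using bij by (metis bij_betw_imp_inj_on ext inj_onD)

lemma coord_bd: "v \<in> C \<Longrightarrow> n \<le> k \<Longrightarrow> \<kappa> v k = 0"
  using bij by (auto simp: bij_betw_def)

definition vecC :: "(nat \<Rightarrow> 'r) \<Rightarrow> 'v" where
  "vecC f = inv_into C \<kappa> f"

lemma vecC: "\<forall>k\<ge>n. f k = 0 \<Longrightarrow> vecC f \<in> C" "\<forall>k\<ge>n. f k = 0 \<Longrightarrow> \<kappa> (vecC f) k = f k"
proof -
  assume "\<forall>k\<ge>n. f k = 0"
  then have f: "f \<in> \<kappa> ` C" using bij by (auto simp: bij_betw_def)
  then show "vecC f \<in> C" by (simp add: vecC_def inv_into_into)
  show "\<kappa> (vecC f) k = f k" using f by (simp add: vecC_def f_inv_into_f)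
qed

definition bas :: "nat \<Rightarrow> 'v" where
  "bas l = vecC (\<lambda>k. if k = l then 1 else 0)"

lemma bas: "l < n \<Longrightarrow> bas l \<in> C" "l < n \<Longrightarrow> \<kappa> (bas l) k = (if k = l then 1 else 0)"
  unfolding bas_def by (rule vecC; force)+

text \<open>The operators x^r are not U(h)-linear but semilinear for a translation of the variables,
  hence the twist \<open>\<sigma>\<close>. The proof builds up a vector one basis coordinate at a
  time.\<close>

lemma semilinear_coord:
  assumes T: "\<And>v. v \<in> C \<Longrightarrow> T v \<in> C" "\<And>v w. v \<in> C \<Longrightarrow> w \<in> C \<Longrightarrow> T (pl v w) = pl (T v) (T w)"
    "\<And>p v. v \<in> C \<Longrightarrow> T (ms p v) = ms (\<sigma> p) (T v)" and \<sigma>: "rhom \<sigma>" and v: "v \<in> C"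
  shows "\<kappa> (T v) k = (\<Sum>l<n. \<sigma> (\<kappa> v l) * \<kappa> (T (bas l)) k)"
proof -
  have "\<forall>v\<in>C. (\<forall>l\<ge>j. \<kappa> v l = 0) \<longrightarrow> \<kappa> (T v) k = (\<Sum>l<j. \<sigma> (\<kappa> v l) * \<kappa> (T (bas l)) k)"
    if "j \<le> n" for j
    using that
  proof (induction j)
    case 0
    show ?case
    proof (intro ballI impI)
      fix v assume v: "v \<in> C" "\<forall>l\<ge>0. \<kappa> v l = 0"
      have "pl v v = v" by (rule coord_inj) (use v in \<open>auto simp: pl_closed coord_pl\<close>)
      then have "\<kappa> (T v) k = \<kappa> (T v) k + \<kappa> (T v) k" using T v coord_pl by metis
      then show "\<kappa> (T v) k = (\<Sum>l<0. \<sigma> (\<kappa> v l) * \<kappa> (T (bas l)) k)" by simp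
    qed
  next
    case (Suc j)
    show ?case
    proof (intro ballI impI)
      fix v assume v: "v \<in> C" "\<forall>l\<ge>Suc j. \<kappa> v l = 0"
      define w where "w = vecC ((\<kappa> v)(j := 0))"
      have bd: "\<forall>k\<ge>n. ((\<kappa> v)(j := 0)) k = 0" using v coord_bd by auto
      have w: "w \<in> C" "\<And>l. \<kappa> w l = (if l = j then 0 else \<kappa> v l)"
        unfolding w_def using vecC(1)[OF bd] by (blast, simp only: vecC(2)[OF bd] fun_upd_apply)
      have j: "j < n" using Suc by simp
      have "v = pl w (ms (\<kappa> v j) (bas j))"
        by (rule coord_inj) (use v w bas[OF j] in \<open>auto simp: pl_closed ms_closed coord_pl coord_ms\<close>)
      then have "T v = pl (T w) (ms (\<sigma> (\<kappa> v j)) (T (bas j)))"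
        using T w bas[OF j] ms_closed by metis
      then have "\<kappa> (T v) k = \<kappa> (T w) k + \<sigma> (\<kappa> v j) * \<kappa> (T (bas j)) k"
        using T w bas[OF j] by (simp add: coord_pl coord_ms ms_closed)
      also have "\<kappa> (T w) k = (\<Sum>l<j. \<sigma> (\<kappa> w l) * \<kappa> (T (bas l)) k)"
        using Suc w v by (auto simp: Suc_le_eq)
      also have "\<dots> = (\<Sum>l<j. \<sigma> (\<kappa> v l) * \<kappa> (T (bas l)) k)"
        by (rule sum.cong) (auto simp: w)
      finally show "\<kappa> (T v) k = (\<Sum>l<Suc j. \<sigma> (\<kappa> v l) * \<kappa> (T (bas l)) k)" by simp
    qed
  qed
  from this[of n] show ?thesis using v coord_bd by simp
qed

definition tmat :: "('v \<Rightarrow> 'v) \<Rightarrow> 'r fmat" where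
  "tmat T = mkm n (\<lambda>k l. \<kappa> (T (bas l)) k)"

lemma fbd_tmat: "fbd n (tmat T)"
  by (simp add: tmat_def)

lemma ent_tmat: "(\<And>v. v \<in> C \<Longrightarrow> T v \<in> C) \<Longrightarrow> l < n \<Longrightarrow> ent (tmat T) k l = \<kappa> (T (bas l)) k"
  using coord_bd[of "T (bas l)" k] bas by (auto simp: tmat_def not_less)

lemma semilinear_tmat:
  assumes T: "\<And>v. v \<in> C \<Longrightarrow> T v \<in> C" "\<And>v w. v \<in> C \<Longrightarrow> w \<in> C \<Longrightarrow> T (pl v w) = pl (T v) (T w)"
    "\<And>p v. v \<in> C \<Longrightarrow> T (ms p v) = ms (\<sigma> p) (T v)" and \<sigma>: "rhom \<sigma>" and v: "v \<in> C"
  shows "\<kappa> (T v) k = (\<Sum>l<n. ent (tmat T) k l * \<sigma> (\<kappa> v l))"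
proof -
  have "\<kappa> (T v) k = (\<Sum>l<n. \<sigma> (\<kappa> v l) * \<kappa> (T (bas l)) k)" by (rule semilinear_coord[OF assms])
  then show ?thesis by (simp add: ent_tmat[OF T(1)] mult.commute)
qed

text \<open>The outer map twists the coefficients of the inner one, so the matrix of
  \<open>T'\<close> enters through \<open>\<sigma>\<close>.\<close>

lemma tmat_comp:
  assumes T: "\<And>v. v \<in> C \<Longrightarrow> T v \<in> C" "\<And>v w. v \<in> C \<Longrightarrow> w \<in> C \<Longrightarrow> T (pl v w) = pl (T v) (T w)"
    "\<And>p v. v \<in> C \<Longrightarrow> T (ms p v) = ms (\<sigma> p) (T v)" and \<sigma>: "rhom \<sigma>"
    and T': "\<And>v. v \<in> C \<Longrightarrow> T' v \<in> C"
  shows "tmat (\<lambda>v. T (T' v)) = tmat T * fmap \<sigma> (tmat T')"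
proof (rule fmat_eqI)
  fix k l
  show "ent (tmat (\<lambda>v. T (T' v))) k l = ent (tmat T * fmap \<sigma> (tmat T')) k l"
  proof (cases "l < n")
    case True
    have "ent (tmat (\<lambda>v. T (T' v))) k l = \<kappa> (T (T' (bas l))) k"
      using True T T' by (subst ent_tmat) auto
    also have "\<dots> = (\<Sum>j<n. ent (tmat T) k j * \<sigma> (\<kappa> (T' (bas l)) j))"
      by (rule semilinear_tmat[OF T \<sigma>]) (use T' bas True in auto)
    also have "\<dots> = ent (tmat T * fmap \<sigma> (tmat T')) k l"
      using True T' by (simp add: ent_times[of n] fbd_tmat \<sigma> ent_tmat)
    finally show ?thesis .
  next
    case False
    have "ent (tmat T * fmap \<sigma> (tmat T')) k l = 0"
      using fbd_times[OF fbd_tmat fbd_fmap[OF \<sigma> fbd_tmat]] False by (simp add: fbd_def)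
    then show ?thesis using False by (simp add: tmat_def)
  qed
qed

lemma tmat_id: "tmat (\<lambda>v. v) = idm n"
  by (rule fmat_eqI) (auto simp: tmat_def bas ent_idm)

lemma tmat_cong: "(\<And>v. v \<in> C \<Longrightarrow> T v = T' v) \<Longrightarrow> tmat T = tmat T'"
  by (rule fmat_eqI) (simp add: tmat_def bas)

end

lemma free_coordinates:
  fixes N :: "('c::comm_ring_1, 'm) module"
  assumes "free_of_finite_rank ring_of_type_algebra N"
  shows "\<exists>\<kappa> n. coords (carrier N) (add N) (Module.module.smult N) \<kappa> n"
proof -
  obtain B where mod: "Module.module ring_of_type_algebra N" and B: "module_basis ring_of_type_algebra N B"
    using assms by (auto simp: free_of_finite_rank_def)
  interpret N: Module.module ring_of_type_algebra N by (rule mod)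
  have fin: "finite B" and BC: "B \<subseteq> carrier N" using B by (auto simp: module_basis_def)
  define cb where "cb c = (\<Oplus>\<^bsub>N\<^esub>b\<in>B. c b \<odot>\<^bsub>N\<^esub> b)" for c
  have uniq: "\<exists>!c. c \<in> B \<rightarrow>\<^sub>E UNIV \<and> v = cb c" if "v \<in> carrier N" for v
    using B that unfolding module_basis_def cb_def by auto
  have Bsm: "(\<lambda>b. c b \<odot>\<^bsub>N\<^esub> b) \<in> B \<rightarrow> carrier N" for c using BC by auto
  have cb_closed: "cb c \<in> carrier N" for c unfolding cb_def using Bsm by (rule N.finsum_closed)
  define cf where "cf v = (THE c. c \<in> B \<rightarrow>\<^sub>E UNIV \<and> v = cb c)" for v
  have cf: "cf v \<in> B \<rightarrow>\<^sub>E UNIV" "v = cb (cf v)" if "v \<in> carrier N" for v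
    using theI'[OF uniq[OF that]] by (simp_all add: cf_def)
  have cf_eq: "cf v = c" if "c \<in> B \<rightarrow>\<^sub>E UNIV" "v = cb c" for v c
    using uniq[of v] cf[of v] cb_closed that by blast
  have restr: "cb (restrict c B) = cb c" for c
    unfolding cb_def by (rule N.finsum_cong') (use BC in auto)
  have cf_add: "cf (v \<oplus>\<^bsub>N\<^esub> w) = restrict (\<lambda>b. cf v b + cf w b) B" if "v \<in> carrier N" "w \<in> carrier N" for v w
  proof (rule cf_eq)
    have "v \<oplus>\<^bsub>N\<^esub> w = cb (cf v) \<oplus>\<^bsub>N\<^esub> cb (cf w)" using cf that by simp
    also have "\<dots> = (\<Oplus>\<^bsub>N\<^esub>b\<in>B. cf v b \<odot>\<^bsub>N\<^esub> b \<oplus>\<^bsub>N\<^esub> cf w b \<odot>\<^bsub>N\<^esub> b)"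
      unfolding cb_def by (rule N.finsum_addf[symmetric]) (rule Bsm)+
    also have "\<dots> = cb (\<lambda>b. cf v b + cf w b)"
      unfolding cb_def by (rule N.finsum_cong') (use BC N.smult_l_distr in auto)
    finally show "v \<oplus>\<^bsub>N\<^esub> w = cb (restrict (\<lambda>b. cf v b + cf w b) B)" by (simp add: restr)
  qed simp
  have cf_smult: "cf (p \<odot>\<^bsub>N\<^esub> v) = restrict (\<lambda>b. p * cf v b) B" if "v \<in> carrier N" for v p
  proof (rule cf_eq)
    have "p \<odot>\<^bsub>N\<^esub> v = p \<odot>\<^bsub>N\<^esub> cb (cf v)" using cf that by simp
    also have "\<dots> = (\<Oplus>\<^bsub>N\<^esub>b\<in>B. p \<odot>\<^bsub>N\<^esub> (cf v b \<odot>\<^bsub>N\<^esub> b))"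
      unfolding cb_def by (rule N.finsum_smult_ldistr) (use fin Bsm in auto)
    also have "\<dots> = cb (\<lambda>b. p * cf v b)"
      unfolding cb_def by (rule N.finsum_cong') (use BC N.smult_assoc1 in auto)
    finally show "p \<odot>\<^bsub>N\<^esub> v = cb (restrict (\<lambda>b. p * cf v b) B)" by (simp add: restr)
  qed simp
  obtain h where h: "bij_betw h {0..<card B} B" using ex_bij_betw_nat_finite[OF fin] by blast
  define n where "n = card B"
  have hB: "k < n \<Longrightarrow> h k \<in> B" for k using h by (auto simp: bij_betw_def n_def)
  define \<kappa> where "\<kappa> v k = (if k < n then cf v (h k) else 0)" for v k
  have "bij_betw \<kappa> (carrier N) {f. \<forall>k\<ge>n. f k = 0}"
  proof (rule bij_betw_imageI)
    show "inj_on \<kappa> (carrier N)"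
    proof (rule inj_onI)
      fix v w assume vw: "v \<in> carrier N" "w \<in> carrier N" "\<kappa> v = \<kappa> w"
      have "cf v b = cf w b" if b: "b \<in> B" for b
      proof -
        have "b \<in> h ` {0..<card B}" using h b by (simp add: bij_betw_def)
        then obtain k where "k < n" "b = h k" by (auto simp: n_def)
        then show ?thesis using fun_cong[OF vw(3), of k] by (simp add: \<kappa>_def)
      qed
      then have "cf v = cf w" using cf(1)[OF vw(1)] cf(1)[OF vw(2)] by (intro PiE_ext) auto
      then show "v = w" using cf vw by metis
    qed
    show "\<kappa> ` carrier N = {f. \<forall>k\<ge>n. f k = 0}"
    proof (intro equalityI subsetI)
      fix f :: "nat \<Rightarrow> 'c" assume f: "f \<in> {f. \<forall>k\<ge>n. f k = 0}"
      define c where "c = restrict (\<lambda>b. f (inv_into {0..<card B} h b)) B"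
      have "cf (cb c) = c" by (rule cf_eq) (auto simp: c_def)
      moreover have "c (h k) = f k" if "k < n" for k
        using that hB h by (simp add: c_def bij_betw_def n_def inv_into_f_f)
      ultimately have "\<kappa> (cb c) = f" using f by (auto simp: \<kappa>_def)
      then show "f \<in> \<kappa> ` carrier N" using cb_closed by blast
    qed (auto simp: \<kappa>_def)
  qed
  then have "coords (carrier N) (add N) (Module.module.smult N) \<kappa> n"
    by unfold_locales (auto simp: \<kappa>_def cf_add cf_smult hB)
  then show ?thesis by blast
qed

lemma free_of_coordinates:
  fixes N :: "('c::comm_ring_1, 'm) module"
  assumes mod: "Module.module ring_of_type_algebra N"
    and "coords (carrier N) (add N) (Module.module.smult N) \<kappa> n"
  shows "free_of_finite_rank ring_of_type_algebra N"
proof -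
  interpret N: Module.module ring_of_type_algebra N by (rule mod)
  interpret coords "carrier N" "add N" "Module.module.smult N" \<kappa> n by fact
  define B where "B = bas ` {..<n}"
  have inj: "inj_on bas {..<n}"
  proof (rule inj_onI)
    fix k l assume kl: "k \<in> {..<n}" "l \<in> {..<n}" "bas k = bas l"
    then have "(if l = k then 1 else 0) = (1 :: 'c)" using bas(2)[of k l] bas(2)[of l l] by (metis lessThan_iff)
    then show "k = l" by (metis zero_neq_one)
  qed
  have B: "finite B" "B \<subseteq> carrier N" using bas by (auto simp: B_def)
  have zero: "\<kappa> \<zero>\<^bsub>N\<^esub> k = 0" for k
  proof -
    have "\<kappa> (\<zero>\<^bsub>N\<^esub> \<oplus>\<^bsub>N\<^esub> \<zero>\<^bsub>N\<^esub>) k = \<kappa> \<zero>\<^bsub>N\<^esub> k + \<kappa> \<zero>\<^bsub>N\<^esub> k" by (rule coord_pl) auto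
    then show ?thesis by simp
  qed
  have fs: "\<kappa> (\<Oplus>\<^bsub>N\<^esub>b\<in>A. c b \<odot>\<^bsub>N\<^esub> b) k = (\<Sum>b\<in>A. c b * \<kappa> b k)" if "finite A" "A \<subseteq> carrier N" for A c k
    using that
  proof (induction A)
    case (insert b A)
    have fc: "(\<Oplus>\<^bsub>N\<^esub>b\<in>A. c b \<odot>\<^bsub>N\<^esub> b) \<in> carrier N" using insert by (intro N.finsum_closed) auto
    have bC: "b \<in> carrier N" and AC: "A \<subseteq> carrier N" using insert.prems by auto
    have "(\<Oplus>\<^bsub>N\<^esub>b\<in>insert b A. c b \<odot>\<^bsub>N\<^esub> b) = c b \<odot>\<^bsub>N\<^esub> b \<oplus>\<^bsub>N\<^esub> (\<Oplus>\<^bsub>N\<^esub>b\<in>A. c b \<odot>\<^bsub>N\<^esub> b)"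
      by (rule N.finsum_insert) (use insert.hyps bC AC in auto)
    then have "\<kappa> (\<Oplus>\<^bsub>N\<^esub>b\<in>insert b A. c b \<odot>\<^bsub>N\<^esub> b) k
        = \<kappa> (c b \<odot>\<^bsub>N\<^esub> b) k + \<kappa> (\<Oplus>\<^bsub>N\<^esub>b\<in>A. c b \<odot>\<^bsub>N\<^esub> b) k"
      by (simp only: coord_pl[OF ms_closed[OF bC] fc])
    then show ?case by (simp only: coord_ms[OF bC] insert.IH[OF AC] sum.insert[OF insert.hyps])
  qed (simp add: zero)
  have comb: "\<kappa> (\<Oplus>\<^bsub>N\<^esub>b\<in>B. c b \<odot>\<^bsub>N\<^esub> b) k = (if k < n then c (bas k) else 0)" for c k
  proof -
    have "\<kappa> (\<Oplus>\<^bsub>N\<^esub>b\<in>B. c b \<odot>\<^bsub>N\<^esub> b) k = (\<Sum>l<n. c (bas l) * \<kappa> (bas l) k)"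
      using fs[OF B] by (simp add: B_def sum.reindex[OF inj])
    also have "\<dots> = (\<Sum>l<n. if l = k then c (bas k) else 0)" by (rule sum.cong) (auto simp: bas)
    also have "\<dots> = (if k < n then c (bas k) else 0)" by simp
    finally show ?thesis .
  qed
  have "\<exists>!c. c \<in> B \<rightarrow>\<^sub>E UNIV \<and> v = (\<Oplus>\<^bsub>N\<^esub>b\<in>B. c b \<odot>\<^bsub>N\<^esub> b)" if v: "v \<in> carrier N" for v
  proof (rule ex1I)
    define c where "c = restrict (\<lambda>b. \<kappa> v (inv_into {..<n} bas b)) B"
    have cl: "(\<Oplus>\<^bsub>N\<^esub>b\<in>B. c b \<odot>\<^bsub>N\<^esub> b) \<in> carrier N" for c using B by (intro N.finsum_closed) auto
    have "c (bas k) = \<kappa> v k" if "k < n" for k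
      using that inj by (auto simp: c_def B_def)
    then show "c \<in> B \<rightarrow>\<^sub>E UNIV \<and> v = (\<Oplus>\<^bsub>N\<^esub>b\<in>B. c b \<odot>\<^bsub>N\<^esub> b)"
      using coord_inj[OF v cl] comb coord_bd[OF v] by (auto simp: c_def)
    fix d assume d: "d \<in> B \<rightarrow>\<^sub>E UNIV \<and> v = (\<Oplus>\<^bsub>N\<^esub>b\<in>B. d b \<odot>\<^bsub>N\<^esub> b)"
    show "d = c"
    proof (rule PiE_ext)
      show "d \<in> B \<rightarrow>\<^sub>E UNIV" "c \<in> B \<rightarrow>\<^sub>E UNIV" using d by (auto simp: c_def)
      fix b assume "b \<in> B"
      then obtain k where k: "k < n" "b = bas k" by (auto simp: B_def)
      have "\<kappa> v k = d (bas k)" using comb[of d k] d k by simp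
      then show "d b = c b" using \<open>\<And>k. k < n \<Longrightarrow> c (bas k) = \<kappa> v k\<close> k by simp
    qed
  qed
  then have "module_basis ring_of_type_algebra N B"
    using B unfolding module_basis_def by simp
  then show ?thesis using mod by (auto simp: free_of_finite_rank_def)
qed

section \<open>The Weyl algebra acting on functions on the lattice\<close>

text \<open>Extends an operator on Laurent polynomials to arbitrary functions on the lattice, by
  using its coefficients from x^k to x^m as a kernel. The definition is meaningful when only
  finitely many k reach a given m; an infinite sum would default to 0.\<close>

definition hat :: "('d::finite laurent \<Rightarrow> 'd laurent) \<Rightarrow> (int ^ 'd \<Rightarrow> complex fmat) \<Rightarrow> int ^ 'd \<Rightarrow> complex fmat" where
  "hat T F m = (\<Sum>k | Poly_Mapping.lookup (T (xmon k)) m \<noteq> 0. smat (Poly_Mapping.lookup (T (xmon k)) m) (F k))"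

text \<open>The kernel lives on finitely many diagonals m - k. Every element of the Weyl algebra has
  this property, and it is what makes \<open>hat\<close> compatible with composition.\<close>

definition banded :: "('d::finite laurent \<Rightarrow> 'd laurent) \<Rightarrow> bool" where
  "banded T \<longleftrightarrow> (\<forall>f g. T (f + g) = T f + T g) \<and> (\<forall>c f. T (pm_scale c f) = pm_scale c (T f)) \<and>
     (\<exists>S. finite S \<and> (\<forall>k m. Poly_Mapping.lookup (T (xmon k)) m \<noteq> 0 \<longrightarrow> m - k \<in> S))"

lemma hat_superset:
  assumes "finite K" "\<And>k. Poly_Mapping.lookup (T (xmon k)) m \<noteq> 0 \<Longrightarrow> k \<in> K"
  shows "hat T F m = (\<Sum>k\<in>K. smat (Poly_Mapping.lookup (T (xmon k)) m) (F k))"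
  unfolding hat_def by (rule sum.mono_neutral_left) (use assms in auto)

lemma banded_window:
  assumes "banded T"
  shows "finite {k. Poly_Mapping.lookup (T (xmon k)) m \<noteq> 0}"
proof -
  obtain S where S: "finite S" "\<And>k m. Poly_Mapping.lookup (T (xmon k)) m \<noteq> 0 \<Longrightarrow> m - k \<in> S"
    using assms by (auto simp: banded_def)
  have "{k. Poly_Mapping.lookup (T (xmon k)) m \<noteq> 0} \<subseteq> (\<lambda>s. m - s) ` S"
  proof
    fix k assume "k \<in> {k. Poly_Mapping.lookup (T (xmon k)) m \<noteq> 0}"
    then have "m - k \<in> S" using S by blast
    moreover have "k = m - (m - k)" by simp
    ultimately show "k \<in> (\<lambda>s. m - s) ` S" by blast
  qed
  then show ?thesis using S by (meson finite_imageI finite_subset)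
qed

lemma hat_add: "banded S \<Longrightarrow> banded T \<Longrightarrow> hat (\<lambda>f. S f + T f) F m = hat S F m + hat T F m"
proof -
  assume b: "banded S" "banded T"
  let ?K = "{k. Poly_Mapping.lookup (S (xmon k)) m \<noteq> 0} \<union> {k. Poly_Mapping.lookup (T (xmon k)) m \<noteq> 0}"
  have K: "finite ?K" using banded_window[OF b(1)] banded_window[OF b(2)] by simp
  show ?thesis
    by (subst (1 2 3) hat_superset[OF K]) (auto simp: lookup_add smat_add_left sum.distrib)
qed

lemma hat_scale: "hat (\<lambda>f. pm_scale c (T f)) F m = smat c (hat T F m)" if "banded T"
  by (subst (1 2) hat_superset[OF banded_window[OF that, of m]]) (auto simp: smat_sum)

lemma banded_expand:
  assumes "banded T"
  shows "Poly_Mapping.lookup (T f) m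
    = (\<Sum>l\<in>Poly_Mapping.keys f. Poly_Mapping.lookup f l * Poly_Mapping.lookup (T (xmon l)) m)"
proof -
  have add: "T (f + g) = T f + T g" and sc: "T (pm_scale c f) = pm_scale c (T f)" for f g c
    using assms by (auto simp: banded_def)
  have T0: "T 0 = 0" using add[of 0 0] by simp
  have sum: "T (sum h A) = (\<Sum>a\<in>A. T (h a))" for h and A :: "(int ^ 'a) set"
    by (induction A rule: infinite_finite_induct) (auto simp: add T0)
  have "f = (\<Sum>l\<in>Poly_Mapping.keys f. pm_scale (Poly_Mapping.lookup f l) (xmon l))"
    using sum_single_keys[of f] by (simp add: xmon_def pm_scale_single)
  then have "T f = (\<Sum>l\<in>Poly_Mapping.keys f. pm_scale (Poly_Mapping.lookup f l) (T (xmon l)))"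
    by (metis (no_types, lifting) sum sc sum.cong)
  then show ?thesis by (simp add: lookup_sum)
qed

lemma banded_comp:
  assumes S: "banded S" and T: "banded T"
  shows "banded (\<lambda>f. S (T f))"
proof -
  obtain A where A: "finite A" "\<And>k m. Poly_Mapping.lookup (S (xmon k)) m \<noteq> 0 \<Longrightarrow> m - k \<in> A"
    using S by (auto simp: banded_def)
  obtain B where B: "finite B" "\<And>k m. Poly_Mapping.lookup (T (xmon k)) m \<noteq> 0 \<Longrightarrow> m - k \<in> B"
    using T by (auto simp: banded_def)
  have "m - k \<in> (\<lambda>(a, b). a + b) ` (A \<times> B)" if "Poly_Mapping.lookup (S (T (xmon k))) m \<noteq> 0" for k m
  proof -
    have "(\<Sum>l\<in>Poly_Mapping.keys (T (xmon k)).
        Poly_Mapping.lookup (T (xmon k)) l * Poly_Mapping.lookup (S (xmon l)) m) \<noteq> 0"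
      using that banded_expand[OF S] by metis
    then obtain l where "Poly_Mapping.lookup (T (xmon k)) l * Poly_Mapping.lookup (S (xmon l)) m \<noteq> 0"
      by (meson sum.neutral)
    then have "m - l \<in> A" "l - k \<in> B" using A B by auto
    moreover have "m - k = (m - l) + (l - k)" by simp
    ultimately show ?thesis by (metis (mono_tags, lifting) SigmaI case_prod_conv image_eqI)
  qed
  moreover have "finite ((\<lambda>(a, b). a + b) ` (A \<times> B))" using A B by simp
  ultimately show ?thesis using S T unfolding banded_def by (metis (no_types, lifting))
qed

lemma hat_comp:
  assumes S: "banded S" and T: "banded T"
  shows "hat (\<lambda>f. S (T f)) F m = hat S (hat T F) m"
proof -
  define L where "L = {l. Poly_Mapping.lookup (S (xmon l)) m \<noteq> 0}"
  have L: "finite L" using banded_window[OF S] by (simp add: L_def)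
  define K where "K = {k. Poly_Mapping.lookup (S (T (xmon k))) m \<noteq> 0}
     \<union> (\<Union>l\<in>L. {k. Poly_Mapping.lookup (T (xmon k)) l \<noteq> 0})"
  have K: "finite K" using L banded_window[OF T] banded_window[OF banded_comp[OF S T]] by (simp add: K_def)
  have "Poly_Mapping.lookup (S (T (xmon k))) m
      = (\<Sum>l\<in>L. Poly_Mapping.lookup (T (xmon k)) l * Poly_Mapping.lookup (S (xmon l)) m)" for k
  proof -
    let ?h = "\<lambda>l. Poly_Mapping.lookup (T (xmon k)) l * Poly_Mapping.lookup (S (xmon l)) m"
    have "Poly_Mapping.lookup (S (T (xmon k))) m = (\<Sum>l\<in>Poly_Mapping.keys (T (xmon k)). ?h l)"
      by (rule banded_expand[OF S])
    also have "\<dots> = (\<Sum>l\<in>Poly_Mapping.keys (T (xmon k)) \<union> L. ?h l)"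
      by (rule sum.mono_neutral_left) (auto simp: L in_keys_iff)
    also have "\<dots> = (\<Sum>l\<in>L. ?h l)"
      by (rule sum.mono_neutral_right) (use L in \<open>auto simp: L_def\<close>)
    finally show ?thesis .
  qed
  then have "hat (\<lambda>f. S (T f)) F m = (\<Sum>k\<in>K. \<Sum>l\<in>L.
      smat (Poly_Mapping.lookup (S (xmon l)) m) (smat (Poly_Mapping.lookup (T (xmon k)) l) (F k)))"
    by (subst hat_superset[OF K]) (auto simp: K_def fv.scale_sum_left mult.commute)
  also have "\<dots> = (\<Sum>l\<in>L. smat (Poly_Mapping.lookup (S (xmon l)) m) (\<Sum>k\<in>K. smat (Poly_Mapping.lookup (T (xmon k)) l) (F k)))"
    by (subst sum.swap) (simp add: smat_sum)
  also have "\<dots> = (\<Sum>l\<in>L. smat (Poly_Mapping.lookup (S (xmon l)) m) (hat T F l))"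
    by (intro sum.cong refl arg_cong2[where f = smat] hat_superset[OF K, symmetric]) (auto simp: K_def)
  also have "\<dots> = hat S (hat T F) m"
    by (rule hat_superset[OF L, symmetric]) (simp add: L_def)
  finally show ?thesis .
qed

lemma hat_right: "hat T (\<lambda>k. F k + G k) m = hat T F m + hat T G m"
  "hat T (\<lambda>k. smat c (F k)) m = smat c (hat T F m)"
  "hat T (\<lambda>k. A * F k) m = A * hat T F m"
  by (simp_all add: hat_def smat_add sum.distrib smat_sum mult.commute smat_mult_right sum_distrib_left)

lemma lookup_mult_xmon: "Poly_Mapping.lookup (a * xmon k) m = Poly_Mapping.lookup a (m - k)"
proof (induction a rule: pm_induct)
  case (single s c)
  show ?case by (auto simp: xmon_def mult_single lookup_single when_def)
qed (simp_all add: distrib_right lookup_add)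

lemma banded_mult: "banded (\<lambda>f. a * f)"
  unfolding banded_def
  by (auto simp: distrib_left pm_scale_mult_right lookup_mult_xmon in_keys_iff
      intro!: exI[of _ "Poly_Mapping.keys a"])

lemma hat_mult: "hat (\<lambda>f. a * f) F m = (\<Sum>s\<in>Poly_Mapping.keys a. smat (Poly_Mapping.lookup a s) (F (m - s)))"
proof -
  have fin: "finite ((\<lambda>s. m - s) ` Poly_Mapping.keys a)" by simp
  have "hat (\<lambda>f. a * f) F m = (\<Sum>k\<in>(\<lambda>s. m - s) ` Poly_Mapping.keys a. smat (Poly_Mapping.lookup (a * xmon k) m) (F k))"
  proof (rule hat_superset[OF fin])
    fix k assume "Poly_Mapping.lookup (a * xmon k) m \<noteq> 0"
    then have "m - k \<in> Poly_Mapping.keys a" by (simp add: lookup_mult_xmon in_keys_iff)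
    moreover have "k = m - (m - k)" by simp
    ultimately show "k \<in> (\<lambda>s. m - s) ` Poly_Mapping.keys a" by blast
  qed
  also have "\<dots> = (\<Sum>s\<in>Poly_Mapping.keys a. smat (Poly_Mapping.lookup a s) (F (m - s)))"
    by (subst sum.reindex) (auto simp: inj_on_def lookup_mult_xmon)
  finally show ?thesis .
qed

lemma hat_xmon: "hat (\<lambda>f. xmon r * f) F m = F (m - r)"
  by (simp add: hat_mult) (simp add: xmon_def)

lemma hat_id: "hat (\<lambda>f. f) F m = F m"
  using hat_xmon[of 0 F m] by (simp add: xmon_0)

lemma banded_euler: "banded (euler i)"
  unfolding banded_def
  by (auto simp: euler_add euler_scale euler_xmon lookup_xmon split: if_splits intro!: exI[of _ "{0}"])

lemma hat_euler: "hat (euler i) F m = smat (of_int (m $ i)) (F m)"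
  by (subst hat_superset[of "{m}"]) (auto simp: euler_xmon lookup_xmon split: if_splits)

lemma weyl_banded: "T \<in> weyl \<Longrightarrow> banded T"
proof (induction rule: weyl.induct)
  case (add S T)
  then obtain A B where "finite A" "finite B"
    "\<And>k m. Poly_Mapping.lookup (S (xmon k)) m \<noteq> 0 \<Longrightarrow> m - k \<in> A"
    "\<And>k m. Poly_Mapping.lookup (T (xmon k)) m \<noteq> 0 \<Longrightarrow> m - k \<in> B"
    unfolding banded_def by blast
  then have "finite (A \<union> B)" "\<And>k m. Poly_Mapping.lookup (S (xmon k) + T (xmon k)) m \<noteq> 0 \<longrightarrow> m - k \<in> A \<union> B"
    by (auto simp: lookup_add) (metis add_0)
  then show ?case using add.IH unfolding banded_def
    by (auto simp: pm_scale_add add_ac)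
next
  case (scale T c)
  then show ?case unfolding banded_def
    by (auto simp: pm_scale_add mult.commute simp flip: pm_scale_assoc)
qed (auto intro: banded_mult banded_euler banded_comp)

lemma hat_witt_D: "hat (witt_D u r) F m = smat (\<Sum>i\<in>UNIV. u $ i * of_int ((m - r) $ i)) (F (m - r))"
proof -
  have "hat (witt_D u r) F m = (\<Sum>k\<in>{m - r}. smat (Poly_Mapping.lookup (witt_D u r (xmon k)) m) (F k))"
    by (rule hat_superset) (auto simp: witt_D_xmon lookup_xmon split: if_splits)
  then show ?thesis by (simp add: witt_D_xmon lookup_xmon)
qed

section \<open>The function model of an admissible module\<close>

lemma ext_witt_simps:
  "carrier ext_witt = witt \<times> UNIV" "\<zero>\<^bsub>ext_witt\<^esub> = (\<lambda>f. 0, 0)"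
  "(\<xi>, a) \<oplus>\<^bsub>ext_witt\<^esub> (\<eta>, b) = (\<lambda>f. \<xi> f + \<eta> f, a + b)"
  "c \<odot>\<^bsub>ext_witt\<^esub> (\<xi>, a) = (\<lambda>f. pm_scale c (\<xi> f), pm_scale c a)"
  by (simp_all add: ext_witt_def)

lemma zero_in_witt: "(\<lambda>f. 0) \<in> witt"
  by (simp add: witt_def)

lemma add_in_witt: "\<xi> \<in> witt \<Longrightarrow> \<eta> \<in> witt \<Longrightarrow> (\<lambda>f. \<xi> f + \<eta> f) \<in> witt"
  and scale_in_witt: "\<xi> \<in> witt \<Longrightarrow> (\<lambda>f. pm_scale c (\<xi> f)) \<in> witt"
  by (auto simp: witt_def algebra_simps pm_scale_add pm_scale_mult_left pm_scale_mult_right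
      simp flip: pm_scale_assoc)

lemma axis_dot: "(\<Sum>j\<in>UNIV. axis i 1 $ j * of_int (s $ j)) = (of_int (s $ i) :: complex)"
  by (simp add: axis_def if_distrib[of "\<lambda>x. x * _"] cong: if_cong)

lemma sum_axis_smat:
  "(\<Sum>i\<in>UNIV. smat (axis j 1 $ i) (h i)) = h j" for h :: "'d::finite \<Rightarrow> complex fmat"
proof -
  have "(\<Sum>i\<in>UNIV. smat (axis j 1 $ i) (h i)) = (\<Sum>i\<in>UNIV. if i = j then h j else 0)"
    by (rule sum.cong) (auto simp: axis_def)
  then show ?thesis by simp
qed

locale admissible_free =
  fixes M :: "(complex, 'm) module" and act :: "'d::finite ext_witt_elem \<Rightarrow> 'm \<Rightarrow> 'm"
    and \<mu> :: "'d U_h \<Rightarrow> 'm \<Rightarrow> 'm" and \<kappa> :: "'m \<Rightarrow> nat \<Rightarrow> 'd U_h" and n :: nat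
  assumes lie: "lie_module ext_witt M act"
    and simple: "simple_action (carrier ext_witt) M act"
    and adm: "admissible M act"
    and \<mu>_const: "v \<in> carrier M \<Longrightarrow> \<mu> (U_h_const c) v = c \<odot>\<^bsub>M\<^esub> v"
    and \<mu>_var: "v \<in> carrier M \<Longrightarrow> \<mu> (U_h_var i) v = act (of_D (axis i 1) 0) v"
    and \<mu>_module: "Module.module ring_of_type_algebra (module_record (carrier M) (add M) \<zero>\<^bsub>M\<^esub> \<mu>)"
    and co: "coords (carrier M) (add M) \<mu> \<kappa> n"
begin

sublocale L: lie_module ext_witt M act by (rule lie)
sublocale Cd: coords "carrier M" "add M" \<mu> \<kappa> n by (rule co)

abbreviation "C \<equiv> carrier M"

lemma \<mu>_add: "v \<in> C \<Longrightarrow> \<mu> (p + q) v = \<mu> p v \<oplus>\<^bsub>M\<^esub> \<mu> q v"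
  and \<mu>_mult: "v \<in> C \<Longrightarrow> \<mu> (p * q) v = \<mu> p (\<mu> q v)"
  using module.smult_l_distr[OF \<mu>_module, of p q v] module.smult_assoc1[OF \<mu>_module, of p q v]
  by (auto simp: module_record_def)

lemma in_L [simp]: "of_A a \<in> carrier ext_witt" "of_D u r \<in> carrier ext_witt"
  by (auto simp: ext_witt_simps zero_in_witt witt_D_in_witt)

definition "xs r v = act (of_A (xmon r)) v"
definition "Dr i r v = act (of_D (axis i 1) r) v"

abbreviation "dd i \<equiv> Dr i 0"

lemma closed [simp]: "v \<in> C \<Longrightarrow> xs r v \<in> C" "v \<in> C \<Longrightarrow> Dr i r v \<in> C" "v \<in> C \<Longrightarrow> \<mu> p v \<in> C"
  by (simp_all add: xs_def Dr_def L.act_closed Cd.ms_closed)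

lemma xs_add: "v \<in> C \<Longrightarrow> w \<in> C \<Longrightarrow> xs r (v \<oplus>\<^bsub>M\<^esub> w) = xs r v \<oplus>\<^bsub>M\<^esub> xs r w"
  and xs_smult: "v \<in> C \<Longrightarrow> xs r (c \<odot>\<^bsub>M\<^esub> v) = c \<odot>\<^bsub>M\<^esub> xs r v"
  and Dr_add: "v \<in> C \<Longrightarrow> w \<in> C \<Longrightarrow> Dr i r (v \<oplus>\<^bsub>M\<^esub> w) = Dr i r v \<oplus>\<^bsub>M\<^esub> Dr i r w"
  and Dr_smult: "v \<in> C \<Longrightarrow> Dr i r (c \<odot>\<^bsub>M\<^esub> v) = c \<odot>\<^bsub>M\<^esub> Dr i r v"
  by (simp_all add: xs_def Dr_def L.act_add_right L.act_smult_right)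

lemma xs_0 [simp]: "v \<in> C \<Longrightarrow> xs 0 v = v"
  and xs_xs: "v \<in> C \<Longrightarrow> xs r (xs s v) = xs (s + r) v"
  using adm by (auto simp: admissible_def xs_def)

lemma k_add: "v \<in> C \<Longrightarrow> w \<in> C \<Longrightarrow> \<kappa> (v \<oplus>\<^bsub>M\<^esub> w) k = \<kappa> v k + \<kappa> w k"
  by (rule Cd.coord_pl)

lemma k_smult: "v \<in> C \<Longrightarrow> \<kappa> (c \<odot>\<^bsub>M\<^esub> v) k = U_h_const c * \<kappa> v k"
  using Cd.coord_ms[of v "U_h_const c" k] by (simp add: \<mu>_const)

lemma k_minus: "v \<in> C \<Longrightarrow> w \<in> C \<Longrightarrow> \<kappa> (v \<ominus>\<^bsub>M\<^esub> w) k = \<kappa> v k - \<kappa> w k"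
proof -
  assume vw: "v \<in> C" "w \<in> C"
  then have "(v \<ominus>\<^bsub>M\<^esub> w) \<oplus>\<^bsub>M\<^esub> w = v" by (simp add: a_minus_def L.M.a_assoc L.M.l_neg)
  then show ?thesis using k_add[of "v \<ominus>\<^bsub>M\<^esub> w" w k] vw by simp
qed

lemma k_zero: "\<kappa> \<zero>\<^bsub>M\<^esub> k = 0"
  using k_add[of "\<zero>\<^bsub>M\<^esub>" "\<zero>\<^bsub>M\<^esub>" k] by simp

lemmas kk = k_add k_smult k_minus Cd.coord_ms

lemma eqI: "v \<in> C \<Longrightarrow> w \<in> C \<Longrightarrow> (\<And>k. \<kappa> v k = \<kappa> w k) \<Longrightarrow> v = w"
  by (rule Cd.coord_inj)

lemma xs_minus: "v \<in> C \<Longrightarrow> w \<in> C \<Longrightarrow> xs r (v \<ominus>\<^bsub>M\<^esub> w) = xs r v \<ominus>\<^bsub>M\<^esub> xs r w"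
proof -
  assume vw: "v \<in> C" "w \<in> C"
  then have e: "(v \<ominus>\<^bsub>M\<^esub> w) \<oplus>\<^bsub>M\<^esub> w = v" by (simp add: a_minus_def L.M.a_assoc L.M.l_neg)
  have "\<kappa> (xs r v) k = \<kappa> (xs r (v \<ominus>\<^bsub>M\<^esub> w)) k + \<kappa> (xs r w) k" for k
    using xs_add[of "v \<ominus>\<^bsub>M\<^esub> w" w r] vw by (simp add: e k_add)
  then show ?thesis using vw by (intro eqI) (simp_all add: k_minus)
qed

lemma Dr_xs: "v \<in> C \<Longrightarrow>
  Dr i r (xs s v) = xs s (Dr i r v) \<oplus>\<^bsub>M\<^esub> of_int (s $ i) \<odot>\<^bsub>M\<^esub> xs (r + s) v"
proof -
  assume v: "v \<in> C"
  have "act (bracket ext_witt (of_D (axis i 1) r) (of_A (xmon s))) v = Dr i r (xs s v) \<ominus>\<^bsub>M\<^esub> xs s (Dr i r v)"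
    unfolding xs_def Dr_def by (rule L.act_bracket) (use v in simp_all)
  moreover have "bracket ext_witt (of_D (axis i 1) r) (of_A (xmon s))
      = of_int (s $ i) \<odot>\<^bsub>ext_witt\<^esub> of_A (xmon (r + s))"
    by (simp add: of_D_of_A_bracket axis_dot ext_witt_simps)
  ultimately have e: "of_int (s $ i) \<odot>\<^bsub>M\<^esub> xs (r + s) v = Dr i r (xs s v) \<ominus>\<^bsub>M\<^esub> xs s (Dr i r v)"
    using L.act_smult_left[OF in_L(1) v] by (simp add: xs_def)
  have "\<kappa> (of_int (s $ i) \<odot>\<^bsub>M\<^esub> xs (r + s) v) k = \<kappa> (Dr i r (xs s v)) k - \<kappa> (xs s (Dr i r v)) k" for k
    unfolding e using v by (simp add: k_minus)
  then show ?thesis using v by (intro eqI) (simp_all add: k_add)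
qed

lemma Dr_Dr: "v \<in> C \<Longrightarrow>
  Dr i r (Dr j s v) \<ominus>\<^bsub>M\<^esub> Dr j s (Dr i r v) =
    of_int (s $ i) \<odot>\<^bsub>M\<^esub> Dr j (r + s) v \<ominus>\<^bsub>M\<^esub> of_int (r $ j) \<odot>\<^bsub>M\<^esub> Dr i (r + s) v"
proof -
  assume v: "v \<in> C"
  have "act (bracket ext_witt (of_D (axis i 1) r) (of_D (axis j 1) s)) v
      = Dr i r (Dr j s v) \<ominus>\<^bsub>M\<^esub> Dr j s (Dr i r v)"
    unfolding Dr_def by (rule L.act_bracket) (use v in simp_all)
  moreover have "bracket ext_witt (of_D (axis i 1) r) (of_D (axis j 1) s)
      = of_int (s $ i) \<odot>\<^bsub>ext_witt\<^esub> of_D (axis j 1) (r + s)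
        \<oplus>\<^bsub>ext_witt\<^esub> (- of_int (r $ j)) \<odot>\<^bsub>ext_witt\<^esub> of_D (axis i 1) (r + s)"
  proof -
    have wl: "witt_D (\<chi> k. a * u $ k - b * w $ k) r f
        = pm_scale a (witt_D u r f) + pm_scale (- b) (witt_D w r f)" for a b u w r and f :: "'d laurent"
    proof -
      have "(\<Sum>k\<in>UNIV. pm_scale ((\<chi> k. a * u $ k - b * w $ k) $ k) (euler k f))
          = pm_scale a (\<Sum>k\<in>UNIV. pm_scale (u $ k) (euler k f))
            + pm_scale (- b) (\<Sum>k\<in>UNIV. pm_scale (w $ k) (euler k f))"
        by (simp add: pm_scale_sum flip: pm_scale_assoc sum.distrib)
          (simp add: pm_scale_add_left[symmetric])
      then show ?thesis
        by (simp add: witt_D_def distrib_left pm_scale_mult_right)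
    qed
    show ?thesis
      unfolding witt_D_bracket axis_dot by (simp add: ext_witt_simps wl fun_eq_iff)
  qed
  moreover have "act (of_int (s $ i) \<odot>\<^bsub>ext_witt\<^esub> of_D (axis j 1) (r + s)
        \<oplus>\<^bsub>ext_witt\<^esub> (- of_int (r $ j)) \<odot>\<^bsub>ext_witt\<^esub> of_D (axis i 1) (r + s)) v
      = of_int (s $ i) \<odot>\<^bsub>M\<^esub> Dr j (r + s) v \<oplus>\<^bsub>M\<^esub> (- of_int (r $ j)) \<odot>\<^bsub>M\<^esub> Dr i (r + s) v"
    using v by (simp add: L.act_add_left L.act_smult_left Dr_def)
  ultimately have "Dr i r (Dr j s v) \<ominus>\<^bsub>M\<^esub> Dr j s (Dr i r v)
      = of_int (s $ i) \<odot>\<^bsub>M\<^esub> Dr j (r + s) v \<oplus>\<^bsub>M\<^esub> (- of_int (r $ j)) \<odot>\<^bsub>M\<^esub> Dr i (r + s) v" by simp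
  also have "\<dots> = of_int (s $ i) \<odot>\<^bsub>M\<^esub> Dr j (r + s) v \<ominus>\<^bsub>M\<^esub> of_int (r $ j) \<odot>\<^bsub>M\<^esub> Dr i (r + s) v"
    by (rule eqI) (use v in \<open>simp_all add: kk\<close>)
  finally show ?thesis .
qed

text \<open>As the commutator of \<partial>_i with x^r is r_i x^r, moving x^r to the right of a
  polynomial in the \<partial>_i replaces \<partial>_i by \<partial>_i - r_i.\<close>

lemma xs_\<mu>: "v \<in> C \<Longrightarrow> xs r (\<mu> p v) = \<mu> (pshift (\<lambda>i. - of_int (r $ i)) p) (xs r v)"
proof (induction p arbitrary: v rule: U_h_induct)
  case (const c)
  then show ?case by (simp add: \<mu>_const xs_smult)
next
  case (var i)
  have "xs r (dd i v) = dd i (xs r v) \<oplus>\<^bsub>M\<^esub> (- of_int (r $ i)) \<odot>\<^bsub>M\<^esub> xs r v"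
    by (rule eqI) (use var in \<open>simp_all add: Dr_xs kk\<close>)
  then show ?case using var by (simp add: \<mu>_var \<mu>_add \<mu>_const flip: Dr_def U_h_const_simps(5))
next
  case (add p q)
  then show ?case by (simp add: \<mu>_add xs_add)
next
  case (mult p q)
  then show ?case by (simp add: \<mu>_mult)
qed

text \<open>The fibre at m is first moved to the fibre at 0 by x^(-m). Compared with evaluating the
  coordinates of \<open>v\<close> at m, this removes the matrix of x^m, so that x^s acts as a plain
  translation. The size is \<open>max n 1\<close> so that column 0 exists even for n = 0.\<close>

definition \<psi> :: "'m \<Rightarrow> int ^ 'd \<Rightarrow> complex fmat" where
  "\<psi> v m = mkm (max n 1) (\<lambda>k l. if l = 0 then peval (\<lambda>_. 0) (\<kappa> (xs (- m) v) k) else 0)"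

lemma ent_\<psi>: "v \<in> C \<Longrightarrow> ent (\<psi> v m) k l = (if l = 0 then peval (\<lambda>_. 0) (\<kappa> (xs (- m) v) k) else 0)"
  using Cd.coord_bd[of "xs (- m) v" k] by (auto simp: \<psi>_def)

lemma \<psi>_add: "v \<in> C \<Longrightarrow> w \<in> C \<Longrightarrow> \<psi> (v \<oplus>\<^bsub>M\<^esub> w) m = \<psi> v m + \<psi> w m"
  by (rule fmat_eqI) (simp add: ent_\<psi> xs_add kk)

lemma \<psi>_minus: "v \<in> C \<Longrightarrow> w \<in> C \<Longrightarrow> \<psi> (v \<ominus>\<^bsub>M\<^esub> w) m = \<psi> v m - \<psi> w m"
  by (rule fmat_eqI) (simp add: ent_\<psi> xs_minus kk)

lemma \<psi>_smult: "v \<in> C \<Longrightarrow> \<psi> (c \<odot>\<^bsub>M\<^esub> v) m = smat c (\<psi> v m)"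
  by (rule fmat_eqI) (simp add: ent_\<psi> xs_smult kk)

lemma \<psi>_zero: "\<psi> \<zero>\<^bsub>M\<^esub> m = 0"
  using \<psi>_add[of "\<zero>\<^bsub>M\<^esub>" "\<zero>\<^bsub>M\<^esub>" m] by simp

lemma \<psi>_zero': "\<psi> \<zero>\<^bsub>M\<^esub> = (\<lambda>m. 0)"
  by (rule ext) (rule \<psi>_zero)

lemma \<psi>_xs: "v \<in> C \<Longrightarrow> \<psi> (xs r v) m = \<psi> v (m - r)"
  by (rule fmat_eqI) (simp add: ent_\<psi> xs_xs)

lemma \<psi>_\<mu>: "v \<in> C \<Longrightarrow> \<psi> (\<mu> p v) m = smat (peval (\<lambda>i. of_int (m $ i)) p) (\<psi> v m)"
  by (rule fmat_eqI) (simp add: ent_\<psi> xs_\<mu> kk peval_pshift)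

lemma \<psi>_dd: "v \<in> C \<Longrightarrow> \<psi> (dd i v) m = smat (of_int (m $ i)) (\<psi> v m)"
  using \<psi>_\<mu>[of v "U_h_var i" m] by (simp add: \<mu>_var flip: Dr_def)

text \<open>By semilinearity, the coordinates of u at the point r are combinations of those of
  x^(-r) u at 0, and these are the entries of \<open>\<psi> u r\<close>. If all of them vanish, the
  coordinates are polynomials that vanish on the lattice.\<close>

lemma \<psi>_inj: "v \<in> C \<Longrightarrow> w \<in> C \<Longrightarrow> \<psi> v = \<psi> w \<Longrightarrow> v = w"
proof (rule eqI)
  fix k assume vw: "v \<in> C" "w \<in> C" "\<psi> v = \<psi> w"
  define u where "u = v \<ominus>\<^bsub>M\<^esub> w"
  have u: "u \<in> C" "\<psi> u m = 0" for m using vw by (simp_all add: u_def \<psi>_minus)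
  have "peval (\<lambda>i. of_int (m i)) (\<kappa> u k) = 0" for m :: "'d \<Rightarrow> int"
  proof -
    define r :: "int ^ 'd" where "r = (\<chi> i. m i)"
    let ?w = "xs (- r) u"
    have w: "?w \<in> C" "xs r ?w = u" using u by (simp_all add: xs_xs)
    have w0: "peval (\<lambda>_. 0) (\<kappa> ?w l) = 0" for l
      using arg_cong[OF u(2)[of r], of "\<lambda>A. ent A l 0"] u(1) by (simp add: ent_\<psi>)
    have "\<kappa> (xs r ?w) k = (\<Sum>l<n. pshift (\<lambda>i. - of_int (r $ i)) (\<kappa> ?w l) * \<kappa> (xs r (Cd.bas l)) k)"
      by (rule Cd.semilinear_coord) (use w in \<open>simp_all add: xs_add xs_\<mu> rhom_pshift\<close>)
    then have "peval (\<lambda>i. of_int (r $ i)) (\<kappa> u k)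
      = (\<Sum>l<n. peval (\<lambda>i. of_int (r $ i)) (pshift (\<lambda>i. - of_int (r $ i)) (\<kappa> ?w l))
          * peval (\<lambda>i. of_int (r $ i)) (\<kappa> (xs r (Cd.bas l)) k))"
      unfolding w(2) by (simp add: rhom_sum[OF rhom_peval])
    also have "\<dots> = 0" using w0 by (simp add: peval_pshift)
    finally show ?thesis by (simp add: r_def)
  qed
  then have "\<kappa> u k = 0" by (rule peval_int_eq_0)
  then show "\<kappa> v k = \<kappa> w k" using vw by (simp add: u_def k_minus)
qed

section \<open>The operators X(u, r) and their constant matrices\<close>

definition "Y i r v = xs (- r) (Dr i r v)"
definition "Xv i r v = Y i r v \<ominus>\<^bsub>M\<^esub> dd i v"

lemma Y_closed [simp]: "v \<in> C \<Longrightarrow> Y i r v \<in> C" "v \<in> C \<Longrightarrow> Xv i r v \<in> C"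
  by (simp_all add: Y_def Xv_def)

lemma Y_0: "v \<in> C \<Longrightarrow> Y i 0 v = dd i v"
  by (simp add: Y_def)

lemma Y_add: "v \<in> C \<Longrightarrow> w \<in> C \<Longrightarrow> Y i r (v \<oplus>\<^bsub>M\<^esub> w) = Y i r v \<oplus>\<^bsub>M\<^esub> Y i r w"
  and Y_smult: "v \<in> C \<Longrightarrow> Y i r (c \<odot>\<^bsub>M\<^esub> v) = c \<odot>\<^bsub>M\<^esub> Y i r v"
  by (simp_all add: Y_def Dr_add Dr_smult xs_add xs_smult)

lemma Y_xs: "v \<in> C \<Longrightarrow> Y i r (xs s v) = xs s (Y i r v) \<oplus>\<^bsub>M\<^esub> of_int (s $ i) \<odot>\<^bsub>M\<^esub> xs s v"
  by (simp add: Y_def Dr_xs xs_add xs_smult xs_xs add.commute)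

lemma Y_dd: "v \<in> C \<Longrightarrow> Y i r (dd j v) = dd j (Y i r v)"
proof -
  assume v: "v \<in> C"
  have "Dr i r (dd j v) = dd j (Dr i r v) \<ominus>\<^bsub>M\<^esub> of_int (r $ j) \<odot>\<^bsub>M\<^esub> Dr i r v"
  proof (rule eqI)
    fix k
    have "\<kappa> (dd j (Dr i r v) \<ominus>\<^bsub>M\<^esub> Dr i r (dd j v)) k
        = \<kappa> (of_int (r $ j) \<odot>\<^bsub>M\<^esub> Dr i (0 + r) v \<ominus>\<^bsub>M\<^esub> of_int (0 $ i) \<odot>\<^bsub>M\<^esub> Dr j (0 + r) v) k"
      using v by (subst Dr_Dr) auto
    then show "\<kappa> (Dr i r (dd j v)) k = \<kappa> (dd j (Dr i r v) \<ominus>\<^bsub>M\<^esub> of_int (r $ j) \<odot>\<^bsub>M\<^esub> Dr i r v) k"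
      using v by (simp add: kk algebra_simps)
  qed (use v in simp_all)
  then show ?thesis using v
    by (intro eqI) (simp_all add: Y_def xs_minus xs_smult Dr_xs kk)
qed

lemma Xv_add: "v \<in> C \<Longrightarrow> w \<in> C \<Longrightarrow> Xv i r (v \<oplus>\<^bsub>M\<^esub> w) = Xv i r v \<oplus>\<^bsub>M\<^esub> Xv i r w"
  by (rule eqI) (simp_all add: Xv_def Y_add Dr_add kk)

lemma Xv_xs: "v \<in> C \<Longrightarrow> Xv i r (xs s v) = xs s (Xv i r v)"
  by (rule eqI) (simp_all add: Xv_def Y_xs Dr_xs xs_minus kk)

lemma Y_\<mu>: "v \<in> C \<Longrightarrow> Y i r (\<mu> p v) = \<mu> p (Y i r v)"
proof (induction p arbitrary: v rule: U_h_induct)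
  case (const c)
  then show ?case by (simp add: \<mu>_const Y_smult)
next
  case (var j)
  then show ?case using Y_dd[of v i r j] by (simp add: \<mu>_var flip: Dr_def)
next
  case (add p q)
  then show ?case by (simp add: \<mu>_add Y_add)
next
  case (mult p q)
  then show ?case by (simp add: \<mu>_mult)
qed

lemma Xv_\<mu>: "v \<in> C \<Longrightarrow> Xv i r (\<mu> p v) = \<mu> p (Xv i r v)"
  using Y_\<mu>[of v i r p] Y_\<mu>[of v i 0 p] by (intro eqI) (simp_all add: Xv_def Y_0 kk algebra_simps)

definition x :: "'d \<Rightarrow> int ^ 'd \<Rightarrow> complex fmat" where
  "x i r = mkm n (\<lambda>k l. peval (\<lambda>_. 0) (\<kappa> (Xv i r (Cd.bas l)) k))"

lemma fbd_x: "fbd n (x i r)"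
  by (simp add: x_def)

lemma ent_x: "l < n \<Longrightarrow> ent (x i r) k l = peval (\<lambda>_. 0) (\<kappa> (Xv i r (Cd.bas l)) k)"
  using Cd.coord_bd[of "Xv i r (Cd.bas l)" k] Cd.bas(1)[of l] by (auto simp: x_def not_less)

text \<open>Being U(h)-linear, \<open>Xv i r\<close> acts on the fibre at 0 by its coordinate matrix
  evaluated there; commuting with translations, it acts by the same matrix on every fibre.\<close>

lemma \<psi>_Xv: "v \<in> C \<Longrightarrow> \<psi> (Xv i r v) m = x i r * \<psi> v m"
proof (rule fmat_eqI)
  fix k l assume v: "v \<in> C"
  let ?w = "xs (- m) v"
  have "\<kappa> (Xv i r ?w) k = (\<Sum>j<n. \<kappa> ?w j * \<kappa> (Xv i r (Cd.bas j)) k)"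
    using Cd.semilinear_coord[of "Xv i r" "\<lambda>p. p" ?w k] v by (simp add: Xv_add Xv_\<mu> rhom_id)
  then show "ent (\<psi> (Xv i r v) m) k l = ent (x i r * \<psi> v m) k l"
    using v by (simp add: ent_\<psi> ent_times[of n] fbd_x ent_x rhom_sum[OF rhom_peval] mult.commute
        flip: Xv_xs)
qed

lemma \<psi>_Dr: "v \<in> C \<Longrightarrow> \<psi> (Dr i r v) m = x i r * \<psi> v (m - r) + smat (of_int ((m - r) $ i)) (\<psi> v (m - r))"
proof -
  assume v: "v \<in> C"
  have "Dr i r v = xs r (Xv i r v \<oplus>\<^bsub>M\<^esub> dd i v)"
  proof (rule eqI)
    fix k
    have "\<kappa> (Xv i r v \<oplus>\<^bsub>M\<^esub> dd i v) j = \<kappa> (Y i r v) j" for j using v by (simp add: Xv_def kk)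
    then have "Xv i r v \<oplus>\<^bsub>M\<^esub> dd i v = Y i r v" using v by (intro eqI) auto
    then show "\<kappa> (Dr i r v) k = \<kappa> (xs r (Xv i r v \<oplus>\<^bsub>M\<^esub> dd i v)) k" using v by (simp add: Y_def xs_xs)
  qed (use v in simp_all)
  then show ?thesis using v by (simp add: \<psi>_xs \<psi>_add \<psi>_Xv \<psi>_dd)
qed

text \<open>The action carried over to functions. It is assembled from sums, scalings, translations,
  coordinate multiplications and the matrices \<open>x i r\<close>, so a space of functions stable
  under these is stable under the whole Lie algebra.\<close>

definition opF :: "'d ext_witt_elem \<Rightarrow> (int ^ 'd \<Rightarrow> complex fmat) \<Rightarrow> int ^ 'd \<Rightarrow> complex fmat" where
  "opF = (\<lambda>(\<xi>, a) F m.
     (\<Sum>r\<in>witt_supp \<xi>. \<Sum>i\<in>UNIV. smat (witt_coeff \<xi> r $ i)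
        (x i r * F (m - r) + smat (of_int ((m - r) $ i)) (F (m - r))))
     + (\<Sum>s\<in>Poly_Mapping.keys a. smat (Poly_Mapping.lookup a s) (F (m - s))))"

lemma act_zero: "v \<in> C \<Longrightarrow> \<psi> (act (\<lambda>f. 0, 0) v) m = 0"
proof -
  assume v: "v \<in> C"
  have "act (0 \<odot>\<^bsub>ext_witt\<^esub> of_A 0) v = 0 \<odot>\<^bsub>M\<^esub> act (of_A 0) v" using v by (intro L.act_smult_left) auto
  then have e: "act (of_A 0) v = 0 \<odot>\<^bsub>M\<^esub> act (of_A 0) v" by (simp add: ext_witt_simps)
  have "\<psi> (act (of_A 0) v) m = \<psi> (0 \<odot>\<^bsub>M\<^esub> act (of_A 0) v) m" by (subst e) (rule refl)
  then show ?thesis using v by (simp add: \<psi>_smult L.act_closed)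
qed

lemma act_D_sum:
  assumes v: "v \<in> C" and A: "finite A" and g: "\<And>a. a \<in> A \<Longrightarrow> g a \<in> witt"
  shows "\<psi> (act (\<lambda>f. \<Sum>a\<in>A. g a f, 0) v) m = (\<Sum>a\<in>A. \<psi> (act (g a, 0) v) m)"
  using A g
proof (induction A rule: finite_induct)
  case empty
  then show ?case using act_zero[OF v] by simp
next
  case (insert a A)
  have in1: "(g a, 0) \<in> carrier ext_witt" "(\<lambda>f. \<Sum>a\<in>A. g a f, 0) \<in> carrier ext_witt"
    using insert by (auto simp: ext_witt_simps intro: witt_sum)
  have "act ((g a, 0) \<oplus>\<^bsub>ext_witt\<^esub> (\<lambda>f. \<Sum>a\<in>A. g a f, 0)) v
      = act (g a, 0) v \<oplus>\<^bsub>M\<^esub> act (\<lambda>f. \<Sum>a\<in>A. g a f, 0) v"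
    by (rule L.act_add_left[OF in1 v])
  then show ?case using insert in1 v by (simp add: ext_witt_simps(3) \<psi>_add L.act_closed)
qed

lemma \<psi>_act_D: "v \<in> C \<Longrightarrow> \<psi> (act (of_D u r) v) m
  = (\<Sum>i\<in>UNIV. smat (u $ i) (x i r * \<psi> v (m - r) + smat (of_int ((m - r) $ i)) (\<psi> v (m - r))))"
proof -
  assume v: "v \<in> C"
  have ax: "witt_D (axis i 1) r f = xmon r * euler i f" for i and f :: "'d laurent"
  proof -
    have "(\<Sum>j\<in>UNIV. pm_scale (axis i 1 $ j) (euler j f)) = (\<Sum>j\<in>UNIV. if j = i then euler i f else 0)"
      by (rule sum.cong) (auto simp: axis_def)
    then show ?thesis by (simp add: witt_D_def)
  qed
  have wD: "witt_D u r = (\<lambda>f. \<Sum>i\<in>UNIV. pm_scale (u $ i) (witt_D (axis i 1) r f))"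
    by (rule ext) (simp add: ax witt_D_def[of u] sum_distrib_left pm_scale_mult_right)
  have "act (\<lambda>f. pm_scale c (witt_D (axis i 1) r f), 0) v = c \<odot>\<^bsub>M\<^esub> Dr i r v" for c i
    using L.act_smult_left[OF in_L(2) v, of c "axis i 1" r] by (simp add: ext_witt_simps Dr_def)
  then show ?thesis using v
    by (subst wD, subst act_D_sum[OF v]) (auto simp: scale_in_witt witt_D_in_witt \<psi>_smult \<psi>_Dr)
qed

lemma \<psi>_act_A: "v \<in> C \<Longrightarrow> \<psi> (act (of_A a) v) m
  = (\<Sum>s\<in>Poly_Mapping.keys a. smat (Poly_Mapping.lookup a s) (\<psi> v (m - s)))"
proof -
  assume v: "v \<in> C"
  have "\<psi> (act (of_A a) v) m = lin (\<lambda>s. \<psi> v (m - s)) a"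
  proof (induction a rule: pm_induct)
    case zero
    then show ?case using act_zero[OF v] by simp
  next
    case (single k c)
    have "of_A (Poly_Mapping.single k c) = c \<odot>\<^bsub>ext_witt\<^esub> of_A (xmon k)"
      by (simp add: ext_witt_simps xmon_def pm_scale_single)
    then have "act (of_A (Poly_Mapping.single k c)) v = c \<odot>\<^bsub>M\<^esub> xs k v"
      using L.act_smult_left[OF in_L(1) v] by (simp add: xs_def)
    then show ?case using v by (simp add: \<psi>_smult \<psi>_xs)
  next
    case (add f g)
    have "of_A (f + g) = of_A f \<oplus>\<^bsub>ext_witt\<^esub> of_A g" by (simp add: ext_witt_simps)
    then have "act (of_A (f + g)) v = act (of_A f) v \<oplus>\<^bsub>M\<^esub> act (of_A g) v"
      using L.act_add_left[OF in_L(1) in_L(1) v] by simp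
    then show ?case using v add by (simp add: \<psi>_add L.act_closed lin_add)
  qed
  then show ?thesis by (simp add: lin_def)
qed

lemma \<psi>_act: "v \<in> C \<Longrightarrow> y \<in> carrier ext_witt \<Longrightarrow> \<psi> (act y v) = opF y (\<psi> v)"
proof (rule ext)
  fix m assume v: "v \<in> C" and y: "y \<in> carrier ext_witt"
  obtain \<xi> a where ya: "y = (\<xi>, a)" by (cases y)
  have \<xi>: "\<xi> \<in> witt" using y by (simp add: ya ext_witt_simps)
  then have in1: "(\<xi>, 0) \<in> carrier ext_witt" by (simp add: ext_witt_simps)
  have "y = (\<xi>, 0) \<oplus>\<^bsub>ext_witt\<^esub> of_A a" by (simp add: ya ext_witt_simps)
  then have "act y v = act (\<xi>, 0) v \<oplus>\<^bsub>M\<^esub> act (of_A a) v"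
    using L.act_add_left[OF in1 in_L(1) v] by simp
  then have "\<psi> (act y v) m = \<psi> (act (\<xi>, 0) v) m + \<psi> (act (of_A a) v) m"
    using v in1 by (simp add: \<psi>_add L.act_closed)
  also have "\<psi> (act (\<xi>, 0) v) m = (\<Sum>r\<in>witt_supp \<xi>. \<psi> (act (of_D (witt_coeff \<xi> r) r) v) m)"
    by (subst witt_decomposition[OF \<xi>], rule act_D_sum[OF v]) (auto simp: finite_witt_supp witt_D_in_witt)
  finally show "\<psi> (act y v) m = opF y (\<psi> v) m"
    using v by (simp add: opF_def ya \<psi>_act_D \<psi>_act_A)
qed

lemma \<psi>_surj_0:
  assumes "idm n * w = w" "w * idm 1 = w"
  shows "\<exists>F\<in>\<psi> ` C. F 0 = w"
proof -
  have w1: "ent w k l = 0" if "n \<le> k" for k l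
  proof -
    have "ent (idm n * w) k l = 0"
      by (subst ent_times[of n]) (use that in \<open>auto simp: ent_idm intro!: sum.neutral\<close>)
    then show ?thesis using assms by simp
  qed
  have w2: "ent w k l = 0" if "l \<noteq> 0" for k l
  proof -
    have "ent (w * idm 1) k l = 0"
      by (subst ent_times[of 1]) (use that in \<open>auto simp: ent_idm\<close>)
    then show ?thesis using assms by simp
  qed
  define v where "v = Cd.vecC (\<lambda>k. U_h_const (ent w k 0))"
  have b: "\<forall>k\<ge>n. U_h_const (ent w k 0) = (0 :: 'd U_h)" using w1 by simp
  have v: "v \<in> C" "\<And>k. \<kappa> v k = U_h_const (ent w k 0)"
    unfolding v_def using Cd.vecC[OF b] by auto
  have "\<psi> v 0 = w" by (rule fmat_eqI) (use v w2 in \<open>simp add: ent_\<psi>\<close>)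
  then show ?thesis using v by blast
qed

text \<open>Evaluate the commutator of D(e_i, r) and D(e_j, s) at the lattice point r + s. All terms
  translate back to the point 0, where the vectors of the module take every column as value.\<close>

lemma x_bracket_rel: "x i r * x j s - x j s * x i r =
  smat (of_int (s $ i)) (x j (r + s) - x j s) - smat (of_int (r $ j)) (x i (r + s) - x i r)"
proof -
  let ?A = "x i r * x j s - x j s * x i r"
  let ?B = "smat (of_int (s $ i)) (x j (r + s) - x j s) - smat (of_int (r $ j)) (x i (r + s) - x i r)"
  have AB: "(?A - ?B) * w = 0" if w: "idm n * w = w" "w * idm 1 = w" for w
  proof -
    obtain v where v: "v \<in> C" "\<psi> v 0 = w" using \<psi>_surj_0[OF w] by auto
    have "\<psi> (Dr i r (Dr j s v) \<ominus>\<^bsub>M\<^esub> Dr j s (Dr i r v)) (r + s)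
        = x i r * (x j s * w) - x j s * (x i r * w) + smat (of_int (s $ i)) (x j s * w)
          - smat (of_int (r $ j)) (x i r * w)"
      using v by (simp add: \<psi>_minus \<psi>_Dr distrib_left smat_add smat_mult_right)
    moreover have "\<psi> (Dr i r (Dr j s v) \<ominus>\<^bsub>M\<^esub> Dr j s (Dr i r v)) (r + s)
        = smat (of_int (s $ i)) (x j (r + s) * w) - smat (of_int (r $ j)) (x i (r + s) * w)"
      using v by (simp add: Dr_Dr \<psi>_minus \<psi>_smult \<psi>_Dr)
    ultimately show ?thesis
      by (simp add: left_diff_distrib smat_mult_left smat_minus mult.assoc algebra_simps)
  qed
  have f: "fbd n (?A - ?B)" by (intro fbd_minus fbd_times fbd_smat fbd_x)
  have "?A - ?B = 0" by (rule mat_eq_0I[OF f AB])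
  then show ?thesis by (rule eq_iff_diff_eq_0[THEN iffD2])
qed

lemma x_0_eq: "x i 0 = 0"
proof (rule mat_eq_0I[OF fbd_x])
  fix w :: "complex fmat" assume "idm n * w = w" "w * idm 1 = w"
  then obtain v where v: "v \<in> C" "\<psi> v 0 = w" using \<psi>_surj_0 by auto
  have "x i 0 * \<psi> v 0 = \<psi> (Xv i 0 v) 0" using v by (simp add: \<psi>_Xv)
  also have "\<dots> = 0" using v by (simp add: Xv_def Y_0 \<psi>_minus)
  finally show "x i 0 * w = 0" using v by simp
qed

lemma opF_in:
  assumes add: "\<And>F G. F \<in> N \<Longrightarrow> G \<in> N \<Longrightarrow> (\<lambda>m. F m + G m) \<in> N"
    and zero: "(\<lambda>m. 0) \<in> N"
    and scale: "\<And>c F. F \<in> N \<Longrightarrow> (\<lambda>m. smat c (F m)) \<in> N"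
    and shift: "\<And>r F. F \<in> N \<Longrightarrow> (\<lambda>m. F (m - r)) \<in> N"
    and euler: "\<And>i F. F \<in> N \<Longrightarrow> (\<lambda>m. smat (of_int (m $ i)) (F m)) \<in> N"
    and mx: "\<And>i r F. F \<in> N \<Longrightarrow> (\<lambda>m. x i r * F m) \<in> N"
    and F: "F \<in> N"
  shows "opF y F \<in> N"
proof -
  have sum: "(\<lambda>m. \<Sum>a\<in>A. h a m) \<in> N" if "\<And>a. a \<in> A \<Longrightarrow> h a \<in> N" for A :: "'z set" and h
    using that by (induction A rule: infinite_finite_induct) (auto simp: zero add)
  obtain \<xi> a where y: "y = (\<xi>, a)" by (cases y)
  have "(\<lambda>m. x i r * F (m - r) + smat (of_int ((m - r) $ i)) (F (m - r))) \<in> N" for i r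
    using shift[OF add[OF mx[OF F, of i r] euler[OF F, of i]], of r] by simp
  then have "(\<lambda>m. \<Sum>r\<in>witt_supp \<xi>. \<Sum>i\<in>UNIV. smat (witt_coeff \<xi> r $ i)
      (x i r * F (m - r) + smat (of_int ((m - r) $ i)) (F (m - r)))) \<in> N"
    by (intro sum scale)
  moreover have "(\<lambda>m. \<Sum>s\<in>Poly_Mapping.keys a. smat (Poly_Mapping.lookup a s) (F (m - s))) \<in> N"
    by (intro sum scale shift F)
  ultimately show ?thesis using add by (simp add: opF_def y)
qed

lemma submodule_\<psi>I:
  assumes "H \<subseteq> C" "\<zero>\<^bsub>M\<^esub> \<in> H" "\<And>v w. v \<in> H \<Longrightarrow> w \<in> H \<Longrightarrow> v \<oplus>\<^bsub>M\<^esub> w \<in> H"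
    "\<And>c v. v \<in> H \<Longrightarrow> c \<odot>\<^bsub>M\<^esub> v \<in> H"
  shows "submodule H complex_ring M"
proof (rule L.M.submoduleI)
  fix a assume a: "a \<in> H"
  have aC: "a \<in> C" using assms a by blast
  have "\<ominus>\<^bsub>M\<^esub> a = (- 1) \<odot>\<^bsub>M\<^esub> a"
    by (rule eqI) (use aC k_minus[of "\<zero>\<^bsub>M\<^esub>" a] in \<open>auto simp: k_smult k_zero a_minus_def\<close>)
  then show "\<ominus>\<^bsub>M\<^esub> a \<in> H" using assms a by simp
qed (use assms in auto)

text \<open>Simplicity is transported by pulling a stable space \<open>N\<close> of functions back
  along \<open>\<psi>\<close>; \<open>opF_in\<close> shows that the preimage is a submodule.\<close>

sublocale S: shift_module n "\<psi> ` C" x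
proof
  fix F assume F: "F \<in> \<psi> ` C"
  then obtain v where v: "v \<in> C" "F = \<psi> v" by blast
  show "idm n * F m = F m" for m
  proof (rule fmat_eqI)
    fix k l
    have "ent (idm n * F m) k l = (\<Sum>p<n. ent (idm n) k p * ent (F m) p l)" by (rule ent_times) simp
    also have "\<dots> = (\<Sum>p<n. if p = k then ent (F m) k l else 0)" by (rule sum.cong) (auto simp: ent_idm)
    also have "\<dots> = ent (F m) k l" using v Cd.coord_bd[of "xs (- m) v" k] by (auto simp: ent_\<psi>)
    finally show "ent (idm n * F m) k l = ent (F m) k l" .
  qed
  show "F m * idm 1 = F m" for m
    by (rule fmat_eqI, subst ent_times[of 1]) (use v in \<open>auto simp: ent_\<psi> ent_idm\<close>)
  show "(\<lambda>m. smat c (F m)) \<in> \<psi> ` C" for c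
    using v \<psi>_smult[of v c] by (intro image_eqI[of _ _ "c \<odot>\<^bsub>M\<^esub> v"]) auto
  show "(\<lambda>m. F (m - r)) \<in> \<psi> ` C" for r
    using v \<psi>_xs[of v r] by (intro image_eqI[of _ _ "xs r v"]) auto
  show "(\<lambda>m. smat (of_int (m $ i)) (F m)) \<in> \<psi> ` C" for i
    using v \<psi>_dd[of v i] by (intro image_eqI[of _ _ "dd i v"]) auto
  show "(\<lambda>m. x i r * F m) \<in> \<psi> ` C" for i r
    using v \<psi>_Xv[of v i r] by (intro image_eqI[of _ _ "Xv i r v"]) auto
  fix G assume "G \<in> \<psi> ` C"
  then obtain w where w: "w \<in> C" "G = \<psi> w" by blast
  show "(\<lambda>m. F m + G m) \<in> \<psi> ` C"
    using v w \<psi>_add[of v w] by (intro image_eqI[of _ _ "v \<oplus>\<^bsub>M\<^esub> w"]) auto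
next
  show "(\<lambda>m. 0) \<in> \<psi> ` C" by (intro image_eqI[of _ _ "\<zero>\<^bsub>M\<^esub>"]) (simp_all add: \<psi>_zero')
  show "\<psi> ` C \<noteq> {\<lambda>m. 0}"
  proof
    assume e: "\<psi> ` C = {\<lambda>m. 0}"
    have "v = \<zero>\<^bsub>M\<^esub>" if "v \<in> C" for v
    proof (rule \<psi>_inj)
      have "\<psi> v \<in> {\<lambda>m. 0}" using that e by blast
      then show "\<psi> v = \<psi> \<zero>\<^bsub>M\<^esub>" by (simp add: \<psi>_zero')
    qed (use that in auto)
    then show False using simple by (auto simp: simple_action_def)
  qed
  fix N assume sub: "N \<subseteq> \<psi> ` C" and cl: "(\<lambda>m. 0) \<in> N" "\<And>F G. F \<in> N \<Longrightarrow> G \<in> N \<Longrightarrow> (\<lambda>m. F m + G m) \<in> N"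
    "\<And>c F. F \<in> N \<Longrightarrow> (\<lambda>m. smat c (F m)) \<in> N" "\<And>r F. F \<in> N \<Longrightarrow> (\<lambda>m. F (m - r)) \<in> N"
    "\<And>i F. F \<in> N \<Longrightarrow> (\<lambda>m. smat (of_int (m $ i)) (F m)) \<in> N" "\<And>i r F. F \<in> N \<Longrightarrow> (\<lambda>m. x i r * F m) \<in> N"
  define H where "H = {v \<in> C. \<psi> v \<in> N}"
  have H1: "submodule H complex_ring M"
  proof (rule submodule_\<psi>I)
    show "\<zero>\<^bsub>M\<^esub> \<in> H" using cl(1) by (simp add: H_def \<psi>_zero')
    show "v \<oplus>\<^bsub>M\<^esub> w \<in> H" if "v \<in> H" "w \<in> H" for v w
    proof -
      have "\<psi> (v \<oplus>\<^bsub>M\<^esub> w) = (\<lambda>m. \<psi> v m + \<psi> w m)" using that by (auto simp: H_def \<psi>_add)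
      then show ?thesis using that cl(2) by (simp add: H_def)
    qed
    show "c \<odot>\<^bsub>M\<^esub> v \<in> H" if "v \<in> H" for c v
    proof -
      have "\<psi> (c \<odot>\<^bsub>M\<^esub> v) = (\<lambda>m. smat c (\<psi> v m))" using that by (auto simp: H_def \<psi>_smult)
      then show ?thesis using that cl(3) by (simp add: H_def)
    qed
  qed (auto simp: H_def)
  have H2: "act y v \<in> H" if "y \<in> carrier ext_witt" "v \<in> H" for y v
  proof -
    have v: "v \<in> C" "\<psi> v \<in> N" using that by (auto simp: H_def)
    have "\<psi> (act y v) \<in> N"
      unfolding \<psi>_act[OF v(1) that(1)] by (rule opF_in[OF cl(2) cl(1) cl(3-6) v(2)])
    then show ?thesis using v that by (simp add: H_def L.act_closed)
  qed
  have "H = {\<zero>\<^bsub>M\<^esub>} \<or> H = C"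
    by (rule simple[unfolded simple_action_def, THEN conjunct2, THEN spec, THEN mp])
      (intro conjI ballI H1 H2)
  moreover have N: "N = \<psi> ` H" using sub by (auto simp: H_def)
  ultimately show "N = {\<lambda>m. 0} \<or> N = \<psi> ` C"
  proof (elim disjE)
    assume "H = {\<zero>\<^bsub>M\<^esub>}"
    then show ?thesis unfolding N by (simp add: \<psi>_zero')
  next
    assume "H = C"
    then show ?thesis unfolding N by simp
  qed
next
  show "fbd n (x i r)" "x i 0 = 0" for i r by (rule fbd_x x_0_eq)+
  show "x i r * x j s - x j s * x i r =
    smat (of_int (s $ i)) (x j (r + s) - x j s) - smat (of_int (r $ j)) (x i (r + s) - x i r)" for i j r s
    by (rule x_bracket_rel)
  show "\<exists>F\<in>\<psi> ` C. F 0 = w" if "idm n * w = w" "w * idm 1 = w" for w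
    using that by (rule \<psi>_surj_0)
qed

end

section \<open>The factors of the tensor product\<close>

lemma fmat_subspace_coords:
  assumes L: "fv.subspace L" and b: "\<And>A. A \<in> L \<Longrightarrow> fbd n A"
  shows "\<exists>\<kappa> k. coords L (+) smat \<kappa> k"
proof -
  obtain B where B: "B \<subseteq> L" "fv.independent B" "L \<subseteq> fv.span B" "card B = fv.dim L"
    using fv.basis_exists by blast
  have sp: "fv.span B = L" using B fv.span_minimal[OF B(1) L] by blast
  have "B \<subseteq> fv.span (munits n)" using B b fbd_span by blast
  then have fin: "finite B" using fv.independent_span_bound[OF finite_munits B(2)] by blast
  obtain h where h: "bij_betw h {0..<card B} B" using ex_bij_betw_nat_finite[OF fin] by blast
  define \<kappa> where "\<kappa> A i = (if i < card B then fv.representation B A (h i) else 0)" for A i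
  have hB: "i < card B \<Longrightarrow> h i \<in> B" for i using h by (auto simp: bij_betw_def)
  have hinj: "inj_on h {0..<card B}" and him: "h ` {0..<card B} = B" using h by (auto simp: bij_betw_def)
  have rep: "(\<Sum>v\<in>B. smat (fv.representation B A v) v) = A" if "A \<in> L" for A
    by (rule fv.sum_representation_eq) (use B fin that sp in auto)
  have "bij_betw \<kappa> L {f. \<forall>k\<ge>card B. f k = 0}"
  proof (rule bij_betw_imageI)
    show "inj_on \<kappa> L"
    proof (rule inj_onI)
      fix A A' assume A: "A \<in> L" "A' \<in> L" "\<kappa> A = \<kappa> A'"
      have "fv.representation B A v = fv.representation B A' v" if "v \<in> B" for v
      proof -
        have "v \<in> h ` {0..<card B}" using him that by simp
        then obtain i where i: "i < card B" "v = h i" by auto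
        then show ?thesis using fun_cong[OF A(3), of i] by (simp add: \<kappa>_def)
      qed
      then have "(\<Sum>v\<in>B. smat (fv.representation B A v) v) = (\<Sum>v\<in>B. smat (fv.representation B A' v) v)"
        by (intro sum.cong) auto
      then show "A = A'" using rep A by simp
    qed
    show "\<kappa> ` L = {f. \<forall>k\<ge>card B. f k = 0}"
    proof (intro equalityI subsetI)
      fix f :: "nat \<Rightarrow> complex" assume f: "f \<in> {f. \<forall>k\<ge>card B. f k = 0}"
      define A where "A = (\<Sum>i<card B. smat (f i) (h i))"
      have A: "A \<in> L" unfolding A_def sp[symmetric]
        by (rule fv.span_sum, rule fv.span_scale, rule fv.span_base) (use hB in auto)
      have "fv.representation B A (h j) = f j" if "j < card B" for j
      proof -
        have spn: "smat (f i) (h i) \<in> fv.span B" if "i < card B" for i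
          by (rule fv.span_scale, rule fv.span_base) (rule hB[OF that])
        have "fv.representation B A (h j) = (\<Sum>i<card B. fv.representation B (smat (f i) (h i)) (h j))"
          unfolding A_def by (subst fv.representation_sum) (use B(2) spn in auto)
        also have "\<dots> = (\<Sum>i<card B. if i = j then f j else 0)"
        proof (rule sum.cong[OF refl])
          fix i assume i: "i \<in> {..<card B}"
          have "h i = h j \<longleftrightarrow> i = j" using hinj i that by (auto simp: inj_on_def)
          then show "fv.representation B (smat (f i) (h i)) (h j) = (if i = j then f j else 0)"
            using i hB B(2) fv.span_base[of "h i" B]
            by (auto simp: fv.representation_scale fv.representation_basis)
        qed
        finally show ?thesis using that by simp
      qed
      then have "\<kappa> A = f" using f by (auto simp: \<kappa>_def)
      then show "f \<in> \<kappa> ` L" using A by blast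
    qed (auto simp: \<kappa>_def)
  qed
  then have "coords L (+) smat \<kappa> (card B)"
    by unfold_locales
      (use B L sp in \<open>auto simp: \<kappa>_def fv.subspace_add fv.subspace_scale fv.representation_add fv.representation_scale\<close>)
  then show ?thesis by blast
qed

lemma minus_eqI:
  assumes "abelian_group G" "x \<in> carrier G" "a \<in> carrier G" "b \<in> carrier G" "x \<oplus>\<^bsub>G\<^esub> b = a"
  shows "x = a \<ominus>\<^bsub>G\<^esub> b"
proof -
  interpret abelian_group G by fact
  show ?thesis using assms by (auto simp: a_minus_def a_assoc r_neg)
qed

lemma abelian_group_module_record:
  assumes "abelian_group P"
  shows "abelian_group (module_record (carrier P) (add P) \<zero>\<^bsub>P\<^esub> \<mu>)"
proof -
  interpret abelian_group P by fact
  show ?thesis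
  proof (rule abelian_groupI)
    fix y assume "y \<in> carrier (module_record (carrier P) (add P) \<zero>\<^bsub>P\<^esub> \<mu>)"
    then show "\<exists>z\<in>carrier (module_record (carrier P) (add P) \<zero>\<^bsub>P\<^esub> \<mu>).
        z \<oplus>\<^bsub>module_record (carrier P) (add P) \<zero>\<^bsub>P\<^esub> \<mu>\<^esub> y = \<zero>\<^bsub>module_record (carrier P) (add P) \<zero>\<^bsub>P\<^esub> \<mu>\<^esub>"
      by (intro bexI[of _ "\<ominus>\<^bsub>P\<^esub> y"]) (auto simp: module_record_def l_neg)
  qed (auto simp: module_record_def a_ac)
qed

text \<open>The choice of \<open>q\<close>, a nonzero vector of e M, singles out one copy U q of V
  inside the module.\<close>

locale min_idem = admissible_free M act \<mu> \<kappa> n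
  for M :: "(complex, 'm) module" and act :: "'d::finite ext_witt_elem \<Rightarrow> 'm \<Rightarrow> 'm" and \<mu> \<kappa> n +
  fixes e :: "complex fmat" and q :: 'm
  assumes e: "e \<in> S.U" "e * e = e" "e \<noteq> 0" and eU: "u \<in> S.U \<Longrightarrow> \<exists>c. e * u * e = smat c e"
    and q: "q \<in> carrier M" "e * \<psi> q m = \<psi> q m" "q \<noteq> \<zero>\<^bsub>M\<^esub>"
begin

definition \<tau> :: "(int ^ 'd \<Rightarrow> complex fmat) \<Rightarrow> 'm" where
  "\<tau> F = inv_into C \<psi> F"

lemma \<tau>: "F \<in> \<psi> ` C \<Longrightarrow> \<tau> F \<in> C" "F \<in> \<psi> ` C \<Longrightarrow> \<psi> (\<tau> F) = F"
  by (auto simp: \<tau>_def inv_into_into f_inv_into_f)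

lemma \<tau>_U: "u \<in> S.U \<Longrightarrow> v \<in> C \<Longrightarrow> \<tau> (\<lambda>m. u * \<psi> v m) \<in> C"
  "u \<in> S.U \<Longrightarrow> v \<in> C \<Longrightarrow> \<psi> (\<tau> (\<lambda>m. u * \<psi> v m)) m = u * \<psi> v m"
  using \<tau>[OF S.M_U[of u "\<psi> v"]] by auto

lemma \<psi>I: "v \<in> C \<Longrightarrow> w \<in> C \<Longrightarrow> (\<And>m. \<psi> v m = \<psi> w m) \<Longrightarrow> v = w"
  by (rule \<psi>_inj) auto

lemma q_nz: "\<exists>m. \<psi> q m \<noteq> 0"
  using \<psi>I[of q "\<zero>\<^bsub>M\<^esub>"] q by (auto simp: \<psi>_zero)

subsection \<open>The Weyl module\<close>

definition "PC = {v \<in> C. \<forall>m. e * \<psi> v m = \<psi> v m}"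
definition "P = M\<lparr>carrier := PC\<rparr>"
definition "actP T v = \<tau> (hat T (\<psi> v))"

lemma P_simps [simp]: "carrier P = PC" "add P = add M" "\<zero>\<^bsub>P\<^esub> = \<zero>\<^bsub>M\<^esub>"
  "Module.module.smult P = Module.module.smult M"
  by (simp_all add: P_def)

lemma PC_C: "v \<in> PC \<Longrightarrow> v \<in> C" by (simp add: PC_def)

lemma hat_M: "T \<in> weyl \<Longrightarrow> F \<in> \<psi> ` C \<Longrightarrow> hat T F \<in> \<psi> ` C"
proof (induction arbitrary: F rule: weyl.induct)
  case (xmon r)
  have "hat (\<lambda>f. xmon r * f) F = (\<lambda>m. F (m - r))" by (rule ext) (rule hat_xmon)
  then show ?case using S.M_shift[OF xmon] by simp
next
  case (euler i)
  have "hat (Defs.euler i) F = (\<lambda>m. smat (of_int (m $ i)) (F m))" by (rule ext) (rule hat_euler)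
  then show ?case using S.M_euler[OF euler] by simp
next
  case (add S T)
  have "hat (\<lambda>f. S f + T f) F = (\<lambda>m. hat S F m + hat T F m)"
    by (rule ext) (intro hat_add weyl_banded add)
  then show ?case using S.M_add[OF add.IH(1)[OF add.prems] add.IH(2)[OF add.prems]] by simp
next
  case (scale T c)
  have "hat (\<lambda>f. pm_scale c (T f)) F = (\<lambda>m. smat c (hat T F m))"
    by (rule ext) (intro hat_scale weyl_banded scale)
  then show ?case using S.M_scale[OF scale.IH[OF scale.prems]] by simp
next
  case (comp S T)
  have "hat (\<lambda>f. S (T f)) F = hat S (hat T F)"
    by (rule ext) (intro hat_comp weyl_banded comp)
  then show ?case using comp.IH comp.prems by simp
qed

lemma actP_C: "T \<in> weyl \<Longrightarrow> v \<in> C \<Longrightarrow> actP T v \<in> C" "T \<in> weyl \<Longrightarrow> v \<in> C \<Longrightarrow> \<psi> (actP T v) = hat T (\<psi> v)"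
  using \<tau>[OF hat_M[of T "\<psi> v"]] by (auto simp: actP_def)

lemma actP_PC: "T \<in> weyl \<Longrightarrow> v \<in> PC \<Longrightarrow> actP T v \<in> PC"
proof -
  assume T: "T \<in> weyl" and v: "v \<in> PC"
  have "e * hat T (\<psi> v) m = hat T (\<psi> v) m" for m
  proof -
    have ev: "(\<lambda>k. e * \<psi> v k) = \<psi> v" using v by (auto simp: PC_def)
    show ?thesis using hat_right(3)[of T e "\<psi> v" m] unfolding ev by (rule sym)
  qed
  then show ?thesis using actP_C[OF T PC_C[OF v]] by (simp add: PC_def)
qed

lemma PC_submodule: "submodule PC complex_ring M"
  by (rule submodule_\<psi>I)
    (auto simp: PC_def \<psi>_zero \<psi>_add \<psi>_smult distrib_left smat_mult_right)

lemma P_module: "Module.module complex_ring P"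
  unfolding P_def by (rule submodule.submodule_is_module[OF PC_submodule L.M.module_axioms])

lemma weyl_module_P: "weyl_module P actP"
proof -
  interpret Module.module complex_ring P by (rule P_module)
  show ?thesis
  proof
    fix S T :: "'d laurent \<Rightarrow> 'd laurent" and v w c assume v: "v \<in> carrier P"
    then have vC: "v \<in> C" by (simp add: PC_C)
    show "actP (\<lambda>f. f) v = v"
      by (rule \<psi>I) (use vC \<tau>[of "\<psi> v"] in \<open>auto simp: actP_def hat_id[abs_def]\<close>)
    assume T: "T \<in> weyl"
    show "actP T v \<in> carrier P" using actP_PC T v by simp
    show "actP (\<lambda>f. pm_scale c (T f)) v = c \<odot>\<^bsub>P\<^esub> actP T v"
      using vC T by (intro \<psi>I) (auto simp: actP_C weyl.scale \<psi>_smult hat_scale weyl_banded)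
    show "actP T (c \<odot>\<^bsub>P\<^esub> v) = c \<odot>\<^bsub>P\<^esub> actP T v"
    proof (rule \<psi>I)
      have "\<psi> (c \<odot>\<^bsub>M\<^esub> v) = (\<lambda>m. smat c (\<psi> v m))" by (rule ext) (simp add: \<psi>_smult vC)
      then show "\<psi> (actP T (c \<odot>\<^bsub>P\<^esub> v)) m = \<psi> (c \<odot>\<^bsub>P\<^esub> actP T v) m" for m
        using vC T by (simp add: actP_C \<psi>_smult hat_right)
    qed (use vC T in \<open>auto simp: actP_C\<close>)
    { assume w: "w \<in> carrier P"
      then have wC: "w \<in> C" by (simp add: PC_C)
      show "actP T (v \<oplus>\<^bsub>P\<^esub> w) = actP T v \<oplus>\<^bsub>P\<^esub> actP T w"
      proof (rule \<psi>I)
        have "\<psi> (v \<oplus>\<^bsub>M\<^esub> w) = (\<lambda>m. \<psi> v m + \<psi> w m)" by (rule ext) (simp add: \<psi>_add vC wC)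
        then show "\<psi> (actP T (v \<oplus>\<^bsub>P\<^esub> w)) m = \<psi> (actP T v \<oplus>\<^bsub>P\<^esub> actP T w) m" for m
          using vC wC T by (simp add: actP_C \<psi>_add hat_right)
      qed (use vC wC T in \<open>auto simp: actP_C\<close>) }
    { assume S: "S \<in> weyl"
      show "actP (\<lambda>f. S f + T f) v = actP S v \<oplus>\<^bsub>P\<^esub> actP T v"
        using vC S T by (intro \<psi>I) (auto simp: actP_C weyl.add \<psi>_add hat_add weyl_banded)
      show "actP (\<lambda>f. S (T f)) v = actP S (actP T v)"
        using vC S T by (intro \<psi>I) (auto simp: actP_C weyl.comp hat_comp weyl_banded) }
  qed
qed

inductive_set uspan :: "(int ^ 'd \<Rightarrow> complex fmat) set \<Rightarrow> (int ^ 'd \<Rightarrow> complex fmat) set" for N where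
  zero: "(\<lambda>m. 0) \<in> uspan N"
| base: "u \<in> S.U \<Longrightarrow> F \<in> N \<Longrightarrow> (\<lambda>m. u * F m) \<in> uspan N"
| add: "F \<in> uspan N \<Longrightarrow> G \<in> uspan N \<Longrightarrow> (\<lambda>m. F m + G m) \<in> uspan N"

text \<open>U commutes with translations and coordinate multiplications and contains every
  \<open>x i r\<close>. Hence U N is stable under the whole action once N is stable under the
  former, and simplicity applies to it.\<close>

lemma uspan_full:
  assumes N: "N \<subseteq> \<psi> ` C" and scale: "\<And>c F. F \<in> N \<Longrightarrow> (\<lambda>m. smat c (F m)) \<in> N"
    and shift: "\<And>r F. F \<in> N \<Longrightarrow> (\<lambda>m. F (m - r)) \<in> N"
    and euler: "\<And>i F. F \<in> N \<Longrightarrow> (\<lambda>m. smat (of_int (m $ i)) (F m)) \<in> N"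
    and nz: "F0 \<in> N" "F0 \<noteq> (\<lambda>m. 0)"
  shows "uspan N = \<psi> ` C"
proof -
  have "uspan N = {\<lambda>m. 0} \<or> uspan N = \<psi> ` C"
  proof (rule S.M_simple)
    show "uspan N \<subseteq> \<psi> ` C"
    proof
      fix F assume "F \<in> uspan N"
      then show "F \<in> \<psi> ` C"
      proof induction
        case zero
        show ?case by (rule S.M_zero)
      next
        case (base u F)
        have "F \<in> \<psi> ` C" using N base(2) by blast
        then show ?case by (rule S.M_U[OF base(1)])
      next
        case (add F G)
        then show ?case by (intro S.M_add)
      qed
    qed
    show "(\<lambda>m. smat c (F m)) \<in> uspan N" if "F \<in> uspan N" for c F using that
    proof induction
      case (base u F)
      then show ?case using uspan.base[OF base(1) scale[OF base(2)], of c] by (simp add: smat_mult_right)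
    qed (auto simp: smat_add intro: uspan.intros)
    show "(\<lambda>m. F (m - r)) \<in> uspan N" if "F \<in> uspan N" for r F using that
    proof induction
      case (base u F)
      then show ?case using uspan.base[OF base(1) shift[OF base(2)], of r] by simp
    next
      case (add F G)
      then show ?case using uspan.add by fast
    qed (auto intro: uspan.intros)
    show "(\<lambda>m. smat (of_int (m $ i)) (F m)) \<in> uspan N" if "F \<in> uspan N" for i F using that
    proof induction
      case (base u F)
      then show ?case using uspan.base[OF base(1) euler[OF base(2)], of i] by (simp add: smat_mult_right)
    next
      case (add F G)
      then show ?case using uspan.add[OF add.IH] by (simp add: smat_add)
    qed (auto intro: uspan.intros)
    show "(\<lambda>m. x i r * F m) \<in> uspan N" if "F \<in> uspan N" for i r F using that
    proof induction
      case (base u F)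
      then show ?case using uspan.base[OF S.U.mult[OF S.U.gen base(1)] base(2), of i r]
        by (simp add: mult.assoc)
    next
      case (add F G)
      then show ?case using uspan.add[OF add.IH] by (simp add: distrib_left)
    qed (auto intro: uspan.intros)
  qed (rule uspan.intros; assumption)+
  moreover have "F0 \<in> uspan N"
  proof -
    have "F0 \<in> \<psi> ` C" using N nz by blast
    then have "(\<lambda>m. idm n * F0 m) = F0" using S.val by auto
    then show ?thesis using uspan.base[OF S.U.one nz(1)] by simp
  qed
  ultimately show ?thesis using nz(2) by blast
qed

text \<open>For a nonzero submodule N of P, U N is all of M. Then P = e M = e U N = e U e N, which
  lies in N because e U e consists of multiples of e.\<close>

lemma simple_P: "simple_action weyl P actP"
  unfolding simple_action_def
proof (intro conjI allI impI)
  have "q \<in> PC" using q by (simp add: PC_def)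
  then show "carrier P \<noteq> {\<zero>\<^bsub>P\<^esub>}" using q(3) by auto
  fix N assume "submodule N complex_ring P \<and> (\<forall>T\<in>weyl. \<forall>v\<in>N. actP T v \<in> N)"
  then have sub: "submodule N complex_ring P" and st: "\<And>T v. T \<in> weyl \<Longrightarrow> v \<in> N \<Longrightarrow> actP T v \<in> N" by auto
  note subE = Module.module.submoduleE[OF P_module sub]
  have NP: "N \<subseteq> PC" using subE(1) by simp
  have N_add: "v \<oplus>\<^bsub>M\<^esub> w \<in> N" if "v \<in> N" "w \<in> N" for v w using subE(5)[OF that] by simp
  have N_sc: "c \<odot>\<^bsub>M\<^esub> v \<in> N" if "v \<in> N" for c v using subE(4)[of c v] that by simp
  have N0: "\<zero>\<^bsub>M\<^esub> \<in> N"
  proof -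
    obtain v where v: "v \<in> N" using subE(2) by blast
    have "0 \<odot>\<^bsub>M\<^esub> v = \<zero>\<^bsub>M\<^esub>" using v NP PC_C by (intro \<psi>I) (auto simp: \<psi>_smult \<psi>_zero)
    then show ?thesis using N_sc[OF v, of 0] by simp
  qed
  show "N = {\<zero>\<^bsub>P\<^esub>} \<or> N = carrier P"
  proof (cases "N = {\<zero>\<^bsub>M\<^esub>}")
    case False
    then obtain v0 where v0: "v0 \<in> N" "v0 \<noteq> \<zero>\<^bsub>M\<^esub>" using N0 by blast
    have NC: "N \<subseteq> C" using NP PC_C by blast
    have [simp]: "v \<in> C" if "v \<in> N" for v using that NC by blast
    have img: "G \<in> \<psi> ` N" if "v \<in> N" "T \<in> weyl" "\<And>m. G m = hat T (\<psi> v) m" for G v T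
    proof -
      have "v \<in> C" using that NC by blast
      then have "\<psi> (actP T v) = G" using actP_C(2)[OF that(2)] that(3) by auto
      then show ?thesis using st[OF that(2,1)] by blast
    qed
    have full: "uspan (\<psi> ` N) = \<psi> ` C"
    proof (rule uspan_full)
      show "\<psi> ` N \<subseteq> \<psi> ` C" using NC by blast
      show "\<psi> v0 \<in> \<psi> ` N" using v0 by blast
      show "\<psi> v0 \<noteq> (\<lambda>m. 0)"
      proof
        assume "\<psi> v0 = (\<lambda>m. 0)"
        then have "v0 = \<zero>\<^bsub>M\<^esub>" using v0 NC by (intro \<psi>_inj) (auto simp: \<psi>_zero')
        then show False using v0 by simp
      qed
      show "(\<lambda>m. smat c (F m)) \<in> \<psi> ` N" if F: "F \<in> \<psi> ` N" for c F
      proof -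
        obtain v where v: "v \<in> N" "F = \<psi> v" using F by blast
        have cv: "\<psi> (c \<odot>\<^bsub>M\<^esub> v) = (\<lambda>m. smat c (F m))" using v NC by (auto simp: \<psi>_smult)
        show ?thesis unfolding cv[symmetric] by (rule imageI[OF N_sc[OF v(1)]])
      qed
      show "(\<lambda>m. F (m - r)) \<in> \<psi> ` N" if F: "F \<in> \<psi> ` N" for r F
      proof -
        obtain v where v: "v \<in> N" "F = \<psi> v" using F by blast
        show ?thesis by (rule img[OF v(1) weyl.xmon[of r]]) (simp add: hat_xmon v(2))
      qed
      show "(\<lambda>m. smat (of_int (m $ i)) (F m)) \<in> \<psi> ` N" if F: "F \<in> \<psi> ` N" for i F
      proof -
        obtain v where v: "v \<in> N" "F = \<psi> v" using F by blast
        show ?thesis by (rule img[OF v(1) weyl.euler[of i]]) (simp add: hat_euler v(2))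
      qed
    qed
    have proj: "(\<lambda>m. e * F m) \<in> \<psi> ` N" if "F \<in> uspan (\<psi> ` N)" for F
      using that
    proof induction
      case zero
      then show ?case using N0 by (auto simp flip: \<psi>_zero')
    next
      case (base u F)
      then obtain v where v: "v \<in> N" "F = \<psi> v" by blast
      obtain c where c: "e * u * e = smat c e" using eU base(1) by blast
      have vP: "e * \<psi> v m = \<psi> v m" for m using v NP by (auto simp: PC_def)
      have "e * (u * F m) = smat c (\<psi> v m)" for m
      proof -
        have "e * (u * F m) = (e * u * e) * \<psi> v m" by (simp add: mult.assoc v(2) vP)
        then show ?thesis by (simp add: c smat_mult_left vP)
      qed
      moreover have "\<psi> (c \<odot>\<^bsub>M\<^esub> v) m = smat c (\<psi> v m)" for m using v NC by (auto simp: \<psi>_smult)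
      ultimately have "(\<lambda>m. e * (u * F m)) = \<psi> (c \<odot>\<^bsub>M\<^esub> v)" by auto
      then show ?case using N_sc[OF v(1), of c] by auto
    next
      case (add F G)
      then obtain v w where vw: "v \<in> N" "w \<in> N" "(\<lambda>m. e * F m) = \<psi> v" "(\<lambda>m. e * G m) = \<psi> w" by blast
      have "(\<lambda>m. e * (F m + G m)) = \<psi> (v \<oplus>\<^bsub>M\<^esub> w)"
        using vw NC fun_cong[OF vw(3)] fun_cong[OF vw(4)] by (intro ext) (auto simp: distrib_left \<psi>_add)
      then show ?case using N_add[OF vw(1,2)] by auto
    qed
    have "v \<in> N" if v: "v \<in> PC" for v
    proof -
      have "(\<lambda>m. e * \<psi> v m) \<in> \<psi> ` N" using full v PC_C by (intro proj) auto
      then obtain w where "w \<in> N" "(\<lambda>m. e * \<psi> v m) = \<psi> w" by blast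
      then have "\<psi> v = \<psi> w" using v by (auto simp: PC_def)
      then have "v = w" using v NC \<open>w \<in> N\<close> by (intro \<psi>_inj) (auto simp: PC_def)
      then show ?thesis using \<open>w \<in> N\<close> by simp
    qed
    then show ?thesis using NP by auto
  qed simp
qed

lemma simple_weyl_P: "simple_weyl_module P actP"
  by (simp add: simple_weyl_module_def weyl_module_P simple_P)

subsection \<open>Freeness of the Weyl module\<close>

definition "Te v = \<tau> (\<lambda>m. e * \<psi> v m)"

lemma Te: "v \<in> C \<Longrightarrow> Te v \<in> C" "v \<in> C \<Longrightarrow> \<psi> (Te v) m = e * \<psi> v m"
  unfolding Te_def using \<tau>_U[OF e(1)] by auto

lemma Te_add: "v \<in> C \<Longrightarrow> w \<in> C \<Longrightarrow> Te (v \<oplus>\<^bsub>M\<^esub> w) = Te v \<oplus>\<^bsub>M\<^esub> Te w"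
  by (rule \<psi>I) (simp_all add: Te \<psi>_add distrib_left)

lemma Te_\<mu>: "v \<in> C \<Longrightarrow> Te (\<mu> p v) = \<mu> p (Te v)"
  by (rule \<psi>I) (simp_all add: Te \<psi>_\<mu> smat_mult_right)

lemma Te_xs: "v \<in> C \<Longrightarrow> Te (xs r v) = xs r (Te v)"
  by (rule \<psi>I) (simp_all add: Te \<psi>_xs)

lemma Te_PC: "v \<in> PC \<longleftrightarrow> v \<in> C \<and> Te v = v"
proof
  assume v: "v \<in> PC"
  then have "Te v = v" by (intro \<psi>I) (auto simp: Te PC_def)
  then show "v \<in> C \<and> Te v = v" using v PC_C by simp
next
  assume v: "v \<in> C \<and> Te v = v"
  then have "e * \<psi> v m = \<psi> v m" for m using Te(2)[of v m] by simp
  then show "v \<in> PC" using v by (simp add: PC_def)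
qed

text \<open>The projection onto P as a matrix over U(h); its image is P in coordinates, so splitting
  it means finding a basis of P.\<close>

abbreviation "E \<equiv> Cd.tmat Te"

lemma E_idem: "E * E = E"
proof -
  have "Cd.tmat (\<lambda>v. Te (Te v)) = E * fmap (\<lambda>p. p) E"
    by (rule Cd.tmat_comp) (simp_all add: Te Te_add Te_\<mu> rhom_id)
  moreover have "Cd.tmat (\<lambda>v. Te (Te v)) = E"
  proof (rule Cd.tmat_cong)
    fix v assume v: "v \<in> C"
    show "Te (Te v) = Te v"
      by (rule \<psi>I) (use v e(2) in \<open>simp_all add: Te mult.assoc[symmetric]\<close>)
  qed
  moreover have "fmap (\<lambda>p. p) E = E" by (rule fmat_eqI) (simp add: rhom_id)
  ultimately show ?thesis by simp
qed

text \<open>The operator W = x^(-e_j) commutes with e and is semilinear for the shift by +e_j, so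
  its matrix G satisfies G E(s + e_j) = E(s) G. The shifted matrix H of x^(e_j) inverts G, and E(s +
  e_j) = (H E) (E G).\<close>

lemma E_shift: "mvn (fmap (pshift (unit1 j)) E) E"
proof -
  let ?W = "xs (- axis j 1)" and ?W' = "xs (axis j 1)"
  let ?s = "pshift (unit1 j) :: 'd U_h \<Rightarrow> 'd U_h" and ?t = "pshift (\<lambda>i. - of_int (axis j 1 $ i)) :: 'd U_h \<Rightarrow> 'd U_h"
  have ax: "(\<lambda>i. - of_int ((- axis j (1::int)) $ i)) = (unit1 j :: 'd \<Rightarrow> complex)" by (auto simp: axis_def)
  have W: "?W v \<in> C" "?W (\<mu> p v) = \<mu> (?s p) (?W v)" if "v \<in> C" for v p
    using that xs_\<mu>[OF that, of "- axis j 1" p] by (simp_all only: ax closed)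
  have W': "?W' (\<mu> p v) = \<mu> (?t p) (?W' v)" if "v \<in> C" for v p by (rule xs_\<mu>[OF that])
  have id: "fmap (\<lambda>p. p) A = A" for A :: "'d U_h fmat" by (rule fmat_eqI) (simp add: rhom_id)
  have "Cd.tmat (\<lambda>v. ?W (Te v)) = Cd.tmat ?W * fmap ?s E"
    by (rule Cd.tmat_comp) (simp_all add: W Te xs_add rhom_pshift)
  moreover have "Cd.tmat (\<lambda>v. Te (?W v)) = E * fmap (\<lambda>p. p) (Cd.tmat ?W)"
    by (rule Cd.tmat_comp) (simp_all add: Te Te_add Te_\<mu> rhom_id)
  moreover have "Cd.tmat (\<lambda>v. ?W (Te v)) = Cd.tmat (\<lambda>v. Te (?W v))"
    by (rule Cd.tmat_cong) (simp add: Te_xs)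
  ultimately have GE: "Cd.tmat ?W * fmap ?s E = E * Cd.tmat ?W" by (simp add: id)
  have "Cd.tmat (\<lambda>v. ?W (?W' v)) = Cd.tmat ?W * fmap ?s (Cd.tmat ?W')"
    by (rule Cd.tmat_comp) (simp_all add: W xs_add rhom_pshift)
  moreover have "Cd.tmat (\<lambda>v. ?W (?W' v)) = Cd.tmat (\<lambda>v. v)"
    by (rule Cd.tmat_cong) (simp add: xs_xs)
  ultimately have GH: "Cd.tmat ?W * fmap ?s (Cd.tmat ?W') = idm n" by (simp add: Cd.tmat_id)
  have "Cd.tmat (\<lambda>v. ?W' (?W v)) = Cd.tmat ?W' * fmap ?t (Cd.tmat ?W)"
    by (rule Cd.tmat_comp) (simp_all add: W' xs_add rhom_pshift)
  moreover have "Cd.tmat (\<lambda>v. ?W' (?W v)) = Cd.tmat (\<lambda>v. v)"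
    by (rule Cd.tmat_cong) (simp add: xs_xs)
  ultimately have WW: "Cd.tmat ?W' * fmap ?t (Cd.tmat ?W) = idm n" by (simp only: Cd.tmat_id)
  have "fmap ?s (Cd.tmat ?W' * fmap ?t (Cd.tmat ?W)) = idm n"
    unfolding WW by (rule fmap_idm[OF rhom_pshift])
  moreover have "fmap ?s (fmap ?t (Cd.tmat ?W)) = Cd.tmat ?W"
  proof (rule fmat_eqI)
    have "(\<lambda>i. unit1 j i + - of_int (axis j 1 $ i)) = (\<lambda>i. 0 :: complex)" by (auto simp: axis_def)
    then have "?s (?t p) = p" for p unfolding pshift_pshift by (simp only: pshift_0)
    then show "ent (fmap ?s (fmap ?t (Cd.tmat ?W))) k l = ent (Cd.tmat ?W) k l" for k l
      by (simp add: rhom_pshift)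
  qed
  ultimately have HG: "fmap ?s (Cd.tmat ?W') * Cd.tmat ?W = idm n"
    by (simp add: fmap_mult rhom_pshift)
  let ?G = "Cd.tmat ?W" and ?H = "fmap ?s (Cd.tmat ?W')"
  have "(?H * E) * (E * ?G) = ?H * (E * E) * ?G" by (simp only: mult.assoc)
  also have "\<dots> = ?H * (?G * fmap ?s E)" by (simp only: E_idem GE mult.assoc)
  also have "\<dots> = idm n * fmap ?s E" by (simp only: HG mult.assoc[symmetric])
  also have "\<dots> = fmap ?s E" by (rule idm_mult) (intro fbd_fmap rhom_pshift Cd.fbd_tmat)
  finally have 1: "fmap ?s E = (?H * E) * (E * ?G)" by simp
  have "(E * ?G) * (?H * E) = E * (?G * ?H) * E" by (simp only: mult.assoc)
  also have "\<dots> = E * E" by (simp add: GH Cd.fbd_tmat)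
  finally have 2: "E = (E * ?G) * (?H * E)" by (simp add: E_idem)
  show ?thesis unfolding mvn_def using 1 2 by blast
qed

lemma free_P: "U_h_free_of_finite_rank P (weyl_restrict actP)"
proof -
  obtain p f0 g0 where fg0: "f0 * g0 = E" "g0 * f0 = idm p" using shift_idem_split[OF E_idem E_shift] by blast
  \<comment> \<open>Trims the factors to inner dimension \<open>p\<close>; the ones obtained may
    have entries outside that range.\<close>
  define f where "f = f0 * idm p"
  define g where "g = idm p * g0"
  have "f * g = f0 * (idm p * idm p) * g0" by (simp only: f_def g_def mult.assoc)
  also have "\<dots> = f0 * (g0 * f0) * g0" by (simp only: idm_idem fg0)
  also have "\<dots> = (f0 * g0) * (f0 * g0)" by (simp only: mult.assoc)
  finally have fg: "f * g = E" by (simp only: fg0 E_idem)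
  have "g * f = idm p * (g0 * f0) * idm p" by (simp only: f_def g_def mult.assoc)
  then have gf: "g * f = idm p" by (simp add: fg0)
  have fp: "f * idm p = f" by (simp add: f_def mult.assoc)
  have gp: "idm p * g = g" by (simp add: g_def mult.assoc[symmetric])
  have Ef: "E * f = f" by (simp only: fg[symmetric] mult.assoc gf fp)
  have row0: "ent (A * B) k l = 0" if "fbd N A" "N \<le> k" for A B :: "'d U_h fmat" and N k l
    using that by (simp add: ent_times[of N] fbd_def)
  have f_row: "ent (f * h) k l = 0" if "n \<le> k" for k l h
    using row0[OF Cd.fbd_tmat that, of Te "f * h" l] by (simp add: Ef mult.assoc[symmetric])
  have g_row: "ent (g * h) k l = 0" if "p \<le> k" for k l h
    using row0[OF fbd_idm that, of "g * h" l] by (simp add: gp mult.assoc[symmetric])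
  define col where "col v = mkm (max n 1) (\<lambda>k l. if l = 0 then \<kappa> v k else 0)" for v
  have col: "ent (col v) k l = (if l = 0 then \<kappa> v k else 0)" if "v \<in> C" for v k l
    using Cd.coord_bd[OF that, of k] by (auto simp: col_def)
  have col_Te: "col (Te v) = E * col v" if v: "v \<in> C" for v
  proof (rule fmat_eqI)
    fix k l
    have "\<kappa> (Te v) k = (\<Sum>l<n. ent E k l * \<kappa> v l)"
      by (rule Cd.semilinear_tmat) (use v in \<open>simp_all add: Te Te_add Te_\<mu> rhom_id\<close>)
    then show "ent (col (Te v)) k l = ent (E * col v) k l"
      using v by (simp add: col Te ent_times[of n] Cd.fbd_tmat)
  qed
  have col_inj: "v = w" if "v \<in> C" "w \<in> C" "col v = col w" for v w
    by (rule eqI) (use that col[of v _ 0] col[of w _ 0] in auto)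
  \<comment> \<open>The splitting read as a change of coordinates: \<open>g\<close> maps the old
    coordinates of a vector of P to its new ones, and \<open>f\<close> maps back.\<close>
  define \<kappa>' where "\<kappa>' v k = ent (g * col v) k 0" for v k
  have gcol: "ent (g * col v) k l = (if l = 0 then \<kappa>' v k else 0)" if v: "v \<in> C" for v k l
  proof -
    obtain N where N: "fbd N g" using ex_fbd by blast
    show ?thesis using v by (auto simp: \<kappa>'_def ent_times[of N] N col)
  qed
  have bij: "bij_betw \<kappa>' PC {h. \<forall>k\<ge>p. h k = 0}"
  proof (rule bij_betw_imageI)
    show "inj_on \<kappa>' PC"
    proof (rule inj_onI)
      fix v w assume vw: "v \<in> PC" "w \<in> PC" "\<kappa>' v = \<kappa>' w"
      then have C: "v \<in> C" "w \<in> C" by (auto simp: PC_C)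
      have "g * col v = g * col w" by (rule fmat_eqI) (simp add: gcol C vw)
      then have "E * col v = E * col w" by (simp only: fg[symmetric] mult.assoc)
      then have "col v = col w" using vw by (simp add: Te_PC flip: col_Te)
      then show "v = w" using col_inj C by blast
    qed
    show "\<kappa>' ` PC = {h. \<forall>k\<ge>p. h k = 0}"
    proof (intro equalityI subsetI)
      fix h :: "nat \<Rightarrow> 'd U_h" assume h: "h \<in> {h. \<forall>k\<ge>p. h k = 0}"
      define H where "H = mkm (max p 1) (\<lambda>k l. if l = 0 then h k else 0)"
      have H: "ent H k l = (if l = 0 then h k else 0)" for k l using h by (auto simp: H_def)
      have bd: "\<forall>k\<ge>n. ent (f * H) k 0 = 0" using f_row by simp
      define v where "v = Cd.vecC (\<lambda>k. ent (f * H) k 0)"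
      have v: "v \<in> C" "\<And>k. \<kappa> v k = ent (f * H) k 0" unfolding v_def using Cd.vecC[OF bd] by auto
      obtain N where N: "fbd N f" using ex_fbd by blast
      have colv: "col v = f * H"
        by (rule fmat_eqI) (use v in \<open>auto simp: col ent_times[of N] N H\<close>)
      have "col (Te v) = col v" using v by (simp add: col_Te colv Ef mult.assoc[symmetric])
      then have vP: "v \<in> PC" using col_inj[OF Te(1)] v Te_PC by blast
      have pH: "idm p * H = H"
      proof (rule fmat_eqI)
        fix k l
        have "ent (idm p * H) k l = (\<Sum>j<p. ent (idm p) k j * ent H j l)" by (rule ent_times) simp
        also have "\<dots> = (\<Sum>j<p. if j = k then ent H k l else 0)"
          by (rule sum.cong) (auto simp: ent_idm)
        finally show "ent (idm p * H) k l = ent H k l" using h by (auto simp: H)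
      qed
      have gH: "g * col v = H" by (simp add: colv mult.assoc[symmetric] gf pH)
      have "\<kappa>' v = h" by (rule ext) (simp add: \<kappa>'_def gH H)
      then show "h \<in> \<kappa>' ` PC" using vP by blast
    qed (auto simp: \<kappa>'_def g_row)
  qed
  have col_add: "col (v \<oplus>\<^bsub>M\<^esub> w) = col v + col w" if "v \<in> C" "w \<in> C" for v w
    by (rule fmat_eqI) (simp add: col that kk)
  have col_\<mu>: "col (\<mu> p v) = smat p (col v)" if "v \<in> C" for v p
    by (rule fmat_eqI) (simp add: col that kk)
  have PC_\<mu>: "\<mu> p v \<in> PC" if "v \<in> PC" for v p
    using that PC_C[OF that] by (simp add: PC_def \<psi>_\<mu> smat_mult_right)
  have PC_add: "v \<oplus>\<^bsub>M\<^esub> w \<in> PC" if "v \<in> PC" "w \<in> PC" for v w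
    using that by (simp add: PC_def \<psi>_add distrib_left)
  have "coords PC (add M) \<mu> \<kappa>' p"
    by unfold_locales
      (simp_all add: bij PC_add PC_\<mu> \<kappa>'_def PC_C col_add col_\<mu> distrib_left smat_mult_right)
  moreover
  let ?N = "module_record (carrier P) (add P) \<zero>\<^bsub>P\<^esub> \<mu>"
  interpret Pm: Module.module complex_ring P by (rule P_module)
  interpret Rm: Module.module ring_of_type_algebra "module_record C (add M) \<zero>\<^bsub>M\<^esub> \<mu>" by (rule \<mu>_module)
  have "Module.module ring_of_type_algebra ?N"
  proof (rule moduleI[OF cring_from_type_algebra abelian_group_module_record])
    show "abelian_group P" by unfold_locales
  qed (use PC_\<mu> Rm.smult_l_distr Rm.smult_r_distr Rm.smult_assoc1 Rm.smult_one PC_C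
      in \<open>auto simp: module_record_def\<close>)
  ultimately have "free_of_finite_rank ring_of_type_algebra ?N"
    by (intro free_of_coordinates[of _ \<kappa>' p]) (simp_all add: module_record_def)
  moreover have "\<mu> (U_h_var i) v = weyl_restrict actP (of_D (axis i 1) 0) v" if v: "v \<in> PC" for i v
  proof (rule \<psi>I)
    have T: "(\<lambda>f. witt_D (axis i 1) 0 f + 0 * f) \<in> weyl" by (rule ext_witt_in_weyl[OF witt_D_in_witt])
    have vC: "v \<in> C" using v by (rule PC_C)
    show "\<mu> (U_h_var i) v \<in> C" "weyl_restrict actP (of_D (axis i 1) 0) v \<in> C"
      using vC actP_C(1)[OF T vC] by (simp_all add: weyl_restrict_def)
    have "(\<Sum>k\<in>UNIV. axis i 1 $ k * of_int (m $ k)) = (of_int (m $ i) :: complex)" for m :: "int ^ 'd"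
      by (rule axis_dot)
    then show "\<psi> (\<mu> (U_h_var i) v) m = \<psi> (weyl_restrict actP (of_D (axis i 1) 0) v) m" for m
      using vC actP_C(2)[OF T vC] by (simp add: weyl_restrict_def \<psi>_\<mu> hat_witt_D)
  qed
  moreover have "\<mu> (U_h_const c) v = c \<odot>\<^bsub>P\<^esub> v" if "v \<in> PC" for c v using that by (simp add: \<mu>_const PC_C)
  ultimately show ?thesis
    unfolding U_h_free_of_finite_rank_def by (intro exI[of _ \<mu>]) simp
qed

end

section \<open>Transport of module structures along a bijection\<close>

lemma abelian_groupI_transport:
  assumes G: "abelian_group G" and bij: "bij_betw \<phi> (carrier G) (carrier H)"
    and add: "\<And>v w. v \<in> carrier G \<Longrightarrow> w \<in> carrier G \<Longrightarrow> \<phi> (v \<oplus>\<^bsub>G\<^esub> w) = \<phi> v \<oplus>\<^bsub>H\<^esub> \<phi> w"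
    and zero: "\<phi> \<zero>\<^bsub>G\<^esub> = \<zero>\<^bsub>H\<^esub>"
  shows "abelian_group H"
proof -
  interpret abelian_group G by (rule G)
  have im: "\<phi> v \<in> carrier H" if "v \<in> carrier G" for v using bij that by (auto simp: bij_betw_def)
  have pre: "\<exists>v\<in>carrier G. a = \<phi> v" if "a \<in> carrier H" for a using bij that by (auto simp: bij_betw_def)
  show ?thesis
  proof (rule abelian_groupI)
    show "\<zero>\<^bsub>H\<^esub> \<in> carrier H" using im[of "\<zero>\<^bsub>G\<^esub>"] zero by simp
    fix a assume "a \<in> carrier H"
    then obtain v where v: "v \<in> carrier G" "a = \<phi> v" using pre by blast
    show "\<zero>\<^bsub>H\<^esub> \<oplus>\<^bsub>H\<^esub> a = a" using add[of "\<zero>\<^bsub>G\<^esub>" v] v zero by simp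
    show "\<exists>b\<in>carrier H. b \<oplus>\<^bsub>H\<^esub> a = \<zero>\<^bsub>H\<^esub>"
    proof (rule bexI)
      show "\<phi> (\<ominus>\<^bsub>G\<^esub> v) \<oplus>\<^bsub>H\<^esub> a = \<zero>\<^bsub>H\<^esub>" using add[of "\<ominus>\<^bsub>G\<^esub> v" v] v zero by (simp add: l_neg)
    qed (use im v in simp)
    fix b assume "b \<in> carrier H"
    then obtain w where w: "w \<in> carrier G" "b = \<phi> w" using pre by blast
    have ab: "a \<oplus>\<^bsub>H\<^esub> b = \<phi> (v \<oplus>\<^bsub>G\<^esub> w)" using v w add by simp
    show "a \<oplus>\<^bsub>H\<^esub> b \<in> carrier H" unfolding ab using v w by (intro im) simp
    show "a \<oplus>\<^bsub>H\<^esub> b = b \<oplus>\<^bsub>H\<^esub> a" using ab add[of w v] v w by (simp add: a_comm)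
    fix c assume "c \<in> carrier H"
    then obtain u where u: "u \<in> carrier G" "c = \<phi> u" using pre by blast
    have "a \<oplus>\<^bsub>H\<^esub> b \<oplus>\<^bsub>H\<^esub> c = \<phi> (v \<oplus>\<^bsub>G\<^esub> w \<oplus>\<^bsub>G\<^esub> u)"
      using v w u by (simp add: add)
    also have "\<dots> = \<phi> (v \<oplus>\<^bsub>G\<^esub> (w \<oplus>\<^bsub>G\<^esub> u))" using v w u by (simp add: a_assoc)
    also have "\<dots> = a \<oplus>\<^bsub>H\<^esub> (b \<oplus>\<^bsub>H\<^esub> c)" using v w u add by simp
    finally show "a \<oplus>\<^bsub>H\<^esub> b \<oplus>\<^bsub>H\<^esub> c = a \<oplus>\<^bsub>H\<^esub> (b \<oplus>\<^bsub>H\<^esub> c)" .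
  qed
qed

text \<open>The axioms for the tensor product are not checked on cosets; they are carried over from
  M along the isomorphism.\<close>

lemma lie_module_transport:
  assumes lie: "lie_module L M act" and bij: "bij_betw \<phi> (carrier M) (carrier N)"
    and tr_add: "\<And>v w. v \<in> carrier M \<Longrightarrow> w \<in> carrier M \<Longrightarrow> \<phi> (v \<oplus>\<^bsub>M\<^esub> w) = \<phi> v \<oplus>\<^bsub>N\<^esub> \<phi> w"
    and tr_smult: "\<And>c v. v \<in> carrier M \<Longrightarrow> \<phi> (c \<odot>\<^bsub>M\<^esub> v) = c \<odot>\<^bsub>N\<^esub> \<phi> v"
    and tr_zero: "\<phi> \<zero>\<^bsub>M\<^esub> = \<zero>\<^bsub>N\<^esub>"
    and tr_act: "\<And>y v. y \<in> carrier L \<Longrightarrow> v \<in> carrier M \<Longrightarrow> \<phi> (act y v) = act' y (\<phi> v)"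
  shows "lie_module L N act'"
proof -
  interpret lie_module L M act by (rule lie)
  have ab: "abelian_group N"
    by (rule abelian_groupI_transport[OF _ bij tr_add tr_zero]) unfold_locales
  have im: "\<phi> v \<in> carrier N" if "v \<in> carrier M" for v using bij that by (auto simp: bij_betw_def)
  have pre: "\<exists>v\<in>carrier M. a = \<phi> v" if "a \<in> carrier N" for a using bij that by (auto simp: bij_betw_def)
  have mod: "Module.module complex_ring N"
  proof (rule moduleI[OF cring_from_type_algebra ab])
    fix c d :: complex and a assume "a \<in> carrier N"
    then obtain v where v: "v \<in> carrier M" "a = \<phi> v" using pre by blast
    have ca: "c \<odot>\<^bsub>N\<^esub> a = \<phi> (c \<odot>\<^bsub>M\<^esub> v)" for c using v by (simp add: tr_smult)
    show "c \<odot>\<^bsub>N\<^esub> a \<in> carrier N" unfolding ca using v by (intro im M.smult_closed) auto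
    show "(c \<oplus>\<^bsub>complex_ring\<^esub> d) \<odot>\<^bsub>N\<^esub> a = c \<odot>\<^bsub>N\<^esub> a \<oplus>\<^bsub>N\<^esub> d \<odot>\<^bsub>N\<^esub> a"
      unfolding ca using v M.smult_l_distr[of c d v] tr_add[of "c \<odot>\<^bsub>M\<^esub> v" "d \<odot>\<^bsub>M\<^esub> v"] by simp
    show "(c \<otimes>\<^bsub>complex_ring\<^esub> d) \<odot>\<^bsub>N\<^esub> a = c \<odot>\<^bsub>N\<^esub> (d \<odot>\<^bsub>N\<^esub> a)"
      unfolding ca using v M.smult_assoc1[of c d v] tr_smult[of "d \<odot>\<^bsub>M\<^esub> v" c] by simp
    show "\<one>\<^bsub>complex_ring\<^esub> \<odot>\<^bsub>N\<^esub> a = a"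
      unfolding ca using v M.smult_one[of v] by simp
    fix b assume "b \<in> carrier N"
    then obtain w where w: "w \<in> carrier M" "b = \<phi> w" using pre by blast
    have "c \<odot>\<^bsub>N\<^esub> (a \<oplus>\<^bsub>N\<^esub> b) = \<phi> (c \<odot>\<^bsub>M\<^esub> (v \<oplus>\<^bsub>M\<^esub> w))"
      using v w tr_add[of v w] tr_smult[of "v \<oplus>\<^bsub>M\<^esub> w" c] by simp
    also have "\<dots> = \<phi> (c \<odot>\<^bsub>M\<^esub> v) \<oplus>\<^bsub>N\<^esub> \<phi> (c \<odot>\<^bsub>M\<^esub> w)"
      using v w M.smult_r_distr[of c v w] tr_add[of "c \<odot>\<^bsub>M\<^esub> v" "c \<odot>\<^bsub>M\<^esub> w"] by simp
    finally show "c \<odot>\<^bsub>N\<^esub> (a \<oplus>\<^bsub>N\<^esub> b) = c \<odot>\<^bsub>N\<^esub> a \<oplus>\<^bsub>N\<^esub> c \<odot>\<^bsub>N\<^esub> b" using v w tr_smult by simp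
  qed
  interpret N: Module.module complex_ring N by (rule mod)
  have inj: "\<phi> v = \<phi> w \<Longrightarrow> v \<in> carrier M \<Longrightarrow> w \<in> carrier M \<Longrightarrow> v = w" for v w
    using bij by (auto simp: bij_betw_def dest: inj_onD)
  show ?thesis
  proof
    fix y z :: 'a and c a assume y: "y \<in> carrier L" and "a \<in> carrier N"
    then obtain v where v: "v \<in> carrier M" "a = \<phi> v" using pre by blast
    have ya: "act' y a = \<phi> (act y v)" if "y \<in> carrier L" for y using v tr_act that by simp
    show "act' y a \<in> carrier N" unfolding ya[OF y] using v y by (intro im act_closed)
    have "act' (c \<odot>\<^bsub>L\<^esub> y) a = \<phi> (c \<odot>\<^bsub>M\<^esub> act y v)"
      using v y by (subst ya) (auto simp: act_smult_left smult_closed)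
    then show "act' (c \<odot>\<^bsub>L\<^esub> y) a = c \<odot>\<^bsub>N\<^esub> act' y a" using ya[OF y] tr_smult act_closed v y by simp
    have "act' y (c \<odot>\<^bsub>N\<^esub> a) = \<phi> (act y (c \<odot>\<^bsub>M\<^esub> v))" using v y tr_act[of y "c \<odot>\<^bsub>M\<^esub> v"] tr_smult by simp
    then show "act' y (c \<odot>\<^bsub>N\<^esub> a) = c \<odot>\<^bsub>N\<^esub> act' y a"
      using ya[OF y] tr_smult act_closed v y by (simp add: act_smult_right)
    { fix b assume "b \<in> carrier N"
      then obtain w where w: "w \<in> carrier M" "b = \<phi> w" using pre by blast
      have "act' y (a \<oplus>\<^bsub>N\<^esub> b) = \<phi> (act y (v \<oplus>\<^bsub>M\<^esub> w))" using v w y tr_act[of y "v \<oplus>\<^bsub>M\<^esub> w"] tr_add by simp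
      then show "act' y (a \<oplus>\<^bsub>N\<^esub> b) = act' y a \<oplus>\<^bsub>N\<^esub> act' y b"
        using v w y tr_add tr_act act_closed by (simp add: act_add_right) }
    { assume z: "z \<in> carrier L"
      have "act' (y \<oplus>\<^bsub>L\<^esub> z) a = \<phi> (act y v \<oplus>\<^bsub>M\<^esub> act z v)"
        using v y z by (subst ya) (auto simp: act_add_left)
      then show "act' (y \<oplus>\<^bsub>L\<^esub> z) a = act' y a \<oplus>\<^bsub>N\<^esub> act' z a"
        using tr_add act_closed v y z ya by simp
      have 1: "act' y (act' z a) = \<phi> (act y (act z v))" "act' z (act' y a) = \<phi> (act z (act y v))"
        using v y z tr_act act_closed by simp_all
      have 2: "act' (bracket L y z) a = \<phi> (act y (act z v) \<ominus>\<^bsub>M\<^esub> act z (act y v))"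
        using v y z bracket_closed by (subst ya) (auto simp: act_bracket)
      show "act' (bracket L y z) a = act' y (act' z a) \<ominus>\<^bsub>N\<^esub> act' z (act' y a)"
      proof (rule minus_eqI)
        have c: "act y (act z v) \<in> carrier M" "act z (act y v) \<in> carrier M" using v y z act_closed by auto
        then show "act' (bracket L y z) a \<oplus>\<^bsub>N\<^esub> act' z (act' y a) = act' y (act' z a)"
          unfolding 1 2 by (subst tr_add[symmetric]) (auto simp: a_minus_def M.a_assoc M.l_neg)
        show "act' (bracket L y z) a \<in> carrier N" "act' y (act' z a) \<in> carrier N" "act' z (act' y a) \<in> carrier N"
          unfolding 1 2 using c by (auto intro!: im)
        show "abelian_group N" by (rule ab)
      qed }
  qed
qed

section \<open>Free vector spaces on a set of pairs\<close>

lemma free_space_simps: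
  "carrier (free_space B) = {f. Poly_Mapping.keys f \<subseteq> B}" "add (free_space B) = (+)"
  "\<zero>\<^bsub>free_space B\<^esub> = 0" "Module.module.smult (free_space B) = pm_scale"
  by (simp_all add: free_space_def module_record_def)

lemma free_space_closed:
  "Poly_Mapping.keys f \<subseteq> B \<Longrightarrow> Poly_Mapping.keys g \<subseteq> B \<Longrightarrow> Poly_Mapping.keys (f + g) \<subseteq> B"
  "Poly_Mapping.keys f \<subseteq> B \<Longrightarrow> Poly_Mapping.keys (pm_scale c f) \<subseteq> B"
  "Poly_Mapping.keys f \<subseteq> B \<Longrightarrow> Poly_Mapping.keys g \<subseteq> B \<Longrightarrow> Poly_Mapping.keys (f - g) \<subseteq> B"
  "Poly_Mapping.keys f \<subseteq> B \<Longrightarrow> Poly_Mapping.keys (- f) \<subseteq> B"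
  for f g :: "'b \<Rightarrow>\<^sub>0 complex"
  by (auto simp: in_keys_iff lookup_add lookup_minus subset_iff) (metis add_0 diff_0 neg_0_equal_iff_equal)+

lemma free_space_sum_closed:
  "(\<And>a. a \<in> A \<Longrightarrow> Poly_Mapping.keys (h a) \<subseteq> B) \<Longrightarrow> Poly_Mapping.keys (sum h A) \<subseteq> B"
  for h :: "'a \<Rightarrow> 'b \<Rightarrow>\<^sub>0 complex"
proof (induction A rule: infinite_finite_induct)
  case (insert a A)
  then show ?case using free_space_closed(1)[of "h a" B "sum h A"] by simp
qed simp_all

lemma free_space_abelian: "abelian_group (free_space B)"
proof (rule abelian_groupI)
  fix f assume "f \<in> carrier (free_space B)"
  then show "\<exists>g\<in>carrier (free_space B). g \<oplus>\<^bsub>free_space B\<^esub> f = \<zero>\<^bsub>free_space B\<^esub>"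
    by (intro bexI[of _ "- f"]) (simp_all add: free_space_simps free_space_closed)
qed (simp_all add: free_space_simps free_space_closed add_ac)

lemma free_space_module: "Module.module complex_ring (free_space B)"
  by (rule moduleI[OF cring_from_type_algebra free_space_abelian])
    (simp_all add: free_space_simps free_space_closed pm_scale_add pm_scale_add_left pm_scale_assoc)

context min_idem
begin

subsection \<open>The general linear module\<close>

definition \<rho> :: "complex ^ 'd ^ 'd \<Rightarrow> complex fmat" where
  "\<rho> A = (\<Sum>p\<in>UNIV. smat (A $ fst p $ snd p) (x (snd p) (axis (fst p) 1)))"

lemma U_sum: "(\<And>a. a \<in> A \<Longrightarrow> h a \<in> S.U) \<Longrightarrow> sum h A \<in> S.U"
  by (rule fv.subspace_sum[OF S.U_subspace])

lemma \<rho>_U: "\<rho> A \<in> S.U"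
  unfolding \<rho>_def by (intro U_sum S.U.scale S.U.gen)

lemma sum_pairs: "(\<Sum>p\<in>UNIV. h p) = (\<Sum>i\<in>UNIV. \<Sum>j\<in>UNIV. h (i, j))"
  for h :: "'d \<times> 'd \<Rightarrow> complex fmat"
  by (simp add: sum.cartesian_product)

text \<open>This is where linearity of X(u, r) in r enters: it makes the value on r u^T equal to
  X(u, r) for every lattice vector r, not only for the unit vectors that define
  \<open>\<rho>\<close>.\<close>

lemma \<rho>_outer: "\<rho> (outer r u) = (\<Sum>j\<in>UNIV. smat (u $ j) (x j r))"
proof -
  have "\<rho> (outer r u) = (\<Sum>i\<in>UNIV. \<Sum>j\<in>UNIV. smat (u $ j) (smat (of_int (r $ i)) (x j (axis i 1))))"
    by (simp add: \<rho>_def sum_pairs outer_def mult.commute)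
  also have "\<dots> = (\<Sum>j\<in>UNIV. smat (u $ j) (x j r))"
    by (subst sum.swap) (simp only: smat_sum[symmetric] S.x_linear[symmetric])
  finally show ?thesis .
qed

lemma \<rho>_add: "\<rho> (A + B) = \<rho> A + \<rho> B"
  and \<rho>_minus: "\<rho> (A - B) = \<rho> A - \<rho> B"
  and \<rho>_scale: "\<rho> (\<chi> i j. c * A $ i $ j) = smat c (\<rho> A)"
  by (simp_all add: \<rho>_def smat_add_left sum.distrib smat_minus_left sum_subtractf smat_sum)

lemma \<rho>_bracket: "\<rho> (A ** B - B ** A) = \<rho> A * \<rho> B - \<rho> B * \<rho> A"
proof -
  have prod: "\<rho> (A ** B) = (\<Sum>i\<in>UNIV. \<Sum>j\<in>UNIV. \<Sum>k\<in>UNIV. \<Sum>l\<in>UNIV.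
      smat (A $ i $ j * B $ k $ l) (if k = j then x l (axis i 1) else 0))" for A B
  proof -
    have "(\<Sum>k\<in>UNIV. \<Sum>l\<in>UNIV. smat (A $ i $ j * B $ k $ l) (if k = j then x l (axis i 1) else 0))
       = (\<Sum>l\<in>UNIV. smat (A $ i $ j * B $ j $ l) (x l (axis i 1)))" for i j
    proof -
      have "(\<Sum>l\<in>UNIV. smat (A $ i $ j * B $ k $ l) (if k = j then x l (axis i 1) else 0))
        = (if k = j then (\<Sum>l\<in>UNIV. smat (A $ i $ j * B $ j $ l) (x l (axis i 1))) else 0)" for k
        by auto
      then show ?thesis by simp
    qed
    then have "(\<Sum>i\<in>UNIV. \<Sum>j\<in>UNIV. \<Sum>k\<in>UNIV. \<Sum>l\<in>UNIV.
        smat (A $ i $ j * B $ k $ l) (if k = j then x l (axis i 1) else 0))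
      = (\<Sum>i\<in>UNIV. \<Sum>l\<in>UNIV. \<Sum>j\<in>UNIV. smat (A $ i $ j * B $ j $ l) (x l (axis i 1)))"
      by (simp only:) (intro sum.cong refl sum.swap)
    also have "\<dots> = \<rho> (A ** B)"
      by (simp add: \<rho>_def sum_pairs matrix_matrix_mult_def flip: fv.scale_sum_left)
    finally show ?thesis by simp
  qed
  have "\<rho> A * \<rho> B = (\<Sum>p\<in>UNIV. \<Sum>q\<in>UNIV. smat (A $ fst p $ snd p * B $ fst q $ snd q)
      (x (snd p) (axis (fst p) 1) * x (snd q) (axis (fst q) 1)))"
    by (simp only: \<rho>_def sum_product smat_mult_left smat_mult_right smat_smat)
      (intro sum.cong refl arg_cong2[where f = smat] mult.commute)
  moreover have "\<rho> B * \<rho> A = (\<Sum>p\<in>UNIV. \<Sum>q\<in>UNIV. smat (A $ fst p $ snd p * B $ fst q $ snd q)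
      (x (snd q) (axis (fst q) 1) * x (snd p) (axis (fst p) 1)))"
    by (simp only: \<rho>_def sum_product smat_mult_left smat_mult_right smat_smat)
      (rule sum.swap)
  ultimately have "\<rho> A * \<rho> B - \<rho> B * \<rho> A = (\<Sum>p\<in>UNIV. \<Sum>q\<in>UNIV. smat (A $ fst p $ snd p * B $ fst q $ snd q)
      (x (snd p) (axis (fst p) 1) * x (snd q) (axis (fst q) 1) - x (snd q) (axis (fst q) 1) * x (snd p) (axis (fst p) 1)))"
    by (simp only: smat_minus sum_subtractf)
  also have "\<dots> = (\<Sum>p\<in>UNIV. \<Sum>q\<in>UNIV. smat (A $ fst p $ snd p * B $ fst q $ snd q)
      (if fst q = snd p then x (snd q) (axis (fst p) 1) else 0))
    - (\<Sum>p\<in>UNIV. \<Sum>q\<in>UNIV. smat (A $ fst p $ snd p * B $ fst q $ snd q)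
      (if fst p = snd q then x (snd p) (axis (fst q) 1) else 0))"
    by (simp only: S.x_gl_bracket smat_minus sum_subtractf)
  also have "(\<Sum>p\<in>UNIV. \<Sum>q\<in>UNIV. smat (A $ fst p $ snd p * B $ fst q $ snd q)
      (if fst q = snd p then x (snd q) (axis (fst p) 1) else 0)) = \<rho> (A ** B)"
    by (simp only: prod[symmetric] sum_pairs fst_conv snd_conv)
  also have "(\<Sum>p\<in>UNIV. \<Sum>q\<in>UNIV. smat (A $ fst p $ snd p * B $ fst q $ snd q)
      (if fst p = snd q then x (snd p) (axis (fst q) 1) else 0)) = \<rho> (B ** A)"
    by (subst sum.swap)
      (simp only: prod[symmetric] sum_pairs fst_conv snd_conv mult.commute[of "A $ _ $ _"])
  finally show ?thesis by (simp add: \<rho>_minus)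
qed

text \<open>The left ideal U e, which acting on \<open>q\<close> becomes V = U q. An element of V
  has many coefficients in U but only one in U e, which \<open>lam\<close> selects.\<close>

definition "LI = (\<lambda>u. u * e) ` S.U"
definition "VC = {v \<in> C. \<exists>u\<in>S.U. \<forall>m. \<psi> v m = u * \<psi> q m}"
definition "lam y = (THE u. u \<in> LI \<and> (\<forall>m. \<psi> y m = u * \<psi> q m))"
definition "V = M\<lparr>carrier := VC\<rparr>"
definition "actV A v = \<tau> (\<lambda>m. \<rho> A * \<psi> v m)"

lemma V_simps [simp]: "carrier V = VC" "add V = add M" "\<zero>\<^bsub>V\<^esub> = \<zero>\<^bsub>M\<^esub>"
  "Module.module.smult V = Module.module.smult M"
  by (simp_all add: V_def)

lemma LI: "u \<in> LI \<Longrightarrow> u \<in> S.U" "u \<in> LI \<Longrightarrow> u * e = u" "u \<in> S.U \<Longrightarrow> u * e \<in> LI"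
  "u \<in> S.U \<Longrightarrow> w \<in> LI \<Longrightarrow> u * w \<in> LI"
  unfolding LI_def using S.U.mult e by (auto simp: mult.assoc) (metis S.U.mult image_eqI mult.assoc)

lemma LI_subspace: "fv.subspace LI"
proof (rule fv.subspaceI)
  show "0 \<in> LI" using LI(3)[OF fv.subspace_0[OF S.U_subspace]] by simp
  show "a + b \<in> LI" if "a \<in> LI" "b \<in> LI" for a b
    using LI(3)[OF S.U.add[OF LI(1)[OF that(1)] LI(1)[OF that(2)]]] that by (simp add: distrib_right LI)
  show "smat c a \<in> LI" if "a \<in> LI" for c a
    using LI(3)[OF S.U.scale[OF LI(1)[OF that]], of c] that by (simp add: smat_mult_left LI)
qed

lemma scalar: "u \<in> LI \<Longrightarrow> w \<in> S.U \<Longrightarrow> \<exists>c. e * w * u = smat c e"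
proof -
  assume u: "u \<in> LI" "w \<in> S.U"
  have "e * (w * u) * e = e * w * u" using LI(2)[OF u(1)] by (simp add: mult.assoc)
  then show ?thesis using eU[OF S.U.mult[OF u(2) LI(1)[OF u(1)]]] by simp
qed

text \<open>For u \<noteq> 0, primeness gives w with e w u = c e and c \<noteq> 0. Applied to q this
  yields c q = e w (u q), so u cannot kill q.\<close>

lemma LI_zero:
  assumes u: "u \<in> LI" and z: "\<And>m. u * \<psi> q m = 0"
  shows "u = 0"
proof (rule ccontr)
  assume "u \<noteq> 0"
  then obtain w where w: "w \<in> S.U" "e * w * u \<noteq> 0" using S.U_prime[OF e(1,3) LI(1)[OF u]] by blast
  obtain c where c: "e * w * u = smat c e" using scalar[OF u w(1)] by blast
  then have c0: "c \<noteq> 0" using w(2) by auto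
  obtain m where m: "\<psi> q m \<noteq> 0" using q_nz by blast
  have "smat c (\<psi> q m) = smat c e * \<psi> q m" using q(2) by (simp add: smat_mult_left)
  also have "\<dots> = e * w * (u * \<psi> q m)" by (simp only: c[symmetric] mult.assoc)
  also have "\<dots> = smat c 0" by (simp add: z)
  finally show False using smat_cancel[OF c0] m by blast
qed

lemma lamI:
  assumes u: "u \<in> LI" and y: "\<And>m. \<psi> y m = u * \<psi> q m"
  shows "lam y = u"
  unfolding lam_def
proof (rule the_equality)
  show "u \<in> LI \<and> (\<forall>m. \<psi> y m = u * \<psi> q m)" using assms by blast
  fix w assume w: "w \<in> LI \<and> (\<forall>m. \<psi> y m = w * \<psi> q m)"
  have "w - u = 0"
  proof (rule LI_zero)
    show "w - u \<in> LI" using w u fv.subspace_diff[OF LI_subspace] by blast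
    show "(w - u) * \<psi> q m = 0" for m using w y[of m] by (simp add: left_diff_distrib)
  qed
  then show "w = u" by simp
qed

lemma lam: "y \<in> VC \<Longrightarrow> lam y \<in> LI" "y \<in> VC \<Longrightarrow> \<psi> y m = lam y * \<psi> q m"
proof -
  assume "y \<in> VC"
  then obtain u where u: "u \<in> S.U" "\<And>m. \<psi> y m = u * \<psi> q m" by (auto simp: VC_def)
  have ue: "\<psi> y m = (u * e) * \<psi> q m" for m by (simp add: u q(2) mult.assoc)
  then show "lam y \<in> LI" "\<psi> y m = lam y * \<psi> q m" using lamI[OF LI(3)[OF u(1)] ue] LI(3)[OF u(1)] by auto
qed

definition "vL u = \<tau> (\<lambda>m. u * \<psi> q m)"

lemma vL: "u \<in> LI \<Longrightarrow> vL u \<in> VC" "u \<in> LI \<Longrightarrow> lam (vL u) = u"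
proof -
  assume u: "u \<in> LI"
  have 1: "vL u \<in> C" "\<psi> (vL u) m = u * \<psi> q m" for m
    unfolding vL_def using \<tau>_U[OF LI(1)[OF u] q(1)] by auto
  show "vL u \<in> VC" using 1 LI(1)[OF u] by (auto simp: VC_def)
  show "lam (vL u) = u" by (rule lamI[OF u 1(2)])
qed

lemma VC_C: "v \<in> VC \<Longrightarrow> v \<in> C" by (simp add: VC_def)

lemma VC_closed: "v \<in> VC \<Longrightarrow> w \<in> VC \<Longrightarrow> v \<oplus>\<^bsub>M\<^esub> w \<in> VC" "v \<in> VC \<Longrightarrow> c \<odot>\<^bsub>M\<^esub> v \<in> VC" "\<zero>\<^bsub>M\<^esub> \<in> VC"
proof -
  show "v \<in> VC \<Longrightarrow> w \<in> VC \<Longrightarrow> v \<oplus>\<^bsub>M\<^esub> w \<in> VC"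
    unfolding VC_def using S.U.add by (auto simp: \<psi>_add simp flip: distrib_right)
  show "v \<in> VC \<Longrightarrow> c \<odot>\<^bsub>M\<^esub> v \<in> VC"
    unfolding VC_def using S.U.scale by (auto simp: \<psi>_smult simp flip: smat_mult_left)
  show "\<zero>\<^bsub>M\<^esub> \<in> VC" unfolding VC_def using fv.subspace_0[OF S.U_subspace]
    by (auto simp: \<psi>_zero intro!: bexI[of _ 0])
qed

lemma lam_add: "v \<in> VC \<Longrightarrow> w \<in> VC \<Longrightarrow> lam (v \<oplus>\<^bsub>M\<^esub> w) = lam v + lam w"
  by (rule lamI) (simp_all add: fv.subspace_add[OF LI_subspace] lam(1) \<psi>_add VC_C lam(2) distrib_right)

lemma lam_smult: "v \<in> VC \<Longrightarrow> lam (c \<odot>\<^bsub>M\<^esub> v) = smat c (lam v)"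
  by (rule lamI) (simp_all add: fv.subspace_scale[OF LI_subspace] lam(1) \<psi>_smult VC_C lam(2)[symmetric] smat_mult_left)

lemma lam_inj: "v \<in> VC \<Longrightarrow> w \<in> VC \<Longrightarrow> lam v = lam w \<Longrightarrow> v = w"
  by (rule \<psi>I) (simp_all add: VC_C lam(2))

lemma actV: "v \<in> VC \<Longrightarrow> actV A v \<in> VC" "v \<in> VC \<Longrightarrow> \<psi> (actV A v) m = \<rho> A * \<psi> v m"
  "v \<in> VC \<Longrightarrow> lam (actV A v) = \<rho> A * lam v"
proof -
  assume v: "v \<in> VC"
  show 1: "\<psi> (actV A v) m = \<rho> A * \<psi> v m" for m unfolding actV_def using \<tau>_U[OF \<rho>_U VC_C[OF v]] by simp
  have 2: "\<psi> (actV A v) m = (\<rho> A * lam v) * \<psi> q m" for m using v by (simp add: 1 lam(2) mult.assoc)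
  have 3: "\<rho> A * lam v \<in> LI" by (rule LI(4)[OF \<rho>_U lam(1)[OF v]])
  show "actV A v \<in> VC" unfolding VC_def
    using 2 LI(1)[OF 3] \<tau>_U(1)[OF \<rho>_U VC_C[OF v], of A] by (auto simp: actV_def)
  show "lam (actV A v) = \<rho> A * lam v" by (rule lamI[OF 3 2])
qed

lemma V_module: "Module.module complex_ring V"
proof -
  have "submodule VC complex_ring M"
    by (rule submodule_\<psi>I) (auto simp: VC_closed VC_C)
  then show ?thesis unfolding V_def by (rule submodule.submodule_is_module) (rule L.M.module_axioms)
qed

lemma ex_V_coords: "\<exists>\<kappa>L k. coords LI (+) smat \<kappa>L k"
  by (rule fmat_subspace_coords[OF LI_subspace]) (use LI(1) S.U_fbd in blast)

lemma V_coords: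
  assumes "coords LI (+) smat \<kappa>L k"
  shows "coords VC (add M) (Module.module.smult M) (\<lambda>v. \<kappa>L (lam v)) k"
proof -
  interpret Lc: coords LI "(+)" smat \<kappa>L k by fact
  have "bij_betw lam VC LI"
    by (rule bij_betwI[where g = vL]) (use lam(1) vL lam_inj in \<open>auto simp: Pi_def\<close>)
  then have "bij_betw (\<kappa>L \<circ> lam) VC {f. \<forall>i\<ge>k. f i = 0}" using Lc.bij by (rule bij_betw_trans)
  then show ?thesis
    by unfold_locales (simp_all add: comp_def VC_closed lam_add lam_smult Lc.coord_pl Lc.coord_ms lam(1))
qed

lemma V_fd: "finite_dimensional V"
proof -
  obtain \<kappa>L k where "coords LI (+) smat \<kappa>L k" using ex_V_coords by blast
  then show ?thesis using free_of_coordinates[OF V_module, of "\<lambda>v. \<kappa>L (lam v)" k] V_coords by simp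
qed

lemma gl_simps: "carrier gl = UNIV" "A \<oplus>\<^bsub>gl\<^esub> B = A + B" "c \<odot>\<^bsub>gl\<^esub> A = (\<chi> i j. c * A $ i $ j)"
  "bracket gl A B = A ** B - B ** A"
  by (simp_all add: gl_def)

lemma lie_module_V: "lie_module gl V actV"
proof -
  interpret g: lie_algebra "gl :: (complex ^ 'd ^ 'd) lie_alg" by (rule lie_algebra_gl)
  interpret V: Module.module complex_ring V by (rule V_module)
  show ?thesis
  proof
    fix A B :: "complex ^ 'd ^ 'd" and c v assume "v \<in> carrier V"
    then have v: "v \<in> VC" by simp
    note vs = v VC_C[OF v] actV[OF v] VC_C[OF actV(1)[OF v]]
    show "actV A v \<in> carrier V" using vs by simp
    show "actV (A \<oplus>\<^bsub>gl\<^esub> B) v = actV A v \<oplus>\<^bsub>V\<^esub> actV B v"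
      by (rule \<psi>I) (simp_all add: vs gl_simps \<psi>_add \<rho>_add distrib_right)
    show "actV (c \<odot>\<^bsub>gl\<^esub> A) v = c \<odot>\<^bsub>V\<^esub> actV A v"
      by (rule \<psi>I) (simp_all add: vs gl_simps \<psi>_smult \<rho>_scale smat_mult_left)
    show "actV A (c \<odot>\<^bsub>V\<^esub> v) = c \<odot>\<^bsub>V\<^esub> actV A v"
      by (rule \<psi>I) (simp_all add: vs VC_C actV VC_closed \<psi>_smult smat_mult_right)
    show "actV (bracket gl A B) v = actV A (actV B v) \<ominus>\<^bsub>V\<^esub> actV B (actV A v)"
    proof (rule minus_eqI)
      show "abelian_group V" by unfold_locales
      show "actV (bracket gl A B) v \<oplus>\<^bsub>V\<^esub> actV B (actV A v) = actV A (actV B v)"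
        by (rule \<psi>I) (simp_all add: vs VC_C actV gl_simps \<psi>_add \<rho>_bracket left_diff_distrib mult.assoc)
    qed (simp_all add: vs actV)
    fix w assume "w \<in> carrier V"
    then have w: "w \<in> VC" by simp
    show "actV A (v \<oplus>\<^bsub>V\<^esub> w) = actV A v \<oplus>\<^bsub>V\<^esub> actV A w"
      by (rule \<psi>I) (simp_all add: v w VC_C actV VC_closed \<psi>_add distrib_left)
  qed
qed

text \<open>A gl_d-stable subspace is U-stable. For v \<noteq> 0 in it, some e w sends v to a
  nonzero multiple of q, and q generates V.\<close>

lemma simple_V: "simple_action (carrier gl) V actV"
  unfolding simple_action_def
proof (intro conjI allI impI)
  have qV: "q \<in> VC" using q e(1) unfolding VC_def by (auto intro!: bexI[of _ e])
  then show "carrier V \<noteq> {\<zero>\<^bsub>V\<^esub>}" using q(3) by auto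
  fix N assume "submodule N complex_ring V \<and> (\<forall>A\<in>carrier gl. \<forall>v\<in>N. actV A v \<in> N)"
  then have sub: "submodule N complex_ring V" and st: "\<And>A v. v \<in> N \<Longrightarrow> actV A v \<in> N"
    by (auto simp: gl_simps)
  note subE = Module.module.submoduleE[OF V_module sub]
  have NV: "N \<subseteq> VC" using subE(1) by simp
  have N_add: "v \<oplus>\<^bsub>M\<^esub> w \<in> N" if "v \<in> N" "w \<in> N" for v w using subE(5)[OF that] by simp
  have N_sc: "c \<odot>\<^bsub>M\<^esub> v \<in> N" if "v \<in> N" for c v using subE(4)[of c v] that by simp
  have NC: "v \<in> C" if "v \<in> N" for v using that NV VC_C by blast
  have zN: "\<zero>\<^bsub>M\<^esub> \<in> N"
  proof -
    obtain v where v: "v \<in> N" using subE(2) by blast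
    have "0 \<odot>\<^bsub>M\<^esub> v = \<zero>\<^bsub>M\<^esub>" using NC[OF v] by (intro \<psi>I) (auto simp: \<psi>_smult \<psi>_zero)
    then show ?thesis using N_sc[OF v, of 0] by simp
  qed
  \<comment> \<open>Induction over U; a generator \<open>x i r\<close> is the action of the matrix r
    e_i^T of gl_d.\<close>
  have Ust: "\<forall>v\<in>N. \<exists>w\<in>N. \<forall>m. \<psi> w m = u * \<psi> v m" if "u \<in> S.U" for u
    using that
  proof induction
    case one
    have "idm n * \<psi> v m = \<psi> v m" if "v \<in> N" for v m using NC[OF that] S.val[of "\<psi> v" m] by blast
    then show ?case by metis
  next
    case (gen i r)
    have "(\<Sum>j\<in>UNIV. smat (axis i 1 $ j) (x j r)) = x i r" by (rule sum_axis_smat)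
    then have "\<rho> (outer r (axis i 1)) = x i r" by (simp add: \<rho>_outer)
    then show ?case using st NV actV(2) by (metis subsetD)
  next
    case (add A B)
    show ?case
    proof
      fix v assume "v \<in> N"
      then obtain a b where "a \<in> N" "b \<in> N" "\<forall>m. \<psi> a m = A * \<psi> v m" "\<forall>m. \<psi> b m = B * \<psi> v m"
        using add.IH by meson
      then show "\<exists>w\<in>N. \<forall>m. \<psi> w m = (A + B) * \<psi> v m"
        by (intro bexI[of _ "a \<oplus>\<^bsub>M\<^esub> b"]) (auto simp: \<psi>_add NC distrib_right N_add)
    qed
  next
    case (scale A c)
    show ?case
    proof
      fix v assume "v \<in> N"
      then obtain a where "a \<in> N" "\<forall>m. \<psi> a m = A * \<psi> v m" using scale.IH by meson
      then show "\<exists>w\<in>N. \<forall>m. \<psi> w m = smat c A * \<psi> v m"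
        by (intro bexI[of _ "c \<odot>\<^bsub>M\<^esub> a"]) (auto simp: \<psi>_smult NC smat_mult_left N_sc)
    qed
  next
    case (mult A B)
    show ?case
    proof
      fix v assume "v \<in> N"
      then obtain b where b: "b \<in> N" "\<forall>m. \<psi> b m = B * \<psi> v m" using mult.IH by meson
      then obtain a where "a \<in> N" "\<forall>m. \<psi> a m = A * \<psi> b m" using mult.IH by meson
      then show "\<exists>w\<in>N. \<forall>m. \<psi> w m = A * B * \<psi> v m" using b by (metis mult.assoc)
    qed
  qed
  show "N = {\<zero>\<^bsub>V\<^esub>} \<or> N = carrier V"
  proof (cases "N = {\<zero>\<^bsub>M\<^esub>}")
    case False
    then obtain v where v: "v \<in> N" "v \<noteq> \<zero>\<^bsub>M\<^esub>" using zN by blast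
    have vV: "v \<in> VC" using v NV by blast
    have "lam v \<noteq> 0"
    proof
      assume "lam v = 0"
      then have "v = \<zero>\<^bsub>M\<^esub>" using lam(2)[OF vV] VC_C[OF vV] by (intro \<psi>I) (auto simp: \<psi>_zero)
      then show False using v by simp
    qed
    then obtain w where w: "w \<in> S.U" "e * w * lam v \<noteq> 0" using S.U_prime[OF e(1,3) LI(1)[OF lam(1)[OF vV]]] by blast
    obtain c where c: "e * w * lam v = smat c e" using scalar[OF lam(1)[OF vV] w(1)] by blast
    then have c0: "c \<noteq> 0" using w(2) by auto
    obtain a where a: "a \<in> N" "\<forall>m. \<psi> a m = (e * w) * \<psi> v m" using Ust[OF S.U.mult[OF e(1) w(1)]] v by blast
    have "\<psi> a m = smat c (\<psi> q m)" for m
    proof -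
      have "\<psi> a m = (e * w * lam v) * \<psi> q m" using a lam(2)[OF vV] by (simp add: mult.assoc)
      then show ?thesis by (simp add: c smat_mult_left q(2))
    qed
    then have "inverse c \<odot>\<^bsub>M\<^esub> a = q" using a(1) c0 q(1) by (intro \<psi>I) (auto simp: NC \<psi>_smult)
    then have qN: "q \<in> N" using N_sc[OF a(1), of "inverse c"] by simp
    have "y \<in> N" if y: "y \<in> VC" for y
    proof -
      obtain b where b: "b \<in> N" "\<forall>m. \<psi> b m = lam y * \<psi> q m" using Ust[OF LI(1)[OF lam(1)[OF y]]] qN by blast
      then have "y = b" using lam(2)[OF y] by (intro \<psi>I) (auto simp: VC_C[OF y] NC)
      then show ?thesis using b by simp
    qed
    then show ?thesis using NV by auto
  qed simp
qed

lemma simple_lie_V: "simple_lie_module gl V actV"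
  by (simp add: simple_lie_module_def lie_module_V simple_V)

end

subsection \<open>The tensor product\<close>

lemma tensor_relatorsI:
  "z \<in> carrier P \<Longrightarrow> z' \<in> carrier P \<Longrightarrow> y \<in> carrier V \<Longrightarrow>
    pair (z \<oplus>\<^bsub>P\<^esub> z') y - pair z y - pair z' y \<in> tensor_relators P V"
  "z \<in> carrier P \<Longrightarrow> y \<in> carrier V \<Longrightarrow> y' \<in> carrier V \<Longrightarrow>
    pair z (y \<oplus>\<^bsub>V\<^esub> y') - pair z y - pair z y' \<in> tensor_relators P V"
  "z \<in> carrier P \<Longrightarrow> y \<in> carrier V \<Longrightarrow> pair (c \<odot>\<^bsub>P\<^esub> z) y - pm_scale c (pair z y) \<in> tensor_relators P V"
  "z \<in> carrier P \<Longrightarrow> y \<in> carrier V \<Longrightarrow> pair z (c \<odot>\<^bsub>V\<^esub> y) - pm_scale c (pair z y) \<in> tensor_relators P V"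
  unfolding tensor_relators_def by blast+

context min_idem
begin

abbreviation "FS \<equiv> free_space (PC \<times> VC)"

text \<open>The candidate for the isomorphism: with y = u q and u in U e, the tensor of z and y goes
  to u z. In particular z paired with q goes to e z = z.\<close>

definition \<Theta> :: "(('m \<times> 'm) \<Rightarrow>\<^sub>0 complex) \<Rightarrow> int ^ 'd \<Rightarrow> complex fmat" where
  "\<Theta> f m = lin (\<lambda>b. lam (snd b) * \<psi> (fst b) m) f"

lemma \<Theta>_simps [simp]: "\<Theta> (f + g) m = \<Theta> f m + \<Theta> g m" "\<Theta> (f - g) m = \<Theta> f m - \<Theta> g m"
  "\<Theta> (pm_scale c f) m = smat c (\<Theta> f m)" "\<Theta> 0 m = 0"
  "\<Theta> (pair z y) m = lam y * \<psi> z m"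
  by (simp_all add: \<Theta>_def lin_add lin_minus lin_scale)

lemma \<Theta>_sum: "\<Theta> (sum h A) m = (\<Sum>a\<in>A. \<Theta> (h a) m)"
  by (simp add: \<Theta>_def lin_sum)

lemma PC_closed: "v \<in> PC \<Longrightarrow> w \<in> PC \<Longrightarrow> v \<oplus>\<^bsub>M\<^esub> w \<in> PC" "v \<in> PC \<Longrightarrow> c \<odot>\<^bsub>M\<^esub> v \<in> PC" "\<zero>\<^bsub>M\<^esub> \<in> PC"
  "v \<in> PC \<Longrightarrow> xs r v \<in> PC" "v \<in> PC \<Longrightarrow> dd i v \<in> PC"
  by (auto simp: PC_def \<psi>_add \<psi>_smult \<psi>_zero \<psi>_xs \<psi>_dd distrib_left smat_mult_right)

lemma \<Theta>_in: "f \<in> carrier FS \<Longrightarrow> \<Theta> f \<in> \<psi> ` C"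
proof -
  assume f: "f \<in> carrier FS"
  have sum: "(\<lambda>m. \<Sum>a\<in>A. h a m) \<in> \<psi> ` C" if "\<And>a. a \<in> A \<Longrightarrow> h a \<in> \<psi> ` C" for A :: "('m \<times> 'm) set" and h
    using that by (induction A rule: infinite_finite_induct) (auto simp: S.M_zero intro: S.M_add)
  have "(\<lambda>m. smat c (lam (snd b) * \<psi> (fst b) m)) \<in> \<psi> ` C" if "b \<in> PC \<times> VC" for b c
    by (rule S.M_scale, rule S.M_U[OF LI(1)[OF lam(1)]]) (use that PC_C in auto)
  then have "(\<lambda>m. \<Sum>b\<in>Poly_Mapping.keys f. smat (Poly_Mapping.lookup f b) (lam (snd b) * \<psi> (fst b) m)) \<in> \<psi> ` C"
    using f by (intro sum) (auto simp: free_space_simps subset_iff)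
  then show ?thesis unfolding \<Theta>_def[abs_def] lin_def .
qed

lemma pair_in: "z \<in> PC \<Longrightarrow> y \<in> VC \<Longrightarrow> Poly_Mapping.keys (pair z y) \<subseteq> PC \<times> VC"
  by simp

text \<open>P is stable under the Weyl operators and nonzero, so U P is all of M by
  \<open>uspan_full\<close>.\<close>

lemma \<Theta>_surj: "F \<in> \<psi> ` C \<Longrightarrow> \<exists>f\<in>carrier FS. \<Theta> f = F"
proof -
  assume F: "F \<in> \<psi> ` C"
  have "uspan (\<psi> ` PC) = \<psi> ` C"
  proof (rule uspan_full)
    show "\<psi> ` PC \<subseteq> \<psi> ` C" using PC_C by blast
    show "\<psi> q \<in> \<psi> ` PC" using q by (auto simp: PC_def)
    show "\<psi> q \<noteq> (\<lambda>m. 0)" using q_nz by auto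
    show "(\<lambda>m. smat c (G m)) \<in> \<psi> ` PC" if G: "G \<in> \<psi> ` PC" for c G
    proof -
      obtain v where v: "v \<in> PC" "G = \<psi> v" using G by blast
      have "\<psi> (c \<odot>\<^bsub>M\<^esub> v) = (\<lambda>m. smat c (G m))" using v PC_C by (auto simp: \<psi>_smult)
      then show ?thesis using PC_closed(2)[OF v(1), of c] by (metis imageI)
    qed
    show "(\<lambda>m. G (m - r)) \<in> \<psi> ` PC" if G: "G \<in> \<psi> ` PC" for r G
    proof -
      obtain v where v: "v \<in> PC" "G = \<psi> v" using G by blast
      have "\<psi> (xs r v) = (\<lambda>m. G (m - r))" using v PC_C by (auto simp: \<psi>_xs)
      then show ?thesis using PC_closed(4)[OF v(1), of r] by (metis imageI)
    qed
    show "(\<lambda>m. smat (of_int (m $ i)) (G m)) \<in> \<psi> ` PC" if G: "G \<in> \<psi> ` PC" for i G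
    proof -
      obtain v where v: "v \<in> PC" "G = \<psi> v" using G by blast
      have "\<psi> (dd i v) = (\<lambda>m. smat (of_int (m $ i)) (G m))" using v PC_C by (auto simp: \<psi>_dd)
      then show ?thesis using PC_closed(5)[OF v(1), of i] by (metis imageI)
    qed
  qed
  then have "F \<in> uspan (\<psi> ` PC)" using F by simp
  then show ?thesis
  proof induction
    case zero
    show ?case by (rule bexI[of _ 0]) (auto simp: free_space_simps)
  next
    case (base u F)
    then obtain z where z: "z \<in> PC" "F = \<psi> z" by blast
    \<comment> \<open>On P the coefficient u acts as u e, and the latter is the coefficient of an
      element of V.\<close>
    have ue: "u * e \<in> LI" using LI(3) base by blast
    have "\<Theta> (pair z (vL (u * e))) m = u * F m" for m
      using z by (simp add: vL(2)[OF ue] mult.assoc PC_def)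
    then show ?case using z vL(1)[OF ue]
      by (intro bexI[of _ "pair z (vL (u * e))"]) (auto simp: free_space_simps)
  next
    case (add F G)
    then obtain f g where "f \<in> carrier FS" "g \<in> carrier FS" "\<Theta> f = F" "\<Theta> g = G" by blast
    then show ?case by (intro bexI[of _ "f + g"]) (auto simp: free_space_simps free_space_closed)
  qed
qed

text \<open>Applying e u to the relation turns the basis vector b_i of U e into a scalar c_i, so the
  z_i satisfy the relation with coefficients c_i. Fix a lattice point and a matrix entry, with
  values t_i for the z_i. Then D = \<Sum> t_i b_i satisfies e U D = 0, so D = 0 by primeness and all
  t_i vanish.\<close>

lemma independent_action:
  assumes Lc: "coords LI (+) smat \<kappa>L k"
    and z: "\<And>i. i < k \<Longrightarrow> z i \<in> PC"
    and s: "\<And>m. (\<Sum>i<k. coords.bas LI \<kappa>L i * \<psi> (z i) m) = 0" and i: "i < k"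
  shows "z i = \<zero>\<^bsub>M\<^esub>"
proof -
  interpret Lc: coords LI "(+)" smat \<kappa>L k by (rule Lc)
  have A: "Lc.bas i \<in> LI" if "i < k" for i using Lc.bas(1)[OF that] .
  have "\<psi> (z i) m = 0" for m
  proof (rule fmat_eqI)
    fix a b
    define t where "t i = ent (\<psi> (z i) m) a b" for i
    define D where "D = (\<Sum>i<k. smat (t i) (Lc.bas i))"
    have DL: "D \<in> LI" unfolding D_def
      by (intro fv.subspace_sum[OF LI_subspace] fv.subspace_scale[OF LI_subspace] A) simp
    have "e * u * D = 0" if u: "u \<in> S.U" for u
    proof -
      have "\<forall>i. \<exists>c. i < k \<longrightarrow> e * u * Lc.bas i = smat c e" using scalar[OF A u] by blast
      then obtain c where c: "\<And>i. i < k \<Longrightarrow> e * u * Lc.bas i = smat (c i) e" by metis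
      have "0 = e * u * (\<Sum>i<k. Lc.bas i * \<psi> (z i) m)" by (simp add: s)
      also have "\<dots> = (\<Sum>i<k. (e * u * Lc.bas i) * \<psi> (z i) m)" by (simp add: sum_distrib_left mult.assoc)
      also have "\<dots> = (\<Sum>i<k. smat (c i) (\<psi> (z i) m))"
        by (rule sum.cong) (use c z in \<open>auto simp: smat_mult_left PC_def\<close>)
      finally have "ent (\<Sum>i<k. smat (c i) (\<psi> (z i) m)) a b = 0" by simp
      then have ct: "(\<Sum>i<k. t i * c i) = 0" by (simp add: ent_sum t_def mult.commute)
      have "e * u * D = (\<Sum>i<k. smat (t i) (e * u * Lc.bas i))"
        by (simp add: D_def sum_distrib_left smat_mult_right)
      also have "\<dots> = smat (\<Sum>i<k. t i * c i) e"
        unfolding fv.scale_sum_left by (rule sum.cong) (use c in auto)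
      finally show ?thesis by (simp add: ct)
    qed
    then have "D = 0" using S.U_prime[OF e(1,3) LI(1)[OF DL]] by blast
    have part: "(\<Sum>i\<in>I. smat (t i) (Lc.bas i)) \<in> LI \<and> \<kappa>L (\<Sum>i\<in>I. smat (t i) (Lc.bas i)) j = (\<Sum>i\<in>I. t i * (if j = i then 1 else 0))"
      if "finite I" "I \<subseteq> {..<k}" for I j
      using that
    proof (induction I rule: finite_induct)
      case empty
      have "\<kappa>L (0 + 0) j = \<kappa>L 0 j + \<kappa>L 0 j" by (rule Lc.coord_pl) (simp_all add: fv.subspace_0[OF LI_subspace])
      then show ?case by (simp add: fv.subspace_0[OF LI_subspace])
    next
      case (insert i I)
      then have i: "i < k" and IH: "(\<Sum>i\<in>I. smat (t i) (Lc.bas i)) \<in> LI"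
        "\<kappa>L (\<Sum>i\<in>I. smat (t i) (Lc.bas i)) j = (\<Sum>i\<in>I. t i * (if j = i then 1 else 0))" by auto
      have sA: "smat (t i) (Lc.bas i) \<in> LI" by (rule Lc.ms_closed[OF A[OF i]])
      show ?case unfolding sum.insert[OF insert.hyps]
        using Lc.pl_closed[OF sA IH(1)] Lc.coord_pl[OF sA IH(1), of j] IH(2)
          Lc.coord_ms[OF A[OF i], of "t i" j] Lc.bas(2)[OF i, of j] by simp
    qed
    have "\<kappa>L D i = (\<Sum>l<k. t l * (if i = l then 1 else 0))" using part[of "{..<k}" i] by (simp add: D_def)
    also have "\<dots> = (\<Sum>l<k. if l = i then t i else 0)" by (rule sum.cong) auto
    finally have "\<kappa>L D i = t i" using i by simp
    moreover have "\<kappa>L 0 i = 0" using part[of "{}" i] by simp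
    ultimately show "ent (\<psi> (z i) m) a b = ent 0 a b" using \<open>D = 0\<close> by (simp add: t_def)
  qed
  then show ?thesis using PC_C[OF z[OF i]] by (intro \<psi>I) (auto simp: \<psi>_zero)
qed

definition "K0 = {f \<in> carrier FS. \<Theta> f = (\<lambda>m. 0)}"

text \<open>Expands the V-factor in a basis and collects terms. \<open>N\<close> is any set with
  these closure properties, so that the same z_i can be used for two such sets by taking their
  intersection.\<close>

lemma tensor_normal_form:
  assumes Lc: "coords LI (+) smat \<kappa>L k"
    and rel: "tensor_relators P V \<subseteq> N"
    and N_add: "\<And>f g. f \<in> N \<Longrightarrow> g \<in> N \<Longrightarrow> f + g \<in> N"
    and N_scale: "\<And>c f. f \<in> N \<Longrightarrow> pm_scale c f \<in> N"
    and f: "f \<in> carrier FS"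
  shows "\<exists>z. (\<forall>i. z i \<in> PC) \<and> f - (\<Sum>i<k. pair (z i) (vL (coords.bas LI \<kappa>L i))) \<in> N"
proof -
  interpret Lc: coords LI "(+)" smat \<kappa>L k by (rule Lc)
  let ?y = "\<lambda>i. vL (Lc.bas i)"
  have neg: "pm_scale (- 1) f = - f" for f :: "('m \<times> 'm) \<Rightarrow>\<^sub>0 complex"
    by (rule poly_mapping_eqI) simp
  have N_minus: "f - g \<in> N" if "f \<in> N" "g \<in> N" for f g
    using N_add[OF that(1) N_scale[OF that(2), of "- 1"]] by (simp add: neg)
  have r1: "pair (z \<oplus>\<^bsub>M\<^esub> z') y - pair z y - pair z' y \<in> N" if "z \<in> PC" "z' \<in> PC" "y \<in> VC" for z z' y
    using subsetD[OF rel tensor_relatorsI(1)[of z P z' y V]] that by simp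
  have r2: "pair z (y \<oplus>\<^bsub>M\<^esub> y') - pair z y - pair z y' \<in> N" if "z \<in> PC" "y \<in> VC" "y' \<in> VC" for z y y'
    using subsetD[OF rel tensor_relatorsI(2)[of z P y V y']] that by simp
  have r3: "pair (c \<odot>\<^bsub>M\<^esub> z) y - pm_scale c (pair z y) \<in> N" if "z \<in> PC" "y \<in> VC" for c z y
    using subsetD[OF rel tensor_relatorsI(3)[of z P y V c]] that by simp
  have r4: "pair z (c \<odot>\<^bsub>M\<^esub> y) - pm_scale c (pair z y) \<in> N" if "z \<in> PC" "y \<in> VC" for c z y
    using subsetD[OF rel tensor_relatorsI(4)[of z P y V c]] that by simp
  have zero: "0 \<odot>\<^bsub>M\<^esub> v = \<zero>\<^bsub>M\<^esub>" if "v \<in> C" for v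
    using that by (intro \<psi>I) (auto simp: \<psi>_smult \<psi>_zero)
  have z0: "pair \<zero>\<^bsub>M\<^esub> y \<in> N" if "y \<in> VC" for y
    using r3[OF PC_closed(3) that, of 0] by (simp add: zero)
  have y0: "pair z \<zero>\<^bsub>M\<^esub> \<in> N" if "z \<in> PC" for z
    using r4[OF that VC_closed(3), of 0] by (simp add: zero)
  have yV: "?y i \<in> VC" "lam (?y i) = Lc.bas i" if "i < k" for i using vL[OF Lc.bas(1)[OF that]] by auto
  interpret Vc: coords VC "add M" "Module.module.smult M" "\<lambda>v. \<kappa>L (lam v)" k by (rule V_coords[OF Lc])
  have ky: "\<kappa>L (lam (?y i)) l = (if l = i then 1 else 0)" if "i < k" for i l
    using yV(2)[OF that] Lc.bas(2)[OF that] by simp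
  have step: "\<forall>y\<in>VC. (\<forall>i\<ge>j. \<kappa>L (lam y) i = 0) \<longrightarrow>
      pair z y - (\<Sum>i<j. pair (\<kappa>L (lam y) i \<odot>\<^bsub>M\<^esub> z) (?y i)) \<in> N" if z: "z \<in> PC" and "j \<le> k" for z j
    using that(2)
  proof (induction j)
    case 0
    show ?case
    proof (intro ballI impI)
      fix y assume y: "y \<in> VC" "\<forall>i\<ge>0. \<kappa>L (lam y) i = 0"
      have "\<kappa>L (lam \<zero>\<^bsub>M\<^esub>) i = 0" for i
        using Vc.coord_ms[of "\<zero>\<^bsub>M\<^esub>" 0 i] VC_closed(3) by (simp add: zero)
      then have "y = \<zero>\<^bsub>M\<^esub>" using y VC_closed(3) by (intro Vc.coord_inj) auto
      then show "pair z y - (\<Sum>i<0. pair (\<kappa>L (lam y) i \<odot>\<^bsub>M\<^esub> z) (?y i)) \<in> N" using y0[OF z] by simp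
    qed
  next
    case (Suc j)
    show ?case
    proof (intro ballI impI)
      fix y assume y: "y \<in> VC" "\<forall>i\<ge>Suc j. \<kappa>L (lam y) i = 0"
      have j: "j < k" using Suc by simp
      let ?c = "\<kappa>L (lam y) j"
      have bd: "\<forall>i\<ge>k. ((\<lambda>i. \<kappa>L (lam y) i)(j := 0)) i = 0" using y Vc.coord_bd by auto
      define w where "w = Vc.vecC ((\<lambda>i. \<kappa>L (lam y) i)(j := 0))"
      have w: "w \<in> VC" "\<And>i. \<kappa>L (lam w) i = (if i = j then 0 else \<kappa>L (lam y) i)"
        unfolding w_def using Vc.vecC(1)[OF bd] by (blast, simp only: Vc.vecC(2)[OF bd] fun_upd_apply)
      have cy: "?c \<odot>\<^bsub>M\<^esub> ?y j \<in> VC" by (rule VC_closed(2)[OF yV(1)[OF j]])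
      have yw: "y = w \<oplus>\<^bsub>M\<^esub> ?c \<odot>\<^bsub>M\<^esub> ?y j"
      proof (rule Vc.coord_inj[OF y(1) VC_closed(1)[OF w(1) cy]])
        fix i show "\<kappa>L (lam y) i = \<kappa>L (lam (w \<oplus>\<^bsub>M\<^esub> ?c \<odot>\<^bsub>M\<^esub> ?y j)) i"
          unfolding Vc.coord_pl[OF w(1) cy] Vc.coord_ms[OF yV(1)[OF j]] ky[OF j] w(2) by simp
      qed
      have 1: "pair z y - pair z w - pair z (?c \<odot>\<^bsub>M\<^esub> ?y j) \<in> N"
        using r2[OF z w(1) cy] by (simp only: yw[symmetric])
      have 2: "pair z w - (\<Sum>i<j. pair (\<kappa>L (lam y) i \<odot>\<^bsub>M\<^esub> z) (?y i)) \<in> N"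
      proof -
        have "\<forall>i\<ge>j. \<kappa>L (lam w) i = 0" using y(2) w(2) by (metis Suc_leI le_neq_implies_less)
        then have "pair z w - (\<Sum>i<j. pair (\<kappa>L (lam w) i \<odot>\<^bsub>M\<^esub> z) (?y i)) \<in> N"
          using Suc w(1) by auto
        moreover have "(\<Sum>i<j. pair (\<kappa>L (lam w) i \<odot>\<^bsub>M\<^esub> z) (?y i)) = (\<Sum>i<j. pair (\<kappa>L (lam y) i \<odot>\<^bsub>M\<^esub> z) (?y i))"
          by (rule sum.cong) (auto simp: w(2))
        ultimately show ?thesis by simp
      qed
      have 3: "pair z (?c \<odot>\<^bsub>M\<^esub> ?y j) - pm_scale ?c (pair z (?y j)) \<in> N" by (rule r4[OF z yV(1)[OF j]])
      have 4: "pair (?c \<odot>\<^bsub>M\<^esub> z) (?y j) - pm_scale ?c (pair z (?y j)) \<in> N" by (rule r3[OF z yV(1)[OF j]])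
      have alg: "a - (s + d) = (a - b - c) + (b - s) + (c - p) - (d - p)" for a b c d s p :: "('m \<times> 'm) \<Rightarrow>\<^sub>0 complex"
        by simp
      show "pair z y - (\<Sum>i<Suc j. pair (\<kappa>L (lam y) i \<odot>\<^bsub>M\<^esub> z) (?y i)) \<in> N"
        unfolding sum.lessThan_Suc
          alg[of "pair z y" _ _ "pair z w" "pair z (?c \<odot>\<^bsub>M\<^esub> ?y j)" "pm_scale ?c (pair z (?y j))"]
        by (rule N_minus[OF N_add[OF N_add[OF 1 2] 3] 4])
    qed
  qed
  have "\<exists>z. (\<forall>i. z i \<in> PC) \<and> (\<Sum>b\<in>A. Poly_Mapping.single b (c b)) - (\<Sum>i<k. pair (z i) (?y i)) \<in> N"
    if "finite A" "A \<subseteq> PC \<times> VC" for A c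
    using that
  proof (induction A rule: finite_induct)
    case empty
    have "0 - (\<Sum>i<k. pair \<zero>\<^bsub>M\<^esub> (?y i)) \<in> N"
    proof -
      have z: "0 \<in> N" using N_minus[OF y0[OF PC_closed(3)] y0[OF PC_closed(3)]] by simp
      have "(\<Sum>i\<in>I. pair \<zero>\<^bsub>M\<^esub> (?y i)) \<in> N" if "finite I" "I \<subseteq> {..<k}" for I
        using that by (induction I rule: finite_induct) (auto simp: z intro!: N_add z0 yV)
      then show ?thesis using N_minus[OF z] by blast
    qed
    then show ?case using PC_closed(3) by (intro exI[of _ "\<lambda>_. \<zero>\<^bsub>M\<^esub>"]) simp
  next
    case (insert b A)
    then obtain z where z: "\<And>i. z i \<in> PC" "(\<Sum>b\<in>A. Poly_Mapping.single b (c b)) - (\<Sum>i<k. pair (z i) (?y i)) \<in> N"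
      by auto
    obtain p v where b: "b = (p, v)" "p \<in> PC" "v \<in> VC" using insert.prems by auto
    have cp: "c b \<odot>\<^bsub>M\<^esub> p \<in> PC" using b PC_closed by blast
    define w where "w i = \<kappa>L (lam v) i \<odot>\<^bsub>M\<^esub> (c b \<odot>\<^bsub>M\<^esub> p)" for i
    have w: "w i \<in> PC" for i unfolding w_def using cp PC_closed by blast
    have 1: "pair (c b \<odot>\<^bsub>M\<^esub> p) v - (\<Sum>i<k. pair (w i) (?y i)) \<in> N"
      using step[OF cp order.refl] b Vc.coord_bd[OF b(3)] by (auto simp: w_def)
    have 2: "pair (c b \<odot>\<^bsub>M\<^esub> p) v - Poly_Mapping.single b (c b) \<in> N"
      using r3[OF b(2,3), of "c b"] by (simp add: b(1) pm_scale_single)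
    have 3: "(\<Sum>i\<in>I. pair (z i \<oplus>\<^bsub>M\<^esub> w i) (?y i)) - (\<Sum>i\<in>I. pair (z i) (?y i)) - (\<Sum>i\<in>I. pair (w i) (?y i)) \<in> N"
      if "finite I" "I \<subseteq> {..<k}" for I
      using that
    proof (induction I rule: finite_induct)
      case empty
      show ?case using N_minus[OF 1 1] by simp
    next
      case (insert i I)
      have a: "pair (z i \<oplus>\<^bsub>M\<^esub> w i) (?y i) - pair (z i) (?y i) - pair (w i) (?y i) \<in> N"
        by (rule r1[OF z(1) w yV(1)]) (use insert in auto)
      have alg: "(a + s) - (b + t) - (c + u) = (a - b - c) + (s - t - u)" for a b c s t u :: "('m \<times> 'm) \<Rightarrow>\<^sub>0 complex"
        by simp
      show ?case unfolding sum.insert[OF insert.hyps] alg using N_add[OF a insert.IH] insert.prems by blast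
    qed
    have alg: "(d + s) - x = (s - t) + (a - u) - (a - d) - (x - t - u)" for a d s t u x :: "('m \<times> 'm) \<Rightarrow>\<^sub>0 complex"
      by simp
    have "(Poly_Mapping.single b (c b) + (\<Sum>b\<in>A. Poly_Mapping.single b (c b))) - (\<Sum>i<k. pair (z i \<oplus>\<^bsub>M\<^esub> w i) (?y i)) \<in> N"
      by (subst alg[of _ _ _ "\<Sum>i<k. pair (z i) (?y i)" "pair (c b \<odot>\<^bsub>M\<^esub> p) v" "\<Sum>i<k. pair (w i) (?y i)"])
        (rule N_minus[OF N_minus[OF N_add[OF z(2) 1] 2] 3], auto)
    then show ?case unfolding sum.insert[OF insert.hyps]
      using z(1) w PC_closed(1) by (intro exI[of _ "\<lambda>i. z i \<oplus>\<^bsub>M\<^esub> w i"]) blast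
  qed
  from this[of "Poly_Mapping.keys f" "Poly_Mapping.lookup f"] show ?thesis
    using f by (simp add: sum_single_keys free_space_simps)
qed

lemma K0_closed: "f \<in> K0 \<Longrightarrow> g \<in> K0 \<Longrightarrow> f + g \<in> K0" "f \<in> K0 \<Longrightarrow> pm_scale c f \<in> K0"
  by (auto simp: K0_def free_space_simps free_space_closed fun_eq_iff)

lemma relators_K0: "tensor_relators P V \<subseteq> K0"
  unfolding tensor_relators_def
proof (intro Un_least subsetI)
  have K0I: "f \<in> K0" if "Poly_Mapping.keys f \<subseteq> PC \<times> VC" "\<And>m. \<Theta> f m = 0" for f
    using that by (simp add: K0_def free_space_simps fun_eq_iff)
  note closed = free_space_closed(2,3) pair_in PC_closed(1,2) VC_closed(1,2)
  note simps = lam_add lam_smult \<psi>_add \<psi>_smult PC_C distrib_left distrib_right smat_mult_left smat_mult_right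
  fix f
  show "f \<in> K0" if h: "f \<in> {pair (z \<oplus>\<^bsub>P\<^esub> z') y - pair z y - pair z' y | z z' y.
      z \<in> carrier P \<and> z' \<in> carrier P \<and> y \<in> carrier V}"
  proof -
    obtain z z' y where f: "f = pair (z \<oplus>\<^bsub>M\<^esub> z') y - pair z y - pair z' y" "z \<in> PC" "z' \<in> PC" "y \<in> VC"
      using h by auto
    show ?thesis unfolding f(1) by (rule K0I, (intro closed f)) (simp add: f simps)
  qed
  show "f \<in> K0" if h: "f \<in> {pair z (y \<oplus>\<^bsub>V\<^esub> y') - pair z y - pair z y' | z y y'.
      z \<in> carrier P \<and> y \<in> carrier V \<and> y' \<in> carrier V}"
  proof -
    obtain z y y' where f: "f = pair z (y \<oplus>\<^bsub>M\<^esub> y') - pair z y - pair z y'" "z \<in> PC" "y \<in> VC" "y' \<in> VC"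
      using h by auto
    show ?thesis unfolding f(1) by (rule K0I, (intro closed f)) (simp add: f simps)
  qed
  show "f \<in> K0" if h: "f \<in> {pair (c \<odot>\<^bsub>P\<^esub> z) y - pm_scale c (pair z y) | c z y. z \<in> carrier P \<and> y \<in> carrier V}"
  proof -
    obtain c z y where f: "f = pair (c \<odot>\<^bsub>M\<^esub> z) y - pm_scale c (pair z y)" "z \<in> PC" "y \<in> VC"
      using h by auto
    show ?thesis unfolding f(1) by (rule K0I, (intro closed f)) (simp add: f simps)
  qed
  show "f \<in> K0" if h: "f \<in> {pair z (c \<odot>\<^bsub>V\<^esub> y) - pm_scale c (pair z y) | c z y. z \<in> carrier P \<and> y \<in> carrier V}"
  proof -
    obtain c z y where f: "f = pair z (c \<odot>\<^bsub>M\<^esub> y) - pm_scale c (pair z y)" "z \<in> PC" "y \<in> VC"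
      using h by auto
    show ?thesis unfolding f(1) by (rule K0I, (intro closed f)) (simp add: f simps)
  qed
qed

text \<open>The relators lie in the kernel of \<Theta>. Conversely, the normal form of an element of
  that kernel has all z_i = 0 by independence, so the element lies in every submodule that contains
  the relators.\<close>

lemma tensor_kernel_eq: "tensor_kernel P V = K0"
proof
  interpret F: Module.module complex_ring FS by (rule free_space_module)
  have neg: "pm_scale (- 1) f = - f" for f :: "('m \<times> 'm) \<Rightarrow>\<^sub>0 complex"
    by (rule poly_mapping_eqI) simp
  have "submodule K0 complex_ring FS"
  proof (rule F.submoduleI)
    fix f assume f: "f \<in> K0"
    then have fF: "f \<in> carrier FS" by (simp add: K0_def)
    have "\<ominus>\<^bsub>FS\<^esub> f = pm_scale (- 1) f"
      using F.M.minus_equality[of "- f" f] fF free_space_closed(4)[of f "PC \<times> VC"]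
      by (simp add: free_space_simps neg)
    then show "\<ominus>\<^bsub>FS\<^esub> f \<in> K0" using K0_closed(2)[OF f] by simp
  qed (auto simp: free_space_simps K0_closed, auto simp: K0_def free_space_simps fun_eq_iff)
  then show "tensor_kernel P V \<subseteq> K0"
    using relators_K0 unfolding tensor_kernel_def submodule_span_def by auto
  show "K0 \<subseteq> tensor_kernel P V"
    unfolding tensor_kernel_def submodule_span_def
  proof (intro subsetI InterI)
    fix f N assume f: "f \<in> K0"
      and "N \<in> {N. submodule N complex_ring (free_space (carrier P \<times> carrier V)) \<and> tensor_relators P V \<subseteq> N}"
    then have sub: "submodule N complex_ring FS" and rel: "tensor_relators P V \<subseteq> N" by auto
    note subE = F.submoduleE[OF sub]
    have N_add: "f + g \<in> N" if "f \<in> N" "g \<in> N" for f g using subE(5)[OF that] by (simp add: free_space_simps)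
    have N_sc: "pm_scale c f \<in> N" if "f \<in> N" for c f using subE(4)[of c f] that by (simp add: free_space_simps)
    obtain \<kappa>L k where Lc: "coords LI (+) smat \<kappa>L k" using ex_V_coords by blast
    interpret Lc: coords LI "(+)" smat \<kappa>L k by (rule Lc)
    \<comment> \<open>With the intersection, one and the same normal form is congruent to
      \<open>f\<close> modulo \<open>N\<close> and modulo the kernel.\<close>
    have "\<exists>z. (\<forall>i. z i \<in> PC) \<and> f - (\<Sum>i<k. pair (z i) (vL (Lc.bas i))) \<in> N \<inter> K0"
      by (rule tensor_normal_form[OF Lc]) (use rel relators_K0 N_add N_sc K0_closed f in \<open>auto simp: K0_def\<close>)
    then obtain z where z: "\<And>i. z i \<in> PC" and fz: "f - (\<Sum>i<k. pair (z i) (vL (Lc.bas i))) \<in> N"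
      "f - (\<Sum>i<k. pair (z i) (vL (Lc.bas i))) \<in> K0" by blast
    have "(\<Sum>i<k. Lc.bas i * \<psi> (z i) m) = 0" for m
    proof -
      have "\<Theta> (f - (\<Sum>i<k. pair (z i) (vL (Lc.bas i)))) m = 0" "\<Theta> f m = 0"
        using fz(2) f by (simp_all only: K0_def mem_Collect_eq)
      then have "(\<Sum>i<k. lam (vL (Lc.bas i)) * \<psi> (z i) m) = 0" by (simp add: \<Theta>_sum)
      moreover have "(\<Sum>i<k. lam (vL (Lc.bas i)) * \<psi> (z i) m) = (\<Sum>i<k. Lc.bas i * \<psi> (z i) m)"
        by (rule sum.cong) (auto simp: vL(2) Lc.bas)
      ultimately show ?thesis by simp
    qed
    then have z0: "z i = \<zero>\<^bsub>M\<^esub>" if "i < k" for i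
      by (rule independent_action[OF Lc, where z = z, rotated]) (rule that z)+
    have rz: "pair \<zero>\<^bsub>M\<^esub> y \<in> N" if "y \<in> VC" for y
    proof -
      have "0 \<odot>\<^bsub>M\<^esub> \<zero>\<^bsub>M\<^esub> = \<zero>\<^bsub>M\<^esub>" by (intro \<psi>I) (auto simp: \<psi>_smult \<psi>_zero)
      moreover have "pair (0 \<odot>\<^bsub>P\<^esub> \<zero>\<^bsub>M\<^esub>) y - pm_scale 0 (pair \<zero>\<^bsub>M\<^esub> y) \<in> tensor_relators P V"
        using tensor_relatorsI(3)[of "\<zero>\<^bsub>M\<^esub>" P y V 0] that PC_closed(3) by simp
      ultimately show ?thesis using rel by auto
    qed
    have zN: "0 \<in> N" using N_sc[OF fz(1), of 0] by simp
    have "(\<Sum>i\<in>I. pair (z i) (vL (Lc.bas i))) \<in> N" if "finite I" "I \<subseteq> {..<k}" for I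
      using that by (induction I rule: finite_induct) (auto simp: zN z0 intro!: N_add rz vL(1) Lc.bas)
    then have "(\<Sum>i<k. pair (z i) (vL (Lc.bas i))) \<in> N" by blast
    from N_add[OF fz(1) this] show "f \<in> N" by simp
  qed
qed

text \<open>The inverse of the map induced by \<Theta>: the whole fibre over \<open>\<psi> v\<close>
  is a coset of the kernel, so no representative has to be chosen.\<close>

definition "\<phi> v = {f \<in> carrier FS. \<Theta> f = \<psi> v}"

lemma \<phi>_ne: "v \<in> C \<Longrightarrow> \<exists>f. f \<in> \<phi> v"
  using \<Theta>_surj[of "\<psi> v"] by (auto simp: \<phi>_def)

lemma coset_\<phi>: "f \<in> \<phi> v \<Longrightarrow> a_r_coset FS K0 f = \<phi> v"
proof -
  assume f: "f \<in> \<phi> v"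
  have "g \<in> (\<lambda>h. h + f) ` K0 \<longleftrightarrow> g \<in> \<phi> v" for g
  proof
    assume "g \<in> \<phi> v"
    then have "g - f \<in> K0" using f by (auto simp: \<phi>_def K0_def free_space_simps free_space_closed fun_eq_iff)
    then show "g \<in> (\<lambda>h. h + f) ` K0" by (intro image_eqI[of _ _ "g - f"]) auto
  qed (use f in \<open>auto simp: \<phi>_def K0_def free_space_simps free_space_closed fun_eq_iff intro: free_space_closed(1) del: subsetI\<close>)
  then show ?thesis unfolding a_r_coset_def' by (auto simp: free_space_simps image_iff)
qed

lemma \<phi>_ex: "f \<in> carrier FS \<Longrightarrow> \<exists>v\<in>C. f \<in> \<phi> v"
  using \<Theta>_in[of f] by (auto simp: \<phi>_def)

lemma \<phi>_inj: "v \<in> C \<Longrightarrow> w \<in> C \<Longrightarrow> \<phi> v = \<phi> w \<Longrightarrow> v = w"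
proof (rule \<psi>_inj)
  assume a: "v \<in> C" "w \<in> C" "\<phi> v = \<phi> w"
  obtain f where f: "f \<in> \<phi> v" using \<phi>_ne a(1) by blast
  then have "f \<in> \<phi> w" using a(3) by simp
  then show "\<psi> v = \<psi> w" using f by (simp add: \<phi>_def)
qed

text \<open>The union in \<open>quot_map\<close> runs over cosets that all coincide, and the fibre
  is nonempty, so one coset results.\<close>

lemma quot_map_\<phi>:
  assumes v: "v \<in> C" and g: "\<And>f. f \<in> \<phi> v \<Longrightarrow> g f \<in> \<phi> w"
  shows "quot_map FS K0 g (\<phi> v) = \<phi> w"
proof -
  have "a_r_coset FS K0 (g f) = \<phi> w" if "f \<in> \<phi> v" for f by (rule coset_\<phi>[OF g[OF that]])
  then show ?thesis using \<phi>_ne[OF v] unfolding quot_map_def by auto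
qed

lemma tensor_simps: "carrier (tensor P V) = A_RCOSETS FS K0" "add (tensor P V) = set_add FS"
  "\<zero>\<^bsub>tensor P V\<^esub> = K0" "c \<odot>\<^bsub>tensor P V\<^esub> Cs = quot_map FS K0 (pm_scale c) Cs"
  by (simp_all add: tensor_def quot_module_def module_record_def tensor_kernel_eq free_space_simps eta_contract_eq)

lemma \<phi>_bij: "bij_betw \<phi> C (carrier (tensor P V))"
proof (rule bij_betw_imageI)
  show "inj_on \<phi> C" using \<phi>_inj by (auto intro: inj_onI)
  show "\<phi> ` C = carrier (tensor P V)"
  proof (intro equalityI subsetI)
    fix Cs assume "Cs \<in> \<phi> ` C"
    then obtain v f where v: "v \<in> C" "Cs = \<phi> v" "f \<in> \<phi> v" using \<phi>_ne by blast
    then have "Cs = a_r_coset FS K0 f" "f \<in> carrier FS" using coset_\<phi> by (auto simp: \<phi>_def)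
    then show "Cs \<in> carrier (tensor P V)" unfolding tensor_simps A_RCOSETS_def' by blast
  next
    fix Cs assume "Cs \<in> carrier (tensor P V)"
    then obtain f where f: "f \<in> carrier FS" "Cs = a_r_coset FS K0 f"
      unfolding tensor_simps A_RCOSETS_def' by blast
    then show "Cs \<in> \<phi> ` C" using \<phi>_ex[OF f(1)] coset_\<phi> by blast
  qed
qed

lemma \<phi>_add: "v \<in> C \<Longrightarrow> w \<in> C \<Longrightarrow> \<phi> (v \<oplus>\<^bsub>M\<^esub> w) = \<phi> v \<oplus>\<^bsub>tensor P V\<^esub> \<phi> w"
proof -
  assume vw: "v \<in> C" "w \<in> C"
  obtain g where g: "g \<in> \<phi> v" using \<phi>_ne vw by blast
  have "f \<in> \<phi> (v \<oplus>\<^bsub>M\<^esub> w) \<longleftrightarrow> (\<exists>a\<in>\<phi> v. \<exists>b\<in>\<phi> w. f = a + b)" for f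
  proof
    assume "f \<in> \<phi> (v \<oplus>\<^bsub>M\<^esub> w)"
    then have "f - g \<in> \<phi> w" using g vw by (auto simp: \<phi>_def free_space_simps free_space_closed fun_eq_iff \<psi>_add)
    then show "\<exists>a\<in>\<phi> v. \<exists>b\<in>\<phi> w. f = a + b" using g by (intro bexI[of _ g] bexI[of _ "f - g"]) auto
  qed (use vw in \<open>auto simp: \<phi>_def free_space_simps free_space_closed fun_eq_iff \<psi>_add
      intro: free_space_closed(1) del: subsetI\<close>)
  then show ?thesis unfolding tensor_simps set_add_def' by (auto simp: free_space_simps)
qed

lemma \<phi>_smult: "v \<in> C \<Longrightarrow> \<phi> (c \<odot>\<^bsub>M\<^esub> v) = c \<odot>\<^bsub>tensor P V\<^esub> \<phi> v"
  unfolding tensor_simps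
  by (rule quot_map_\<phi>[symmetric])
    (auto simp: \<phi>_def free_space_simps free_space_closed fun_eq_iff \<psi>_smult)

lemma \<phi>_zero: "\<phi> \<zero>\<^bsub>M\<^esub> = \<zero>\<^bsub>tensor P V\<^esub>"
  by (simp add: tensor_simps \<phi>_def K0_def \<psi>_zero')

lemma opF_linear: "opF w (\<lambda>m. \<Sum>b\<in>A. smat (c b) (G b m)) m = (\<Sum>b\<in>A. smat (c b) (opF w (G b) m))"
proof -
  have add: "opF w (\<lambda>m. F m + G m) m = opF w F m + opF w G m" for F G
    by (cases w) (simp only: opF_def prod.case distrib_left smat_add sum.distrib add_ac)
  have sc: "opF w (\<lambda>m. smat a (F m)) m = smat a (opF w F m)" for a F
    by (cases w) (simp add: opF_def smat_mult_right smat_add smat_sum mult.commute mult.left_commute)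
  have z: "opF w (\<lambda>m. 0) m = 0" by (cases w) (simp add: opF_def)
  show ?thesis by (induction A rule: infinite_finite_induct) (simp_all add: z add sc)
qed

text \<open>In D(u, r) = x^r (D(u, 0) + X(u, r)), the first summand commutes with
  \<open>lam y\<close> and comes from the action on P. The second multiplies \<open>lam y\<close> on
  the left and comes from the action of r u^T on V.\<close>

lemma F_on_pair_\<Theta>:
  assumes w: "w \<in> carrier ext_witt" and z: "z \<in> PC" and y: "y \<in> VC"
  shows "Poly_Mapping.keys (F_on_pair (weyl_restrict actP) actV w (z, y)) \<subseteq> PC \<times> VC"
    and "\<Theta> (F_on_pair (weyl_restrict actP) actV w (z, y)) m = opF w (\<lambda>m. lam y * \<psi> z m) m"
proof -
  obtain \<xi> a where wx: "w = (\<xi>, a)" by (cases w)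
  have zC: "z \<in> C" using z by (rule PC_C)
  have T: "(\<lambda>f. witt_D u r f + 0 * f) \<in> weyl" "(\<lambda>f. 0 + a * f) \<in> weyl" for u r a
    using ext_witt_in_weyl[OF witt_D_in_witt, of u r 0] ext_witt_in_weyl[OF zero_in_witt, of a] by auto
  have wr: "weyl_restrict actP (of_D u r) z \<in> PC" "weyl_restrict actP (of_A a) z \<in> PC" for u r a
    using actP_PC[OF T(1) z, of u r] actP_PC[OF T(2) z, of a] by (simp_all add: weyl_restrict_def)
  have wD: "\<psi> (weyl_restrict actP (of_D u r) z) m = smat (\<Sum>i\<in>UNIV. u $ i * of_int ((m - r) $ i)) (\<psi> z (m - r))" for u r
    using actP_C(2)[OF T(1) zC, of u r] by (simp add: weyl_restrict_def hat_witt_D)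
  have wA: "\<psi> (weyl_restrict actP (of_A a) z) m = (\<Sum>s\<in>Poly_Mapping.keys a. smat (Poly_Mapping.lookup a s) (\<psi> z (m - s)))" for a
    using actP_C(2)[OF T(2) zC, of a] by (simp add: weyl_restrict_def hat_mult)
  have wX: "\<psi> (weyl_restrict actP (of_A (xmon r)) z) m = \<psi> z (m - r)" for r
    by (simp add: wA) (simp add: xmon_def)
  show "Poly_Mapping.keys (F_on_pair (weyl_restrict actP) actV w (z, y)) \<subseteq> PC \<times> VC"
    unfolding wx F_on_pair_def prod.case
    by (intro free_space_closed(1) free_space_sum_closed pair_in wr y actV(1))
  have "\<Theta> (F_on_pair (weyl_restrict actP) actV w (z, y)) m =
    (\<Sum>r\<in>witt_supp \<xi>. lam y * \<psi> (weyl_restrict actP (of_D (witt_coeff \<xi> r) r) z) m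
      + lam (actV (outer r (witt_coeff \<xi> r)) y) * \<psi> (weyl_restrict actP (of_A (xmon r)) z) m)
    + lam y * \<psi> (weyl_restrict actP (of_A a) z) m"
    unfolding wx F_on_pair_def prod.case by (simp only: \<Theta>_simps \<Theta>_sum)
  also have "\<dots> = (\<Sum>r\<in>witt_supp \<xi>. \<Sum>i\<in>UNIV. smat (witt_coeff \<xi> r $ i)
        (x i r * (lam y * \<psi> z (m - r)) + smat (of_int ((m - r) $ i)) (lam y * \<psi> z (m - r))))
     + (\<Sum>s\<in>Poly_Mapping.keys a. smat (Poly_Mapping.lookup a s) (lam y * \<psi> z (m - s)))"
  proof (intro arg_cong2[where f = "(+)"] sum.cong refl)
    fix r
    have "lam y * \<psi> (weyl_restrict actP (of_D (witt_coeff \<xi> r) r) z) m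
       = (\<Sum>i\<in>UNIV. smat (witt_coeff \<xi> r $ i) (smat (of_int ((m - r) $ i)) (lam y * \<psi> z (m - r))))"
      by (simp only: wD smat_mult_right fv.scale_sum_left smat_smat sum_distrib_left)
    moreover have "lam (actV (outer r (witt_coeff \<xi> r)) y) * \<psi> (weyl_restrict actP (of_A (xmon r)) z) m
       = (\<Sum>i\<in>UNIV. smat (witt_coeff \<xi> r $ i) (x i r * (lam y * \<psi> z (m - r))))"
      unfolding wX actV(3)[OF y] \<rho>_outer by (simp only: sum_distrib_right smat_mult_left mult.assoc)
    ultimately show "lam y * \<psi> (weyl_restrict actP (of_D (witt_coeff \<xi> r) r) z) m
      + lam (actV (outer r (witt_coeff \<xi> r)) y) * \<psi> (weyl_restrict actP (of_A (xmon r)) z) m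
      = (\<Sum>i\<in>UNIV. smat (witt_coeff \<xi> r $ i)
        (x i r * (lam y * \<psi> z (m - r)) + smat (of_int ((m - r) $ i)) (lam y * \<psi> z (m - r))))"
      by (simp only: smat_add sum.distrib add.commute)
  next
    show "lam y * \<psi> (weyl_restrict actP (of_A a) z) m
      = (\<Sum>s\<in>Poly_Mapping.keys a. smat (Poly_Mapping.lookup a s) (lam y * \<psi> z (m - s)))"
      unfolding wA by (simp only: sum_distrib_left smat_mult_right)
  qed
  finally show "\<Theta> (F_on_pair (weyl_restrict actP) actV w (z, y)) m = opF w (\<lambda>m. lam y * \<psi> z m) m"
    by (simp only: wx opF_def prod.case)
qed

lemma \<phi>_act:
  assumes v: "v \<in> C" and w: "w \<in> carrier ext_witt"
  shows "\<phi> (act w v) = F_act P (weyl_restrict actP) V actV w (\<phi> v)"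
proof -
  let ?G = "F_on_pair (weyl_restrict actP) actV w"
  have "free_extend ?G f \<in> \<phi> (act w v)" if f: "f \<in> \<phi> v" for f
  proof -
    have k: "Poly_Mapping.keys f \<subseteq> PC \<times> VC" and Tf: "\<Theta> f = \<psi> v" using f by (auto simp: \<phi>_def free_space_simps)
    have "Poly_Mapping.keys (free_extend ?G f) \<subseteq> PC \<times> VC"
      unfolding free_extend_def
      by (intro free_space_sum_closed free_space_closed(2)) (use k F_on_pair_\<Theta>(1)[OF w] in blast)
    moreover have "\<Theta> (free_extend ?G f) m = \<psi> (act w v) m" for m
    proof -
      have "\<Theta> (free_extend ?G f) m = (\<Sum>b\<in>Poly_Mapping.keys f. smat (Poly_Mapping.lookup f b) (\<Theta> (?G b) m))"
        by (simp add: free_extend_def \<Theta>_sum)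
      also have "\<dots> = (\<Sum>b\<in>Poly_Mapping.keys f. smat (Poly_Mapping.lookup f b)
          (opF w (\<lambda>m. lam (snd b) * \<psi> (fst b) m) m))"
      proof (rule sum.cong[OF refl])
        fix b assume "b \<in> Poly_Mapping.keys f"
        then have "fst b \<in> PC" "snd b \<in> VC" using k by auto
        then show "smat (Poly_Mapping.lookup f b) (\<Theta> (?G b) m)
            = smat (Poly_Mapping.lookup f b) (opF w (\<lambda>m. lam (snd b) * \<psi> (fst b) m) m)"
          using F_on_pair_\<Theta>(2)[OF w, of "fst b" "snd b" m] by simp
      qed
      also have "\<dots> = opF w (\<Theta> f) m"
        unfolding \<Theta>_def[abs_def] lin_def by (rule opF_linear[symmetric])
      finally show ?thesis by (simp add: Tf \<psi>_act[OF v w])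
    qed
    ultimately show ?thesis by (auto simp: \<phi>_def free_space_simps)
  qed
  then have "quot_map FS K0 (free_extend ?G) (\<phi> v) = \<phi> (act w v)" by (rule quot_map_\<phi>[OF v])
  then show ?thesis by (simp add: F_act_def tensor_kernel_eq)
qed

lemma M_isomorphic: "lie_module_isomorphic ext_witt M act (tensor P V) (F_act P (weyl_restrict actP) V actV)"
  unfolding lie_module_isomorphic_def
proof (intro conjI)
  show "lie_module ext_witt M act" by (rule lie)
  show "lie_module ext_witt (tensor P V) (F_act P (weyl_restrict actP) V actV)"
  proof (rule lie_module_transport[where M = M and act = act and \<phi> = \<phi>])
    show "lie_module ext_witt M act" by (rule lie)
    show "bij_betw \<phi> C (carrier (tensor P V))" by (rule \<phi>_bij)
    show "\<phi> \<zero>\<^bsub>M\<^esub> = \<zero>\<^bsub>tensor P V\<^esub>" by (rule \<phi>_zero)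
    show "\<phi> (v \<oplus>\<^bsub>M\<^esub> w) = \<phi> v \<oplus>\<^bsub>tensor P V\<^esub> \<phi> w" if "v \<in> C" "w \<in> C" for v w
      using that by (rule \<phi>_add)
    show "\<phi> (c \<odot>\<^bsub>M\<^esub> v) = c \<odot>\<^bsub>tensor P V\<^esub> \<phi> v" if "v \<in> C" for c v using that by (rule \<phi>_smult)
    show "\<phi> (act y v) = F_act P (weyl_restrict actP) V actV y (\<phi> v)"
      if "y \<in> carrier ext_witt" "v \<in> C" for y v using that(2,1) by (rule \<phi>_act)
  qed
  show "\<exists>\<phi>. bij_betw \<phi> (carrier M) (carrier (tensor P V)) \<and>
      (\<forall>v\<in>carrier M. \<forall>w\<in>carrier M. \<phi> (v \<oplus>\<^bsub>M\<^esub> w) = \<phi> v \<oplus>\<^bsub>tensor P V\<^esub> \<phi> w) \<and>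
      (\<forall>c. \<forall>v\<in>carrier M. \<phi> (c \<odot>\<^bsub>M\<^esub> v) = c \<odot>\<^bsub>tensor P V\<^esub> \<phi> v) \<and>
      (\<forall>x\<in>carrier ext_witt. \<forall>v\<in>carrier M. \<phi> (act x v) = F_act P (weyl_restrict actP) V actV x (\<phi> v))"
    by (intro exI[of _ \<phi>] conjI ballI allI \<phi>_bij \<phi>_add \<phi>_smult \<phi>_act)
qed

end

theorem corollary4p9:
  fixes M :: "(complex, 'm) module"
    and act :: "'d::finite ext_witt_elem \<Rightarrow> 'm \<Rightarrow> 'm"
  assumes "simple_lie_module ext_witt M act"
    and "admissible M act"
    and "U_h_free_of_finite_rank M act"
  shows "\<exists>(P :: (complex, 'm) module) (actP :: ('d laurent \<Rightarrow> 'd laurent) \<Rightarrow> 'm \<Rightarrow> 'm)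
          (V :: (complex, 'm) module) (actV :: complex ^ 'd ^ 'd \<Rightarrow> 'm \<Rightarrow> 'm).
     simple_weyl_module P actP \<and>
     U_h_free_of_finite_rank P (weyl_restrict actP) \<and>
     finite_dimensional V \<and>
     simple_lie_module gl V actV \<and>
     lie_module_isomorphic ext_witt M act
       (tensor P V) (F_act P (weyl_restrict actP) V actV)"
proof -
  obtain \<mu> :: "'d U_h \<Rightarrow> 'm \<Rightarrow> 'm" where \<mu>: "\<And>c v. v \<in> carrier M \<Longrightarrow> \<mu> (U_h_const c) v = c \<odot>\<^bsub>M\<^esub> v"
    "\<And>i v. v \<in> carrier M \<Longrightarrow> \<mu> (U_h_var i) v = act (of_D (axis i 1) 0) v"
    and free: "free_of_finite_rank ring_of_type_algebra (module_record (carrier M) (add M) \<zero>\<^bsub>M\<^esub> \<mu>)"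
    using assms(3) unfolding U_h_free_of_finite_rank_def by blast
  obtain \<kappa> n where "coords (carrier M) (add M) \<mu> \<kappa> n"
    using free_coordinates[OF free] by (auto simp: module_record_def)
  then have af: "admissible_free M act \<mu> \<kappa> n"
    by (intro admissible_free.intro)
      (use assms free \<mu> in \<open>simp_all add: simple_lie_module_def free_of_finite_rank_def\<close>)
  interpret admissible_free M act \<mu> \<kappa> n by (rule af)
  obtain e where e: "e \<in> S.U" "e * e = e" "e \<noteq> 0" "\<And>u. u \<in> S.U \<Longrightarrow> \<exists>c. e * u * e = smat c e"
    using S.ex_minimal_idempotent by blast
  \<comment> \<open>Every column is a value at 0, so e \<noteq> 0 moves some vector of M to a
    nonzero vector of e M.\<close>
  obtain F where F: "F \<in> \<psi> ` carrier M" "e * F 0 \<noteq> 0" using S.mat_zeroI[OF S.U_fbd[OF e(1)]] e(3) by blast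
  have "(\<lambda>m. e * F m) \<in> \<psi> ` carrier M" by (rule S.M_U[OF e(1) F(1)])
  then obtain q where q: "q \<in> carrier M" "\<And>m. \<psi> q m = e * F m" by (metis imageE)
  have "q \<noteq> \<zero>\<^bsub>M\<^esub>" using q(2)[of 0] F(2) \<psi>_zero[of 0] by auto
  moreover have "e * \<psi> q m = \<psi> q m" for m unfolding q(2) using e(2) by (simp add: mult.assoc[symmetric])
  ultimately interpret min_idem M act \<mu> \<kappa> n e q
    by (intro min_idem.intro[OF af] min_idem_axioms.intro e q(1))
  show ?thesis
    using simple_weyl_P free_P V_fd simple_lie_V M_isomorphic by blast
qed

end
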